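(* Let $\mathbf{\Gamma}$ be a strongly torsion-free discrete quantum group, i.e. a discrete quantum group whose fusion ring $\mathrm{Fus}(\mathbf{\Gamma})$ is torsion-free. Then $\mathbf{\Gamma}$ is torsion-free.
   Context: Discrete quantum groups. A discrete quantum group $\mathbf{\Gamma}$ means a Hopf $^*$-algebra $(\mathbb{C}[\mathbf{\Gamma}],\Delta)$ (over $\mathbb{C}$, counit $\varepsilon$) with an invariant positive state $\varphi:\mathbb{C}[\mathbf{\Gamma}]\to\mathbb{C}$, i.e. $(\mathrm{id}\otimes\varphi)\Delta(x)=\varphi(x)1=(\varphi\otimes\mathrm{id})\Delta(x)$. A corepresentation is a finite-dimensional vector space $V$ with a linear map $\delta:V\to V\otimes\mathbb{C}[\mathbf{\Gamma}]$ with $(\mathrm{id}\otimes\Delta)\delta=(\delta\otimes\mathrm{id})\delta$ and $(\mathrm{id}\otimes\varepsilon)\delta=\mathrm{id}$. It is unitary if $V$ is a Hilbert space and $\delta(\xi)^*\delta(\eta)=\langle\xi,\eta\rangle1$ for all $\xi,\eta\in V$ (where $\xi^*\eta=\langle\xi,\eta\rangle$). A coaction is a corepresentation $(A,\alpha)$ where $A$ is a (finite-dimensional) C$^*$-algebra and $\alpha:A\to A\otimes\mathbb{C}[\mathbf{\Gamma}]$ is a unital $^*$-homomorphism. For a unitary corepresentation $(V,\delta)$ the adjoint coaction on $B(V)$ is $\xi\eta^*\mapsto\delta(\xi)\delta(\eta)^*$. $\mathbf{\Gamma}$ is torsion-free if every coaction on a finite-dimensional C$^*$-algebra is equivariantly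 Morita equivalent to a direct sum of trivial coactions (of $\mathbb{C}$); equivalently, every coaction on a finite-dimensional C$^*$-algebra is isomorphic to a direct sum of adjoint coactions. The fusion ring $\mathrm{Fus}(\mathbf{\Gamma})$ has basis the set $I$ of equivalence classes $[V]$ of irreducible unitary corepresentations, unit the class $\mathbb{1}$ of the trivial corepresentation on $\mathbb{C}$, involution $\overline{[V]}=[\overline{V}]$ (dual corepresentation), product $[V]\otimes[W]=\sum_{[Z]}N_{[V],[W]}^{[Z]}[Z]$ with $N_{[V],[W]}^{[Z]}=\dim\mathrm{Mor}^{\mathbf{\Gamma}}(Z,V\otimes W)$ (intertwiners), and dimension function $d([V])=\dim V$. Fusion rings. Let $I$ be a set with distinguished element $\mathbb{1}$ and an involution fixing $\mathbb{1}$; let $\mathbb{Z}_I$ be the free abelian group on $I$ with the involution extended linearly, and $\tau:\mathbb{Z}_I\to\mathbb{Z}$ linear with $\tau(\alpha)=\delta_{\alpha,\mathbb{1}}$. An $I$-based ring is a ring structure $\otimes$ on $\mathbb{Z}_I$ with unit $\mathbb{1}$ such that for $\alpha,\beta,\gamma\in I$: $\overline{\alpha\otimes\beta}=\overline{\beta}\otimes\overline{\alpha}$, $\tau(\overline{\alpha}\otimes\beta)=\delta_{\alpha,\beta}$, $\tau(\alpha\otimes\beta\otimes\gamma)\in\mathbb{N}$ ($0\in\mathbb{N}$). It is a fusion ring if there is a unital ring homomorphism $d:\mathbb{Z}_I\to\mathbb{R}$ with $d(\alpha)>0$, $d(\alpha)=d(\overline{\alpha})$ for $\alpha\in I$. A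 cofinite based module over it (with basis a set $J$) is a unital left module structure on $\mathbb{Z}_J$ with a $\mathbb{Z}_I$-valued bilinear form such that for $\alpha\in I$, $b,c\in J$: $\langle\alpha\otimes b,c\rangle=\alpha\otimes\langle b,c\rangle$, $\langle b,c\rangle=\overline{\langle c,b\rangle}$, $\tau(\langle b,c\rangle)=\delta_{b,c}$, $\tau(\alpha\otimes\langle b,c\rangle)\in\mathbb{N}$. It is connected if for all $b,c\in J$ there is $\alpha\in I$ with $\tau(\alpha\otimes\langle b,c\rangle)\neq0$. The standard based module is $\mathbb{Z}_I$ with left multiplication and $\langle\alpha,\beta\rangle=\alpha\otimes\overline{\beta}$. Isomorphisms of based modules take basis elements to basis elements. A fusion ring is torsion-free if every non-zero connected cofinite based module is isomorphic to the standard based module. *)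

theory Defs
  imports Complex_Main "HOL-Library.Function_Algebras" "HOL-Library.Poly_Mapping"
begin

section \<open>Complex vector spaces and unital *-algebras\<close>

class complex_vector = ab_group_add +
  fixes scaleC :: "complex \<Rightarrow> 'a \<Rightarrow> 'a" (infixr "*\<^sub>C" 75)
  assumes scaleC_add_right: "c *\<^sub>C (x + y) = c *\<^sub>C x + c *\<^sub>C y"
    and scaleC_add_left: "(c + d) *\<^sub>C x = c *\<^sub>C x + d *\<^sub>C x"
    and scaleC_scaleC: "c *\<^sub>C d *\<^sub>C x = (c * d) *\<^sub>C x"
    and scaleC_one: "1 *\<^sub>C x = x"

text \<open>The zero algebra is not excluded here; a discrete quantum group carries a state, so its
  algebra is non-zero.\<close>

class complex_star_algebra = complex_vector + ring + monoid_mult +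
  fixes star :: "'a \<Rightarrow> 'a"
  assumes mult_scaleC_left: "(c *\<^sub>C x) * y = c *\<^sub>C (x * y)"
    and mult_scaleC_right: "x * (c *\<^sub>C y) = c *\<^sub>C (x * y)"
    and star_add: "star (x + y) = star x + star y"
    and star_scaleC: "star (c *\<^sub>C x) = cnj c *\<^sub>C star x"
    and star_mult: "star (x * y) = star y * star x"
    and star_star: "star (star x) = x"

global_interpretation complex_vector: vector_space "scaleC :: complex \<Rightarrow> 'a \<Rightarrow> 'a::complex_vector"
  defines cspan = complex_vector.span
    and cdependent = complex_vector.dependent
    and csubspace = complex_vector.subspace
    and cdim = complex_vector.dim
    and cextend_basis = complex_vector.extend_basis
    and crepresentation = complex_vector.representation
  by unfold_locales (simp_all add: scaleC_add_right scaleC_add_left scaleC_scaleC scaleC_one)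

instantiation complex :: complex_vector
begin
definition "c *\<^sub>C (x::complex) = c * x"
instance by standard (simp_all add: scaleC_complex_def algebra_simps)
end

instantiation "fun" :: (type, complex_vector) complex_vector
begin
definition "c *\<^sub>C f = (\<lambda>i. c *\<^sub>C f i)"
instance by standard
    (simp_all add: scaleC_fun_def fun_eq_iff scaleC_add_right scaleC_add_left scaleC_scaleC scaleC_one)
end

definition clinear_on ::
    "'a::complex_vector set \<Rightarrow> 'b::complex_vector set \<Rightarrow> ('a \<Rightarrow> 'b) \<Rightarrow> bool" where
  "clinear_on V W f \<longleftrightarrow> (\<forall>x\<in>V. f x \<in> W) \<and> (\<forall>x\<in>V. \<forall>y\<in>V. f (x + y) = f x + f y)
     \<and> (\<forall>c. \<forall>x\<in>V. f (c *\<^sub>C x) = c *\<^sub>C f x)"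

definition antilinear_on ::
    "'a::complex_vector set \<Rightarrow> 'b::complex_vector set \<Rightarrow> ('a \<Rightarrow> 'b) \<Rightarrow> bool" where
  "antilinear_on V W f \<longleftrightarrow> (\<forall>x\<in>V. f x \<in> W) \<and> (\<forall>x\<in>V. \<forall>y\<in>V. f (x + y) = f x + f y)
     \<and> (\<forall>c. \<forall>x\<in>V. f (c *\<^sub>C x) = cnj c *\<^sub>C f x)"

definition cbilinear ::
    "('a::complex_vector \<Rightarrow> 'b::complex_vector \<Rightarrow> 'c::complex_vector) \<Rightarrow> bool" where
  "cbilinear f \<longleftrightarrow> (\<forall>x. clinear_on UNIV UNIV (f x)) \<and> (\<forall>y. clinear_on UNIV UNIV (\<lambda>x. f x y))"

section \<open>Algebraic tensor products\<close>

text \<open>A list \<open>[(a\<^sub>1, b\<^sub>1), \<dots>, (a\<^sub>n, b\<^sub>n)]\<close> stands for \<open>a\<^sub>1 \<otimes> b\<^sub>1 + \<dots> + a\<^sub>n \<otimes> b\<^sub>n\<close>. Two such sums are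
  identified when no bilinear form tells them apart; as linear functionals separate points, this is
  the usual algebraic tensor product (see \<open>tensor_sum_add\<close>,
  \<open>tensor_sum_scaleC\<close>, \<open>tensor_sum_tensor\<close> below for the universal property).\<close>

definition formal_sum :: "('a \<Rightarrow> 'b \<Rightarrow> 'c::monoid_add) \<Rightarrow> ('a \<times> 'b) list \<Rightarrow> 'c" where
  "formal_sum f s = sum_list (map (\<lambda>(a, b). f a b) s)"

definition tensor_eq ::
    "('a::complex_vector \<times> 'b::complex_vector) list \<Rightarrow> ('a \<times> 'b) list \<Rightarrow> bool" where
  "tensor_eq s t \<longleftrightarrow>
     (\<forall>f :: 'a \<Rightarrow> 'b \<Rightarrow> complex. cbilinear f \<longrightarrow> formal_sum f s = formal_sum f t)"

quotient_type (overloaded) ('a, 'b) tensor =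
  "('a::complex_vector \<times> 'b::complex_vector) list" / tensor_eq
  by (rule equivpI) (auto simp: reflp_def symp_def transp_def tensor_eq_def)

lemma formal_sum_simps [simp]:
  "formal_sum f [] = 0" "formal_sum f ((a, b) # s) = f a b + formal_sum f s"
  "formal_sum f (s @ t) = formal_sum f s + formal_sum f t"
  by (simp_all add: formal_sum_def)

lemma cbilinear_simps:
  assumes "cbilinear f"
  shows "f (x + y) z = f x z + f y z" "f x (z + w) = f x z + f x w"
    "f (c *\<^sub>C x) z = c *\<^sub>C f x z" "f x (c *\<^sub>C z) = c *\<^sub>C f x z"
  using assms by (simp_all add: cbilinear_def clinear_on_def)

lemma cbilinearI:
  assumes "\<And>x y z. f (x + y) z = f x z + f y z" "\<And>x z w. f x (z + w) = f x z + f x w"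
    "\<And>c x z. f (c *\<^sub>C x) z = c *\<^sub>C f x z" "\<And>c x z. f x (c *\<^sub>C z) = c *\<^sub>C f x z"
  shows "cbilinear f"
  using assms by (simp add: cbilinear_def clinear_on_def)

lemma scaleC_zero_right [simp]: "c *\<^sub>C (0::'a::complex_vector) = 0"
  by (rule complex_vector.scale_zero_right)

lemma formal_sum_scale_left:
  assumes "cbilinear f"
  shows "formal_sum f (map (\<lambda>(a, b). (c *\<^sub>C a, b)) s) = c *\<^sub>C formal_sum f s"
  by (induction s) (auto simp: cbilinear_simps[OF assms] scaleC_add_right)

instantiation tensor :: (complex_vector, complex_vector) complex_vector
begin

lift_definition zero_tensor :: "('a, 'b) tensor" is "[]" .
lift_definition plus_tensor :: "('a, 'b) tensor \<Rightarrow> ('a, 'b) tensor \<Rightarrow> ('a, 'b) tensor" is append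
  by (auto simp: tensor_eq_def)
lift_definition scaleC_tensor :: "complex \<Rightarrow> ('a, 'b) tensor \<Rightarrow> ('a, 'b) tensor"
  is "\<lambda>c. map (\<lambda>(a, b). (c *\<^sub>C a, b))"
  by (auto simp: tensor_eq_def formal_sum_scale_left)
definition uminus_tensor :: "('a, 'b) tensor \<Rightarrow> ('a, 'b) tensor" where
  "- x = (-1) *\<^sub>C (x :: ('a, 'b) tensor)"
definition minus_tensor :: "('a, 'b) tensor \<Rightarrow> ('a, 'b) tensor \<Rightarrow> ('a, 'b) tensor" where
  "x - y = x + (- y :: ('a, 'b) tensor)"

instance
proof
  fix x y z :: "('a, 'b) tensor" and c d :: complex
  show "x + y + z = x + (y + z)" by transfer (simp add: tensor_eq_def)
  show "x + y = y + x" by transfer (simp add: tensor_eq_def)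
  show "0 + x = x" by transfer (simp add: tensor_eq_def)
  show "- x + x = 0"
    unfolding uminus_tensor_def
    by transfer (auto simp: tensor_eq_def formal_sum_scale_left scaleC_complex_def
        simp del: complex_vector.scale_minus_left complex_vector.scale_one)
  show "x - y = x + - y" by (simp add: minus_tensor_def)
  show "c *\<^sub>C (x + y) = c *\<^sub>C x + c *\<^sub>C y" by transfer (simp add: tensor_eq_def)
  show "(c + d) *\<^sub>C x = c *\<^sub>C x + d *\<^sub>C x"
    by transfer (auto simp: tensor_eq_def formal_sum_scale_left scaleC_complex_def distrib_right)
  show "c *\<^sub>C d *\<^sub>C x = (c * d) *\<^sub>C x"
    by transfer (auto simp: tensor_eq_def formal_sum_scale_left scaleC_scaleC simp del: map_map)
  show "1 *\<^sub>C x = x"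
    by transfer (auto simp: tensor_eq_def formal_sum_scale_left scaleC_one)
qed

end

lift_definition tensor :: "'a::complex_vector \<Rightarrow> 'b::complex_vector \<Rightarrow> ('a, 'b) tensor"
    (infixr "\<otimes>" 70) is "\<lambda>a b. [(a, b)]" .

text \<open>The linear map \<open>A \<otimes> B \<rightarrow> C\<close> induced by a bilinear \<open>f\<close>, i.e. \<open>\<Sum> f a\<^sub>i b\<^sub>i\<close> for \<open>t = \<Sum> a\<^sub>i \<otimes> b\<^sub>i\<close>.\<close>

definition tensor_sum ::
    "('a::complex_vector \<Rightarrow> 'b::complex_vector \<Rightarrow> 'c::complex_vector) \<Rightarrow> ('a, 'b) tensor \<Rightarrow> 'c" where
  "tensor_sum f t = formal_sum f (rep_tensor t)"

lemma functional_separates: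
  assumes "x \<noteq> (0::'a::complex_vector)"
  shows "\<exists>g :: 'a \<Rightarrow> complex. clinear_on UNIV UNIV g \<and> g x \<noteq> 0"
proof -
  interpret vp: vector_space_pair "scaleC :: complex \<Rightarrow> 'a \<Rightarrow> 'a"
    "scaleC :: complex \<Rightarrow> complex \<Rightarrow> complex"
    by unfold_locales
  have "\<not> module.dependent scaleC {x}" using assms 
    using complex_vector.dependent_single[of x] by (simp add: cdependent_def)
  then obtain g where g: "Vector_Spaces.linear scaleC scaleC g" "\<forall>y\<in>{x}. g y = (1::complex)"
    using vp.linear_independent_extend[of "{x}" "\<lambda>_. 1"] by blast
  then have "clinear_on UNIV UNIV g"
    by (auto simp: clinear_on_def Vector_Spaces.linear_def module_hom_def module_hom_axioms_def)
  then show ?thesis using g(2) by auto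
qed

lemma formal_sum_cong_tensor_eq:
  fixes f :: "'a::complex_vector \<Rightarrow> 'b::complex_vector \<Rightarrow> 'c::complex_vector"
  assumes f: "cbilinear f" and st: "tensor_eq s t"
  shows "formal_sum f s = formal_sum f t"
proof (rule ccontr)
  assume "formal_sum f s \<noteq> formal_sum f t"
  then obtain g :: "'c \<Rightarrow> complex" where g: "clinear_on UNIV UNIV g"
    and ne: "g (formal_sum f s - formal_sum f t) \<noteq> 0"
    using functional_separates by (metis right_minus_eq)
  have add: "g (x + y) = g x + g y" and sc: "g (c *\<^sub>C x) = c *\<^sub>C g x" for x y c
    using g by (simp_all add: clinear_on_def)
  have g0: "g 0 = 0" using add[of 0 0] by simp
  have diff: "g (x - y) = g x - g y" for x y using add[of "x - y" y] by simp
  have fs: "g (formal_sum f u) = formal_sum (\<lambda>a b. g (f a b)) u" for u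
    by (induction u) (auto simp: add g0)
  have "cbilinear (\<lambda>a b. g (f a b))"
    by (rule cbilinearI) (simp_all add: cbilinear_simps[OF f] add sc)
  then have "g (formal_sum f s) = g (formal_sum f t)"
    using st by (simp add: fs tensor_eq_def)
  with ne show False by (simp add: diff)
qed

lemma tensor_sum_abs:
  assumes "cbilinear f"
  shows "tensor_sum f (abs_tensor s) = formal_sum f s"
  unfolding tensor_sum_def
  by (rule formal_sum_cong_tensor_eq[OF assms])
    (use Quotient_rep_abs[OF Quotient_tensor] in \<open>auto simp: tensor_eq_def\<close>)

lemma tensor_sum_tensor:
  assumes "cbilinear f"
  shows "tensor_sum f (a \<otimes> b) = f a b"
  unfolding tensor.abs_eq by (simp add: tensor_sum_abs[OF assms])

lemma tensor_sum_add:
  assumes "cbilinear f"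
  shows "tensor_sum f (s + t) = tensor_sum f s + tensor_sum f t"
  by (induction s rule: tensor.abs_induct, induction t rule: tensor.abs_induct)
    (simp add: plus_tensor.abs_eq tensor_sum_abs[OF assms])

lemma tensor_sum_scaleC:
  assumes "cbilinear f"
  shows "tensor_sum f (c *\<^sub>C t) = c *\<^sub>C tensor_sum f t"
  by (induction t rule: tensor.abs_induct)
    (simp add: scaleC_tensor.abs_eq tensor_sum_abs[OF assms] formal_sum_scale_left[OF assms])

text \<open>The *-algebra structure with \<open>(a \<otimes> b)(c \<otimes> d) = ac \<otimes> bd\<close> and
  \<open>(a \<otimes> b)\<^sup>* = a\<^sup>* \<otimes> b\<^sup>*\<close>.\<close>

definition formal_mult ::
    "('a::times \<times> 'b::times) list \<Rightarrow> ('a \<times> 'b) list \<Rightarrow> ('a \<times> 'b) list" where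
  "formal_mult s t = concat (map (\<lambda>(a, b). map (\<lambda>(c, d). (a * c, b * d)) t) s)"

lemma formal_sum_mult:
  "formal_sum f (formal_mult s t)
     = formal_sum (\<lambda>a b. formal_sum (\<lambda>c d. f (a * c) (b * d)) t) s"
proof (induction s)
  case (Cons p s)
  have "formal_sum f (map (\<lambda>(c, d). (fst p * c, snd p * d)) t)
      = formal_sum (\<lambda>c d. f (fst p * c) (snd p * d)) t"
    by (induction t) auto
  then show ?case using Cons by (auto simp: formal_mult_def split: prod.splits)
qed (simp add: formal_mult_def)

lemma formal_sum_add_fun:
  "formal_sum (\<lambda>a b. f a b + g a b) s = formal_sum f s + (formal_sum g s :: 'c::comm_monoid_add)"
  by (induction s) (auto simp: algebra_simps)

lemma formal_sum_scale_fun: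
  "formal_sum (\<lambda>a b. c *\<^sub>C f a b) s = c *\<^sub>C (formal_sum f s :: 'c::complex_vector)"
  by (induction s) (auto simp: scaleC_add_right)

lemma formal_sum_swap:
  "formal_sum (\<lambda>a b. formal_sum (\<lambda>c d. f a b c d) t) s
     = (formal_sum (\<lambda>c d. formal_sum (\<lambda>a b. f a b c d) s) t :: 'c::comm_monoid_add)"
proof (induction s)
  case Nil show ?case by (induction t) auto
next
  case (Cons p s) then show ?case by (cases p) (simp add: formal_sum_add_fun)
qed

lemma formal_sum_star:
  "formal_sum f (map (\<lambda>(a, b). (star a, star b)) s) = formal_sum (\<lambda>a b. f (star a) (star b)) s"
  by (induction s) auto

lemma formal_sum_cnj: "cnj (formal_sum f s) = formal_sum (\<lambda>a b. cnj (f a b)) s"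
  by (induction s) auto

lemma tensor_eq_mult_aux:
  fixes s s' t t' :: "('a::complex_star_algebra \<times> 'b::complex_star_algebra) list"
  assumes "tensor_eq s s'" "tensor_eq t t'"
  shows "tensor_eq (formal_mult s t) (formal_mult s' t')"
  unfolding tensor_eq_def
proof (intro allI impI)
  fix f :: "'a \<Rightarrow> 'b \<Rightarrow> complex" assume f: "cbilinear f"
  have 1: "cbilinear (\<lambda>c d. f (a * c) (b * d))" for a b
    by (rule cbilinearI) (simp_all add: cbilinear_simps[OF f] distrib_left mult_scaleC_right)
  have 2: "cbilinear (\<lambda>a b. f (a * c) (b * d))" for c d
    by (rule cbilinearI) (simp_all add: cbilinear_simps[OF f] distrib_right mult_scaleC_left)
  have "formal_sum f (formal_mult s t)
      = formal_sum (\<lambda>a b. formal_sum (\<lambda>c d. f (a * c) (b * d)) t') s"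
    using 1 assms(2) by (simp add: formal_sum_mult tensor_eq_def)
  also have "\<dots> = formal_sum (\<lambda>c d. formal_sum (\<lambda>a b. f (a * c) (b * d)) s) t'"
    by (rule formal_sum_swap)
  also have "\<dots> = formal_sum (\<lambda>c d. formal_sum (\<lambda>a b. f (a * c) (b * d)) s') t'"
    using 2 assms(1) by (simp add: tensor_eq_def)
  also have "\<dots> = formal_sum f (formal_mult s' t')"
    unfolding formal_sum_mult by (rule formal_sum_swap)
  finally show "formal_sum f (formal_mult s t) = formal_sum f (formal_mult s' t')" .
qed

lemma tensor_eq_star_aux:
  fixes s s' :: "('a::complex_star_algebra \<times> 'b::complex_star_algebra) list"
  assumes "tensor_eq s s'"
  shows "tensor_eq (map (\<lambda>(a, b). (star a, star b)) s) (map (\<lambda>(a, b). (star a, star b)) s')"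
  unfolding tensor_eq_def
proof (intro allI impI)
  fix f :: "'a \<Rightarrow> 'b \<Rightarrow> complex" assume f: "cbilinear f"
  have "cbilinear (\<lambda>a b. cnj (f (star a) (star b)))"
    by (rule cbilinearI)
      (simp_all add: cbilinear_simps[OF f] star_add star_scaleC scaleC_complex_def)
  then have "cnj (formal_sum (\<lambda>a b. f (star a) (star b)) s)
      = cnj (formal_sum (\<lambda>a b. f (star a) (star b)) s')"
    using assms by (simp add: formal_sum_cnj tensor_eq_def)
  then show "formal_sum f (map (\<lambda>(a, b). (star a, star b)) s)
      = formal_sum f (map (\<lambda>(a, b). (star a, star b)) s')"
    by (simp add: formal_sum_star)
qed

instantiation tensor :: (complex_star_algebra, complex_star_algebra) complex_star_algebra
begin

lift_definition one_tensor :: "('a, 'b) tensor" is "[(1, 1)]" .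
lift_definition times_tensor :: "('a, 'b) tensor \<Rightarrow> ('a, 'b) tensor \<Rightarrow> ('a, 'b) tensor"
  is formal_mult by (rule tensor_eq_mult_aux)
lift_definition star_tensor :: "('a, 'b) tensor \<Rightarrow> ('a, 'b) tensor"
  is "map (\<lambda>(a, b). (star a, star b))" by (rule tensor_eq_star_aux)

instance
proof
  fix x y z :: "('a, 'b) tensor" and c :: complex
  have fm: "formal_mult [(1, 1)] s = s" "formal_mult s [(1, 1)] = s" for s :: "('a \<times> 'b) list"
    by (induction s) (auto simp: formal_mult_def)
  show "x * y * z = x * (y * z)" 
    by transfer (simp add: tensor_eq_def formal_sum_mult mult.assoc)
  show "1 * x = x" by transfer (simp add: fm tensor_eq_def)
  show "x * 1 = x" by transfer (simp add: fm tensor_eq_def)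
  show "(x + y) * z = x * z + y * z" by transfer (simp add: tensor_eq_def formal_sum_mult)
  show "x * (y + z) = x * y + x * z"
    by transfer (simp add: tensor_eq_def formal_sum_mult formal_sum_add_fun)
  show "(c *\<^sub>C x) * y = c *\<^sub>C (x * y)"
  proof transfer
    fix c and s t :: "('a \<times> 'b) list"
    have "formal_mult (map (\<lambda>(a, b). (c *\<^sub>C a, b)) s) t
        = map (\<lambda>(a, b). (c *\<^sub>C a, b)) (formal_mult s t)"
      by (induction s) (auto simp: formal_mult_def mult_scaleC_left)
    then show "tensor_eq (formal_mult (map (\<lambda>(a, b). (c *\<^sub>C a, b)) s) t)
        (map (\<lambda>(a, b). (c *\<^sub>C a, b)) (formal_mult s t))"
      by (simp add: tensor_eq_def)
  qed
  show "x * (c *\<^sub>C y) = c *\<^sub>C (x * y)"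
  proof transfer
    fix c and s t :: "('a \<times> 'b) list"
    have "formal_mult s (map (\<lambda>(a, b). (c *\<^sub>C a, b)) t)
        = map (\<lambda>(a, b). (c *\<^sub>C a, b)) (formal_mult s t)"
      by (induction s) (auto simp: formal_mult_def mult_scaleC_right)
    then show "tensor_eq (formal_mult s (map (\<lambda>(a, b). (c *\<^sub>C a, b)) t))
        (map (\<lambda>(a, b). (c *\<^sub>C a, b)) (formal_mult s t))"
      by (simp add: tensor_eq_def)
  qed
  show "star (x + y) = star x + star y" by transfer (simp add: tensor_eq_def)
  show "star (star x) = x"
  proof transfer
    fix s :: "('a \<times> 'b) list"
    have "map (\<lambda>(a, b). (star a, star b)) (map (\<lambda>(a, b). (star a, star b)) s) = s"
      by (induction s) (auto simp: star_star)
    then show "tensor_eq (map (\<lambda>(a, b). (star a, star b)) (map (\<lambda>(a, b). (star a, star b)) s)) s"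
      by (simp add: tensor_eq_def)
  qed
  show "star (c *\<^sub>C x) = cnj c *\<^sub>C star x"
  proof transfer
    fix c and s :: "('a \<times> 'b) list"
    have eq: "map (\<lambda>(a, b). (star a, star b)) (map (\<lambda>(a, b). (c *\<^sub>C a, b)) s)
       = map (\<lambda>(a, b). (cnj c *\<^sub>C a, b)) (map (\<lambda>(a, b). (star a, star b)) s)"
      by (induction s) (auto simp: star_scaleC)
    then show "tensor_eq (map (\<lambda>(a, b). (star a, star b)) (map (\<lambda>(a, b). (c *\<^sub>C a, b)) s))
       (map (\<lambda>(a, b). (cnj c *\<^sub>C a, b)) (map (\<lambda>(a, b). (star a, star b)) s))"
      unfolding eq by (simp add: tensor_eq_def)
  qed
  show "star (x * y) = star y * star x"
  proof transfer
    fix s t :: "('a \<times> 'b) list"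
    show "tensor_eq (map (\<lambda>(a, b). (star a, star b)) (formal_mult s t))
       (formal_mult (map (\<lambda>(a, b). (star a, star b)) t) (map (\<lambda>(a, b). (star a, star b)) s))"
      unfolding tensor_eq_def
      unfolding formal_sum_star formal_sum_mult star_mult
      by (intro allI impI) (rule formal_sum_swap)
  qed
qed

end

section \<open>Discrete quantum groups\<close>

record (overloaded) 'a quantum_group =
  comult :: "'a::complex_star_algebra \<Rightarrow> ('a, 'a) tensor"
  counit :: "'a \<Rightarrow> complex"
  antipode :: "'a \<Rightarrow> 'a"
  haar :: "'a \<Rightarrow> complex"

text \<open>The type \<open>'a\<close> is the *-algebra \<open>\<complex>[\<Gamma>]\<close>. Coassociativity is written in \<open>'a \<otimes> ('a \<otimes> 'a)\<close>.\<close>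

locale discrete_quantum_group =
  fixes G :: "'a::complex_star_algebra quantum_group"
  assumes comult_linear: "clinear_on UNIV UNIV (comult G)"
    and comult_one: "comult G 1 = 1"
    and comult_mult: "comult G (x * y) = comult G x * comult G y"
    and comult_star: "comult G (star x) = star (comult G x)"
    and coassoc: "tensor_sum (\<lambda>y z. y \<otimes> comult G z) (comult G x)
      = tensor_sum (\<lambda>y z. tensor_sum (\<lambda>y\<^sub>1 y\<^sub>2. y\<^sub>1 \<otimes> y\<^sub>2 \<otimes> z) (comult G y)) (comult G x)"
    and counit_linear: "clinear_on UNIV UNIV (counit G)"
    and counit_one: "counit G 1 = 1"
    and counit_mult: "counit G (x * y) = counit G x * counit G y"
    and counit_left: "tensor_sum (\<lambda>y z. counit G y *\<^sub>C z) (comult G x) = x"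
    and counit_right: "tensor_sum (\<lambda>y z. counit G z *\<^sub>C y) (comult G x) = x"
    and antipode_linear: "clinear_on UNIV UNIV (antipode G)"
    and antipode_left: "tensor_sum (\<lambda>y z. antipode G y * z) (comult G x) = counit G x *\<^sub>C 1"
    and antipode_right: "tensor_sum (\<lambda>y z. y * antipode G z) (comult G x) = counit G x *\<^sub>C 1"
    and haar_linear: "clinear_on UNIV UNIV (haar G)"
    and haar_one: "haar G 1 = 1"
    and haar_positive: "\<exists>r::real. r \<ge> 0 \<and> haar G (star x * x) = complex_of_real r"
    and haar_right_invariant: "tensor_sum (\<lambda>y z. haar G z *\<^sub>C y) (comult G x) = haar G x *\<^sub>C 1"
    and haar_left_invariant: "tensor_sum (\<lambda>y z. haar G y *\<^sub>C z) (comult G x) = haar G x *\<^sub>C 1"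

section \<open>Corepresentations\<close>

text \<open>Finite-dimensional vector spaces are taken to be \<open>\<complex>\<^sup>n\<close>, realised as the functions on \<open>nat\<close> that
  vanish from \<open>n\<close> on; finite-dimensional Hilbert spaces are \<open>\<complex>\<^sup>n\<close> with the standard inner product.
  Correspondingly \<open>\<complex>\<^sup>n \<otimes> X\<close> is \<open>X\<^sup>n\<close>, with \<open>\<xi> \<otimes> x\<close> the tuple \<open>(\<xi>\<^sub>i x)\<^sub>i\<close>. Under this
  identification \<open>id \<otimes> f\<close> is composition with \<open>f\<close>. The standard basis vector \<open>e\<^sub>i\<close> is
  \<open>ebasis i\<close>.\<close>

type_synonym cvec = "nat \<Rightarrow> complex"

definition Cpow :: "nat \<Rightarrow> (nat \<Rightarrow> 'b::zero) set" where
  "Cpow n = {v. \<forall>i\<ge>n. v i = 0}"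

definition ebasis :: "nat \<Rightarrow> cvec" where
  "ebasis i = (\<lambda>j. if j = i then 1 else 0)"

definition elem_tensor :: "cvec \<Rightarrow> 'b \<Rightarrow> nat \<Rightarrow> 'b::complex_vector" where
  "elem_tensor \<xi> x = (\<lambda>i. \<xi> i *\<^sub>C x)"

text \<open>\<open>T \<otimes> id\<close> and \<open>\<delta> \<otimes> id\<close> for linear \<open>T : \<complex>\<^sup>n \<rightarrow> \<complex>\<^sup>m\<close> and \<open>\<delta> : \<complex>\<^sup>n \<rightarrow> \<complex>\<^sup>m \<otimes> X\<close>, evaluated at
  \<open>s = \<Sum>\<^sub>j e\<^sub>j \<otimes> s\<^sub>j\<close>.\<close>

definition map_tensor_id :: "nat \<Rightarrow> (cvec \<Rightarrow> cvec) \<Rightarrow> (nat \<Rightarrow> 'b) \<Rightarrow> nat \<Rightarrow> 'b::complex_vector" where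
  "map_tensor_id n T s = (\<Sum>j<n. elem_tensor (T (ebasis j)) (s j))"

definition coact_tensor_id ::
    "nat \<Rightarrow> (cvec \<Rightarrow> nat \<Rightarrow> 'a) \<Rightarrow> (nat \<Rightarrow> 'b) \<Rightarrow> nat \<Rightarrow> ('a::complex_vector, 'b::complex_vector) tensor"
  where "coact_tensor_id n \<delta> s = (\<lambda>i. \<Sum>j<n. \<delta> (ebasis j) i \<otimes> s j)"

text \<open>A pair \<open>(n, \<delta>)\<close> with \<open>\<delta> : \<complex>\<^sup>n \<rightarrow> \<complex>\<^sup>n \<otimes> \<complex>[\<Gamma>]\<close>; the values of \<open>\<delta>\<close> outside \<open>\<complex>\<^sup>n\<close> are irrelevant.\<close>

type_synonym 'a corep = "nat \<times> (cvec \<Rightarrow> nat \<Rightarrow> 'a)"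

definition corepresentation :: "'a::complex_star_algebra quantum_group \<Rightarrow> 'a corep \<Rightarrow> bool" where
  "corepresentation G = (\<lambda>(n, \<delta>). clinear_on (Cpow n) (Cpow n) \<delta>
     \<and> (\<forall>\<xi>\<in>Cpow n. comult G \<circ> \<delta> \<xi> = coact_tensor_id n \<delta> (\<delta> \<xi>))
     \<and> (\<forall>\<xi>\<in>Cpow n. counit G \<circ> \<delta> \<xi> = \<xi>))"

definition inner_prod :: "nat \<Rightarrow> cvec \<Rightarrow> cvec \<Rightarrow> complex" where
  "inner_prod n \<xi> \<eta> = (\<Sum>i<n. cnj (\<xi> i) * \<eta> i)"

text \<open>\<open>\<delta>(\<xi>)\<^sup>* \<delta>(\<eta>) \<in> \<complex>[\<Gamma>]\<close> is computed with \<open>(e\<^sub>i \<otimes> x)\<^sup>*(e\<^sub>j \<otimes> y) = \<langle>e\<^sub>i, e\<^sub>j\<rangle> x\<^sup>* y\<close>.\<close>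

definition unitary_corep :: "'a::complex_star_algebra quantum_group \<Rightarrow> 'a corep \<Rightarrow> bool" where
  "unitary_corep G = (\<lambda>(n, \<delta>). corepresentation G (n, \<delta>)
     \<and> (\<forall>\<xi>\<in>Cpow n. \<forall>\<eta>\<in>Cpow n.
          (\<Sum>i<n. star (\<delta> \<xi> i) * \<delta> \<eta> i) = inner_prod n \<xi> \<eta> *\<^sub>C 1))"

definition irreducible_corep :: "'a::complex_star_algebra corep \<Rightarrow> bool" where
  "irreducible_corep = (\<lambda>(n, \<delta>). n \<noteq> 0 \<and>
     (\<forall>W. csubspace W \<and> W \<subseteq> Cpow n
        \<and> (\<forall>\<xi>\<in>W. \<delta> \<xi> \<in> cspan {elem_tensor w x | w x. w \<in> W})
        \<longrightarrow> W = {0} \<or> W = Cpow n))"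

text \<open>Intertwiners are extended by \<open>0\<close> outside \<open>\<complex>\<^sup>n\<close>, so that \<open>Mor\<close> is a genuine space of functions.\<close>

definition Mor :: "'a::complex_star_algebra corep \<Rightarrow> 'a corep \<Rightarrow> (cvec \<Rightarrow> cvec) set" where
  "Mor = (\<lambda>(n, \<delta>) (m, \<delta>'). {T. clinear_on (Cpow n) (Cpow m) T \<and> (\<forall>\<xi>. \<xi> \<notin> Cpow n \<longrightarrow> T \<xi> = 0)
     \<and> (\<forall>\<xi>\<in>Cpow n. \<delta>' (T \<xi>) = map_tensor_id n T (\<delta> \<xi>))})"

definition equivalent_corep :: "'a::complex_star_algebra corep \<Rightarrow> 'a corep \<Rightarrow> bool" where
  "equivalent_corep V W \<longleftrightarrow> (\<exists>T\<in>Mor V W. bij_betw T (Cpow (fst V)) (Cpow (fst W)))"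

text \<open>\<open>n\<close> copies of the trivial corepresentation, \<open>\<xi> \<mapsto> \<xi> \<otimes> 1\<close>.\<close>

definition trivial_corep :: "nat \<Rightarrow> 'a::complex_star_algebra corep" where
  "trivial_corep n = (n, \<lambda>\<xi>. elem_tensor \<xi> 1)"

text \<open>On \<open>V \<otimes> W\<close> with basis vector number \<open>i * dim W + j\<close> equal to \<open>e\<^sub>i \<otimes> e\<^sub>j\<close>:
  \<open>v \<otimes> w \<mapsto> v\<^sub>0 \<otimes> w\<^sub>0 \<otimes> v\<^sub>1 w\<^sub>1\<close>.\<close>

definition tensor_corep :: "'a::complex_star_algebra corep \<Rightarrow> 'a corep \<Rightarrow> 'a corep" where
  "tensor_corep = (\<lambda>(n, \<delta>) (m, \<delta>'). (n * m, \<lambda>\<xi> l. if l < n * m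
     then \<Sum>k<n * m. \<xi> k *\<^sub>C (\<delta> (ebasis (k div m)) (l div m) * \<delta>' (ebasis (k mod m)) (l mod m)) else 0))"

text \<open>On the dual space with the dual basis: \<open>e\<^sub>j\<^sup>* \<mapsto> \<Sum>\<^sub>i e\<^sub>i\<^sup>* \<otimes> S(u\<^sub>j\<^sub>i)\<close>, where
  \<open>\<delta>(e\<^sub>i) = \<Sum>\<^sub>j e\<^sub>j \<otimes> u\<^sub>j\<^sub>i\<close>. It need not be unitary for the standard inner product.\<close>

definition dual_corep :: "'a::complex_star_algebra quantum_group \<Rightarrow> 'a corep \<Rightarrow> 'a corep" where
  "dual_corep G = (\<lambda>(n, \<delta>).
     (n, \<lambda>\<xi> i. if i < n then \<Sum>j<n. \<xi> j *\<^sub>C antipode G (\<delta> (ebasis i) j) else 0))"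

section \<open>Based rings and modules\<close>

text \<open>\<open>\<int>\<^sub>I\<close> is the set of finitely supported functions on the type with support in \<open>I\<close>.\<close>

definition free_Z :: "'i set \<Rightarrow> ('i \<Rightarrow>\<^sub>0 int) set" where
  "free_Z I = {x. Poly_Mapping.keys x \<subseteq> I}"

abbreviation basis_elem :: "'i \<Rightarrow> 'i \<Rightarrow>\<^sub>0 int" where
  "basis_elem i \<equiv> Poly_Mapping.single i 1"

definition linear_ext :: "('i \<Rightarrow> 'j) \<Rightarrow> ('i \<Rightarrow>\<^sub>0 int) \<Rightarrow> ('j \<Rightarrow>\<^sub>0 int)" where
  "linear_ext f x = (\<Sum>i\<in>Poly_Mapping.keys x. Poly_Mapping.single (f i) (Poly_Mapping.lookup x i))"

record 'i based_ring =
  rbasis :: "'i set"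
  runit :: 'i
  rbar :: "'i \<Rightarrow> 'i"
  rmult :: "('i \<Rightarrow>\<^sub>0 int) \<Rightarrow> ('i \<Rightarrow>\<^sub>0 int) \<Rightarrow> ('i \<Rightarrow>\<^sub>0 int)"

definition bar :: "'i based_ring \<Rightarrow> ('i \<Rightarrow>\<^sub>0 int) \<Rightarrow> ('i \<Rightarrow>\<^sub>0 int)" where
  "bar R = linear_ext (rbar R)"

definition tau :: "'i based_ring \<Rightarrow> ('i \<Rightarrow>\<^sub>0 int) \<Rightarrow> int" where
  "tau R x = Poly_Mapping.lookup x (runit R)"

definition biadditive_on :: "('x::ab_group_add) set \<Rightarrow> ('y::ab_group_add) set \<Rightarrow>
    ('z::ab_group_add) set \<Rightarrow> ('x \<Rightarrow> 'y \<Rightarrow> 'z) \<Rightarrow> bool" where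
  "biadditive_on X Y Z f \<longleftrightarrow> (\<forall>x\<in>X. \<forall>y\<in>Y. f x y \<in> Z)
     \<and> (\<forall>x\<in>X. \<forall>x'\<in>X. \<forall>y\<in>Y. f (x + x') y = f x y + f x' y)
     \<and> (\<forall>x\<in>X. \<forall>y\<in>Y. \<forall>y'\<in>Y. f x (y + y') = f x y + f x y')"

locale fusion_ring =
  fixes R :: "'i based_ring"
  assumes unit_in: "runit R \<in> rbasis R"
    and bar_in: "\<alpha> \<in> rbasis R \<Longrightarrow> rbar R \<alpha> \<in> rbasis R"
    and bar_bar: "\<alpha> \<in> rbasis R \<Longrightarrow> rbar R (rbar R \<alpha>) = \<alpha>"
    and bar_unit: "rbar R (runit R) = runit R"
    and mult_biadditive:
      "biadditive_on (free_Z (rbasis R)) (free_Z (rbasis R)) (free_Z (rbasis R)) (rmult R)"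
    and mult_assoc: "\<lbrakk>x \<in> free_Z (rbasis R); y \<in> free_Z (rbasis R); z \<in> free_Z (rbasis R)\<rbrakk>
      \<Longrightarrow> rmult R (rmult R x y) z = rmult R x (rmult R y z)"
    and mult_unit: "x \<in> free_Z (rbasis R)
      \<Longrightarrow> rmult R (basis_elem (runit R)) x = x \<and> rmult R x (basis_elem (runit R)) = x"
    and bar_mult: "\<lbrakk>\<alpha> \<in> rbasis R; \<beta> \<in> rbasis R\<rbrakk>
      \<Longrightarrow> bar R (rmult R (basis_elem \<alpha>) (basis_elem \<beta>))
          = rmult R (bar R (basis_elem \<beta>)) (bar R (basis_elem \<alpha>))"
    and tau_bar_mult: "\<lbrakk>\<alpha> \<in> rbasis R; \<beta> \<in> rbasis R\<rbrakk>
      \<Longrightarrow> tau R (rmult R (bar R (basis_elem \<alpha>)) (basis_elem \<beta>)) = (if \<alpha> = \<beta> then 1 else 0)"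
    and tau_mult_nonneg: "\<lbrakk>\<alpha> \<in> rbasis R; \<beta> \<in> rbasis R; \<gamma> \<in> rbasis R\<rbrakk>
      \<Longrightarrow> tau R (rmult R (rmult R (basis_elem \<alpha>) (basis_elem \<beta>)) (basis_elem \<gamma>)) \<ge> 0"
    and dimension_function: "\<exists>d :: ('i \<Rightarrow>\<^sub>0 int) \<Rightarrow> real.
        d (basis_elem (runit R)) = 1
      \<and> (\<forall>x\<in>free_Z (rbasis R). \<forall>y\<in>free_Z (rbasis R).
            d (x + y) = d x + d y \<and> d (rmult R x y) = d x * d y)
      \<and> (\<forall>\<alpha>\<in>rbasis R. d (basis_elem \<alpha>) > 0 \<and> d (basis_elem \<alpha>) = d (bar R (basis_elem \<alpha>)))"

record ('i, 'j) based_module =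
  mbasis :: "'j set"
  act :: "('i \<Rightarrow>\<^sub>0 int) \<Rightarrow> ('j \<Rightarrow>\<^sub>0 int) \<Rightarrow> ('j \<Rightarrow>\<^sub>0 int)"
  form :: "('j \<Rightarrow>\<^sub>0 int) \<Rightarrow> ('j \<Rightarrow>\<^sub>0 int) \<Rightarrow> ('i \<Rightarrow>\<^sub>0 int)"

locale cofinite_based_module =
  fixes R :: "'i based_ring" and M :: "('i, 'j) based_module"
  assumes act_biadditive:
      "biadditive_on (free_Z (rbasis R)) (free_Z (mbasis M)) (free_Z (mbasis M)) (act M)"
    and act_unit: "m \<in> free_Z (mbasis M) \<Longrightarrow> act M (basis_elem (runit R)) m = m"
    and act_mult: "\<lbrakk>x \<in> free_Z (rbasis R); y \<in> free_Z (rbasis R); m \<in> free_Z (mbasis M)\<rbrakk>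
      \<Longrightarrow> act M (rmult R x y) m = act M x (act M y m)"
    and form_biadditive:
      "biadditive_on (free_Z (mbasis M)) (free_Z (mbasis M)) (free_Z (rbasis R)) (form M)"
    and form_act: "\<lbrakk>\<alpha> \<in> rbasis R; b \<in> mbasis M; c \<in> mbasis M\<rbrakk>
      \<Longrightarrow> form M (act M (basis_elem \<alpha>) (basis_elem b)) (basis_elem c)
          = rmult R (basis_elem \<alpha>) (form M (basis_elem b) (basis_elem c))"
    and form_sym: "\<lbrakk>b \<in> mbasis M; c \<in> mbasis M\<rbrakk>
      \<Longrightarrow> form M (basis_elem b) (basis_elem c) = bar R (form M (basis_elem c) (basis_elem b))"
    and tau_form: "\<lbrakk>b \<in> mbasis M; c \<in> mbasis M\<rbrakk>
      \<Longrightarrow> tau R (form M (basis_elem b) (basis_elem c)) = (if b = c then 1 else 0)"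
    and tau_act_nonneg: "\<lbrakk>\<alpha> \<in> rbasis R; b \<in> mbasis M; c \<in> mbasis M\<rbrakk>
      \<Longrightarrow> tau R (rmult R (basis_elem \<alpha>) (form M (basis_elem b) (basis_elem c))) \<ge> 0"

definition connected_module :: "'i based_ring \<Rightarrow> ('i, 'j) based_module \<Rightarrow> bool" where
  "connected_module R M \<longleftrightarrow> (\<forall>b\<in>mbasis M. \<forall>c\<in>mbasis M. \<exists>\<alpha>\<in>rbasis R.
     tau R (rmult R (basis_elem \<alpha>) (form M (basis_elem b) (basis_elem c))) \<noteq> 0)"

definition standard_module :: "'i based_ring \<Rightarrow> ('i, 'i) based_module" where
  "standard_module R =
     \<lparr>mbasis = rbasis R, act = rmult R, form = (\<lambda>x y. rmult R x (bar R y))\<rparr>"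

definition isomorphic_modules ::
    "'i based_ring \<Rightarrow> ('i, 'j) based_module \<Rightarrow> ('i, 'k) based_module \<Rightarrow> bool" where
  "isomorphic_modules R M N \<longleftrightarrow> (\<exists>f. bij_betw f (mbasis M) (mbasis N)
     \<and> (\<forall>x\<in>free_Z (rbasis R). \<forall>m\<in>free_Z (mbasis M).
          linear_ext f (act M x m) = act N x (linear_ext f m))
     \<and> (\<forall>m\<in>free_Z (mbasis M). \<forall>m'\<in>free_Z (mbasis M).
          form N (linear_ext f m) (linear_ext f m') = form M m m'))"

text \<open>Module bases are taken inside \<open>'i \<times> nat\<close>. This is no restriction: in a connected module with a
  basis element \<open>b\<close>, every basis element \<open>c\<close> occurs in \<open>\<alpha> \<otimes> b\<close> for some \<open>\<alpha> \<in> I\<close>, because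
  \<open>\<tau>(\<alpha> \<otimes> \<langle>b, c\<rangle>)\<close> is the coefficient of \<open>c\<close> in \<open>\<alpha> \<otimes> b\<close>. Each \<open>\<alpha> \<otimes> b\<close> has finite support, so the
  basis injects into \<open>I \<times> nat\<close>.\<close>

definition torsion_free_ring :: "'i based_ring \<Rightarrow> bool" where
  "torsion_free_ring R \<longleftrightarrow> (\<forall>M :: ('i, 'i \<times> nat) based_module.
     cofinite_based_module R M \<and> mbasis M \<noteq> {} \<and> connected_module R M
       \<longrightarrow> isomorphic_modules R M (standard_module R))"

section \<open>The fusion ring of a discrete quantum group\<close>

definition irr_coreps :: "'a::complex_star_algebra quantum_group \<Rightarrow> 'a corep set" where
  "irr_coreps G = {V. unitary_corep G V \<and> irreducible_corep V}"

definition irr_equiv :: "'a::complex_star_algebra quantum_group \<Rightarrow> ('a corep \<times> 'a corep) set" where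
  "irr_equiv G = {(V, W). V \<in> irr_coreps G \<and> W \<in> irr_coreps G \<and> equivalent_corep V W}"

definition fusion_coeff :: "'a::complex_star_algebra corep set \<Rightarrow> 'a corep set \<Rightarrow> 'a corep set \<Rightarrow> nat"
  where "fusion_coeff a b c =
    cdim (Mor (SOME Z. Z \<in> c) (tensor_corep (SOME V. V \<in> a) (SOME W. W \<in> b)))"

text \<open>The conjugate class of \<open>a\<close> consists of the irreducible unitary corepresentations that are
  equivalent to the dual of a member of \<open>a\<close>.\<close>

definition Fus :: "'a::complex_star_algebra quantum_group \<Rightarrow> 'a corep set based_ring" where
  "Fus G = \<lparr>rbasis = irr_coreps G // irr_equiv G,
     runit = irr_equiv G `` {trivial_corep 1},
     rbar = (\<lambda>a. {W \<in> irr_coreps G. \<exists>V\<in>a. equivalent_corep W (dual_corep G V)}),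
     rmult = (\<lambda>x y. Poly_Mapping.Abs_poly_mapping (\<lambda>c.
       if c \<in> irr_coreps G // irr_equiv G
       then \<Sum>a\<in>Poly_Mapping.keys x. \<Sum>b\<in>Poly_Mapping.keys y.
         Poly_Mapping.lookup x a * Poly_Mapping.lookup y b * int (fusion_coeff a b c)
       else 0))\<rparr>"

text \<open>\<open>Fus G\<close> is a fusion ring for every discrete quantum group \<open>G\<close>, so this is not a hypothesis.\<close>

definition strongly_torsion_free :: "'a::complex_star_algebra quantum_group \<Rightarrow> bool" where
  "strongly_torsion_free G \<longleftrightarrow> torsion_free_ring (Fus G)"

section \<open>Coactions on finite-dimensional C*-algebras\<close>

record fd_algebra =
  adim :: nat
  amult :: "cvec \<Rightarrow> cvec \<Rightarrow> cvec"
  aone :: cvec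
  astar :: "cvec \<Rightarrow> cvec"

definition cbilinear_on :: "'a::complex_vector set \<Rightarrow> 'b::complex_vector set \<Rightarrow> 'c::complex_vector set
    \<Rightarrow> ('a \<Rightarrow> 'b \<Rightarrow> 'c) \<Rightarrow> bool" where
  "cbilinear_on V W X f \<longleftrightarrow>
     (\<forall>v\<in>V. clinear_on W X (f v)) \<and> (\<forall>w\<in>W. clinear_on V X (\<lambda>v. f v w))"

locale fd_cstar_algebra =
  fixes A :: fd_algebra
  assumes mult_bilinear: "cbilinear_on (Cpow (adim A)) (Cpow (adim A)) (Cpow (adim A)) (amult A)"
    and one_in: "aone A \<in> Cpow (adim A)"
    and star_antilinear: "antilinear_on (Cpow (adim A)) (Cpow (adim A)) (astar A)"
    and mult_assoc: "\<lbrakk>x \<in> Cpow (adim A); y \<in> Cpow (adim A); z \<in> Cpow (adim A)\<rbrakk>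
      \<Longrightarrow> amult A (amult A x y) z = amult A x (amult A y z)"
    and mult_one: "x \<in> Cpow (adim A) \<Longrightarrow> amult A (aone A) x = x \<and> amult A x (aone A) = x"
    and star_mult: "\<lbrakk>x \<in> Cpow (adim A); y \<in> Cpow (adim A)\<rbrakk>
      \<Longrightarrow> astar A (amult A x y) = amult A (astar A y) (astar A x)"
    and star_star: "x \<in> Cpow (adim A) \<Longrightarrow> astar A (astar A x) = x"
    and cstar_norm: "\<exists>N :: cvec \<Rightarrow> real.
      \<forall>x\<in>Cpow (adim A). \<forall>y\<in>Cpow (adim A). \<forall>c.
        N x \<ge> 0 \<and> (N x = 0 \<longleftrightarrow> x = 0) \<and> N (x + y) \<le> N x + N y \<and> N (c *\<^sub>C x) = cmod c * N x
        \<and> N (amult A x y) \<le> N x * N y \<and> N (amult A (astar A x) x) = (N x)\<^sup>2"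

text \<open>The extension \<open>(\<complex>\<^sup>p \<otimes> X) \<times> (\<complex>\<^sup>q \<otimes> X) \<rightarrow> \<complex>\<^sup>r \<otimes> X\<close> of a map \<open>f\<close> on \<open>\<complex>\<^sup>p \<times> \<complex>\<^sup>q\<close>, with
  \<open>(e\<^sub>i \<otimes> x, e\<^sub>j \<otimes> y) \<mapsto> f(e\<^sub>i, e\<^sub>j) \<otimes> xy\<close>. If \<open>f\<close> is antilinear in an argument, apply it to the
  tuple of adjoints in that argument.\<close>

definition ext2 :: "nat \<Rightarrow> nat \<Rightarrow> (cvec \<Rightarrow> cvec \<Rightarrow> cvec) \<Rightarrow>
    (nat \<Rightarrow> 'a) \<Rightarrow> (nat \<Rightarrow> 'a) \<Rightarrow> nat \<Rightarrow> 'a::complex_star_algebra" where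
  "ext2 p q f s t = (\<Sum>i<p. \<Sum>j<q. elem_tensor (f (ebasis i) (ebasis j)) (s i * t j))"

definition coaction ::
    "'a::complex_star_algebra quantum_group \<Rightarrow> fd_algebra \<Rightarrow> (cvec \<Rightarrow> nat \<Rightarrow> 'a) \<Rightarrow> bool" where
  "coaction G A \<alpha> \<longleftrightarrow> corepresentation G (adim A, \<alpha>)
     \<and> \<alpha> (aone A) = elem_tensor (aone A) 1
     \<and> (\<forall>x\<in>Cpow (adim A). \<forall>y\<in>Cpow (adim A).
          \<alpha> (amult A x y) = ext2 (adim A) (adim A) (amult A) (\<alpha> x) (\<alpha> y))
     \<and> (\<forall>x\<in>Cpow (adim A). \<alpha> (astar A x) = map_tensor_id (adim A) (astar A) (star \<circ> \<alpha> x))"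

text \<open>An equivariant imprimitivity bimodule \<open>\<complex>\<^sup>m\<close> between \<open>(A, \<alpha>)\<close> and \<open>(B, \<beta>)\<close>: \<open>lin\<close> is the
  \<open>A\<close>-valued inner product (antilinear in the second variable), \<open>rin\<close> the \<open>B\<close>-valued one (antilinear
  in the first variable). The equivariance conditions read \<open>\<delta>(a\<xi>) = \<alpha>(a)\<delta>(\<xi>)\<close>,
  \<open>\<delta>(\<xi>b) = \<delta>(\<xi>)\<beta>(b)\<close>, \<open>\<delta>(\<xi>)\<delta>(\<eta>)\<^sup>* = \<alpha>(lin \<xi> \<eta>)\<close> and \<open>\<delta>(\<xi>)\<^sup>*\<delta>(\<eta>) = \<beta>(rin \<xi> \<eta>)\<close>.\<close>

locale equivariant_imprimitivity_bimodule =
  fixes G :: "'a::complex_star_algebra quantum_group"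
    and A :: fd_algebra and \<alpha> :: "cvec \<Rightarrow> nat \<Rightarrow> 'a"
    and B :: fd_algebra and \<beta> :: "cvec \<Rightarrow> nat \<Rightarrow> 'a"
    and m :: nat and \<delta> :: "cvec \<Rightarrow> nat \<Rightarrow> 'a"
    and lact ract lin rin :: "cvec \<Rightarrow> cvec \<Rightarrow> cvec"
  assumes lact_bilinear: "cbilinear_on (Cpow (adim A)) (Cpow m) (Cpow m) lact"
    and lact_one: "\<xi> \<in> Cpow m \<Longrightarrow> lact (aone A) \<xi> = \<xi>"
    and lact_mult: "\<lbrakk>x \<in> Cpow (adim A); y \<in> Cpow (adim A); \<xi> \<in> Cpow m\<rbrakk>
      \<Longrightarrow> lact (amult A x y) \<xi> = lact x (lact y \<xi>)"
    and ract_bilinear: "cbilinear_on (Cpow m) (Cpow (adim B)) (Cpow m) ract"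
    and ract_one: "\<xi> \<in> Cpow m \<Longrightarrow> ract \<xi> (aone B) = \<xi>"
    and ract_mult: "\<lbrakk>x \<in> Cpow (adim B); y \<in> Cpow (adim B); \<xi> \<in> Cpow m\<rbrakk>
      \<Longrightarrow> ract \<xi> (amult B x y) = ract (ract \<xi> x) y"
    and bimodule: "\<lbrakk>x \<in> Cpow (adim A); \<xi> \<in> Cpow m; y \<in> Cpow (adim B)\<rbrakk>
      \<Longrightarrow> ract (lact x \<xi>) y = lact x (ract \<xi> y)"
    and lin_linear: "\<eta> \<in> Cpow m \<Longrightarrow> clinear_on (Cpow m) (Cpow (adim A)) (\<lambda>\<xi>. lin \<xi> \<eta>)"
    and lin_lact: "\<lbrakk>x \<in> Cpow (adim A); \<xi> \<in> Cpow m; \<eta> \<in> Cpow m\<rbrakk>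
      \<Longrightarrow> lin (lact x \<xi>) \<eta> = amult A x (lin \<xi> \<eta>)"
    and lin_star: "\<lbrakk>\<xi> \<in> Cpow m; \<eta> \<in> Cpow m\<rbrakk> \<Longrightarrow> astar A (lin \<xi> \<eta>) = lin \<eta> \<xi>"
    and lin_positive: "\<xi> \<in> Cpow m \<Longrightarrow> \<exists>x\<in>Cpow (adim A). lin \<xi> \<xi> = amult A (astar A x) x"
    and lin_definite: "\<lbrakk>\<xi> \<in> Cpow m; lin \<xi> \<xi> = 0\<rbrakk> \<Longrightarrow> \<xi> = 0"
    and lin_full: "cspan {lin \<xi> \<eta> | \<xi> \<eta>. \<xi> \<in> Cpow m \<and> \<eta> \<in> Cpow m} = Cpow (adim A)"
    and rin_linear: "\<xi> \<in> Cpow m \<Longrightarrow> clinear_on (Cpow m) (Cpow (adim B)) (rin \<xi>)"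
    and rin_ract: "\<lbrakk>\<xi> \<in> Cpow m; \<eta> \<in> Cpow m; y \<in> Cpow (adim B)\<rbrakk>
      \<Longrightarrow> rin \<xi> (ract \<eta> y) = amult B (rin \<xi> \<eta>) y"
    and rin_star: "\<lbrakk>\<xi> \<in> Cpow m; \<eta> \<in> Cpow m\<rbrakk> \<Longrightarrow> astar B (rin \<xi> \<eta>) = rin \<eta> \<xi>"
    and rin_positive: "\<xi> \<in> Cpow m \<Longrightarrow> \<exists>y\<in>Cpow (adim B). rin \<xi> \<xi> = amult B (astar B y) y"
    and rin_definite: "\<lbrakk>\<xi> \<in> Cpow m; rin \<xi> \<xi> = 0\<rbrakk> \<Longrightarrow> \<xi> = 0"
    and rin_full: "cspan {rin \<xi> \<eta> | \<xi> \<eta>. \<xi> \<in> Cpow m \<and> \<eta> \<in> Cpow m} = Cpow (adim B)"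
    and lin_rin: "\<lbrakk>\<xi> \<in> Cpow m; \<eta> \<in> Cpow m; \<zeta> \<in> Cpow m\<rbrakk>
      \<Longrightarrow> lact (lin \<xi> \<eta>) \<zeta> = ract \<xi> (rin \<eta> \<zeta>)"
    and corep: "corepresentation G (m, \<delta>)"
    and lact_equivariant: "\<lbrakk>x \<in> Cpow (adim A); \<xi> \<in> Cpow m\<rbrakk>
      \<Longrightarrow> \<delta> (lact x \<xi>) = ext2 (adim A) m lact (\<alpha> x) (\<delta> \<xi>)"
    and ract_equivariant: "\<lbrakk>\<xi> \<in> Cpow m; y \<in> Cpow (adim B)\<rbrakk>
      \<Longrightarrow> \<delta> (ract \<xi> y) = ext2 m (adim B) ract (\<delta> \<xi>) (\<beta> y)"
    and lin_equivariant: "\<lbrakk>\<xi> \<in> Cpow m; \<eta> \<in> Cpow m\<rbrakk>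
      \<Longrightarrow> \<alpha> (lin \<xi> \<eta>) = ext2 m m lin (\<delta> \<xi>) (star \<circ> \<delta> \<eta>)"
    and rin_equivariant: "\<lbrakk>\<xi> \<in> Cpow m; \<eta> \<in> Cpow m\<rbrakk>
      \<Longrightarrow> \<beta> (rin \<xi> \<eta>) = ext2 m m rin (star \<circ> \<delta> \<xi>) (\<delta> \<eta>)"

definition equivariantly_Morita_equivalent :: "'a::complex_star_algebra quantum_group \<Rightarrow>
    fd_algebra \<Rightarrow> (cvec \<Rightarrow> nat \<Rightarrow> 'a) \<Rightarrow> fd_algebra \<Rightarrow> (cvec \<Rightarrow> nat \<Rightarrow> 'a) \<Rightarrow> bool" where
  "equivariantly_Morita_equivalent G A \<alpha> B \<beta> \<longleftrightarrow>
     (\<exists>m \<delta> lact ract lin rin.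
        equivariant_imprimitivity_bimodule G A \<alpha> B \<beta> m \<delta> lact ract lin rin)"

definition C_sum :: "nat \<Rightarrow> fd_algebra" where
  "C_sum k = \<lparr>adim = k, amult = (\<lambda>x y i. x i * y i), aone = (\<lambda>i. if i < k then 1 else 0),
     astar = (\<lambda>x i. cnj (x i))\<rparr>"

text \<open>The direct sum of \<open>k\<close> trivial coactions on \<open>\<complex>\<close> is \<open>\<complex>\<^sup>k\<close> with \<open>x \<mapsto> x \<otimes> 1\<close>; the case \<open>k = 0\<close> is
  needed only for the zero algebra.\<close>

definition torsion_free :: "'a::complex_star_algebra quantum_group \<Rightarrow> bool" where
  "torsion_free G \<longleftrightarrow> (\<forall>A \<alpha>. fd_cstar_algebra A \<and> coaction G A \<alpha> \<longrightarrow>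
     (\<exists>k. equivariantly_Morita_equivalent G A \<alpha> (C_sum k) (snd (trivial_corep k))))"

end

theory Submission
  imports Defs "HOL-Computational_Algebra.Fundamental_Theorem_Algebra"
begin

text \<open>Unitary corepresentations equipped with a star-closed family of operators form a semisimple
category on which corepresentations act by tensoring. Its irreducible objects that are connected to a given
one span a cofinite connected based module over the fusion ring, so by hypothesis some object \<open>E\<close> in the
component satisfies \<open>dim Mor(E, E \<otimes> V) = dim Mor(1, V)\<close> for all \<open>V\<close>. For the operators of a coaction on
\<open>A\<close> this makes the commutant of \<open>A\<close> on \<open>E\<close> scalar, since that commutant is itself a corepresentation.
Applied to the irreducible summands of the regular representation of \<open>A\<close>, this gives finitely many
inequivalent irreducible representations of \<open>A\<close> that carry unitary corepresentations and are jointly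
faithful; their sum is the required bimodule.\<close>

section \<open>Finitely supported matrices\<close>

text \<open>Two notions of irreducibility compete: with respect to all operations including the
  corepresentation, and with respect to the operators of the algebra alone. The summands of the
  regular representation are irreducible in the first sense only, and the commutant of the algebra
  on them may be large. The basis object matched with the unit of the standard module has internal
  form 1, so a morphism from it into itself tensored with any corepresentation meets only trivial
  constituents; a basis of the commutant is such a morphism, and the commutant collapses to scalars.
  Linked objects annihilate the same elements of the algebra, which preserves joint faithfulness. To
  have tensor products, subobjects and conjugates as objects of one kind, all spaces are ranges of
  projections among finitely supported matrices over arbitrary index types. Slicing a
  corepresentation matrix by linear functionals turns equivariance into commutation with a single
  operator family, which unitarity makes closed under adjoints; complete reducibility and Schur's
  lemma are then proved once for both notions.\<close>

instantiation complex :: complex_star_algebra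
begin
definition "star (x::complex) = cnj x"
instance by standard (simp_all add: scaleC_complex_def star_complex_def)
end

lemma star_zero [simp]: "star (0::'a::complex_star_algebra) = 0"
  using star_add[of 0 "0::'a"] by simp

lemma star_one [simp]: "star (1::'a::complex_star_algebra) = 1"
  by (metis mult.left_neutral star_mult star_star)

lemma star_sum: "star (\<Sum>i\<in>I. f i) = (\<Sum>i\<in>I. star (f i :: 'a::complex_star_algebra))"
  by (induction I rule: infinite_finite_induct) (simp_all add: star_add)

lemma scaleC_zero_left [simp]: "(0::complex) *\<^sub>C (x::'a::complex_vector) = 0"
  by (rule complex_vector.scale_zero_left)

lemma scaleC_sum_right: "c *\<^sub>C (\<Sum>i\<in>I. f i) = (\<Sum>i\<in>I. c *\<^sub>C (f i :: 'a::complex_vector))"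
  by (rule complex_vector.scale_sum_right)

lemma scaleC_sum_left: "(\<Sum>i\<in>I. f i) *\<^sub>C x = (\<Sum>i\<in>I. f i *\<^sub>C (x :: 'a::complex_vector))"
  by (rule complex_vector.scale_sum_left)

lemma scaleC_eq_zero [simp]: "c *\<^sub>C x = 0 \<longleftrightarrow> c = 0 \<or> (x::'a::complex_vector) = 0"
  by (rule complex_vector.scale_eq_0_iff)

definition lin :: "('a::complex_vector => 'b::complex_vector) => bool" where
  "lin f \<longleftrightarrow> (\<forall>x y. f (x + y) = f x + f y) \<and> (\<forall>c x. f (c *\<^sub>C x) = c *\<^sub>C f x)"

lemma linI: "(!!x y. f (x + y) = f x + f y) ==> (!!c x. f (c *\<^sub>C x) = c *\<^sub>C f x) ==> lin f"
  by (simp add: lin_def)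

lemma lin_clinear_on: "clinear_on UNIV UNIV f = lin f"
  by (simp add: clinear_on_def lin_def)

lemma lin_add: "lin f ==> f (x + y) = f x + f y"
  and lin_scale: "lin f ==> f (c *\<^sub>C x) = c *\<^sub>C f x"
  by (simp_all add: lin_def)

lemma lin_zero: "lin f ==> f 0 = 0"
  using lin_scale[of f 0 0] by simp

lemma lin_sum: "lin f ==> f (\<Sum>i\<in>I. g i) = (\<Sum>i\<in>I. f (g i))"
  by (induction I rule: infinite_finite_induct) (simp_all add: lin_add lin_zero)

text \<open>Functionals separate points, so an identity between algebra-valued expressions may be
  tested on complex numbers. This reduction later identifies intertwiners of corepresentations with
  the commutant of a family of complex matrices.\<close>

lemma functional_ext:
  assumes "!!f. lin f ==> f x = (f y :: complex)"
  shows "x = (y::'a::complex_vector)"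
proof (rule ccontr)
  assume "x ~= y"
  then obtain g :: "'a => complex" where g: "lin g" "g (x - y) ~= 0"
  using functional_separates[of "x - y"] by (auto simp: lin_clinear_on)
  have "g x = g (x - y) + g y" using lin_add[OF g(1), of "x - y" y] by simp
  with g assms[OF g(1)] show False by simp
qed

instantiation poly_mapping :: (type, complex_vector) complex_vector
begin
definition "c *\<^sub>C A = Poly_Mapping.map (%x. c *\<^sub>C x) A"
lemma lookup_scaleC: "Poly_Mapping.lookup (c *\<^sub>C A) k = c *\<^sub>C Poly_Mapping.lookup A k"
  by (simp add: scaleC_poly_mapping_def Poly_Mapping.map.rep_eq when_def)
instance
  by standard (auto intro!: poly_mapping_eqI
   simp: lookup_scaleC lookup_add scaleC_add_right scaleC_add_left scaleC_scaleC scaleC_one)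
end

text \<open>Finite support makes every product a finite sum without fixing a size in the type. The
  price is that an infinite index type has no identity matrix: the projections \<open>idm S\<close>,
  with \<open>S\<close> covering the support at hand, take its place.\<close>

type_synonym ('i, 'j, 'c) fmat = "('i \<times> 'j) \<Rightarrow>\<^sub>0 'c"

type_synonym ('i, 'j) cmat = "('i, 'j, complex) fmat"

definition ent :: "('i, 'j, 'c::zero) fmat => 'i => 'j => 'c" where
  "ent A i j = Poly_Mapping.lookup A (i, j)"

definition rows :: "('i, 'j, 'c::zero) fmat => 'i set" where "rows A = fst ` Poly_Mapping.keys A"
definition cols :: "('i, 'j, 'c::zero) fmat => 'j set" where "cols A = snd ` Poly_Mapping.keys A"

lemma finite_rows [simp]: "finite (rows A)" and finite_cols [simp]: "finite (cols A)"
  by (simp_all add: rows_def cols_def)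

lemma ent_rows: "i \<notin> rows A ==> ent A i j = 0" and ent_cols: "j \<notin> cols A ==> ent A i j = 0"
  by (force simp: rows_def cols_def ent_def in_keys_iff)+

lemma fmat_eqI: "(!!i j. ent A i j = ent B i j) ==> A = B"
  by (rule poly_mapping_eqI) (auto simp: ent_def)

definition mk :: "'i set => 'j set => ('i => 'j => 'c::zero) => ('i, 'j, 'c) fmat" where
  "mk S S' f = Poly_Mapping.Abs_poly_mapping (%(i, j). if i \<in> S \<and> j \<in> S' then f i j else 0)"

lemma ent_mk:
  assumes "finite S" "finite S'"
  shows "ent (mk S S' f) i j = (if i \<in> S \<and> j \<in> S' then f i j else 0)"
proof -
  have "finite {x. (case x of (i, j) => if i \<in> S \<and> j \<in> S' then f i j else 0) ~= 0}"
  by (rule finite_subset[of _ "S \<times> S'"]) (use assms in \<open>auto split: if_splits\<close>)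
  then show ?thesis
  unfolding ent_def mk_def by (simp add: Abs_poly_mapping_inverse)
qed

lemma ent_zero [simp]: "ent 0 i j = 0"
  and ent_add: "ent (A + B) i j = ent A i j + ent B i j"
  and ent_scaleC: "ent (c *\<^sub>C C) i j = c *\<^sub>C ent C i j"
  by (simp_all add: ent_def lookup_add lookup_scaleC)

lemma ent_uminus: "ent (- A) i j = - ent (A::('i,'j,'c::ab_group_add) fmat) i j"
  and ent_minus: "ent (A - B) i j = ent A i j - ent (B::('i,'j,'c::ab_group_add) fmat) i j"
  by (simp_all add: ent_def lookup_minus)

lemma ent_sum: "ent (\<Sum>k\<in>K. A k) i j = (\<Sum>k\<in>K. ent (A k) i j)"
  by (induction K rule: infinite_finite_induct) (simp_all add: ent_add)

definition mm :: "('i, 'k, 'c) fmat => ('k, 'j, 'c) fmat => ('i, 'j, 'c::semiring_0) fmat"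
  (infixl "**" 70) where
  "A ** B = mk (rows A) (cols B) (%i j. \<Sum>k\<in>cols A. ent A i k * ent B k j)"

lemma ent_mm0: "ent (A ** B) i j = (\<Sum>k\<in>cols A. ent A i k * ent B k j)"
  by (auto simp: mm_def ent_mk ent_rows ent_cols)

text \<open>Any finite range covering the nonzero terms will do, which lets products with different
  supports be compared over a common range.\<close>

lemma ent_mm:
  assumes "finite K" "!!k. k \<notin> K ==> ent A i k * ent B k j = 0"
  shows "ent (A ** B) i j = (\<Sum>k\<in>K. ent A i k * ent B k j)"
  unfolding ent_mm0
  by (rule sum.mono_neutral_cong) (use assms in \<open>auto simp: ent_cols\<close>)

lemma mm_assoc: "(A ** B) ** C = A ** (B ** C)"
proof (rule fmat_eqI)
  fix i j
  have "ent ((A ** B) ** C) i j = (\<Sum>l\<in>cols B. ent (A ** B) i l * ent C l j)"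
  by (rule ent_mm) (simp_all add: ent_mm0 ent_cols)
  also have "... = (\<Sum>l\<in>cols B. \<Sum>k\<in>cols A. ent A i k * ent B k l * ent C l j)"
  by (simp add: ent_mm0 sum_distrib_right)
  also have "... = (\<Sum>k\<in>cols A. \<Sum>l\<in>cols B. ent A i k * ent B k l * ent C l j)"
  by (rule sum.swap)
  also have "... = ent (A ** (B ** C)) i j"
  by (simp add: ent_mm0 sum_distrib_left mult.assoc)
  finally show "ent ((A ** B) ** C) i j = ent (A ** (B ** C)) i j" .
qed

lemma mm_zero [simp]: "A ** 0 = 0" "0 ** A = 0"
  by (rule fmat_eqI, simp add: ent_mm0)+

lemma mm_add_left: "(A + B) ** C = A ** C + B ** C"
proof (rule fmat_eqI)
  fix i j
  let ?K = "cols A \<union> cols B"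
  have "ent ((A + B) ** C) i j = (\<Sum>k\<in>?K. ent (A + B) i k * ent C k j)"
  "ent (A ** C) i j = (\<Sum>k\<in>?K. ent A i k * ent C k j)"
  "ent (B ** C) i j = (\<Sum>k\<in>?K. ent B i k * ent C k j)"
  by (rule ent_mm; simp add: ent_cols ent_add)+
  then show "ent ((A + B) ** C) i j = ent (A ** C + B ** C) i j"
  by (simp add: ent_add sum.distrib distrib_right)
qed

lemma mm_add_right: "A ** (B + C) = A ** B + A ** C"
  by (rule fmat_eqI) (simp add: ent_mm0 ent_add sum.distrib distrib_left)

lemma mm_diff_left: "((A::('i,'k,'c::ring) fmat) - B) ** C = A ** C - B ** C"
  using mm_add_left[of "A - B" B C] by (simp add: algebra_simps)

lemma mm_diff_right: "(A::('i,'k,'c::ring) fmat) ** (B - C) = A ** B - A ** C"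
  using mm_add_right[of A "B - C" C] by (simp add: algebra_simps)

lemma mm_sum_left: "(\<Sum>k\<in>K. A k) ** B = (\<Sum>k\<in>K. A k ** B)"
  by (induction K rule: infinite_finite_induct) (simp_all add: mm_add_left)

lemma mm_sum_right: "B ** (\<Sum>k\<in>K. A k) = (\<Sum>k\<in>K. B ** A k)"
  by (induction K rule: infinite_finite_induct) (simp_all add: mm_add_right)

lemma mm_scale_left: "(c *\<^sub>C A) ** B = c *\<^sub>C (A ** (B::('k,'j,'c::complex_star_algebra) fmat))"
proof (rule fmat_eqI)
  fix i j
  have "ent ((c *\<^sub>C A) ** B) i j = (\<Sum>k\<in>cols A. ent (c *\<^sub>C A) i k * ent B k j)"
  by (rule ent_mm) (simp_all add: ent_scaleC ent_cols)
  then show "ent ((c *\<^sub>C A) ** B) i j = ent (c *\<^sub>C (A ** B)) i j"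
  by (simp add: ent_scaleC ent_mm0 mult_scaleC_left scaleC_sum_right)
qed

lemma mm_scale_right: "A ** (c *\<^sub>C B) = c *\<^sub>C (A ** (B::('k,'j,'c::complex_star_algebra) fmat))"
  by (rule fmat_eqI) (simp add: ent_scaleC ent_mm0 mult_scaleC_right scaleC_sum_right)

lemmas mm_linear = mm_add_left mm_add_right mm_diff_left mm_diff_right mm_scale_left mm_scale_right

definition ad :: "('i, 'j, 'c::complex_star_algebra) fmat => ('j, 'i, 'c) fmat" where
  "ad A = mk (cols A) (rows A) (%i j. star (ent A j i))"

lemma ent_ad: "ent (ad A) i j = star (ent A j i)"
  by (auto simp: ad_def ent_mk ent_rows ent_cols)

lemma ad_ad [simp]: "ad (ad A) = A"
  and ad_zero [simp]: "ad 0 = 0"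
  and ad_add: "ad (A + B) = ad A + ad B"
  and ad_scale: "ad (c *\<^sub>C A) = cnj c *\<^sub>C ad A"
  by (rule fmat_eqI, simp add: ent_ad star_star ent_add star_add ent_scaleC star_scaleC)+

lemma ad_diff: "ad (A - B) = ad A - ad B"
  using ad_add[of "A - B" B] by (simp add: algebra_simps)

lemma ad_sum: "ad (\<Sum>k\<in>K. A k) = (\<Sum>k\<in>K. ad (A k))"
  by (induction K rule: infinite_finite_induct) (simp_all add: ad_add)

lemma ad_mm: "ad (A ** B) = ad B ** ad A"
proof (rule fmat_eqI)
  fix i j
  have "ent (ad B ** ad A) i j = (\<Sum>k\<in>cols A. ent (ad B) i k * ent (ad A) k j)"
  by (rule ent_mm) (simp_all add: ent_ad ent_cols)
  then show "ent (ad (A ** B)) i j = ent (ad B ** ad A) i j"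
  by (simp add: ent_ad ent_mm0 star_sum star_mult)
qed

section \<open>Entrywise maps and scalar matrices\<close>

definition mapm :: "('c => 'd) => ('i, 'j, 'c::zero) fmat => ('i, 'j, 'd::zero) fmat" where
  "mapm f A = mk (rows A) (cols A) (%i j. f (ent A i j))"

lemma ent_mapm: "f 0 = 0 ==> ent (mapm f A) i j = f (ent A i j)"
  by (auto simp: mapm_def ent_mk ent_rows ent_cols)

text \<open>The embedding \<open>A \<mapsto> A \<otimes> 1\<close> of scalar matrices into matrices
  over the algebra.\<close>

definition sc :: "('i, 'j) cmat => ('i, 'j, 'c::complex_star_algebra) fmat" where
  "sc A = mapm (%x. x *\<^sub>C 1) A"

lemma ent_sc: "ent (sc A) i j = ent A i j *\<^sub>C 1"
  by (simp add: sc_def ent_mapm)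

lemma sc_complex [simp]: "sc (A :: ('i, 'j) cmat) = A"
  by (rule fmat_eqI) (simp add: ent_sc scaleC_complex_def)

lemma ent_sc_mm: "ent (sc A ** B) i j = (\<Sum>k\<in>cols A. ent A i k *\<^sub>C ent B k j)"
proof -
  have "ent (sc A ** B) i j = (\<Sum>k\<in>cols A. ent (sc A) i k * ent B k j)"
  by (rule ent_mm) (simp_all add: ent_sc ent_cols)
  then show ?thesis by (simp add: ent_sc mult_scaleC_left)
qed

lemma ent_mm_sc: "ent (B ** sc A) i j = (\<Sum>k\<in>rows A. ent A k j *\<^sub>C ent B i k)"
proof -
  have "ent (B ** sc A) i j = (\<Sum>k\<in>rows A. ent B i k * ent (sc A) k j)"
  by (rule ent_mm) (simp_all add: ent_sc ent_rows)
  then show ?thesis by (simp add: ent_sc mult_scaleC_right)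
qed

lemma sc_mm: "sc (A ** B) = sc A ** sc B"
  by (rule fmat_eqI) (simp add: ent_sc_mm, simp add: ent_sc ent_mm0 scaleC_sum_left scaleC_scaleC)

lemma sc_zero [simp]: "sc 0 = 0"
  and sc_add: "sc (A + B) = sc A + sc B"
  and sc_diff: "sc (A - B) = sc A - sc B"
  and sc_scale: "sc (c *\<^sub>C A) = c *\<^sub>C sc A"
  by (rule fmat_eqI, simp add: ent_sc ent_add ent_minus ent_scaleC scaleC_add_left scaleC_scaleC
   scaleC_complex_def complex_vector.scale_left_diff_distrib)+

lemma sc_sum: "sc (\<Sum>k\<in>K. A k) = (\<Sum>k\<in>K. sc (A k))"
  by (induction K rule: infinite_finite_induct) (simp_all add: sc_add)

lemma ad_sc: "ad (sc A) = sc (ad A)"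
  by (rule fmat_eqI) (simp add: ent_ad ent_sc star_scaleC star_complex_def)

text \<open>Slicing by a linear functional is a bimodule map over the scalar matrices. This rule and
  the next one carry intertwining relations from corepresentation matrices to their slices.\<close>

lemma mapm_sc_mm: "lin f ==> mapm f (sc A ** B) = sc A ** mapm f B"
  by (rule fmat_eqI) (simp add: ent_mapm lin_zero ent_sc_mm lin_sum lin_scale)

lemma mapm_mm_sc: "lin f ==> mapm f (B ** sc A) = mapm f B ** sc A"
  by (rule fmat_eqI) (simp add: ent_mapm lin_zero ent_mm_sc lin_sum lin_scale)

lemma mapm_mm:
  assumes "lin f" "!!x y. f (x * y) = f x * f y"
  shows "mapm f (A ** B) = mapm f A ** mapm f B"
proof (rule fmat_eqI)
  fix i j
  have "ent (mapm f A ** mapm f B) i j = (\<Sum>k\<in>cols A. ent (mapm f A) i k * ent (mapm f B) k j)"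
  by (rule ent_mm) (simp_all add: ent_mapm lin_zero assms(1) ent_cols)
  then show "ent (mapm f (A ** B)) i j = ent (mapm f A ** mapm f B) i j"
  by (simp add: ent_mapm lin_zero ent_mm0 lin_sum assms)
qed

lemma mapm_sc: "lin f ==> f 1 = 1 ==> mapm f (sc A) = sc A"
  by (rule fmat_eqI) (simp add: ent_mapm lin_zero ent_sc lin_scale)

lemma mapm_ad: "lin f ==> (!!x. f (star x) = star (f x)) ==> mapm f (ad A) = ad (mapm f A)"
  by (rule fmat_eqI) (simp add: ent_mapm lin_zero ent_ad)

lemma functional_fmat_ext:
  assumes "!!f :: 'c => complex. lin f ==> mapm f A = mapm f B"
  shows "A = (B :: ('i, 'j, 'c::complex_vector) fmat)"
  by (rule fmat_eqI, rule functional_ext) (metis assms ent_mapm lin_zero)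

definition idm :: "'i set => ('i, 'i, 'c::complex_star_algebra) fmat" where
  "idm S = mk S S (%i j. if i = j then 1 else 0)"

lemma ent_idm: "finite S ==> ent (idm S) i j = (if i \<in> S \<and> i = j then 1 else 0)"
  by (auto simp: idm_def ent_mk)

lemma ent_idm_mm: "finite S ==> ent (idm S ** A) i j = (if i \<in> S then ent A i j else 0)"
proof -
  assume S: "finite S"
  have "ent (idm S ** A) i j = (\<Sum>k\<in>S. ent (idm S) i k * ent A k j)"
  by (rule ent_mm) (auto simp: ent_idm S)
  also have "... = (\<Sum>k\<in>S. if i = k then ent A k j else 0)"
  by (rule sum.cong) (auto simp: ent_idm S)
  finally show ?thesis using S by simp
qed

lemma ent_mm_idm: "finite S ==> ent (A ** idm S) i j = (if j \<in> S then ent A i j else 0)"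
proof -
  assume S: "finite S"
  have "ent (A ** idm S) i j = (\<Sum>k\<in>S. ent A i k * ent (idm S) k j)"
  by (rule ent_mm) (auto simp: ent_idm S)
  also have "... = (\<Sum>k\<in>S. if k = j then ent A i k else 0)"
  by (rule sum.cong) (auto simp: ent_idm S)
  finally show ?thesis using S by simp
qed

lemma idm_mm_iff: "finite S ==> idm S ** A = A \<longleftrightarrow> (\<forall>i j. i \<notin> S \<longrightarrow> ent A i j = 0)"
  by (metis (no_types, lifting) ent_idm_mm fmat_eqI)

lemma mm_idm_iff: "finite S ==> A ** idm S = A \<longleftrightarrow> (\<forall>i j. j \<notin> S \<longrightarrow> ent A i j = 0)"
  by (metis (no_types, lifting) ent_mm_idm fmat_eqI)

lemma idm_idm [simp]: "finite S ==> idm S ** idm S = idm S"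
  by (simp add: idm_mm_iff ent_idm)

lemma ad_idm [simp]: "finite S ==> ad (idm S) = idm S"
  by (rule fmat_eqI) (auto simp: ent_ad ent_idm)

lemma sc_idm [simp]: "finite S ==> sc (idm S) = idm S"
  by (rule fmat_eqI) (auto simp: ent_sc ent_idm scaleC_one)

lemma rows_idm: "idm (rows A) ** A = A" and cols_idm: "A ** idm (cols A) = A"
  by (simp_all add: idm_mm_iff mm_idm_iff ent_rows ent_cols)

definition unitm :: "'i => 'j => ('i, 'j) cmat" where
  "unitm i j = Poly_Mapping.single (i, j) 1"

lemma ent_unitm: "ent (unitm i j) k l = (if k = i \<and> l = j then 1 else 0)"
  by (simp add: ent_def unitm_def lookup_single when_def)

lemma ent_sc_unitm_mm: "ent (sc (unitm i j) ** A) k l = (if k = i then ent A j l else 0)"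
proof -
  have "ent (sc (unitm i j) ** A) k l = (\<Sum>m\<in>{j}. ent (sc (unitm i j)) k m * ent A m l)"
  by (rule ent_mm) (auto simp: ent_sc ent_unitm)
  then show ?thesis by (simp add: ent_sc ent_unitm scaleC_one)
qed

lemma ent_mm_sc_unitm: "ent (A ** sc (unitm i j)) k l = (if l = j then ent A k i else 0)"
proof -
  have "ent (A ** sc (unitm i j)) k l = (\<Sum>m\<in>{i}. ent A k m * ent (sc (unitm i j)) m l)"
  by (rule ent_mm) (auto simp: ent_sc ent_unitm)
  then show ?thesis by (simp add: ent_sc ent_unitm scaleC_one)
qed

lemma ent_unitm_mm: "ent (unitm i j ** A) k l = (if k = i then ent A j l else 0)"
  using ent_sc_unitm_mm[of i j A k l] by simp

lemma ent_mm_unitm: "ent (A ** unitm i j) k l = (if l = j then ent A k i else 0)"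
  using ent_mm_sc_unitm[of A i j k l] by simp

section \<open>Trace and positivity\<close>

definition trace :: "('i, 'i) cmat => complex" where
  "trace A = (\<Sum>i\<in>rows A. ent A i i)"

lemma trace_eq: "finite S ==> (!!i. i \<notin> S ==> ent A i i = 0) ==> trace A = (\<Sum>i\<in>S. ent A i i)"
  unfolding trace_def by (rule sum.mono_neutral_cong) (auto simp: ent_rows)

lemma trace_comm: "trace (A ** B) = trace (B ** A)"
proof -
  have "trace (A ** B) = (\<Sum>i\<in>rows A. ent (A ** B) i i)"
  by (rule trace_eq) (simp_all add: ent_mm0 ent_rows)
  also have "... = (\<Sum>k\<in>cols A. \<Sum>i\<in>rows A. ent A i k * ent B k i)"
  by (simp add: ent_mm0 sum.swap[of _ "rows A"])
  also have "... = (\<Sum>k\<in>cols A. ent (B ** A) k k)"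
  proof (rule sum.cong[OF refl])
  fix k
  have "ent (B ** A) k k = (\<Sum>i\<in>rows A. ent B k i * ent A i k)"
   by (rule ent_mm) (simp_all add: ent_rows)
  then show "(\<Sum>i\<in>rows A. ent A i k * ent B k i) = ent (B ** A) k k" by (simp add: mult.commute)
  qed
  also have "... = trace (B ** A)"
  by (rule trace_eq[symmetric]) (simp_all add: ent_mm0 ent_cols)
  finally show ?thesis .
qed

lemma trace_add: "trace (A + B) = trace A + trace B"
proof -
  have "trace C = (\<Sum>i\<in>rows A \<union> rows B. ent C i i)" if "C \<in> {A, B, A + B}" for C
  using that by (intro trace_eq) (auto simp: ent_rows ent_add)
  then show ?thesis by (simp add: sum.distrib ent_add)
qed

lemma trace_scale: "trace (c *\<^sub>C A) = c * trace A"
proof -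
  have "trace (c *\<^sub>C A) = (\<Sum>i\<in>rows A. ent (c *\<^sub>C A) i i)"
  by (rule trace_eq) (simp_all add: ent_scaleC ent_rows)
  then show ?thesis by (simp add: trace_def ent_scaleC scaleC_complex_def sum_distrib_left)
qed

lemma trace_idm [simp]: "finite S ==> trace (idm S) = of_nat (card S)"
  by (subst trace_eq[of S]) (simp_all add: ent_idm)

lemma trace_zero [simp]: "trace 0 = 0"
  by (simp add: trace_def)

text \<open>Vectors are one-column matrices indexed by \<open>unit\<close>; an inner product
  \<open>ad v ** w\<close> is then a 1 x 1 matrix, and these two rules let it act as the number it
  contains.\<close>

lemma mm_scalar: "A ** (z :: (unit, unit) cmat) = ent z () () *\<^sub>C A"
  by (rule fmat_eqI) (subst ent_mm[of UNIV], auto simp: ent_scaleC scaleC_complex_def mult.commute UNIV_unit)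

lemma scalar_mm: "(z :: (unit, unit) cmat) ** A = ent z () () *\<^sub>C A"
  by (rule fmat_eqI) (subst ent_mm[of UNIV], auto simp: ent_scaleC scaleC_complex_def mult.commute UNIV_unit)

lemma ent_ad_mm_self: "ent (ad A ** A) j j = complex_of_real (\<Sum>i\<in>rows A. (cmod (ent A i j))\<^sup>2)"
proof -
  have "ent (ad A ** A) j j = (\<Sum>i\<in>rows A. ent (ad A) j i * ent A i j)"
  by (rule ent_mm) (simp_all add: ent_rows)
  then show ?thesis
  by (simp add: ent_ad star_complex_def complex_norm_square mult.commute del: of_real_power)
qed

lemma ad_mm_self_zero: "ad A ** A = 0 ==> A = (0 :: ('i, 'j) cmat)"
proof (rule fmat_eqI)
  fix i j assume "ad A ** A = 0"
  then have "complex_of_real (\<Sum>i\<in>rows A. (cmod (ent A i j))\<^sup>2) = 0"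
  by (metis ent_ad_mm_self ent_zero)
  then have "(\<Sum>i\<in>rows A. (cmod (ent A i j))\<^sup>2) = 0"
  using of_real_eq_0_iff by blast
  then have "\<forall>i\<in>rows A. (cmod (ent A i j))\<^sup>2 = 0"
  by (subst (asm) sum_nonneg_eq_0_iff) auto
  then show "ent A i j = ent 0 i j"
  by (cases "i \<in> rows A") (auto simp: ent_rows)
qed

lemma ad_mm_self_pos:
  assumes "(w :: ('i, unit) cmat) ~= 0"
  shows "Re (ent (ad w ** w) () ()) > 0"
proof -
  have "ad w ** w ~= 0" using ad_mm_self_zero assms by auto
  moreover have "ad w ** w = 0" if "ent (ad w ** w) () () = 0"
  by (rule fmat_eqI) (use that in simp)
  ultimately have "ent (ad w ** w) () () ~= 0" by blast
  then show ?thesis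
  by (simp only: ent_ad_mm_self) (simp add: less_le sum_nonneg del: of_real_sum)
qed

lemma column_ext:
  assumes "!!v :: ('j, unit) cmat. A ** v = B ** v"
  shows "A = (B :: ('i, 'j) cmat)"
proof (rule fmat_eqI)
  fix i j
  show "ent A i j = ent B i j"
  using arg_cong[OF assms[of "unitm j ()"], of "%M. ent M i ()"] by (simp add: ent_mm_unitm)
qed

section \<open>Dimensions and eigenvectors\<close>

lemma family_independent:
  assumes "finite I" "!!c. (\<Sum>i\<in>I. c i *\<^sub>C b i) = 0 ==> \<forall>i\<in>I. c i = (0::complex)"
  shows "inj_on b I" "\<not> cdependent (b ` I :: 'a::complex_vector set)"
proof -
  show inj: "inj_on b I"
  proof (rule inj_onI, rule ccontr)
  fix i j assume ij: "i \<in> I" "j \<in> I" "b i = b j" "i ~= j"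
  let ?c = "%k. if k = i then 1 else if k = j then - 1 else (0::complex)"
  have "(\<Sum>k\<in>I. ?c k *\<^sub>C b k) = (\<Sum>k\<in>{i, j}. ?c k *\<^sub>C b k)"
   by (rule sum.mono_neutral_right) (use ij assms(1) in auto)
  also have "... = 0" using ij by simp
  finally show False using assms(2)[of ?c] ij by auto
  qed
  show "\<not> cdependent (b ` I)"
  proof (rule complex_vector.independent_if_scalars_zero)
  fix f x assume f: "(\<Sum>x\<in>b ` I. f x *\<^sub>C x) = 0" and x: "x \<in> b ` I"
  have "(\<Sum>i\<in>I. f (b i) *\<^sub>C b i) = 0" using f by (simp add: sum.reindex[OF inj])
  then show "f x = 0" using assms(2)[of "%i. f (b i)"] x by auto
  qed (use assms in simp)
qed

lemma cdim_indexed: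
  assumes "finite I" "!!i. i \<in> I ==> b i \<in> W"
  and "!!w. w \<in> W ==> \<exists>c. w = (\<Sum>i\<in>I. c i *\<^sub>C b i)"
  and "!!c. (\<Sum>i\<in>I. c i *\<^sub>C b i) = 0 ==> \<forall>i\<in>I. c i = (0::complex)"
  shows "cdim (W :: 'a::complex_vector set) = card I"
proof (rule complex_vector.dim_unique)
  show "W <= cspan (b ` I)"
  proof
  fix w assume "w \<in> W"
  then obtain c where "w = (\<Sum>i\<in>I. c i *\<^sub>C b i)" using assms(3) by blast
  then show "w \<in> cspan (b ` I)"
   by (simp add: complex_vector.span_sum complex_vector.span_scale complex_vector.span_base)
  qed
  show "\<not> cdependent (b ` I)" using family_independent[OF assms(1,4)] by blast
  show "card (b ` I) = card I"
  using family_independent(1)[OF assms(1,4)] by (rule card_image)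
qed (use assms(2) in auto)

text \<open>The twist \<sigma> is the identity for linear maps and \<open>cnj\<close> for the
  adjoint map; the latter case makes the multiplicity of one object in another symmetric. The
  dimension is preserved because a basis is carried over.\<close>

lemma cdim_semilinear_image:
  fixes f :: "'a::complex_vector => 'b::complex_vector" and \<sigma> :: "complex => complex"
  assumes add: "!!x y. f (x + y) = f x + f y" and sc: "!!c x. f (c *\<^sub>C x) = \<sigma> c *\<^sub>C f x"
  and \<sigma>: "!!c. \<sigma> (\<sigma> c) = c" and W: "csubspace W" and inj: "!!x. x \<in> W ==> f x = 0 ==> x = 0"
  shows "cdim (f ` W) = cdim W"
proof -
  have f0: "f 0 = 0" using add[of 0 0] by simp
  have diff: "f (x - y) = f x - f y" for x y using add[of "x - y" y] by simp
  have f_sum: "f (\<Sum>i\<in>I. g i) = (\<Sum>i\<in>I. f (g i))" for I and g :: "'c => 'a"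
  by (induction I rule: infinite_finite_induct) (simp_all add: f0 add)
  have inj': "inj_on f W"
  by (rule inj_onI) (metis complex_vector.subspace_diff[OF W] diff eq_iff_diff_eq_0 inj)
  obtain B where B: "B <= W" "\<not> cdependent B" "W <= cspan B" "card B = cdim W"
  using complex_vector.basis_exists[of W] by blast
  have "cdim (f ` W) = card (f ` B)"
  proof (rule complex_vector.dim_unique)
  show "f ` B <= f ` W" using B(1) by blast
  show "f ` W <= cspan (f ` B)"
  proof clarify
   fix w assume "w \<in> W"
   then have "w \<in> cspan B" using B(3) by blast
   then show "f w \<in> cspan (f ` B)"
    by (induction rule: complex_vector.span_induct_alt)
     (simp_all add: f0 add sc complex_vector.span_zero complex_vector.span_add
      complex_vector.span_scale complex_vector.span_base)
  qed
  show "\<not> cdependent (f ` B)"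
   unfolding complex_vector.independent_explicit_finite_subsets
  proof (intro allI impI ballI)
   fix S u v assume S: "S <= f ` B" "finite S" and u: "(\<Sum>v\<in>S. u v *\<^sub>C v) = 0" and v: "v \<in> S"
   obtain T where T: "T <= B" "finite T" "S = f ` T" using S by (meson finite_subset_image)
   have injT: "inj_on f T" using inj' T(1) B(1) by (meson inj_on_subset)
   have "f (\<Sum>t\<in>T. \<sigma> (u (f t)) *\<^sub>C t) = (\<Sum>t\<in>T. u (f t) *\<^sub>C f t)"
    by (simp add: f_sum sc \<sigma>)
   also have "... = 0" using u by (simp add: T(3) sum.reindex[OF injT])
   finally have "(\<Sum>t\<in>T. \<sigma> (u (f t)) *\<^sub>C t) = 0"
    by (rule inj[rotated]) (use T(1) B(1) W in
     \<open>auto intro!: complex_vector.subspace_sum complex_vector.subspace_scale\<close>)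
   then have "\<forall>t\<in>T. \<sigma> (u (f t)) = 0"
    using complex_vector.independentD[OF B(2) T(2,1), of "%t. \<sigma> (u (f t))"] by blast
   moreover have "\<sigma> 0 = 0" if "f x ~= 0" for x using sc[of 0 x] that f0 by simp
   moreover have "f t ~= 0" if "t \<in> T" for t
    using that T(1) B(1,2) inj complex_vector.dependent_zero by (metis subsetD)
   ultimately show "u v = 0" using v T(3) \<sigma> by (metis imageE)
  qed
  qed (rule refl)
  also have "card (f ` B) = card B"
  by (rule card_image) (meson inj' B(1) inj_on_subset)
  finally show ?thesis using B(4) by simp
qed

lemma cdim_bij:
  assumes f: "lin f" and W: "csubspace W" and "!!x. x \<in> W ==> f x \<in> W'"
  and "!!y. y \<in> W' ==> g y \<in> W \<and> f (g y) = y" and "!!x. x \<in> W ==> g (f x) = x"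
  shows "cdim W' = cdim W"
proof -
  have inj: "x = 0" if "x \<in> W" "f x = 0" for x
  using that assms(5) complex_vector.subspace_0[OF W] f lin_zero by metis
  have "W' = f ` W" using assms(3,4) by (metis image_eqI image_subsetI subsetI subset_antisym)
  then show ?thesis
  using cdim_semilinear_image[of f "%c. c" W] f W inj by (simp add: lin_def)
qed

text \<open>A nonzero polynomial \<open>p\<close> of least degree with \<open>p(f) x0 = 0\<close>
  has a root \<mu>; dividing out the linear factor and applying the quotient to \<open>x0\<close>
  leaves an eigenvector. It stays in the span of the iterates of \<open>x0\<close>, which later
  keeps spectral projections inside the algebra generated by one element.\<close>

lemma eigenvector_exists:
  fixes f :: "'a::complex_vector => 'a"
  assumes T: "finite T" "V <= cspan T" and V: "csubspace V"
  and fV: "!!x. x \<in> V ==> f x \<in> V"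
  and add: "!!x y. x \<in> V ==> y \<in> V ==> f (x + y) = f x + f y"
  and sc: "!!c x. x \<in> V ==> f (c *\<^sub>C x) = c *\<^sub>C f x"
  and x0: "x0 \<in> V" "x0 ~= 0"
  obtains \<mu> y where "y \<in> cspan (range (%i. (f ^^ i) x0))" "y \<in> V" "y ~= 0" "f y = \<mu> *\<^sub>C y"
proof -
  define g where "g = (%i. (f ^^ i) x0)"
  have gV: "g i \<in> V" for i by (induction i) (auto simp: g_def x0 fV)
  have gS: "g (Suc i) = f (g i)" for i by (simp add: g_def)
  have f0: "f 0 = 0" using add[of 0 0] complex_vector.subspace_0[OF V] by simp
  \<comment> \<open>For \<open>degree q \<le> n\<close> this is \<open>q(f) x0\<close>.\<close>
  define E where "E n q = (\<Sum>i\<le>n. coeff q i *\<^sub>C g i)" for n and q :: "complex poly"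
  have EV: "E n q \<in> V" for n q
  unfolding E_def using V gV by (auto intro!: complex_vector.subspace_sum complex_vector.subspace_scale)
  have fE: "f (E n q) = (\<Sum>i\<le>n. coeff q i *\<^sub>C g (Suc i))" for n q
  proof -
  have "f (\<Sum>i\<in>I. coeff q i *\<^sub>C g i) = (\<Sum>i\<in>I. coeff q i *\<^sub>C g (Suc i))" if "finite I" for I
   using that
  proof (induction I rule: finite_induct)
   case (insert i I)
   have "coeff q i *\<^sub>C g i \<in> V" "(\<Sum>i\<in>I. coeff q i *\<^sub>C g i) \<in> V"
    using V gV by (auto intro!: complex_vector.subspace_sum complex_vector.subspace_scale)
   then show ?case using insert by (simp add: add sc gV gS)
  qed (simp add: f0)
  then show ?thesis by (simp add: E_def)
  qed
  have "\<exists>p. p ~= 0 \<and> E (degree p) p = 0"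
  proof -
  let ?I = "{..card T}"
  have "\<exists>c. (\<Sum>i\<in>?I. c i *\<^sub>C g i) = 0 \<and> (\<exists>i\<in>?I. c i ~= 0)"
  proof (rule ccontr)
   assume "\<not> ?thesis"
   then have H: "(\<Sum>i\<in>?I. c i *\<^sub>C g i) = 0 ==> \<forall>i\<in>?I. c i = 0" for c by blast
   have "card (g ` ?I) = card ?I"
    by (rule card_image, rule family_independent(1)) (simp, rule H)
   moreover have "\<not> cdependent (g ` ?I)"
    by (rule family_independent(2)) (simp, rule H)
   moreover have "g ` ?I <= cspan T" using gV T(2) by blast
   ultimately show False
    using complex_vector.independent_span_bound[OF T(1), of "g ` ?I"] by simp
  qed
  then obtain c i where c: "(\<Sum>i\<in>?I. c i *\<^sub>C g i) = 0" "i \<le> card T" "c i ~= 0" by auto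
  define p where "p = (\<Sum>i\<in>?I. monom (c i) i)"
  have cp: "coeff p k = (if k \<le> card T then c k else 0)" for k
   by (simp add: p_def coeff_sum)
  have "degree p \<le> card T" by (rule degree_le) (simp add: cp)
  then have "E (degree p) p = (\<Sum>i\<in>?I. coeff p i *\<^sub>C g i)"
   unfolding E_def by (intro sum.mono_neutral_left) (auto simp: coeff_eq_0)
  also have "... = 0" using c(1) by (simp add: cp)
  finally show ?thesis using c(2,3) cp[of i] by (intro exI[of _ p]) auto
  qed
  then obtain p where p: "p ~= 0" "E (degree p) p = 0"
  and min: "!!q. q ~= 0 \<and> E (degree q) q = 0 ==> degree p \<le> degree q"
  using ex_has_least_nat[of "%p. p ~= 0 \<and> E (degree p) p = 0" _ degree] by blast
  have "degree p ~= 0"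
  proof
  assume d: "degree p = 0"
  then have "coeff p 0 *\<^sub>C x0 = 0" using p(2) by (simp add: E_def g_def)
  then show False using x0(2) p(1) d by (metis leading_coeff_0_iff scaleC_eq_zero)
  qed
  then obtain \<mu> where "poly p \<mu> = 0"
  using fundamental_theorem_of_algebra[of p] constant_degree[of p] by auto
  then obtain q where q: "p = [:- \<mu>, 1:] * q" by (metis poly_eq_0_iff_dvd dvdE)
  have q0: "q ~= 0" using p(1) q by auto
  have dp: "degree p = Suc (degree q)"
  by (subst q, subst degree_mult_eq) (use q0 in auto)
  define y where "y = E (degree q) q"
  have "y ~= 0" using min[of q] q0 dp by (auto simp: y_def)
  \<comment> \<open>Evaluation of \<open>p = (X - \<mu>) q\<close> at \<open>f\<close>, applied to
    \<open>x0\<close>: the left side vanishes and the right side is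
    \<open>f y - \<mu> y\<close>.\<close>
  have "E (degree p) p = - \<mu> *\<^sub>C E (degree p) q + (\<Sum>i\<le>degree p. coeff (pCons 0 q) i *\<^sub>C g i)"
  unfolding E_def q
  by (simp add: complex_vector.scale_left_diff_distrib sum_subtractf scaleC_sum_right scaleC_scaleC sum_negf)
  also have "E (degree p) q = y"
  unfolding y_def E_def dp by (simp add: coeff_eq_0)
  also have "(\<Sum>i\<le>degree p. coeff (pCons 0 q) i *\<^sub>C g i) = f y"
  unfolding y_def fE dp by (subst sum.atMost_Suc_shift) simp
  finally have "f y = \<mu> *\<^sub>C y" using p(2) by (simp add: eq_neg_iff_add_eq_0 add.commute)
  moreover have "y \<in> cspan (range (%i. (f ^^ i) x0))"
  unfolding y_def E_def g_def
  by (simp add: complex_vector.span_sum complex_vector.span_scale complex_vector.span_base)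
  ultimately show thesis using that \<open>y ~= 0\<close> EV y_def by blast
qed

section \<open>Gram--Schmidt\<close>

lemma mm_eq_assoc: "A ** B = C ==> A ** (B ** D) = C ** D"
  by (simp flip: mm_assoc)

lemma ad_unitm: "ad (unitm i j) = unitm j i"
  by (rule fmat_eqI) (auto simp: ent_ad ent_unitm)

lemma vectors_finite_span:
  fixes S :: "'i set"
  assumes "finite S"
  obtains T :: "('i, unit) cmat set" where
  "finite T" "!!w. idm S ** w = w ==> w \<in> cspan T"
proof -
  let ?T = "(%i. unitm i ()) ` S"
  have "w \<in> cspan ?T" if w: "idm S ** w = w" for w :: "('i, unit) cmat"
  proof -
  have "w = (\<Sum>i\<in>S. ent w i () *\<^sub>C unitm i ())"
   using w assms
   by (intro fmat_eqI) (auto simp: ent_sum ent_scaleC ent_unitm scaleC_complex_def idm_mm_iff if_distrib cong: if_cong)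
  then show ?thesis
   by (metis (no_types, lifting) complex_vector.span_sum complex_vector.span_scale
     complex_vector.span_base imageI)
  qed
  with assms that[of ?T] show thesis by blast
qed

text \<open>The form \<open>Q\<close> is kept general because invariant inner products obtained by
  averaging are not the standard one. Vectors are added one at a time: the residual
  \<open>b'\<close> is orthogonal to the earlier columns, and unless it vanishes it is normalised
  and becomes column \<open>n\<close>.\<close>

lemma gram_schmidt_span:
  fixes Q :: "('i, 'i) cmat" and B :: "('i, unit) cmat set"
  assumes "finite B" and herm: "ad Q = Q"
  and "!!w. w \<in> cspan B ==> w ~= 0 ==> Re (ent (ad w ** Q ** w) () ()) > 0"
  shows "\<exists>n (V :: ('i, nat) cmat). ad V ** Q ** V = idm {..<n} \<and> V ** idm {..<n} = V
  \<and> (\<forall>x. V ** x \<in> cspan B) \<and> (\<forall>w\<in>cspan B. V ** (ad V ** Q ** w) = w)"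
  using assms(1,3)
proof (induction B rule: finite_induct)
  case empty
  have "idm {..<0::nat} = (0 :: (nat, nat) cmat)" by (rule fmat_eqI) (simp add: ent_idm)
  then show ?case by (intro exI[of _ 0]) auto
next
  case (insert b B)
  have sub: "cspan B <= cspan (insert b B)" by (rule complex_vector.span_mono) blast
  obtain n and V :: "('i, nat) cmat" where V: "ad V ** Q ** V = idm {..<n}" "V ** idm {..<n} = V"
  "!!x. V ** x \<in> cspan B" "!!w. w \<in> cspan B ==> V ** (ad V ** Q ** w) = w"
  using insert.IH insert.prems sub by blast
  define b' where "b' = b - V ** (ad V ** Q ** b)"
  have b_in: "b \<in> cspan (insert b B)" by (simp add: complex_vector.span_base)
  have b'_in: "b' \<in> cspan (insert b B)"
  unfolding b'_def using V(3) sub b_in by (blast intro: complex_vector.span_diff)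
  have step: "\<exists>k w0. w0 \<in> cspan B \<and> w = k *\<^sub>C b + w0" if "w \<in> cspan (insert b B)" for w
  using that unfolding complex_vector.span_breakdown_eq by (metis add.commute diff_add_cancel)
  show ?case
  proof (cases "b' = 0")
  case True
  then have b: "V ** (ad V ** Q ** b) = b" by (simp add: b'_def)
  have "V ** (ad V ** Q ** w) = w" if "w \<in> cspan (insert b B)" for w
   using step[OF that] V(4) b by (auto simp: mm_linear)
  then show ?thesis using V sub by blast
  next
  case False
  define r where "r = Re (ent (ad b' ** Q ** b') () ())"
  have r: "r > 0" using insert.prems[OF b'_in False] by (simp add: r_def)
  have "ad (ad b' ** Q ** b') = ad b' ** Q ** b'" by (simp add: ad_mm herm mm_assoc)
  then have "cnj (ent (ad b' ** Q ** b') () ()) = ent (ad b' ** Q ** b') () ()"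
   by (metis ent_ad star_complex_def)
  then have r': "ent (ad b' ** Q ** b') () () = complex_of_real r"
   unfolding r_def by (simp add: Reals_cnj_iff)
  define c where "c = complex_of_real (1 / sqrt r)"
  have c: "c * c * complex_of_real r = 1" "cnj c = c" "c ~= 0"
   using r by (auto simp: c_def field_simps simp flip: of_real_mult)
  define d where "d = c *\<^sub>C b'"
  have VQb': "ad V ** Q ** b' = 0"
  proof -
   have "ad V ** Q ** (V ** (ad V ** Q ** b)) = idm {..<n} ** (ad V ** Q ** b)"
    by (simp add: V(1)[symmetric] mm_assoc)
   also have "... = ad (V ** idm {..<n}) ** Q ** b"
    by (simp add: ad_mm mm_assoc)
   also have "... = ad V ** Q ** b" by (simp add: V(2))
   finally show ?thesis by (simp add: b'_def mm_diff_right)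
  qed
  have VQd: "ad V ** Q ** d = 0" by (simp add: d_def mm_scale_right VQb')
  have dQV: "ad d ** Q ** V = 0" using arg_cong[OF VQd, of ad] by (simp add: ad_mm herm mm_assoc)
  have dQd: "ent (ad d ** Q ** d) () () = 1"
   using c by (simp add: d_def ad_scale mm_scale_left mm_scale_right ent_scaleC r' scaleC_complex_def)
  define V' where "V' = V + d ** unitm () n"
  have adV': "ad V' = ad V + unitm n () ** ad d" by (simp add: V'_def ad_add ad_mm ad_unitm)
  have Vn: "V ** unitm n () = 0"
  proof -
   have "V ** unitm n () = V ** (idm {..<n} ** unitm n ())" using V(2) by (simp flip: mm_assoc)
   also have "idm {..<n} ** unitm n () = (0 :: (nat, unit) cmat)"
    by (rule fmat_eqI) (simp add: ent_idm_mm ent_unitm)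
   finally show ?thesis by simp
  qed
  have nV: "unitm () n ** ad V = 0" using arg_cong[OF Vn, of ad] by (simp add: ad_mm ad_unitm)
  have uu: "unitm () n ** unitm n () = (unitm () () :: (unit, unit) cmat)"
   by (rule fmat_eqI) (simp add: ent_unitm_mm ent_unitm)
  have u1: "unitm () () ** A = A" for A :: "(unit, 'j) cmat"
   by (simp add: scalar_mm ent_unitm scaleC_one)
  have 1: "ad V' ** Q ** V' = idm {..<Suc n}"
  proof -
   have "ad V' ** Q ** V' = ad V ** Q ** V + (ad V ** Q ** d) ** unitm () n
     + unitm n () ** (ad d ** Q ** V) + unitm n () ** ((ad d ** Q ** d) ** unitm () n)"
    unfolding adV' by (simp add: V'_def mm_linear mm_assoc)
   also have "... = idm {..<n} + unitm n () ** unitm () n"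
    by (simp only: VQd dQV V(1)) (simp add: scalar_mm dQd scaleC_one)
   also have "... = idm {..<Suc n}"
    by (rule fmat_eqI) (auto simp: ent_add ent_idm ent_unitm_mm ent_unitm)
   finally show ?thesis .
  qed
  have 2: "V' ** idm {..<Suc n} = V'"
   using V(2) by (auto simp: mm_idm_iff V'_def ent_add ent_mm_unitm)
  have 3: "V' ** x \<in> cspan (insert b B)" for x
  proof -
   have "V' ** x = V ** x + (ent (unitm () n ** x) () () * c) *\<^sub>C b'"
    by (simp add: V'_def mm_linear mm_assoc mm_scalar d_def scaleC_scaleC)
   then show ?thesis using V(3) sub b'_in
    by (auto intro!: complex_vector.span_add complex_vector.span_scale)
  qed
  have F: "V' ** (ad V' ** Q ** w) = V ** (ad V ** Q ** w) + d ** (ad d ** Q ** w)" for w :: "('i, unit) cmat"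
  proof -
   have "V' ** (ad V' ** Q ** w) = V ** (ad V ** Q ** w) + (V ** unitm n ()) ** (ad d ** Q ** w)
    + d ** ((unitm () n ** ad V) ** (Q ** w)) + d ** ((unitm () n ** unitm n ()) ** (ad d ** Q ** w))"
    unfolding adV' by (simp add: V'_def mm_linear mm_assoc)
   then show ?thesis by (simp only: Vn nV uu u1) simp
  qed
  have FB: "V' ** (ad V' ** Q ** w) = w" if w: "w \<in> cspan B" for w
  proof -
   have "ad d ** Q ** w = (ad d ** Q ** V) ** (ad V ** Q ** w)"
    using V(4)[OF w] by (simp add: mm_assoc)
   then show ?thesis by (simp add: F V(4)[OF w] dQV)
  qed
  have Fb: "V' ** (ad V' ** Q ** b) = b"
  proof -
   have b: "b = b' + V ** (ad V ** Q ** b)" by (simp add: b'_def)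
   have "ad d ** Q ** b = ad d ** Q ** b' + (ad d ** Q ** V) ** (ad V ** Q ** b)"
    by (subst b) (simp add: mm_linear mm_assoc)
   then have "ad d ** Q ** b = c *\<^sub>C (ad b' ** Q ** b')"
    by (simp only: dQV) (simp add: d_def ad_scale c mm_scale_left)
   then have "d ** (ad d ** Q ** b) = b'"
    using c by (simp add: mm_scalar ent_scaleC r' d_def scaleC_scaleC scaleC_complex_def ac_simps
      scaleC_one)
   then have "V' ** (ad V' ** Q ** b) = b' + V ** (ad V ** Q ** b)" by (simp add: F add.commute)
   also note b[symmetric]
   finally show ?thesis .
  qed
  have 4: "V' ** (ad V' ** Q ** w) = w" if "w \<in> cspan (insert b B)" for w
   using step[OF that] FB Fb by (auto simp: mm_linear)
  show ?thesis using 1 2 3 4 by blast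
  qed
qed

lemma gram_schmidt:
  fixes Q :: "('i, 'i) cmat" and W :: "('i, unit) cmat set"
  assumes "finite S" "csubspace W" "!!w. w \<in> W ==> idm S ** w = w" "ad Q = Q"
  and "!!w. w \<in> W ==> w ~= 0 ==> Re (ent (ad w ** Q ** w) () ()) > 0"
  obtains n and V :: "('i, nat) cmat" where "ad V ** Q ** V = idm {..<n}"
  "V ** idm {..<n} = V" "!!x. V ** x \<in> W" "!!w. w \<in> W ==> V ** (ad V ** Q ** w) = w"
proof -
  obtain T :: "('i, unit) cmat set" where T: "finite T" "!!w. idm S ** w = w ==> w \<in> cspan T"
  using vectors_finite_span[OF assms(1)] by blast
  obtain B where B: "B <= W" "\<not> cdependent B" "W <= cspan B" "card B = cdim W"
  using complex_vector.basis_exists[of W] by blast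
  have "finite B"
  using complex_vector.independent_span_bound[OF T(1) B(2)] B(1) T(2) assms(3) by blast
  moreover have "cspan B = W"
  using B assms(2) by (simp add: complex_vector.span_minimal subset_antisym)
  ultimately show thesis
  using gram_schmidt_span[of B Q] assms(4,5) that by metis
qed

section \<open>Orthogonal projections\<close>

definition proj :: "('i, 'i) cmat => bool" where
  "proj P \<longleftrightarrow> ad P = P \<and> P ** P = P"

lemma projD: "proj P ==> ad P = P" "proj P ==> P ** P = P" "proj P ==> P ** (P ** A) = P ** A"
  by (simp_all add: proj_def flip: mm_assoc)

lemma proj_idm [simp]: "finite S ==> proj (idm S)"
  by (simp add: proj_def)

text \<open>On vectors supported in \<open>S\<close> the form \<open>idm S\<close> is the standard
  inner product, so Gram-Schmidt yields an orthonormal basis as the columns of \<open>V\<close>, and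
  \<open>V ** ad V\<close> is the orthogonal projection.\<close>

lemma proj_onto_subspace:
  fixes W :: "('i, unit) cmat set"
  assumes "finite S" "csubspace W" "!!w. w \<in> W ==> idm S ** w = w"
  obtains n and V :: "('i, nat) cmat" where "ad V ** V = idm {..<n}" "V ** idm {..<n} = V"
  "proj (V ** ad V)" "!!w. V ** ad V ** w \<in> W" "!!w. w \<in> W ==> V ** ad V ** w = w"
proof -
  have *: "idm S ** w = w ==> ad w ** idm S ** w = ad w ** w" for w :: "('i, unit) cmat"
  by (simp add: mm_assoc)
  obtain n and V :: "('i, nat) cmat" where V: "ad V ** idm S ** V = idm {..<n}"
  "V ** idm {..<n} = V" "!!x. V ** x \<in> W" "!!w. w \<in> W ==> V ** (ad V ** idm S ** w) = w"
  by (rule gram_schmidt[of S W "idm S"]) (use assms in \<open>auto simp: * intro: ad_mm_self_pos\<close>)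
  have SV: "idm S ** V = V" by (rule column_ext) (use V(3) assms(3) in \<open>auto simp: mm_assoc\<close>)
  have VS: "ad V ** idm S = ad V" using arg_cong[OF SV, of ad] assms(1) by (simp add: ad_mm)
  have 1: "ad V ** V = idm {..<n}" using V(1) VS by simp
  have "proj (V ** ad V)"
  unfolding proj_def using 1 V(2) by (metis ad_ad ad_mm mm_assoc)
  then show thesis
  using that[OF 1 V(2)] V(3,4) VS by (simp add: mm_assoc)
qed

text \<open>Identifies the range of a projection with coordinates \<open>{..<n}\<close>. By this,
  objects over complicated index types return to the concrete spaces in which corepresentations and
  bimodules are defined.\<close>

lemma proj_isometry:
  assumes "proj (P :: ('i, 'i) cmat)"
  obtains n and V :: "('i, nat) cmat" where "ad V ** V = idm {..<n}" "V ** idm {..<n} = V"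
  "V ** ad V = P" "P ** V = V"
proof -
  let ?W = "{w :: ('i, unit) cmat. P ** w = w}"
  have W: "csubspace ?W" by (simp add: complex_vector.subspace_def mm_linear)
  have supp: "idm (rows P) ** w = w" if "w \<in> ?W" for w
  using that mm_eq_assoc[OF rows_idm[of P], of w] by simp
  obtain n and V :: "('i, nat) cmat" where V: "ad V ** V = idm {..<n}" "V ** idm {..<n} = V"
  "proj (V ** ad V)" "!!w. V ** ad V ** w \<in> ?W" "!!w. w \<in> ?W ==> V ** ad V ** w = w"
  by (rule proj_onto_subspace[OF finite_rows W supp]) blast+
  have 1: "V ** ad V ** P = P"
  by (rule column_ext) (use V(5) in \<open>simp add: mm_assoc projD[OF assms]\<close>)
  have 2: "P ** (V ** ad V) = V ** ad V"
  by (rule column_ext) (use V(4) in \<open>simp add: mm_assoc\<close>)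
  have 3: "V ** ad V = P"
  using arg_cong[OF 1, of ad] 2 projD[OF assms] by (simp add: ad_mm)
  then have "P ** V = V" using V(1,2) by (metis mm_assoc)
  then show thesis using that V 3 by blast
qed

text \<open>The trace is the rank; as a natural number it serves as the measure in the decomposition
  into irreducibles.\<close>

lemma proj_trace:
  assumes "proj (P :: ('i, 'i) cmat)"
  obtains n where "trace P = of_nat n" "n = 0 \<longleftrightarrow> P = 0"
proof -
  obtain n and V :: "('i, nat) cmat" where V: "ad V ** V = idm {..<n}"
  "V ** idm {..<n} = V" "V ** ad V = P" using proj_isometry[OF assms] by blast
  have t: "trace P = of_nat n" using trace_comm[of V "ad V"] V by simp
  have "P = 0" if "n = 0"
  proof -
  have "V = 0" by (rule fmat_eqI) (metis V(2) that ent_mm_idm ent_zero finite_lessThan lessThan_iff not_less0)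
  then show ?thesis using V(3) by simp
  qed
  moreover have "n = 0" if "P = 0" using t that by simp
  ultimately show thesis using that t by blast
qed

section \<open>Star-closed families of matrices\<close>

text \<open>The first component is the orthogonal projection onto the space of the object, so a
  subobject keeps the index type and only shrinks the projection.\<close>

type_synonym ('i, 'x) sfam = "('i, 'i) cmat \<times> ('x => ('i, 'i) cmat)"

definition star_family :: "'x set => ('x => 'x) => ('i, 'x) sfam => bool" where
  "star_family X iv M \<longleftrightarrow> proj (fst M) \<and> (\<forall>x\<in>X. iv x \<in> X \<and> fst M ** snd M x = snd M x
   \<and> snd M x ** fst M = snd M x \<and> ad (snd M x) = snd M (iv x))"

definition Hom :: "'x set => ('i, 'x) sfam => ('j, 'x) sfam => ('j, 'i) cmat set" where
  "Hom X M N = {T. fst N ** T = T \<and> T ** fst M = T \<and> (\<forall>x\<in>X. T ** snd M x = snd N x ** T)}"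

definition irr :: "'x set => ('i, 'x) sfam => bool" where
  "irr X M \<longleftrightarrow> fst M ~= 0 \<and> (\<forall>T\<in>Hom X M M. \<exists>c. T = c *\<^sub>C fst M)"

definition sub :: "('i, 'i) cmat => ('i, 'x) sfam => ('i, 'x) sfam" where
  "sub p M = (p, %x. p ** snd M x)"

definition splits :: "'x set => ('i, 'x) sfam => 'f set => ('f => ('i, 'i) cmat) => bool" where
  "splits X M F p \<longleftrightarrow> finite F \<and> (\<forall>i\<in>F. \<forall>j\<in>F. p i ** p j = (if i = j then p i else 0))
   \<and> (\<forall>i\<in>F. ad (p i) = p i \<and> p i \<in> Hom X M M) \<and> (\<Sum>i\<in>F. p i) = fst M"

definition homdim :: "'x set => ('i, 'x) sfam => ('j, 'x) sfam => nat" where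
  "homdim X M N = cdim (Hom X M N)"

definition equivf :: "'x set => ('i, 'x) sfam => ('j, 'x) sfam => bool" where
  "equivf X M N \<longleftrightarrow> (\<exists>U\<in>Hom X M N. \<exists>U'\<in>Hom X N M. U' ** U = fst M \<and> U ** U' = fst N)"

lemma fst_sub [simp]: "fst (sub p M) = p" and snd_sub [simp]: "snd (sub p M) x = p ** snd M x"
  by (simp_all add: sub_def)

lemma HomD:
  assumes "T \<in> Hom X M N"
  shows "fst N ** T = T" "T ** fst M = T" "x \<in> X ==> T ** snd M x = snd N x ** T"
  using assms by (simp_all add: Hom_def)

lemma star_familyD:
  assumes "star_family X iv M"
  shows "proj (fst M)" "x \<in> X ==> iv x \<in> X" "x \<in> X ==> fst M ** snd M x = snd M x"
  "x \<in> X ==> snd M x ** fst M = snd M x" "x \<in> X ==> ad (snd M x) = snd M (iv x)"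
  "fst M ** fst M = fst M" "ad (fst M) = fst M"
  using assms by (simp_all add: star_family_def proj_def)

lemma Hom_subspace: "csubspace (Hom X M N)"
  by (simp add: complex_vector.subspace_def Hom_def mm_linear)

lemma Hom_zero [simp]: "0 \<in> Hom X M N" by (simp add: Hom_def)

lemma Hom_comp: "T \<in> Hom X M N ==> T' \<in> Hom X N K ==> T' ** T \<in> Hom X M K"
  by (auto simp: Hom_def mm_assoc) (metis mm_assoc)+

lemma Hom_id: "star_family X iv M ==> fst M \<in> Hom X M M"
  by (simp add: Hom_def star_familyD)

lemma Hom_ad:
  assumes M: "star_family X iv M" and N: "star_family X iv N" and T: "T \<in> Hom X M N"
  shows "ad T \<in> Hom X N M"
proof -
  have 1: "ad T ** snd N x = snd M x ** ad T" if x: "x \<in> X" for x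
  proof -
  have x': "iv x \<in> X" using M x by (rule star_familyD)
  have "ad (T ** snd M (iv x)) = ad (snd N (iv x) ** T)" using HomD(3)[OF T x'] by simp
  moreover have "ad (snd M (iv x)) = snd M x" "ad (snd N (iv x)) = snd N x"
   using star_familyD(5)[OF M x] star_familyD(5)[OF N x] by (metis ad_ad)+
  ultimately show ?thesis by (simp add: ad_mm)
  qed
  have 2: "fst M ** ad T = ad T" "ad T ** fst N = ad T"
  using arg_cong[OF HomD(2)[OF T], of ad] arg_cong[OF HomD(1)[OF T], of ad] M N
  by (simp_all add: ad_mm star_familyD)
  show ?thesis using 1 2 by (simp add: Hom_def)
qed

lemma star_family_sub:
  assumes "star_family X iv M" "proj p" "p \<in> Hom X M M"
  shows "star_family X iv (sub p M)"
proof -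
  have "p ** snd M x ** p = p ** snd M x" if "x \<in> X" for x
  using HomD(3)[OF assms(3) that] projD[OF assms(2)] by (metis mm_assoc)
  moreover have "snd M (iv x) ** p = p ** snd M (iv x)" if "x \<in> X" for x
  using HomD(3)[OF assms(3)] star_familyD(2)[OF assms(1) that] by metis
  ultimately show ?thesis
  using assms unfolding star_family_def by (auto simp: projD ad_mm)
qed

lemma Hom_to_sub:
  assumes "p \<in> Hom X M M" "proj p"
  shows "T \<in> Hom X N (sub p M) \<longleftrightarrow> T \<in> Hom X N M \<and> p ** T = T"
proof -
  have "p ** snd M x ** T = snd M x ** T" if "p ** T = T" "x \<in> X" for x
  using HomD(3)[OF assms(1) that(2)] that(1) by (metis mm_assoc)
  moreover have "fst M ** T = T" if "p ** T = T" using HomD(1)[OF assms(1)] that by (metis mm_assoc)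
  ultimately show ?thesis by (auto simp: Hom_def)
qed

lemma Hom_from_sub:
  assumes "p \<in> Hom X M M" "proj p"
  shows "T \<in> Hom X (sub p M) N \<longleftrightarrow> T \<in> Hom X M N \<and> T ** p = T"
proof -
  have "T ** (p ** snd M x) = T ** snd M x" if "T ** p = T" "x \<in> X" for x
  using that(1) by (metis mm_assoc)
  moreover have "T ** fst M = T" if "T ** p = T" using HomD(2)[OF assms(1)] that by (metis mm_assoc)
  ultimately show ?thesis by (auto simp: Hom_def)
qed

lemma sub_sub: "q ** p = q ==> sub q (sub p M) = sub q M"
  by (simp add: sub_def flip: mm_assoc)

lemma splitsD:
  assumes "splits X M F p"
  shows "finite F" "i \<in> F ==> proj (p i)" "i \<in> F ==> p i \<in> Hom X M M"
  "i \<in> F ==> j \<in> F ==> i ~= j ==> p i ** p j = 0" "(\<Sum>i\<in>F. p i) = fst M"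
  using assms by (auto simp: splits_def proj_def)

lemma splits_expand:
  assumes "splits X M F p" "fst M ** T = T"
  shows "T = (\<Sum>i\<in>F. p i ** T)"
  using assms by (simp add: splits_def flip: mm_sum_left)

subsection \<open>Complete reducibility\<close>

text \<open>An endomorphism \<open>T\<close> that is not scalar has an eigenvalue whose eigenspace
  \<open>?W\<close> is proper. Every operator commutes with \<open>T\<close> and so preserves
  \<open>?W\<close>; closure under adjoints makes the orthogonal projection onto \<open>?W\<close>
  commute with all operators.\<close>

lemma reducible_projection:
  fixes M :: "('i, 'x) sfam"
  assumes M: "star_family X iv M" and "fst M ~= 0" and T: "T \<in> Hom X M M" and nsc: "\<nexists>c. T = c *\<^sub>C fst M"
  obtains p where "proj p" "p \<in> Hom X M M" "p ~= 0" "p ~= fst M"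
proof -
  let ?P = "fst M"
  let ?U = "{w :: ('i, unit) cmat. ?P ** w = w}"
  have P: "?P ** ?P = ?P" using M by (rule star_familyD)
  have U: "csubspace ?U" by (simp add: complex_vector.subspace_def mm_linear)
  have supp: "idm (rows ?P) ** w = w" if "w \<in> ?U" for w
  using that mm_eq_assoc[OF rows_idm[of ?P], of w] by simp
  obtain S :: "('i, unit) cmat set" where S: "finite S" "!!w. idm (rows ?P) ** w = w ==> w \<in> cspan S"
  using vectors_finite_span[of "rows ?P"] by auto
  obtain v :: "('i, unit) cmat" where v: "?P ** v ~= 0"
  using column_ext[of ?P 0] assms(2) by auto
  obtain \<mu> y where y: "y \<in> ?U" "y ~= 0" "T ** y = \<mu> *\<^sub>C y"
  proof (rule eigenvector_exists[of S ?U "%w. T ** w" "?P ** v"])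
  show "?U <= cspan S" using S(2) supp by blast
  show "T ** w \<in> ?U" if "w \<in> ?U" for w using HomD(1)[OF T] by (simp flip: mm_assoc)
  qed (use S(1) U P v in \<open>auto simp: mm_linear simp flip: mm_assoc\<close>)
  let ?W = "{w \<in> ?U. T ** w = \<mu> *\<^sub>C w}"
  have W: "csubspace ?W" using U
  by (auto simp: complex_vector.subspace_def mm_linear scaleC_scaleC mult.commute scaleC_add_right)
  obtain n and V :: "('i, nat) cmat" where "ad V ** V = idm {..<n}" "V ** idm {..<n} = V"
  and V: "proj (V ** ad V)"
  "!!w. V ** ad V ** w \<in> ?W" "!!w. w \<in> ?W ==> V ** ad V ** w = w"
  proof (rule proj_onto_subspace[OF finite_rows W])
  show "idm (rows ?P) ** w = w" if "w \<in> ?W" for w using supp that by blast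
  qed blast+
  define p where "p = V ** ad V"
  have p: "proj p" "!!w. p ** w \<in> ?W" "!!w. w \<in> ?W ==> p ** w = w" using V by (simp_all add: p_def)
  have Pp: "?P ** p = p" by (rule column_ext) (use p(2) in \<open>simp add: mm_assoc\<close>)
  have pP: "p ** ?P = p"
  using arg_cong[OF Pp, of ad] projD[OF p(1)] star_familyD[OF M] by (simp add: ad_mm)
  have pres: "p ** snd M x ** p = snd M x ** p" if x: "x \<in> X" for x
  proof (rule column_ext)
  fix w :: "('i, unit) cmat"
  have "T ** (snd M x ** (p ** w)) = snd M x ** (T ** (p ** w))"
   using HomD(3)[OF T x] by (metis mm_assoc)
  also have "... = \<mu> *\<^sub>C (snd M x ** (p ** w))" using p(2)[of w] by (simp add: mm_scale_right)
  finally have "snd M x ** (p ** w) \<in> ?W" using star_familyD(3)[OF M x] by (simp flip: mm_assoc)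
  from p(3)[OF this] show "p ** snd M x ** p ** w = snd M x ** p ** w" by (simp add: mm_assoc)
  qed
  \<comment> \<open>Invariance under the adjoint operator, which belongs to the family with label
    \<open>iv x\<close>, gives the other half.\<close>
  have comm: "p ** snd M x = snd M x ** p" if x: "x \<in> X" for x
  proof -
  have "ad (p ** snd M (iv x) ** p) = ad (snd M (iv x) ** p)"
   using pres star_familyD(2)[OF M x] by simp
  moreover have "ad (snd M (iv x)) = snd M x" using star_familyD(5)[OF M x] by (metis ad_ad)
  ultimately have "p ** snd M x ** p = p ** snd M x"
   using projD[OF p(1)] by (simp add: ad_mm mm_assoc)
  with pres[OF x] show ?thesis by simp
  qed
  have "p ~= 0" using p(3)[of y] y by auto
  moreover have "p ~= ?P"
  proof
  assume pP: "p = ?P"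
  have "T ** p = \<mu> *\<^sub>C p"
   by (rule column_ext) (use p(2) in \<open>simp add: mm_assoc mm_scale_left\<close>)
  with pP show False using nsc HomD(2)[OF T] by auto
  qed
  moreover have "p \<in> Hom X M M" using Pp pP comm by (simp add: Hom_def)
  ultimately show thesis using that p(1) by blast
qed

text \<open>Induction on the rank: a reducible object splits into \<open>p\<close> and
  \<open>fst M - p\<close>, both of smaller rank, and their decompositions are put together.\<close>

lemma complete_reducibility:
  assumes "star_family X iv M"
  obtains F where "splits X M F (%p. p)" "!!p. p \<in> F ==> irr X (sub p M)"
proof -
  obtain n where "trace (fst M) = of_nat n" using proj_trace star_familyD(1)[OF assms] by blast
  with assms have "\<exists>F. splits X M F (%p. p) \<and> (\<forall>p\<in>F. irr X (sub p M))"
  proof (induction n arbitrary: M rule: less_induct)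
  case (less n M)
  let ?P = "fst M"
  note M = star_familyD[OF less.prems(1)]
  consider "?P = 0" | "irr X M" | "?P ~= 0" "\<not> irr X M" by blast
  then show ?case
  proof cases
   case 1
   then show ?thesis by (intro exI[of _ "{}"]) (simp add: splits_def)
  next
   case 2
   have "Hom X (sub ?P M) (sub ?P M) = Hom X M M"
    using M(3) by (simp add: Hom_def)
   then have "irr X (sub ?P M)" using 2 by (simp add: irr_def)
   then show ?thesis using M Hom_id[OF less.prems(1)]
    by (intro exI[of _ "{?P}"]) (simp add: splits_def)
  next
   case 3
   then obtain T where T: "T \<in> Hom X M M" "\<nexists>c. T = c *\<^sub>C ?P" by (auto simp: irr_def)
   obtain p where p: "proj p" "p \<in> Hom X M M" "p ~= 0" "p ~= ?P"
    using reducible_projection[OF less.prems(1) 3(1) T] by blast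
   let ?q = "?P - p"
   have Pp: "?P ** p = p" "p ** ?P = p" using p(2) by (simp_all add: Hom_def)
   have q: "proj ?q" using p(1) M Pp by (simp add: proj_def mm_linear ad_diff)
   have qH: "?q \<in> Hom X M M"
    by (rule complex_vector.subspace_diff[OF Hom_subspace Hom_id[OF less.prems(1)] p(2)])
   have pq: "p ** ?q = 0" "?q ** p = 0" using Pp projD[OF p(1)] by (simp_all add: mm_linear)
   obtain k where k: "trace p = of_nat k" "k ~= 0" using proj_trace[OF p(1)] p(3) by metis
   obtain l where l: "trace ?q = of_nat l" "l ~= 0" using proj_trace[OF q] p(4) by (metis eq_iff_diff_eq_0)
   have "trace ?P = trace p + trace ?q" using trace_add[of p ?q] by simp
   then have "of_nat n = (of_nat (k + l) :: complex)" using k l less.prems(2) by simp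
   then have n: "n = k + l" using of_nat_eq_iff by blast
   obtain D where D: "splits X (sub p M) D (%p. p)" "\<forall>r\<in>D. irr X (sub r (sub p M))"
    using less.IH[of k "sub p M"] star_family_sub[OF less.prems(1) p(1,2)] k l n by auto
   obtain E where E: "splits X (sub ?q M) E (%p. p)" "\<forall>r\<in>E. irr X (sub r (sub ?q M))"
    using less.IH[of l "sub ?q M"] star_family_sub[OF less.prems(1) q qH] k l n by auto
   have Dp: "r ** p = r" "p ** r = r" "proj r" if "r \<in> D" for r
    using splitsD(2,3)[OF D(1) that] by (simp_all add: Hom_def)
   have Eq: "r ** ?q = r" "?q ** r = r" "proj r" if "r \<in> E" for r
    using splitsD(2,3)[OF E(1) that] by (simp_all add: Hom_def)
   have DE: "r ** s = 0" "s ** r = 0" if "r \<in> D" "s \<in> E" for r s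
    using Dp[OF that(1)] Eq[OF that(2)] pq by (metis mm_assoc mm_zero)+
   have D0: "r ~= 0" if "r \<in> D" for r using D(2) that by (auto simp: irr_def)
   have disj: "D \<inter> E = {}" using DE D0 Dp projD(2) by (metis disjoint_iff)
   have DH: "r \<in> Hom X M M" if "r \<in> D" for r
   proof -
    have "r \<in> Hom X (sub p M) M"
     using splitsD(3)[OF D(1) that] Hom_to_sub[OF p(2,1)] by blast
    then show ?thesis using Hom_from_sub[OF p(2,1)] by blast
   qed
   have EH: "r \<in> Hom X M M" if "r \<in> E" for r
   proof -
    have "r \<in> Hom X (sub ?q M) M"
     using splitsD(3)[OF E(1) that] Hom_to_sub[OF qH q] by blast
    then show ?thesis using Hom_from_sub[OF qH q] by blast
   qed
   have "splits X M (D \<union> E) (%p. p)"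
    unfolding splits_def
   proof (intro conjI ballI)
    show "finite (D \<union> E)" using D E by (simp add: splits_def)
    show "(\<Sum>i\<in>D \<union> E. i) = ?P"
     using D(1) E(1) disj by (simp add: splits_def sum.union_disjoint)
    show "i ** j = (if i = j then i else 0)" if "i \<in> D \<union> E" "j \<in> D \<union> E" for i j
     using that D(1) E(1) DE disj by (auto simp: splits_def)
    show "ad i = i" "i \<in> Hom X M M" if "i \<in> D \<union> E" for i
     using that DH EH Dp(3) Eq(3) projD by blast+
   qed
   moreover have "irr X (sub r M)" if "r \<in> D \<union> E" for r
    using that D(2) E(2) Dp(1) Eq(1) sub_sub by (metis Un_iff)
   ultimately show ?thesis by blast
  qed
  qed
  then show thesis using that by blast
qed

subsection \<open>Schur's lemma and multiplicities\<close>

text \<open>Both products are endomorphisms of irreducibles, hence scalars; comparing the two ways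
  of reading \<open>T ** ad T ** T\<close> shows that the scalars agree.\<close>

lemma schur:
  assumes M: "star_family X iv M" "irr X M" and N: "star_family X iv N" "irr X N"
  and T: "T \<in> Hom X M N" "T ~= 0"
  obtains c where "c ~= 0" "ad T ** T = c *\<^sub>C fst M" "T ** ad T = c *\<^sub>C fst N"
proof -
  have T': "ad T \<in> Hom X N M" using Hom_ad[OF M(1) N(1) T(1)] .
  obtain c where c: "ad T ** T = c *\<^sub>C fst M"
  using M(2) Hom_comp[OF T(1) T'] by (auto simp: irr_def)
  obtain d where d: "T ** ad T = d *\<^sub>C fst N"
  using N(2) Hom_comp[OF T' T(1)] by (auto simp: irr_def)
  have "c ~= 0" using c T(2) ad_mm_self_zero by force
  have "c *\<^sub>C T = T ** (ad T ** T)" using c HomD(2)[OF T(1)] by (simp add: mm_scale_right)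
  also have "... = d *\<^sub>C T" using d HomD(1)[OF T(1)] by (simp add: mm_scale_left flip: mm_assoc)
  finally have "c = d" using T(2) by simp
  with c d \<open>c ~= 0\<close> that show thesis by blast
qed

lemma schur_unique:
  assumes M: "star_family X iv M" "irr X M" and N: "star_family X iv N" "irr X N"
  and T: "T \<in> Hom X M N" "T ~= 0" and S: "S \<in> Hom X M N"
  obtains c where "S = c *\<^sub>C T"
proof -
  obtain c where c: "c ~= 0" "T ** ad T = c *\<^sub>C fst N" using schur[OF M N T] by blast
  obtain d where d: "ad T ** S = d *\<^sub>C fst M"
  using M(2) Hom_comp[OF S Hom_ad[OF M(1) N(1) T(1)]] by (auto simp: irr_def)
  have "c *\<^sub>C S = T ** (ad T ** S)"
  using c HomD(1)[OF S] by (simp add: mm_scale_left flip: mm_assoc)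
  also have "... = d *\<^sub>C T" using d HomD(2)[OF T(1)] by (simp add: mm_scale_right)
  finally have "S = (d / c) *\<^sub>C T"
  using c(1) by (metis complex_vector.scale_left_imp_eq complex_vector.scale_scale
    nonzero_mult_div_cancel_left times_divide_eq_right)
  then show thesis using that by blast
qed

lemma homdim_sym:
  assumes "star_family X iv M" "star_family X iv N"
  shows "homdim X M N = homdim X N M"
proof -
  have "Hom X N M = ad ` Hom X M N"
  using Hom_ad assms by (metis ad_ad image_eqI subsetI subset_antisym image_subsetI)
  moreover have "cdim (ad ` Hom X M N) = cdim (Hom X M N)"
  by (rule cdim_semilinear_image[where \<sigma> = cnj]) (auto simp: ad_add ad_scale Hom_subspace dest: arg_cong[of _ _ ad])
  ultimately show ?thesis by (simp add: homdim_def)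
qed

text \<open>By Schur's lemma each irreducible summand contributes one basis vector
  \<open>t i\<close> or nothing, so the dimension is a number of summands. Multiplicities are
  computed through this count.\<close>

lemma homdim_splits_irr:
  assumes C: "star_family X iv C" "irr X C" and M: "star_family X iv M" and F: "splits X M F p"
  and irrF: "!!i. i \<in> F ==> irr X (sub (p i) M)"
  shows "homdim X C M = card {i \<in> F. Hom X C (sub (p i) M) ~= {0}}"
proof -
  let ?I = "{i \<in> F. Hom X C (sub (p i) M) ~= {0}}"
  note F' = splitsD[OF F]
  define t where "t i = (SOME T. T \<in> Hom X C (sub (p i) M) \<and> T ~= 0)" for i
  have t: "t i \<in> Hom X C (sub (p i) M)" "t i ~= 0" if "i \<in> ?I" for i
  proof -
  have "\<exists>T. T \<in> Hom X C (sub (p i) M) \<and> T ~= 0" using that Hom_zero by blast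
  then show "t i \<in> Hom X C (sub (p i) M)" "t i ~= 0" unfolding t_def by (metis (mono_tags, lifting) someI_ex)+
  qed
  have t': "t i \<in> Hom X C M" "p i ** t i = t i" if "i \<in> ?I" for i
  proof -
  have "i \<in> F" using that by simp
  then show "t i \<in> Hom X C M" "p i ** t i = t i"
   using t(1)[OF that] Hom_to_sub[OF F'(3,2)] by blast+
  qed
  have pt: "p j ** t i = (if i = j then t i else 0)" if "i \<in> ?I" "j \<in> F" for i j
  proof (cases "i = j")
  case False
  have "p j ** t i = p j ** p i ** t i" using t'(2)[OF that(1)] by (simp add: mm_assoc)
  then show ?thesis using F'(4)[of j i] that False by simp
  qed (use t'(2)[OF that(1)] in simp)
  show ?thesis unfolding homdim_def
  proof (rule cdim_indexed[where b = t])
  show "finite ?I" using F'(1) by simp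
  fix w assume w: "w \<in> Hom X C M"
  have "\<exists>c. p i ** w = (if i \<in> ?I then c *\<^sub>C t i else 0)" if i: "i \<in> F" for i
  proof -
   have wi: "p i ** w \<in> Hom X C (sub (p i) M)"
    unfolding Hom_to_sub[OF F'(3)[OF i] F'(2)[OF i]]
    using Hom_comp[OF w F'(3)[OF i]] projD[OF F'(2)[OF i]] by simp
   show ?thesis
   proof (cases "i \<in> ?I")
    case True
    then show ?thesis
     using schur_unique[OF C star_family_sub[OF M F'(2)[OF i] F'(3)[OF i]] irrF[OF i] t(1,2)[OF True] wi]
     by auto
   next
    case False
    then show ?thesis using i wi by auto
   qed
  qed
  then have "\<forall>i\<in>F. \<exists>c. p i ** w = (if i \<in> ?I then c *\<^sub>C t i else 0)" by blast
  from bchoice[OF this] obtain c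
   where c: "!!i. i \<in> F ==> p i ** w = (if i \<in> ?I then c i *\<^sub>C t i else 0)" by blast
  have "w = (\<Sum>i\<in>F. p i ** w)" using splits_expand[OF F HomD(1)[OF w]] .
  also have "... = (\<Sum>i\<in>F. if i \<in> ?I then c i *\<^sub>C t i else 0)" using c by (intro sum.cong) auto
  also have "... = (\<Sum>i\<in>?I. c i *\<^sub>C t i)" using F'(1) by (simp add: sum.inter_filter)
  finally show "\<exists>c. w = (\<Sum>i\<in>?I. c i *\<^sub>C t i)" by blast
  next
  fix c assume c: "(\<Sum>i\<in>?I. c i *\<^sub>C t i) = 0"
  show "\<forall>j\<in>?I. c j = 0"
  proof
   fix j assume j: "j \<in> ?I"
   have "p j ** (\<Sum>i\<in>?I. c i *\<^sub>C t i) = (\<Sum>i\<in>?I. if i = j then c i *\<^sub>C t i else 0)"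
    unfolding mm_sum_right by (rule sum.cong) (use j in \<open>auto simp: mm_scale_right pt\<close>)
   also have "... = c j *\<^sub>C t j" using j F'(1) by simp
   finally show "c j = 0" using c t(2)[OF j] by simp
  qed
  qed (use t' in auto)
qed

lemma splits_refine:
  assumes F: "splits X M F p" and D: "!!i. i \<in> F ==> splits X (sub (p i) M) (D i) (q i)"
  shows "splits X M (Sigma F D) (%(i, j). q i j)"
proof -
  note F' = splitsD[OF F]
  have q: "q i j \<in> Hom X M M" "q i j ** p i = q i j" "p i ** q i j = q i j" "proj (q i j)" if "i \<in> F" "j \<in> D i" for i j
  proof -
  have "q i j \<in> Hom X (sub (p i) M) (sub (p i) M)" "proj (q i j)"
   using splitsD[OF D[OF that(1)]] that by auto
  then show "q i j \<in> Hom X M M" "q i j ** p i = q i j" "p i ** q i j = q i j" "proj (q i j)"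
   using that F' by (auto simp: Hom_to_sub Hom_from_sub)
  qed
  have finD: "finite (D i)" if "i \<in> F" for i using splitsD(1)[OF D[OF that]] .
  have adq: "ad (q i j) = q i j" if "i \<in> F" "j \<in> D i" for i j using projD(1)[OF q(4)[OF that]] .
  have orth: "q i j ** q i' j' = (if (i, j) = (i', j') then q i j else 0)"
  if "i \<in> F" "j \<in> D i" "i' \<in> F" "j' \<in> D i'" for i j i' j'
  proof (cases "i = i'")
  case True
  then show ?thesis using that D[of i] by (auto simp: splits_def)
  next
  case False
  have "q i j ** q i' j' = q i j ** (p i ** p i') ** q i' j'"
   using q(2)[OF that(1,2)] q(3)[OF that(3,4)] by (metis mm_assoc)
  then show ?thesis using F'(4) that False by simp
  qed
  have "(\<Sum>x\<in>Sigma F D. case x of (i, j) => q i j) = (\<Sum>i\<in>F. \<Sum>j\<in>D i. q i j)"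
  using F'(1) finD by (subst sum.Sigma) auto
  also have "... = fst M" using D F'(5) by (simp add: splits_def)
  finally show ?thesis
  unfolding splits_def using F'(1) finD by (auto simp: q(1) orth adq)
qed

text \<open>Additivity for summands that may be reducible: all of them are refined to irreducibles,
  where both sides count the same constituents.\<close>

lemma homdim_splits:
  assumes C: "star_family X iv C" "irr X C" and M: "star_family X iv M" and F: "splits X M F p"
  shows "homdim X C M = (\<Sum>i\<in>F. homdim X C (sub (p i) M))"
proof -
  note F' = splitsD[OF F]
  have Mi: "star_family X iv (sub (p i) M)" if "i \<in> F" for i
  using star_family_sub[OF M] F' that by blast
  have "\<forall>i. \<exists>D. i \<in> F \<longrightarrow> splits X (sub (p i) M) D (%p. p) \<and> (\<forall>q\<in>D. irr X (sub q (sub (p i) M)))"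
  using complete_reducibility[OF Mi] by metis
  then obtain D where D: "!!i. i \<in> F ==> splits X (sub (p i) M) (D i) (%p. p)"
  "!!i q. i \<in> F ==> q \<in> D i ==> irr X (sub q (sub (p i) M))" by metis
  have sub: "sub q (sub (p i) M) = sub q M" if "i \<in> F" "q \<in> D i" for i q
  using splitsD(3)[OF D(1)[OF that(1)] that(2)] by (intro sub_sub) (simp add: Hom_def)
  have "homdim X C M = card {x \<in> Sigma F D. Hom X C (sub (case x of (i, j) => j) M) ~= {0}}"
  by (rule homdim_splits_irr[OF C M splits_refine[OF F D(1)]]) (use D(2) sub in auto)
  also have "{x \<in> Sigma F D. Hom X C (sub (case x of (i, j) => j) M) ~= {0}}
   = Sigma F (%i. {q \<in> D i. Hom X C (sub q (sub (p i) M)) ~= {0}})"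
  using sub by auto
  also have "card ... = (\<Sum>i\<in>F. card {q \<in> D i. Hom X C (sub q (sub (p i) M)) ~= {0}})"
  using F'(1) splitsD(1)[OF D(1)] by (subst card_SigmaI) auto
  also have "... = (\<Sum>i\<in>F. homdim X C (sub (p i) M))"
  by (rule sum.cong[OF refl], rule homdim_splits_irr[OF C Mi D, symmetric])
  finally show ?thesis .
qed

lemma equivf_sym: "equivf X M N ==> equivf X N M"
  by (auto simp: equivf_def)

lemma equivf_refl: "star_family X iv M ==> equivf X M M"
  unfolding equivf_def by (intro bexI[of _ "fst M"] conjI Hom_id) (simp_all add: star_familyD)

lemma equivf_trans:
  assumes "equivf X M N" "equivf X N K"
  shows "equivf X M K"
proof -
  obtain U U' where U: "U \<in> Hom X M N" "U' \<in> Hom X N M" "U' ** U = fst M" "U ** U' = fst N"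
  using assms(1) by (auto simp: equivf_def)
  obtain T T' where T: "T \<in> Hom X N K" "T' \<in> Hom X K N" "T' ** T = fst N" "T ** T' = fst K"
  using assms(2) by (auto simp: equivf_def)
  have "U' ** T' ** (T ** U) = fst M" "T ** U ** (U' ** T') = fst K"
  using U T HomD(1)[OF U(1)] HomD(1)[OF T(2)] by (metis mm_assoc)+
  then show ?thesis unfolding equivf_def
  using Hom_comp[OF U(1) T(1)] Hom_comp[OF T(2) U(2)] by blast
qed

lemma homdim_equiv:
  assumes "equivf X M M'" "equivf X N N'"
  shows "homdim X M N = homdim X M' N'"
proof -
  obtain U U' where U: "U \<in> Hom X M M'" "U' \<in> Hom X M' M" "U' ** U = fst M" "U ** U' = fst M'"
  using assms(1) by (auto simp: equivf_def)
  obtain T T' where T: "T \<in> Hom X N N'" "T' \<in> Hom X N' N" "T' ** T = fst N" "T ** T' = fst N'"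
  using assms(2) by (auto simp: equivf_def)
  have "cdim (Hom X M' N') = cdim (Hom X M N)"
  proof (rule cdim_bij[where f = "%A. T ** A ** U'" and g = "%A. T' ** A ** U"])
  show "lin (%A. T ** A ** U')" by (rule linI) (simp_all add: mm_linear)
  show "T ** A ** U' \<in> Hom X M' N'" if "A \<in> Hom X M N" for A
   by (rule Hom_comp[OF U(2) Hom_comp[OF that T(1)]])
  show "T' ** A ** U \<in> Hom X M N \<and> T ** (T' ** A ** U) ** U' = A" if "A \<in> Hom X M' N'" for A
  proof
   show "T' ** A ** U \<in> Hom X M N" by (rule Hom_comp[OF U(1) Hom_comp[OF that T(2)]])
   have "T ** (T' ** A ** U) ** U' = (T ** T') ** A ** (U ** U')" by (simp add: mm_assoc)
   then show "T ** (T' ** A ** U) ** U' = A" using U T HomD[OF that] by simp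
  qed
  show "T' ** (T ** A ** U') ** U = A" if "A \<in> Hom X M N" for A
  proof -
   have "T' ** (T ** A ** U') ** U = (T' ** T) ** A ** (U' ** U)" by (simp add: mm_assoc)
   then show ?thesis using U T HomD[OF that] by simp
  qed
  qed (rule Hom_subspace)
  then show ?thesis by (simp add: homdim_def)
qed

lemma irr_equivf_iff:
  assumes "star_family X iv M" "irr X M" "star_family X iv N" "irr X N"
  shows "equivf X M N \<longleftrightarrow> Hom X M N ~= {0}"
proof
  assume "equivf X M N"
  then obtain U U' where U: "U \<in> Hom X M N" "U' ** U = fst M" by (auto simp: equivf_def)
  then have "U ~= 0" using assms(2) by (auto simp: irr_def)
  with U(1) show "Hom X M N ~= {0}" by blast
next
  assume "Hom X M N ~= {0}"
  then obtain T where T: "T \<in> Hom X M N" "T ~= 0" using Hom_zero by blast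
  obtain c where c: "c ~= 0" "ad T ** T = c *\<^sub>C fst M" "T ** ad T = c *\<^sub>C fst N"
  using schur[OF assms T] by blast
  have "(1 / c) *\<^sub>C ad T \<in> Hom X N M"
  using Hom_ad[OF assms(1,3) T(1)] Hom_subspace complex_vector.subspace_scale by blast
  moreover have "(1 / c) *\<^sub>C ad T ** T = fst M" "T ** (1 / c) *\<^sub>C ad T = fst N"
  using c by (simp_all add: mm_linear scaleC_scaleC scaleC_one)
  ultimately show "equivf X M N" unfolding equivf_def using T(1) by blast
qed

lemma homdim_irr:
  assumes "star_family X iv M" "irr X M" "star_family X iv N" "irr X N"
  shows "homdim X M N = (if equivf X M N then 1 else 0)"
proof (cases "equivf X M N")
  case True
  then obtain T where T: "T \<in> Hom X M N" "T ~= 0" using irr_equivf_iff[OF assms] Hom_zero by blast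
  have "cdim (Hom X M N) = card {()}"
  proof (rule cdim_indexed[where b = "%_. T"])
  fix w assume "w \<in> Hom X M N"
  then obtain c where "w = c *\<^sub>C T" using schur_unique[OF assms T] by blast
  then show "\<exists>c. w = (\<Sum>i\<in>{()}. c i *\<^sub>C T)" by (intro exI[of _ "%_. c"]) simp
  qed (use T in auto)
  then show ?thesis using True by (simp add: homdim_def)
next
  case False
  then have "Hom X M N = {0}" using irr_equivf_iff[OF assms] by blast
  then show ?thesis using False
  by (simp add: homdim_def complex_vector.dim_unique[of "{}" "{0}" 0] complex_vector.independent_empty)
qed

lemma irr_equiv_invariant:
  assumes "equivf X M N" "irr X M"
  shows "irr X N"
proof -
  obtain U U' where U: "U \<in> Hom X M N" "U' \<in> Hom X N M" "U' ** U = fst M" "U ** U' = fst N"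
  using assms(1) by (auto simp: equivf_def)
  have "\<exists>c. T = c *\<^sub>C fst N" if T: "T \<in> Hom X N N" for T
  proof -
  have "U' ** (T ** U) \<in> Hom X M M" by (rule Hom_comp[OF Hom_comp[OF U(1) T] U(2)])
  then obtain c where c: "U' ** (T ** U) = c *\<^sub>C fst M" using assms(2) by (auto simp: irr_def)
  have "T = (U ** U') ** T ** (U ** U')" using U(4) HomD[OF T] by simp
  also have "... = U ** (U' ** (T ** U)) ** U'" by (simp add: mm_assoc)
  also have "... = c *\<^sub>C fst N" using c U(4) HomD(2)[OF U(1)] by (simp add: mm_linear)
  finally show ?thesis by blast
  qed
  moreover have "fst N ~= 0"
  proof
  assume "fst N = 0"
  then have "fst M = 0" using U(3) HomD(1)[OF U(1)] by auto
  then show False using assms(2) by (simp add: irr_def)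
  qed
  ultimately show ?thesis by (simp add: irr_def)
qed

section \<open>Kronecker products and reindexing\<close>

definition kr :: "('i, 'k, 'c) fmat => ('j, 'l, 'c) fmat => ('i \<times> 'j, 'k \<times> 'l, 'c::complex_star_algebra) fmat" where
  "kr A B = mk (rows A \<times> rows B) (cols A \<times> cols B) (%(i, j) (k, l). ent A i k * ent B j l)"

lemma ent_kr: "ent (kr A B) (i, j) (k, l) = ent A i k * ent B j l"
  by (auto simp: kr_def ent_mk ent_rows ent_cols)

lemma kr_eqI: "(!!i j k l. ent A (i, j) (k, l) = ent B (i, j) (k, l)) ==> A = B"
  by (rule fmat_eqI) auto

text \<open>Over a noncommutative algebra the mixed product rule requires the inner factors to be
  exchanged. This is possible when one of them is scalar, or when they sit in different legs of a
  tensor product.\<close>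

lemma kr_mm:
  assumes "!!j m k n. ent B j m * ent C k n = ent C k n * ent B j m"
  shows "kr A B ** kr C D = kr (A ** C) (B ** D)"
proof (rule kr_eqI)
  fix i j k l
  have "ent (kr A B ** kr C D) (i, j) (k, l)
   = (\<Sum>x\<in>cols A \<times> cols B. ent (kr A B) (i, j) x * ent (kr C D) x (k, l))"
  proof (rule ent_mm)
  fix x assume "x \<notin> cols A \<times> cols B"
  then show "ent (kr A B) (i, j) x * ent (kr C D) x (k, l) = 0"
   by (cases x; cases "fst x \<in> cols A") (simp_all add: ent_kr ent_cols)
  qed simp
  also have "... = (\<Sum>m\<in>cols A. \<Sum>n\<in>cols B. (ent A i m * ent C m k) * (ent B j n * ent D n l))"
  unfolding sum.cartesian_product
  proof (rule sum.cong[OF refl])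
  fix x
  have "ent B j n * (ent C m k * z) = ent C m k * (ent B j n * z)" for m n z
   by (metis assms mult.assoc)
  then show "ent (kr A B) (i, j) x * ent (kr C D) x (k, l)
    = (case x of (m, n) => (ent A i m * ent C m k) * (ent B j n * ent D n l))"
   by (cases x) (simp add: ent_kr mult.assoc)
  qed
  also have "... = ent (kr (A ** C) (B ** D)) (i, j) (k, l)"
  by (simp add: ent_kr ent_mm0 sum_product)
  finally show "ent (kr A B ** kr C D) (i, j) (k, l) = ent (kr (A ** C) (B ** D)) (i, j) (k, l)" .
qed

lemma kr_mm_sc1: "kr A (sc B) ** kr C D = kr (A ** C) (sc B ** D)"
  by (rule kr_mm) (simp add: ent_sc mult_scaleC_left mult_scaleC_right)

lemma kr_mm_sc2: "kr A B ** kr (sc C) D = kr (A ** sc C) (B ** D)"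
  by (rule kr_mm) (simp add: ent_sc mult_scaleC_left mult_scaleC_right)

lemma kr_mm_complex: "kr A B ** kr C D = kr (A ** C) (B ** (D :: ('i, 'j) cmat))"
  by (rule kr_mm) simp

lemma kr_add_left: "kr (A + B) C = kr A C + kr B C"
  and kr_add_right: "kr C (A + B) = kr C A + kr C B"
  and kr_scale_left: "kr (c *\<^sub>C A) C = c *\<^sub>C kr A C"
  and kr_scale_right: "kr A (c *\<^sub>C C) = c *\<^sub>C kr A C"
  and kr_zero [simp]: "kr 0 C = 0" "kr C 0 = 0"
  by (rule kr_eqI, simp add: ent_kr ent_add ent_scaleC distrib_right distrib_left
   mult_scaleC_left mult_scaleC_right)+

lemma kr_sum_left: "kr (\<Sum>i\<in>I. f i) C = (\<Sum>i\<in>I. kr (f i) C)"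
  by (induction I rule: infinite_finite_induct) (simp_all add: kr_add_left)

lemma kr_sum_right: "kr C (\<Sum>i\<in>I. f i) = (\<Sum>i\<in>I. kr C (f i))"
  by (induction I rule: infinite_finite_induct) (simp_all add: kr_add_right)

lemma ad_kr:
  assumes "!!j m k n. ent A j m * ent B k n = ent B k n * ent A j m"
  shows "ad (kr A B) = kr (ad A) (ad B)"
  by (rule kr_eqI) (simp add: ent_ad ent_kr assms flip: star_mult)

lemma ad_kr_sc1: "ad (kr (sc A) B) = kr (sc (ad A)) (ad B)"
  by (subst ad_kr) (simp_all add: ent_sc mult_scaleC_left mult_scaleC_right ad_sc)

lemma ad_kr_sc2: "ad (kr A (sc B)) = kr (ad A) (sc (ad B))"
  by (subst ad_kr) (simp_all add: ent_sc mult_scaleC_left mult_scaleC_right ad_sc)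

lemma ad_kr_complex: "ad (kr A B) = kr (ad A) (ad (B :: ('i, 'j) cmat))"
  by (rule ad_kr) simp

lemma sc_kr: "sc (kr A B) = kr (sc A) (sc B)"
  by (rule kr_eqI) (simp add: ent_sc ent_kr mult_scaleC_left mult_scaleC_right scaleC_scaleC)

lemma mapm_kr: "f 0 = 0 ==> (!!x y. f (x * y) = f x * f y) ==> mapm f (kr A B) = kr (mapm f A) (mapm f B)"
  by (rule kr_eqI) (simp add: ent_kr ent_mapm)

lemma kr_idm: "finite S ==> finite T ==> kr (idm S) (idm T) = idm (S \<times> T)"
  by (rule kr_eqI) (auto simp: ent_kr ent_idm)

lemma proj_kr: "proj P ==> proj Q ==> proj (kr P Q)"
  by (simp add: proj_def ad_kr_complex kr_mm_complex)

section \<open>Reindexing of matrices\<close>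

definition rr :: "('k => 'i) => ('i, 'j, 'c::zero) fmat => ('k, 'j, 'c) fmat" where
  "rr g A = mk (g -` rows A) (cols A) (%i j. ent A (g i) j)"

definition cr :: "('k => 'j) => ('i, 'j, 'c::zero) fmat => ('i, 'k, 'c) fmat" where
  "cr g A = mk (rows A) (g -` cols A) (%i j. ent A i (g j))"

lemma ent_rr: "inj g ==> ent (rr g A) i j = ent A (g i) j"
  by (auto simp: rr_def ent_mk finite_vimageI ent_rows ent_cols)

lemma ent_cr: "inj g ==> ent (cr g A) i j = ent A i (g j)"
  by (auto simp: cr_def ent_mk finite_vimageI ent_rows ent_cols)

lemma rr_mm: "inj g ==> rr g A ** B = rr g (A ** B)"
proof (rule fmat_eqI)
  fix i j assume g: "inj g"
  have "ent (rr g A ** B) i j = (\<Sum>k\<in>cols A. ent (rr g A) i k * ent B k j)"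
  by (rule ent_mm) (simp_all add: ent_rr g ent_cols)
  then show "ent (rr g A ** B) i j = ent (rr g (A ** B)) i j"
  by (simp add: ent_rr g ent_mm0)
qed

lemma mm_cr: "inj g ==> A ** cr g B = cr g (A ** B)"
  by (rule fmat_eqI) (simp add: ent_cr ent_mm0)

text \<open>Reindexing along an injection loses nothing as long as its range covers the support;
  \<open>rr g P\<close> and \<open>cr g P\<close> thereby become mutually inverse morphisms between
  an object and its reindexed copy.\<close>

lemma cr_rr_mm:
  assumes "inj g" "cols A <= range g"
  shows "cr g A ** rr g B = A ** B"
proof (rule fmat_eqI)
  fix i j
  have "ent (cr g A ** rr g B) i j = (\<Sum>k\<in>g -` cols A. ent A i (g k) * ent B (g k) j)"
  proof -
  have "finite (g -` cols A)" by (rule finite_vimageI) (simp_all add: assms)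
  then have "ent (cr g A ** rr g B) i j = (\<Sum>k\<in>g -` cols A. ent (cr g A) i k * ent (rr g B) k j)"
   by (rule ent_mm) (simp add: ent_cr assms ent_cols)
  then show ?thesis by (simp add: ent_cr ent_rr assms)
  qed
  also have "... = (\<Sum>k\<in>g ` (g -` cols A). ent A i k * ent B k j)"
  by (subst sum.reindex[OF inj_on_subset[OF assms(1) subset_UNIV]]) simp
  also have "g ` (g -` cols A) = cols A" using assms(2) by blast
  finally show "ent (cr g A ** rr g B) i j = ent (A ** B) i j" by (simp add: ent_mm0)
qed

lemma sc_rr: "inj g ==> sc (rr g A) = rr g (sc A)" and sc_cr: "inj g ==> sc (cr g A) = cr g (sc A)"
  by (rule fmat_eqI, simp add: ent_sc ent_rr ent_cr)+

lemma cols_subset_mm_proj: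
  assumes "A ** P = A"
  shows "cols A <= cols P"
proof
  fix j assume "j \<in> cols A"
  then obtain i where i: "ent A i j ~= 0" by (auto simp: cols_def ent_def in_keys_iff)
  have "ent A i j = (\<Sum>k\<in>cols A. ent A i k * ent P k j)"
  by (subst assms[symmetric]) (rule ent_mm0)
  moreover have "(\<Sum>k\<in>cols A. ent A i k * ent P k j) = 0" if "j \<notin> cols P"
  using that by (simp add: ent_cols)
  ultimately show "j \<in> cols P" using i by auto
qed

section \<open>Entrywise conjugation\<close>

definition cj :: "('i, 'j, 'c::complex_star_algebra) fmat => ('i, 'j, 'c) fmat" where
  "cj A = mapm star A"

lemma ent_cj: "ent (cj A) i j = star (ent A i j)"
  by (simp add: cj_def ent_mapm)

lemma cj_cj [simp]: "cj (cj A) = A"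
  by (rule fmat_eqI) (simp add: ent_cj star_star)

lemma cj_mm:
  assumes "!!i k l j. ent A i k * ent B l j = ent B l j * ent A i k"
  shows "cj (A ** B) = cj A ** cj B"
proof (rule fmat_eqI)
  fix i j
  have "ent (cj A ** cj B) i j = (\<Sum>k\<in>cols A. ent (cj A) i k * ent (cj B) k j)"
  by (rule ent_mm) (simp_all add: ent_cj ent_cols)
  then show "ent (cj (A ** B)) i j = ent (cj A ** cj B) i j"
  by (simp add: ent_cj ent_mm0 star_sum assms flip: star_mult)
qed

lemma cj_sc: "cj (sc A) = sc (cj A)"
  by (rule fmat_eqI) (simp add: ent_cj ent_sc star_scaleC star_complex_def)

lemma kr_assoc_reindex:
  "rr (%(i, j, k). ((i, j), k)) (cr (%(i, j, k). ((i, j), k)) (kr (kr A B) C)) = kr A (kr B C)"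
proof -
  have g: "inj (%(i, j, k). ((i, j), k))" by (auto simp: inj_def)
  show ?thesis
  by (rule fmat_eqI) (auto simp: ent_rr[OF g] ent_cr[OF g] ent_kr mult.assoc split: prod.splits)
qed

lemma cj_mm_sc1: "cj (sc A ** B) = sc (cj A) ** cj B"
  by (subst cj_mm) (simp_all add: ent_sc mult_scaleC_left mult_scaleC_right cj_sc)

lemma cj_mm_sc2: "cj (B ** sc A) = cj B ** sc (cj A)"
  by (subst cj_mm) (simp_all add: ent_sc mult_scaleC_left mult_scaleC_right cj_sc)

lemma cj_mm_complex: "cj (A ** B) = cj A ** cj (B :: ('i, 'j) cmat)"
  by (rule cj_mm) simp

lemma proj_cj: "proj P ==> proj (cj P)"
proof -
  have "ad (cj P) = cj (ad P)" by (rule fmat_eqI) (simp add: ent_ad ent_cj)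
  then show "proj P ==> proj (cj P)" by (simp add: proj_def flip: cj_mm_complex)
qed

lemma cj_idm [simp]: "finite S ==> cj (idm S) = idm S"
  by (rule fmat_eqI) (simp add: ent_cj ent_idm)

section \<open>Tensor products of algebras\<close>

lemma cbilinear_tensor: "cbilinear (%a b. a \<otimes> b)"
  by (rule cbilinearI; transfer) (simp_all add: tensor_eq_def cbilinear_simps)

lemmas tensor_linear = cbilinear_simps[OF cbilinear_tensor]

lemma tensor_zero [simp]: "0 \<otimes> b = 0" "a \<otimes> 0 = 0"
  using tensor_linear(3)[of 0 0 b] tensor_linear(4)[of a 0 0] by simp_all

lemma tensor_sum_left: "(\<Sum>i\<in>I. f i) \<otimes> b = (\<Sum>i\<in>I. f i \<otimes> b)"
  by (induction I rule: infinite_finite_induct) (simp_all add: tensor_linear)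

lemma tensor_times: "(a \<otimes> b) * (c \<otimes> d) = (a * c) \<otimes> (b * d)"
  by (simp add: tensor.abs_eq times_tensor.abs_eq formal_mult_def)

lemma tensor_star: "star (a \<otimes> b) = star a \<otimes> star b"
  by (simp add: tensor.abs_eq star_tensor.abs_eq)

lemma tensor_one: "1 \<otimes> 1 = 1"
  by (simp add: tensor.abs_eq one_tensor_def)

lemma lin_tensor_sum: "cbilinear f ==> lin (tensor_sum f)"
  by (simp add: lin_def tensor_sum_add tensor_sum_scaleC)

abbreviation leg1 :: "'a::complex_star_algebra => ('a, 'a) tensor" where "leg1 x \<equiv> x \<otimes> 1"
abbreviation leg2 :: "'a::complex_star_algebra => ('a, 'a) tensor" where "leg2 x \<equiv> 1 \<otimes> x"

lemma lin_leg1: "lin leg1" and lin_leg2: "lin leg2"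
  by (simp_all add: lin_def tensor_linear)

lemma leg1_mult: "leg1 (x * y) = leg1 x * leg1 y" and leg2_mult: "leg2 (x * y) = leg2 x * leg2 y"
  by (simp_all add: tensor_times)

text \<open>In leg numbering this product is \<open>A_12 B_13\<close>, with the matrices as leg 1.
  The comultiplication of a corepresentation matrix can therefore be written as a matrix
  product.\<close>

lemma ent_leg12: "ent (mapm leg1 A ** mapm leg2 B) i j = (\<Sum>k\<in>cols A. ent A i k \<otimes> ent B k j)"
proof -
  have "ent (mapm leg1 A ** mapm leg2 B) i j = (\<Sum>k\<in>cols A. ent (mapm leg1 A) i k * ent (mapm leg2 B) k j)"
  by (rule ent_mm) (simp_all add: ent_mapm ent_cols)
  then show ?thesis by (simp add: ent_mapm tensor_times)
qed

text \<open>Contracting the two legs by \<open>f x * g y\<close> turns \<open>A_12 B_13\<close> into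
  an ordinary product. With the antipode on one leg, the antipode axioms become statements about
  matrix inverses.\<close>

lemma mapm_tensor_sum:
  assumes b: "cbilinear b" and B: "!!x y. b x y = f x * g y" and f: "lin f" and g: "lin g"
  shows "mapm (tensor_sum b) (mapm leg1 A ** mapm leg2 C) = mapm f A ** mapm g C"
proof (rule fmat_eqI)
  fix i j
  have "ent (mapm f A ** mapm g C) i j = (\<Sum>k\<in>cols A. ent (mapm f A) i k * ent (mapm g C) k j)"
  by (rule ent_mm) (simp_all add: ent_mapm lin_zero f ent_cols)
  then show "ent (mapm (tensor_sum b) (mapm leg1 A ** mapm leg2 C)) i j = ent (mapm f A ** mapm g C) i j"
  by (simp add: ent_mapm lin_zero lin_tensor_sum[OF b] ent_leg12 lin_sum tensor_sum_tensor[OF b] B f g)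
qed

section \<open>Corepresentation matrices\<close>

type_synonym ('i, 'a, 'x) qobj =
  "('i, 'i) cmat \<times> ('i, 'i, 'a) fmat \<times> ('x => ('i, 'i) cmat)"

abbreviation pr :: "('i, 'a, 'x) qobj => ('i, 'i) cmat" where "pr M \<equiv> fst M"
abbreviation cor :: "('i, 'a, 'x) qobj => ('i, 'i, 'a) fmat" where "cor M \<equiv> fst (snd M)"
abbreviation opr :: "('i, 'a, 'x) qobj => 'x => ('i, 'i) cmat" where "opr M \<equiv> snd (snd M)"

text \<open>All slices of the corepresentation matrix by linear functionals are adjoined to the
  operators, so an equivariant object becomes a plain operator family. Labels that are not linear
  are sent to 0 and are excluded by \<open>ix\<close>.\<close>

definition fam :: "('i, 'a::complex_star_algebra, 'x) qobj => ('i, ('a => complex) + 'x) sfam" where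
  "fam M = (pr M, %z. case z of Inl f => if lin f then mapm f (cor M) else 0 | Inr x => opr M x)"

abbreviation ix :: "'x set => (('a::complex_star_algebra => complex) + 'x) set" where
  "ix X \<equiv> Collect lin <+> X"

abbreviation QHom :: "'x set => ('i, 'a::complex_star_algebra, 'x) qobj => ('j, 'a, 'x) qobj => ('j, 'i) cmat set" where
  "QHom X M N \<equiv> Hom (ix X) (fam M) (fam N)"
abbreviation qdim :: "'x set => ('i, 'a::complex_star_algebra, 'x) qobj => ('j, 'a, 'x) qobj => nat" where
  "qdim X M N \<equiv> homdim (ix X) (fam M) (fam N)"
abbreviation qequiv :: "'x set => ('i, 'a::complex_star_algebra, 'x) qobj => ('j, 'a, 'x) qobj => bool" where
  "qequiv X M N \<equiv> equivf (ix X) (fam M) (fam N)"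
abbreviation qirr :: "'x set => ('i, 'a::complex_star_algebra, 'x) qobj => bool" where
  "qirr X M \<equiv> irr (ix X) (fam M)"
abbreviation qsplits :: "'x set => ('i, 'a::complex_star_algebra, 'x) qobj => 'f set => ('f => ('i, 'i) cmat) => bool" where
  "qsplits X M F p \<equiv> splits (ix X) (fam M) F p"

definition qsub :: "('i, 'i) cmat => ('i, 'a::complex_star_algebra, 'x) qobj => ('i, 'a, 'x) qobj" where
  "qsub p M = (p, sc p ** cor M, %x. p ** opr M x)"

text \<open>Operators act on the left factor only: objects with operators form a module category on
  which corepresentations act by tensoring from the right.\<close>

definition qtens :: "('i, 'a::complex_star_algebra, 'x) qobj => ('j, 'a, 'y) qobj => ('i \<times> 'j, 'a, 'x) qobj" where
  "qtens M N = (kr (pr M) (pr N), kr (cor M) (cor N), %x. kr (opr M x) (pr N))"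

definition qconj :: "('i, 'a::complex_star_algebra, 'x) qobj => ('i, 'a, 'x) qobj" where
  "qconj M = (cj (pr M), cj (cor M), %x. cj (opr M x))"

lemma qsub_simps [simp]: "pr (qsub p M) = p" "cor (qsub p M) = sc p ** cor M" "opr (qsub p M) x = p ** opr M x"
  and qtens_simps [simp]: "pr (qtens M N) = kr (pr M) (pr N)" "cor (qtens M N) = kr (cor M) (cor N)"
  "opr (qtens M N) x = kr (opr M x) (pr N)"
  and qconj_simps [simp]: "pr (qconj M) = cj (pr M)" "cor (qconj M) = cj (cor M)" "opr (qconj M) x = cj (opr M x)"
  and fam_simps [simp]: "fst (fam M) = pr M" "snd (fam M) (Inr x) = opr M x"
  by (simp_all add: qsub_def qtens_def qconj_def fam_def)

lemma fam_qsub: "fam (qsub p M) = sub p (fam M)"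
  by (auto simp: fam_def sub_def mapm_sc_mm fun_eq_iff split: sum.split)

lemma ball_Plus: "(\<forall>z\<in>A <+> B. R z) \<longleftrightarrow> (\<forall>a\<in>A. R (Inl a)) \<and> (\<forall>b\<in>B. R (Inr b))"
  by auto

text \<open>Commuting with every slice is the same as intertwining the corepresentation matrices,
  since functionals separate points.\<close>

lemma QHom_iff:
  fixes M :: "('i, 'a::complex_star_algebra, 'x) qobj" and N :: "('j, 'a, 'x) qobj"
  shows "T \<in> QHom X M N \<longleftrightarrow> pr N ** T = T \<and> T ** pr M = T \<and> sc T ** cor M = cor N ** sc T
   \<and> (\<forall>x\<in>X. T ** opr M x = opr N x ** T)"
proof -
  have "(\<forall>f. lin f \<longrightarrow> T ** mapm f (cor M) = mapm f (cor N) ** T) \<longleftrightarrow> sc T ** cor M = cor N ** sc T"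
  (is "?L \<longleftrightarrow> ?R")
  proof
  assume ?L
  show ?R
  proof (rule functional_fmat_ext)
   fix f :: "'a => complex" assume f: "lin f"
   with \<open>?L\<close> show "mapm f (sc T ** cor M) = mapm f (cor N ** sc T)"
    by (simp add: mapm_sc_mm[OF f] mapm_mm_sc[OF f])
  qed
  next
  assume ?R
  then show ?L by (metis mapm_sc_mm mapm_mm_sc sc_complex)
  qed
  then show ?thesis by (simp add: Hom_def fam_def ball_Plus)
qed

lemma qequivI:
  "U \<in> QHom X M N ==> U' \<in> QHom X N M ==> U' ** U = pr M ==> U ** U' = pr N ==> qequiv X M N"
  by (auto simp: equivf_def)

context discrete_quantum_group
begin

lemma lin_comult: "lin (comult G)" and lin_counit: "lin (counit G)"
  and lin_antipode: "lin (antipode G)" and lin_haar: "lin (haar G)"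
  using comult_linear counit_linear antipode_linear haar_linear by (simp_all add: lin_clinear_on)

text \<open>Matrix form of a coaction \<delta>(\<xi>) = v(\<xi> \<otimes> 1) on the range of
  \<open>P\<close>: coassociativity reads (id \<otimes> \<Delta>)v = v_12 v_13, and the counit
  evaluates \<open>v\<close> to the identity of that range.\<close>

definition corepm :: "('i, 'i) cmat => ('i, 'i, 'a) fmat => bool" where
  "corepm P v \<longleftrightarrow> proj P \<and> sc P ** v = v \<and> v ** sc P = v
   \<and> mapm (comult G) v = mapm leg1 v ** mapm leg2 v \<and> mapm (counit G) v = P"

definition ucorepm :: "('i, 'i) cmat => ('i, 'i, 'a) fmat => bool" where
  "ucorepm P u \<longleftrightarrow> corepm P u \<and> ad u ** u = sc P"

lemma corepmD:
  assumes "corepm P v"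
  shows "proj P" "sc P ** v = v" "v ** sc P = v" "mapm (comult G) v = mapm leg1 v ** mapm leg2 v"
  "mapm (counit G) v = P"
  using assms by (simp_all add: corepm_def)

lemma corepm_antipode:
  fixes v :: "('i, 'i, 'a) fmat"
  assumes "corepm P v"
  shows "mapm (antipode G) v ** v = sc P" "v ** mapm (antipode G) v = sc P"
proof -
  note S = lin_add[OF lin_antipode] lin_scale[OF lin_antipode]
  have b1: "cbilinear (%y z. antipode G y * z)" and b2: "cbilinear (%y z. y * antipode G z)"
  by (rule cbilinearI; simp add: S distrib_left distrib_right mult_scaleC_left mult_scaleC_right)+
  have lin_id: "lin (%x :: 'a. x)" by (simp add: lin_def)
  have id: "mapm (%x. x) A = A" for A :: "('x, 'y, 'a) fmat" by (rule fmat_eqI) (simp add: ent_mapm)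
  have P: "mapm (%x. counit G x *\<^sub>C 1) v = (sc P :: ('i, 'i, 'a) fmat)"
  using assms by (intro fmat_eqI) (auto simp: corepm_def ent_mapm lin_zero[OF lin_counit] ent_sc)
  have comp: "mapm f (mapm (comult G) v) = mapm (%x. f (comult G x)) v" if "lin f" for f :: "('a, 'a) tensor => 'a"
  using that by (intro fmat_eqI) (simp add: ent_mapm lin_zero lin_comult)
  have "mapm (antipode G) v ** v = mapm (tensor_sum (%y z. antipode G y * z)) (mapm (comult G) v)"
  using assms mapm_tensor_sum[OF b1 _ lin_antipode lin_id, of v v] by (simp add: corepm_def id)
  also have "... = sc P" by (simp add: comp[OF lin_tensor_sum[OF b1]] antipode_left P)
  finally show "mapm (antipode G) v ** v = sc P" .
  have "v ** mapm (antipode G) v = mapm (tensor_sum (%y z. y * antipode G z)) (mapm (comult G) v)"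
  using assms mapm_tensor_sum[OF b2 _ lin_id lin_antipode, of v v] by (simp add: corepm_def id)
  also have "... = sc P" by (simp add: comp[OF lin_tensor_sum[OF b2]] antipode_right P)
  finally show "v ** mapm (antipode G) v = sc P" .
qed

text \<open>The antipode supplies a two-sided inverse of \<open>u\<close>, so the isometry condition
  alone forces this inverse to be \<open>ad u\<close> and makes \<open>u\<close> unitary.\<close>

lemma ucorepm_antipode:
  assumes "ucorepm P u"
  shows "mapm (antipode G) u = ad u" "u ** ad u = sc P"
proof -
  have c: "corepm P u" and u: "ad u ** u = sc P" using assms by (simp_all add: ucorepm_def)
  have "sc P ** mapm (antipode G) u = mapm (antipode G) (sc P ** u)"
  by (rule mapm_sc_mm[OF lin_antipode, symmetric])
  then have PS: "sc P ** mapm (antipode G) u = mapm (antipode G) u" using c by (simp add: corepm_def)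
  have uP: "ad u ** sc P = ad u"
  using arg_cong[OF corepmD(2)[OF c], of ad] projD(1)[OF corepmD(1)[OF c]] by (simp add: ad_mm ad_sc)
  show 1: "mapm (antipode G) u = ad u"
  using PS u mm_assoc[of "ad u" u "mapm (antipode G) u"] corepm_antipode(2)[OF c] uP by simp
  show "u ** ad u = sc P" using corepm_antipode(2)[OF c] 1 by simp
qed

definition uobj :: "'x set => ('x => 'x) => ('i, 'a, 'x) qobj => bool" where
  "uobj X iv M \<longleftrightarrow> ucorepm (pr M) (cor M) \<and> star_family X iv (pr M, opr M)
   \<and> (\<forall>x. pr M ** opr M x = opr M x)"

text \<open>The adjoint of a slice is again a slice. With \<open>S\<close> the antipode, unitarity
  gives S(u_ij) = star(u_ji), so the conjugate of \<open>f(u_ji)\<close> is the value at u_ij of the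
  functional sending \<open>x\<close> to the conjugate of \<open>f(star (S x))\<close>.\<close>

definition ivq :: "('x => 'x) => ('a => complex) + 'x => ('a => complex) + 'x" where
  "ivq iv z = (case z of Inl f => Inl (%x. cnj (f (star (antipode G x)))) | Inr x => Inr (iv x))"

lemma uobjD:
  assumes "uobj X iv M"
  shows "proj (pr M)" "sc (pr M) ** cor M = cor M" "cor M ** sc (pr M) = cor M"
  "ad (cor M) ** cor M = sc (pr M)" "cor M ** ad (cor M) = sc (pr M)"
  "pr M ** opr M x = opr M x" "x \<in> X ==> opr M x ** pr M = opr M x"
  "corepm (pr M) (cor M)" "mapm (antipode G) (cor M) = ad (cor M)"
  using assms ucorepm_antipode[of "pr M" "cor M"]
  by (auto simp: uobj_def ucorepm_def star_family_def corepm_def)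

lemma star_family_fam:
  assumes "uobj X iv M"
  shows "star_family (ix X) (ivq iv) (fam M)"
proof -
  have X: "star_family X iv (pr M, opr M)" using assms by (simp add: uobj_def)
  have 1: "lin (%x. cnj (f (star (antipode G x))))" if f: "lin f" for f :: "'a => complex"
  by (rule linI) (simp_all add: lin_add[OF f] lin_scale[OF f] lin_add[OF lin_antipode]
    lin_scale[OF lin_antipode] star_add star_scaleC scaleC_complex_def)
  have 2: "ad (mapm f (cor M)) = mapm (%x. cnj (f (star (antipode G x)))) (cor M)" if f: "lin f" for f :: "'a => complex"
  proof (rule fmat_eqI)
  fix i j
  have "antipode G (ent (cor M) i j) = star (ent (cor M) j i)"
   using arg_cong[OF uobjD(9)[OF assms], of "%A. ent A i j"]
   by (simp add: ent_mapm lin_zero[OF lin_antipode] ent_ad)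
  then show "ent (ad (mapm f (cor M))) i j = ent (mapm (%x. cnj (f (star (antipode G x)))) (cor M)) i j"
   by (simp add: ent_ad ent_mapm lin_zero[OF f] lin_zero[OF 1[OF f]] star_star star_complex_def)
  qed
  have 3: "pr M ** mapm f (cor M) = mapm f (cor M)" "mapm f (cor M) ** pr M = mapm f (cor M)" if f: "lin f" for f :: "'a => complex"
  using mapm_sc_mm[OF f, of "pr M" "cor M"] mapm_mm_sc[OF f, of "cor M" "pr M"] uobjD[OF assms] by simp_all
  show ?thesis
  using X 1 2 3 unfolding star_family_def by (auto simp: fam_def ivq_def)
qed

text \<open>A projection that intertwines can be inserted between the two legs of v_12 v_13, so
  compression preserves the comultiplication rule.\<close>

lemma uobj_qsub:
  fixes M :: "('i, 'a, 'x) qobj"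
  assumes M: "uobj X iv M" and p: "proj p" "p \<in> QHom X M M"
  shows "uobj X iv (qsub p M)"
proof -
  note D = uobjD[OF M]
  have pM: "pr M ** p = p" "p ** pr M = p" "sc p ** cor M = cor M ** sc p"
  "!!x. x \<in> X ==> p ** opr M x = opr M x ** p"
  using p(2) by (simp_all add: QHom_iff)
  have pp: "sc p ** (sc p ** A) = sc p ** A" for A :: "('i, 'd, 'a) fmat"
  using projD(2)[OF p(1)] by (simp flip: mm_assoc sc_mm)
  have pp': "sc p ** sc p = (sc p :: ('i, 'i, 'a) fmat)"
  using projD(2)[OF p(1)] by (simp flip: sc_mm)
  have scp: "sc p ** cor M ** sc p = sc p ** cor M"
  using pM(3) pp' by (simp add: mm_assoc)
  have l1: "mapm f (sc p) = sc p" if "f = comult G \<or> f = leg1 \<or> f = leg2" for f :: "'a => ('a, 'a) tensor"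
  using that lin_comult lin_leg1 lin_leg2 comult_one by (intro mapm_sc) (auto simp: tensor_one)
  have "mapm (comult G) (sc p ** cor M) = sc p ** (mapm leg1 (cor M) ** mapm leg2 (cor M))"
  using corepmD(4)[OF D(8)] by (simp add: mapm_sc_mm lin_comult)
  also have "... = sc p ** mapm leg1 (sc p ** cor M) ** mapm leg2 (cor M)"
  using projD(2)[OF p(1)] by (simp add: mapm_sc_mm lin_leg1 flip: mm_assoc sc_mm)
  also have "... = mapm leg1 (sc p ** cor M) ** mapm leg2 (sc p ** cor M)"
  proof -
  have "sc p ** mapm leg1 (sc p ** cor M) = mapm leg1 (sc p ** (sc p ** cor M))"
   by (rule mapm_sc_mm[OF lin_leg1, symmetric])
  also have "... = mapm leg1 (sc p ** cor M ** sc p)" using scp by (simp add: mm_eq_assoc[OF pp'])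
  also have "... = mapm leg1 (sc p ** cor M) ** sc p" by (rule mapm_mm_sc[OF lin_leg1])
  finally show ?thesis by (simp add: mm_assoc mapm_sc_mm lin_leg2)
  qed
  finally have c: "mapm (comult G) (sc p ** cor M) = mapm leg1 (sc p ** cor M) ** mapm leg2 (sc p ** cor M)" .
  have e: "mapm (counit G) (sc p ** cor M) = p"
  using corepmD(5)[OF D(8)] pM(1,2) by (simp add: mapm_sc_mm lin_counit)
  have u: "ad (sc p ** cor M) ** (sc p ** cor M) = sc p"
  proof -
  have "ad (sc p ** cor M) ** (sc p ** cor M) = ad (cor M) ** (sc p ** cor M)"
   using projD(1)[OF p(1)] by (simp add: ad_mm ad_sc mm_assoc mm_eq_assoc[OF pp'])
  also have "... = sc p" using pM by (simp add: mm_eq_assoc[OF D(4)] flip: sc_mm)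
  finally show ?thesis .
  qed
  have "corepm p (sc p ** cor M)"
  unfolding corepm_def using p(1) pp scp c e by simp
  moreover have "star_family X iv (p, %x. p ** opr M x)"
  proof -
  have X: "star_family X iv (pr M, opr M)" using M by (simp add: uobj_def)
  have "p \<in> Hom X (pr M, opr M) (pr M, opr M)" using pM by (simp add: Hom_def)
  from star_family_sub[OF X p(1) this] show ?thesis by (simp add: sub_def)
  qed
  ultimately show ?thesis using u by (simp add: uobj_def ucorepm_def qsub_def projD[OF p(1)])
qed

end

section \<open>Tensor products of objects and their associativity\<close>

definition qre :: "('k => 'i) => ('i, 'a::complex_star_algebra, 'x) qobj => ('k, 'a, 'x) qobj" where
  "qre g M = (rr g (cr g (pr M)), rr g (cr g (cor M)), %x. rr g (cr g (opr M x)))"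

lemma qre_simps [simp]: "pr (qre g M) = rr g (cr g (pr M))" "cor (qre g M) = rr g (cr g (cor M))"
  "opr (qre g M) x = rr g (cr g (opr M x))"
  by (simp_all add: qre_def)

lemma lin_uminus: "lin f ==> f (- x) = - f x"
  using lin_scale[of f "-1" x] by simp

lemma cr_rr: "inj g ==> inj h ==> cr g (rr h A) = rr h (cr g A)"
  by (rule fmat_eqI) (simp add: ent_rr ent_cr)

lemma cols_sc: "cols (sc A :: ('i, 'j, 'c::complex_star_algebra) fmat) <= cols A"
proof
  fix j assume "j \<in> cols (sc A :: ('i, 'j, 'c) fmat)"
  then obtain i where "ent (sc A :: ('i, 'j, 'c) fmat) i j ~= 0" by (auto simp: cols_def ent_def in_keys_iff)
  then have "ent A i j ~= 0" by (auto simp: ent_sc)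
  then show "j \<in> cols A" using ent_cols by metis
qed

context discrete_quantum_group
begin

lemma comult_zero [simp]: "comult G 0 = 0" and counit_zero [simp]: "counit G 0 = 0"
  by (simp_all add: lin_zero lin_comult lin_counit)

text \<open>Corepresentation objects without unitarity. They arise as conjugates of unitary ones,
  which need not be unitary for the standard inner product.\<close>

definition cobj :: "'x set => ('i, 'a, 'x) qobj => bool" where
  "cobj X M \<longleftrightarrow> corepm (pr M) (cor M) \<and> (\<forall>x. pr M ** opr M x = opr M x)
   \<and> (\<forall>x\<in>X. opr M x ** pr M = opr M x)"

lemma cobjD:
  assumes "cobj X M"
  shows "corepm (pr M) (cor M)" "proj (pr M)" "sc (pr M) ** cor M = cor M" "cor M ** sc (pr M) = cor M"
  "pr M ** opr M x = opr M x" "x \<in> X ==> opr M x ** pr M = opr M x" "pr M ** pr M = pr M"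
  "ad (pr M) = pr M"
  using assms by (auto simp: cobj_def corepm_def proj_def)

lemma uobj_cobj: "uobj X iv M ==> cobj X M"
  using uobjD[of X iv M] by (auto simp: cobj_def)

lemma uobj_forget: "uobj X iv M ==> uobj {} jv M"
  by (simp add: uobj_def star_family_def)

lemma cobj_QHom_id: "cobj X M ==> pr M \<in> QHom X M M"
  using cobjD[of X M] by (simp add: QHom_iff)

lemma cobj_refl: "cobj X M ==> qequiv X M M"
  using cobj_QHom_id cobjD(7) by (intro qequivI)

lemma corepm_kr:
  assumes u: "corepm P u" and v: "corepm Q v"
  shows "corepm (kr P Q) (kr u v)"
proof -
  note U = corepmD[OF u] and V = corepmD[OF v]
  have "mapm (comult G) (kr u v) = kr (mapm leg1 u ** mapm leg2 u) (mapm leg1 v ** mapm leg2 v)"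
  using U(4) V(4) by (subst mapm_kr) (simp_all add: comult_mult)
  also have "... = kr (mapm leg1 u) (mapm leg1 v) ** kr (mapm leg2 u) (mapm leg2 v)"
  by (rule kr_mm[symmetric]) (simp add: ent_mapm tensor_times)
  also have "... = mapm leg1 (kr u v) ** mapm leg2 (kr u v)"
  by (simp add: mapm_kr tensor_times)
  finally have "mapm (comult G) (kr u v) = mapm leg1 (kr u v) ** mapm leg2 (kr u v)" .
  moreover have "mapm (counit G) (kr u v) = kr P Q"
  using U(5) V(5) by (subst mapm_kr) (simp_all add: counit_mult)
  moreover have "sc (kr P Q) ** kr u v = kr u v" "kr u v ** sc (kr P Q) = kr u v"
  using U V by (simp_all add: sc_kr kr_mm_sc1 kr_mm_sc2)
  ultimately show ?thesis using U V proj_kr by (simp add: corepm_def)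
qed

lemma ucorepm_kr:
  assumes u: "ucorepm P u" and v: "ucorepm Q v"
  shows "ucorepm (kr P Q) (kr u v)"
proof -
  have cu: "corepm P u" and cv: "corepm Q v" using u v by (simp_all add: ucorepm_def)
  note U = corepmD[OF cu] and V = corepmD[OF cv]
  have P: "sc P ** sc P = (sc P :: (_, _, 'a) fmat)" and Q: "sc Q ** sc Q = (sc Q :: (_, _, 'a) fmat)"
  using projD(2)[OF U(1)] projD(2)[OF V(1)] by (simp_all flip: sc_mm)
  have kuv: "kr u v = kr u (sc Q) ** kr (sc P) v" using U V by (simp add: kr_mm_sc1)
  have "ad (kr u v) ** kr u v = kr (sc P) (ad v) ** (kr (ad u) (sc Q) ** kr u (sc Q)) ** kr (sc P) v"
  unfolding kuv using projD(1)[OF U(1)] projD(1)[OF V(1)]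
  by (simp add: ad_mm ad_kr_sc1 ad_kr_sc2 mm_assoc)
  also have "kr (ad u) (sc Q) ** kr u (sc Q) = kr (sc P) (sc Q)"
  using u Q by (simp add: kr_mm_sc1 ucorepm_def)
  also have "kr (sc P) (ad v) ** kr (sc P) (sc Q) ** kr (sc P) v = kr (sc P) (ad v ** v)"
  using P V(2) by (simp add: kr_mm_sc1 kr_mm_sc2 mm_assoc)
  also have "... = sc (kr P Q)" using v by (simp add: ucorepm_def sc_kr)
  finally show ?thesis using corepm_kr[OF cu cv] by (simp add: ucorepm_def)
qed

lemma uobj_qtens:
  assumes M: "uobj X iv M" and N: "uobj Y jv N"
  shows "uobj X iv (qtens M N)"
proof -
  have X: "star_family X iv (pr M, opr M)" using M by (simp add: uobj_def)
  have N': "proj (pr N)" "pr N ** pr N = pr N" "ad (pr N) = pr N"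
  using uobjD(1)[OF N] by (simp_all add: proj_def)
  have "star_family X iv (kr (pr M) (pr N), %x. kr (opr M x) (pr N))"
  using X N' unfolding star_family_def by (auto simp: kr_mm_complex ad_kr_complex intro: proj_kr)
  then show ?thesis using ucorepm_kr[of "pr M" "cor M" "pr N" "cor N"] M N N'
  by (simp add: uobj_def qtens_def kr_mm_complex)
qed

lemma cobj_qtens: "cobj X M ==> cobj Y N ==> cobj X (qtens M N)"
  using cobjD(7)[of Y N] by (simp add: cobj_def corepm_kr kr_mm_complex)

lemma QHom_kr:
  assumes T: "T \<in> QHom X M M'" and S: "S \<in> QHom ({} :: 'y set) N (N' :: ('l, 'a, 'y) qobj)"
  shows "kr T S \<in> QHom X (qtens M N) (qtens M' N')"
  using T S unfolding QHom_iff
  by (simp add: sc_kr kr_mm_complex kr_mm_sc1 kr_mm_sc2)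

lemma qequiv_qtens:
  assumes "qequiv X M M'" "qequiv ({} :: 'y set) N (N' :: ('l, 'a, 'y) qobj)"
  shows "qequiv X (qtens M N) (qtens M' N')"
proof -
  obtain U U' where U: "U \<in> QHom X M M'" "U' \<in> QHom X M' M" "U' ** U = pr M" "U ** U' = pr M'"
  using assms(1) by (auto simp: equivf_def)
  obtain T T' where T: "T \<in> QHom {} N N'" "T' \<in> QHom {} N' N" "T' ** T = pr N" "T ** T' = pr N'"
  using assms(2) by (auto simp: equivf_def)
  show ?thesis
  by (rule qequivI[OF QHom_kr[OF U(1) T(1)] QHom_kr[OF U(2) T(2)]]) (simp_all add: kr_mm_complex U T)
qed

lemma qsub_qtens_left: "cobj Y N ==> qsub (kr p (pr N)) (qtens M N) = qtens (qsub p M) N"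
  using cobjD[of Y N] by (simp add: qsub_def qtens_def sc_kr kr_mm_sc1 kr_mm_complex)

lemma qsub_qtens_right: "cobj X M ==> p ** pr N = p ==> qsub (kr (pr M) p) (qtens M N) = qtens M (qsub p N)"
  using cobjD[of X M] by (simp add: qsub_def qtens_def sc_kr kr_mm_sc1 kr_mm_complex)

lemma qsplits_qtens_left:
  assumes M: "qsplits X M F p" and N: "cobj ({} :: 'y set) (N :: ('j, 'a, 'y) qobj)"
  shows "qsplits X (qtens M N) F (%i. kr (p i) (pr N))"
  using M cobjD(7,8)[OF N] unfolding splits_def
  by (simp add: kr_mm_complex ad_kr_complex QHom_kr[OF _ cobj_QHom_id[OF N]] flip: kr_sum_left)

lemma qsplits_qtens_right:
  assumes M: "cobj X M" and N: "qsplits ({} :: 'y set) (N :: ('j, 'a, 'y) qobj) F p"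
  shows "qsplits X (qtens M N) F (%i. kr (pr M) (p i))"
  using N cobjD(7,8)[OF M] unfolding splits_def
  by (simp add: kr_mm_complex ad_kr_complex QHom_kr[OF cobj_QHom_id[OF M]] flip: kr_sum_right)

lemma qequiv_qre:
  assumes M: "cobj X M" and g: "inj g" "cols (pr M) <= range g"
  shows "qequiv X M (qre g M)"
proof -
  note C = cobjD[OF M]
  have "cols (cor M) <= cols (sc (pr M) :: (_, _, 'a) fmat)"
  by (rule cols_subset_mm_proj[OF C(4)])
  also have "... <= cols (pr M)" by (rule cols_sc)
  also note g(2)
  finally have c1: "cols (cor M) <= range g" .
  have c2: "cols (opr M x) <= range g" if "x \<in> X" for x
  by (rule subset_trans[OF cols_subset_mm_proj[OF C(6)[OF that]] g(2)])
  have c3: "cols (sc (pr M) :: (_, _, 'a) fmat) <= range g"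
  by (rule subset_trans[OF cols_sc g(2)])
  note s = rr_mm[OF g(1)] mm_cr[OF g(1)] cr_rr_mm[OF g(1)] sc_rr[OF g(1)] sc_cr[OF g(1)]
  cr_rr[OF g(1) g(1)]
  show ?thesis
  proof (rule qequivI)
  show "rr g (pr M) \<in> QHom X M (qre g M)"
   using C c1 c2 g by (simp add: QHom_iff s)
  show "cr g (pr M) \<in> QHom X (qre g M) M"
   using C c3 g by (simp add: QHom_iff s)
  show "cr g (pr M) ** rr g (pr M) = pr M" "rr g (pr M) ** cr g (pr M) = pr (qre g M)"
   using C g by (simp_all add: s)
  qed
qed

lemma qequiv_qtens_assoc:
  assumes "cobj X M" "cobj Y N" "cobj Z K"
  shows "qequiv X (qtens (qtens M N) K) (qtens M (qtens N K))"
proof -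
  let ?g = "%(i, j, k). ((i, j), k)"
  have g: "inj ?g" by (auto simp: inj_def)
  have "qre ?g (qtens (qtens M N) K) = qtens M (qtens N K)"
  by (simp add: qre_def qtens_def kr_assoc_reindex)
  moreover have "qequiv X (qtens (qtens M N) K) (qre ?g (qtens (qtens M N) K))"
  proof (rule qequiv_qre[OF cobj_qtens[OF cobj_qtens[OF assms(1,2)] assms(3)] g])
  have "((i, j), k) \<in> range ?g" for i j k by (rule range_eqI[of _ _ "(i, j, k)"]) simp
  then show "cols (pr (qtens (qtens M N) K)) <= range ?g" by auto
  qed
  ultimately show ?thesis by simp
qed

section \<open>Unitarization\<close>

text \<open>Polarisation: positivity at \<open>x\<close> and at \<open>x + 1\<close> shows that
  \<open>haar G (star x) + haar G x\<close> is real, and the same statement for \<i>x yields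
  equality of the real parts.\<close>

lemma haar_star: "haar G (star x) = cnj (haar G x)"
proof -
  note h = lin_add[OF lin_haar] lin_scale[OF lin_haar]
  have 1: "Im (haar G (star x) + haar G x) = 0" for x
  proof -
  obtain r where "haar G (star (x + 1) * (x + 1)) = complex_of_real r" using haar_positive by blast
  moreover obtain s where "haar G (star x * x) = complex_of_real s" using haar_positive by blast
  ultimately have "complex_of_real s + haar G (star x) + haar G x + 1 = complex_of_real r"
   by (simp add: star_add distrib_left distrib_right h haar_one algebra_simps)
  from arg_cong[OF this, of Im] show ?thesis by simp
  qed
  have "Re (haar G (star x)) = Re (haar G x)"
  using 1[of "\<i> *\<^sub>C x"] by (simp add: star_scaleC h scaleC_complex_def lin_uminus[OF lin_haar])
  then show ?thesis using 1[of x] by (simp add: complex_eq_iff)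
qed

lemma mapm_haar_ad: "ad (mapm (haar G) A) = mapm (haar G) (ad A)"
  by (rule fmat_eqI) (simp add: ent_ad ent_mapm lin_zero lin_haar haar_star star_complex_def)

text \<open>The degenerate case of the Cauchy-Schwarz inequality: otherwise a suitable multiple of
  \<open>x\<close> added to \<open>star y\<close> would have negative squared norm.\<close>

lemma haar_null:
  assumes "haar G (star x * x) = 0"
  shows "haar G (y * x) = 0"
proof (rule ccontr)
  note h = lin_add[OF lin_haar] lin_scale[OF lin_haar]
  let ?y = "star y"
  assume z: "haar G (y * x) ~= 0"
  define z where "z = haar G (y * x)"
  have z': "haar G (star x * ?y) = cnj z"
  unfolding z_def by (simp add: star_mult star_star flip: haar_star)
  obtain r where r: "r \<ge> 0" "haar G (star ?y * ?y) = complex_of_real r" using haar_positive by blast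
  \<comment> \<open>With \<open>c * z = - (r + 1)\<close> the squared norm of
    \<open>c x + star y\<close> becomes \<open>- r - 2\<close>.\<close>
  define c where "c = - complex_of_real (r + 1) / z"
  have cz: "c * z = - complex_of_real (r + 1)" using z by (simp add: c_def z_def)
  obtain s where s: "s \<ge> 0" "haar G (star (c *\<^sub>C x + ?y) * (c *\<^sub>C x + ?y)) = complex_of_real s"
  using haar_positive by blast
  have "haar G (star (c *\<^sub>C x + ?y) * (c *\<^sub>C x + ?y)) = c * z + cnj c * cnj z + complex_of_real r"
  using assms r(2) z'
  by (simp add: star_add star_scaleC star_star distrib_left distrib_right h mult_scaleC_left
    mult_scaleC_right scaleC_complex_def z_def[symmetric])
  also have "... = - complex_of_real (r + 1) + cnj (- complex_of_real (r + 1)) + complex_of_real r"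
  by (simp only: cz flip: complex_cnj_mult)
  also have "... = complex_of_real (- r - 2)" by simp
  finally have "s = - r - 2" using s(2) by (simp only: of_real_eq_iff)
  then show False using r(1) s(1) by simp
qed

text \<open>Since \<Delta>(v) = v_12 v_13, conjugating the average by \<open>v\<close> amounts to
  applying the Haar state to the first leg of the comultiplication of
  \<open>ad v ** sc B ** v\<close>, and left invariance gives the average back.\<close>

lemma haar_average_invariant:
  assumes v: "corepm P v"
  shows "ad v ** sc (mapm (haar G) (ad v ** sc B ** v)) ** v = sc (mapm (haar G) (ad v ** sc B ** v))"
  (is "ad v ** sc ?Q ** v = sc ?Q")
proof -
  let ?M = "ad v ** sc B ** v"
  let ?b = "%y z. haar G y *\<^sub>C z"
  have b: "cbilinear ?b"
  by (rule cbilinearI) (simp_all add: lin_add[OF lin_haar] lin_scale[OF lin_haar] scaleC_add_left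
    scaleC_add_right scaleC_scaleC scaleC_complex_def mult.commute)
  have ads: "star (leg1 x) = leg1 (star x)" "star (leg2 x) = leg2 (star x)" for x :: 'a
  by (simp_all add: tensor_star)
  have sc1: "mapm leg1 (sc B) = (sc B :: (_, _, ('a, 'a) tensor) fmat)"
  "mapm (comult G) (sc B) = (sc B :: (_, _, ('a, 'a) tensor) fmat)"
  by (rule mapm_sc; simp add: lin_leg1 lin_comult tensor_one comult_one)+
  have "mapm (comult G) ?M = ad (mapm (comult G) v) ** sc B ** mapm (comult G) v"
  by (simp add: mapm_mm lin_comult comult_mult sc1 mapm_ad comult_star)
  also have "... = ad (mapm leg2 v) ** (ad (mapm leg1 v) ** sc B ** mapm leg1 v) ** mapm leg2 v"
  by (simp add: corepmD(4)[OF v] ad_mm mm_assoc)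
  also have "... = mapm leg2 (ad v) ** mapm leg1 ?M ** mapm leg2 v"
  by (simp add: mapm_ad lin_leg1 lin_leg2 ads mapm_mm tensor_times sc1)
  finally have D: "mapm (comult G) ?M = mapm leg2 (ad v) ** mapm leg1 ?M ** mapm leg2 v" .
  \<comment> \<open>Elements of different legs commute, so the middle factor alone is seen by the
    Haar state on the first leg.\<close>
  have F: "mapm (tensor_sum ?b) (mapm leg2 A ** mapm leg1 M ** mapm leg2 C) = A ** sc (mapm (haar G) M) ** C"
  for A M C
  proof (rule fmat_eqI)
  fix i j
  have "ent (mapm leg2 A ** mapm leg1 M ** mapm leg2 C) i j
    = (\<Sum>l\<in>cols M. ent (mapm leg2 A ** mapm leg1 M) i l * ent (mapm leg2 C) l j)"
   by (rule ent_mm) (simp_all add: ent_mm0 ent_mapm ent_cols)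
  also have "... = (\<Sum>l\<in>cols M. (\<Sum>k\<in>cols A. leg2 (ent A i k) * leg1 (ent M k l)) * leg2 (ent C l j))"
   by (intro sum.cong refl, subst ent_mm[of "cols A"]) (simp_all add: ent_mapm ent_cols)
  also have "... = (\<Sum>l\<in>cols M. \<Sum>k\<in>cols A. ent M k l \<otimes> (ent A i k * ent C l j))"
   by (simp add: sum_distrib_right tensor_times)
  finally have 1: "ent (mapm leg2 A ** mapm leg1 M ** mapm leg2 C) i j
    = (\<Sum>l\<in>cols M. \<Sum>k\<in>cols A. ent M k l \<otimes> (ent A i k * ent C l j))" .
  have "ent (A ** sc (mapm (haar G) M) ** C) i j
    = (\<Sum>l\<in>cols M. ent (A ** sc (mapm (haar G) M)) i l * ent C l j)"
   by (rule ent_mm) (simp_all add: ent_mm0 ent_sc ent_mapm lin_zero lin_haar ent_cols)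
  also have "... = (\<Sum>l\<in>cols M. \<Sum>k\<in>cols A. haar G (ent M k l) *\<^sub>C (ent A i k * ent C l j))"
   by (simp add: ent_mm0 ent_sc ent_mapm lin_zero lin_haar sum_distrib_right mult_scaleC_right mult_scaleC_left)
  finally show "ent (mapm (tensor_sum ?b) (mapm leg2 A ** mapm leg1 M ** mapm leg2 C)) i j
    = ent (A ** sc (mapm (haar G) M) ** C) i j"
   by (simp add: ent_mapm lin_zero[OF lin_tensor_sum[OF b]] 1 lin_sum[OF lin_tensor_sum[OF b]]
     tensor_sum_tensor[OF b])
  qed
  have "ad v ** sc ?Q ** v = mapm (tensor_sum ?b) (mapm (comult G) ?M)"
  unfolding D F ..
  also have "... = sc ?Q"
  by (rule fmat_eqI) (simp add: ent_mapm lin_zero lin_haar lin_tensor_sum[OF b] lin_comult ent_sc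
    haar_left_invariant)
  finally show ?thesis .
qed

lemma haar_average_hermitian: "ad B = B ==> ad (mapm (haar G) (ad v ** sc B ** v)) = mapm (haar G) (ad v ** sc B ** v)"
proof -
  assume "ad B = B"
  then have *: "ad (ad v ** sc B ** v) = ad v ** sc B ** v" by (simp add: ad_mm ad_sc mm_assoc)
  then show ?thesis by (simp add: mapm_haar_ad)
qed

text \<open>Faithfulness of the Haar state is not among the axioms. The form at \<open>w\<close> is
  the sum of the squared norms of the entries of the column \<open>x\<close>; if all vanish,
  \<open>haar_null\<close> annihilates every left multiple of these entries, in particular those of
  \<open>Y ** x = sc w\<close>, where \<open>Y\<close> is built from the antipode, which inverts
  \<open>v\<close>.\<close>

lemma haar_average_definite:
  fixes w :: "('i, unit) cmat"
  assumes v: "corepm P v" and t: "t' ** t = P" and w: "P ** w = w" "w ~= 0"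
  shows "Re (ent (ad w ** mapm (haar G) (ad v ** sc (ad t ** t) ** v) ** w) () ()) > 0"
proof -
  define x where "x = sc t ** v ** sc w"
  have "mapm (haar G) (ad x ** x) = ad w ** mapm (haar G) (ad v ** sc (ad t ** t) ** v) ** w"
  proof -
  have "ad x ** x = sc (ad w) ** (ad v ** sc (ad t ** t) ** v) ** sc w"
   by (simp add: x_def ad_mm ad_sc sc_mm mm_assoc)
  then show ?thesis by (simp only: mapm_sc_mm mapm_mm_sc lin_haar) simp
  qed
  then have Q: "ent (ad w ** mapm (haar G) (ad v ** sc (ad t ** t) ** v) ** w) () ()
   = haar G (ent (ad x ** x) () ())"
  by (metis ent_mapm lin_haar lin_zero)
  have "ent (ad x ** x) () () = (\<Sum>k\<in>rows x. ent (ad x) () k * ent x k ())"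
  by (rule ent_mm) (simp_all add: ent_rows)
  then have Qs: "haar G (ent (ad x ** x) () ()) = (\<Sum>k\<in>rows x. haar G (star (ent x k ()) * ent x k ()))"
  by (simp add: ent_ad lin_sum lin_haar)
  have "\<exists>r. r \<ge> 0 \<and> haar G (star (ent x k ()) * ent x k ()) = complex_of_real r" for k
  by (rule haar_positive)
  then obtain r where r: "!!k. r k \<ge> 0" "!!k. haar G (star (ent x k ()) * ent x k ()) = complex_of_real (r k)"
  by metis
  have Qr: "Re (haar G (ent (ad x ** x) () ())) = (\<Sum>k\<in>rows x. r k)" by (simp add: Qs r(2))
  have "(\<Sum>k\<in>rows x. r k) ~= 0"
  proof
  assume "(\<Sum>k\<in>rows x. r k) = 0"
  then have "\<forall>k\<in>rows x. r k = 0" using r(1) by (simp add: sum_nonneg_eq_0_iff)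
  then have "haar G (star (ent x k ()) * ent x k ()) = 0" for k
   by (cases "k \<in> rows x") (simp_all add: r(2) ent_rows lin_zero lin_haar)
  then have null: "haar G (y * ent x k ()) = 0" for y k by (rule haar_null)
  define Y where "Y = mapm (antipode G) v ** sc t'"
  have "mapm (haar G) (Y ** x) = 0"
   by (rule fmat_eqI) (simp add: ent_mapm lin_zero lin_haar ent_mm0 lin_sum null)
  moreover have "Y ** x = sc w"
  proof -
   have "Y ** x = mapm (antipode G) v ** (sc (t' ** t) ** v) ** sc w"
    by (simp add: Y_def x_def mm_assoc sc_mm)
   also have "... = sc (P ** w)"
    using corepm_antipode(1)[OF v] by (simp add: t corepmD[OF v] sc_mm)
   finally show ?thesis by (simp add: w)
  qed
  moreover have "mapm (haar G) (sc w) = w"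
   using mapm_sc[OF lin_haar haar_one, of w] by simp
  ultimately show False using w(2) by simp
  qed
  then show ?thesis using Q Qr r(1) by (simp add: less_le sum_nonneg)
qed

lemma corepm_similar:
  assumes v: "corepm P v" and V: "V ** V' = P" "V' ** V = P'" "proj P'" "P' ** V' = V'" "V ** P' = V"
  shows "corepm P' (sc V' ** v ** sc V)"
proof -
  let ?u = "sc V' ** v ** sc V"
  have "mapm (comult G) ?u = sc V' ** mapm leg1 v ** mapm leg2 v ** sc V"
  by (simp add: mapm_sc_mm mapm_mm_sc lin_comult corepmD(4)[OF v] mm_assoc)
  also have "... = sc V' ** mapm leg1 (v ** sc (V ** V')) ** mapm leg2 v ** sc V"
  using corepmD(3)[OF v] by (simp add: V(1))
  also have "... = mapm leg1 ?u ** mapm leg2 ?u"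
  by (simp only: mapm_mm_sc lin_leg1) (simp add: mapm_sc_mm mapm_mm_sc lin_leg1 lin_leg2 sc_mm mm_assoc)
  finally have "mapm (comult G) ?u = mapm leg1 ?u ** mapm leg2 ?u" .
  moreover have "mapm (counit G) ?u = P'"
  proof -
  have "mapm (counit G) ?u = V' ** P ** V"
   using corepmD(5)[OF v] by (simp add: mapm_sc_mm mapm_mm_sc lin_counit)
  also have "... = (V' ** V) ** (V' ** V)" by (simp add: V(1)[symmetric] mm_assoc)
  finally show ?thesis using V(2) projD(2)[OF V(3)] by simp
  qed
  moreover have "sc P' ** ?u = ?u" "?u ** sc P' = ?u"
  proof -
  have e: "sc P' ** sc V' = (sc V' :: (_, _, 'a) fmat)" "sc V ** sc P' = (sc V :: (_, _, 'a) fmat)"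
   using V(4,5) by (simp_all flip: sc_mm)
  show "sc P' ** ?u = ?u" "?u ** sc P' = ?u" by (simp_all add: mm_assoc mm_eq_assoc[OF e(1)] e(2))
  qed
  ultimately show ?thesis using V(3) by (simp add: corepm_def)
qed

text \<open>The averaged form \<open>Q\<close> is an invariant inner product on the range of
  \<open>P\<close>. The columns of \<open>V\<close> are orthonormal for it, so
  \<open>ad V ** Q\<close> inverts \<open>V\<close> and the matrix of \<open>v\<close> in this basis
  is unitary. The starting form \<open>ad t ** t\<close> is left free: \<open>t = P\<close> serves
  an arbitrary corepresentation, while the regular representation brings its own form.\<close>

lemma unitarize:
  fixes v :: "('i, 'i, 'a) fmat"
  assumes v: "corepm P v" and t: "t' ** t = P"
  defines "Q \<equiv> mapm (haar G) (ad v ** sc (ad t ** t) ** v)"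
  obtains n and V :: "('i, nat) cmat" where "V ** (ad V ** Q) = P" "(ad V ** Q) ** V = idm {..<n}"
  "P ** V = V" "V ** idm {..<n} = V" "idm {..<n} ** (ad V ** Q) = ad V ** Q"
  "ucorepm (idm {..<n}) (sc (ad V ** Q) ** v ** sc V)" "ad Q = Q" "Q ** P = Q"
proof -
  let ?W = "{w :: ('i, unit) cmat. P ** w = w}"
  have P: "proj P" by (rule corepmD(1)[OF v])
  have W: "csubspace ?W" by (simp add: complex_vector.subspace_def mm_linear)
  have supp: "idm (rows P) ** w = w" if "w \<in> ?W" for w
  using that mm_eq_assoc[OF rows_idm[of P], of w] by simp
  have Qh: "ad Q = Q" unfolding Q_def by (rule haar_average_hermitian) (simp add: ad_mm)
  have QP: "Q ** P = Q"
  unfolding Q_def by (simp add: mm_assoc corepmD(3)[OF v] flip: mapm_mm_sc[OF lin_haar, of _ P, simplified])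
  obtain n and V :: "('i, nat) cmat" where V: "ad V ** Q ** V = idm {..<n}"
  "V ** idm {..<n} = V" "!!x. V ** x \<in> ?W" "!!w. w \<in> ?W ==> V ** (ad V ** Q ** w) = w"
  proof (rule gram_schmidt[OF finite_rows[of P] W _ Qh])
  show "idm (rows P) ** w = w" if "w \<in> ?W" for w using supp that by blast
  show "Re (ent (ad w ** Q ** w) () ()) > 0" if "w \<in> ?W" "w ~= 0" for w
   unfolding Q_def using haar_average_definite[OF v t _ that(2)] that(1) by simp
  qed blast+
  have PV: "P ** V = V" by (rule column_ext) (use V(3) in \<open>simp add: mm_assoc\<close>)
  have "V ** (ad V ** Q) ** P = P"
  proof (rule column_ext)
  fix w :: "('i, unit) cmat"
  have "P ** w \<in> ?W" by (simp add: projD[OF P])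
  from V(4)[OF this] show "V ** (ad V ** Q) ** P ** w = P ** w" by (simp add: mm_assoc)
  qed
  then have VV: "V ** (ad V ** Q) = P" by (simp add: mm_assoc QP)
  have V4: "idm {..<n} ** (ad V ** Q) = ad V ** Q"
  using arg_cong[OF V(2), of ad] by (simp add: ad_mm flip: mm_assoc)
  let ?u = "sc (ad V ** Q) ** v ** sc V"
  have c: "corepm (idm {..<n}) ?u"
  by (rule corepm_similar[OF v VV V(1)]) (simp_all add: V4 V(2))
  have QQ: "Q ** V ** (ad V ** Q) = Q" using VV QP by (simp add: mm_assoc)
  have "ad ?u ** ?u = sc (ad V) ** (ad v ** sc (Q ** V ** (ad V ** Q)) ** v) ** sc V"
  by (simp add: ad_mm ad_sc Qh sc_mm mm_assoc)
  also have "ad v ** sc (Q ** V ** (ad V ** Q)) ** v = sc Q"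
  unfolding QQ unfolding Q_def by (rule haar_average_invariant[OF v])
  also have "sc (ad V) ** sc Q ** sc V = (sc (idm {..<n}) :: (nat, nat, 'a) fmat)"
  using V(1) by (simp flip: sc_mm)
  finally have "ucorepm (idm {..<n}) ?u" using c by (simp add: ucorepm_def)
  then show thesis using that VV V(1,2) PV V4 Qh QP by blast
qed

lemma unitary_equivalent:
  fixes M :: "('i, 'a, 'x) qobj"
  assumes M: "corepm (pr M) (cor M)"
  obtains n and N :: "(nat, 'a, 'x) qobj" where "uobj {} iv N" "pr N = idm {..<n}" "qequiv {} M N"
proof -
  obtain n and V :: "('i, nat) cmat" and Q where V: "V ** (ad V ** Q) = pr M"
  "(ad V ** Q) ** V = idm {..<n}" "pr M ** V = V" "V ** idm {..<n} = V"
  "idm {..<n} ** (ad V ** Q) = ad V ** Q" "Q ** pr M = Q"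
  "ucorepm (idm {..<n}) (sc (ad V ** Q) ** cor M ** sc V)"
  using unitarize[OF M, of "pr M" "pr M"] projD(2)[OF corepmD(1)[OF M]] by blast
  let ?V' = "ad V ** Q"
  let ?N = "(idm {..<n}, sc ?V' ** cor M ** sc V, %_ :: 'x. 0) :: (nat, 'a, 'x) qobj"
  have N: "uobj {} iv ?N" using V(7) by (simp add: uobj_def star_family_def)
  have "qequiv {} M ?N"
  proof (rule qequivI)
  have *: "sc V ** (sc ?V' ** cor M) = cor M" "cor M ** (sc V ** sc ?V') = cor M"
   using corepmD(2,3)[OF M] V(1) by (simp_all flip: sc_mm mm_assoc)
  show "?V' \<in> QHom {} M ?N" using V(5,6) * by (simp add: QHom_iff mm_assoc)
  show "V \<in> QHom {} ?N M" using V(3,4) * by (simp add: QHom_iff flip: mm_assoc)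
  qed (use V in simp_all)
  then show thesis using that N by (metis fst_conv)
qed

end

section \<open>Duality\<close>

text \<open>Frobenius reciprocity as pure reindexing: an index of the source is moved to the target.
  \<open>bendr\<close> moves the right tensor factor of the source, \<open>bendl\<close> the left
  one.\<close>

definition bendr :: "('i, 'j \<times> 'k, 'c::zero) fmat => ('i \<times> 'k, 'j, 'c) fmat" where
  "bendr = Poly_Mapping.map_key (%((i, k), j). (i, (j, k)))"
definition unbendr :: "('i \<times> 'k, 'j, 'c::zero) fmat => ('i, 'j \<times> 'k, 'c) fmat" where
  "unbendr = Poly_Mapping.map_key (%(i, (j, k)). ((i, k), j))"
definition bendl :: "('i, 'j \<times> 'k, 'c::zero) fmat => ('j \<times> 'i, 'k, 'c) fmat" where
  "bendl = Poly_Mapping.map_key (%((j, i), k). (i, (j, k)))"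
definition unbendl :: "('j \<times> 'i, 'k, 'c::zero) fmat => ('i, 'j \<times> 'k, 'c) fmat" where
  "unbendl = Poly_Mapping.map_key (%(i, (j, k)). ((j, i), k))"

lemma inj_bend: "inj (%((i, k), j). (i, (j, k)))" "inj (%(i, (j, k)). ((i, k), j))"
  "inj (%((j, i), k). (i, (j, k)))" "inj (%(i, (j, k)). ((j, i), k))"
  by (auto simp: inj_def)

lemma ent_bendr: "ent (bendr T) (i, k) j = ent T i (j, k)"
  by (simp add: ent_def bendr_def map_key.rep_eq inj_bend)

lemma ent_unbendr: "ent (unbendr T) i (j, k) = ent T (i, k) j"
  by (simp add: ent_def unbendr_def map_key.rep_eq inj_bend)

lemma ent_bendl: "ent (bendl T) (j, i) k = ent T i (j, k)"
  by (simp add: ent_def bendl_def map_key.rep_eq inj_bend)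

lemma ent_unbendl: "ent (unbendl T) i (j, k) = ent T (j, i) k"
  by (simp add: ent_def unbendl_def map_key.rep_eq inj_bend)

lemma bend_inverse [simp]: "unbendr (bendr T) = T" "bendr (unbendr T') = T'"
  "unbendl (bendl S) = S" "bendl (unbendl S') = S'"
  by (rule fmat_eqI, auto simp: ent_bendr ent_unbendr ent_bendl ent_unbendl split: prod.splits)+

lemma bendr_inject: "bendr A = bendr B \<longleftrightarrow> A = B" and bendl_inject: "bendl C = bendl D \<longleftrightarrow> C = D"
  by (metis bend_inverse(1), metis bend_inverse(3))

lemma lin_bendr: "lin (bendr :: ('i, 'j \<times> 'k) cmat => _)"
  and lin_bendl: "lin (bendl :: ('i, 'j \<times> 'k) cmat => _)"
  by (rule linI; rule fmat_eqI; auto simp: ent_bendr ent_bendl ent_add ent_scaleC)+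

lemma ent_sc_mm_kr:
  assumes "fst ` cols T <= J" "snd ` cols T <= K" "finite J" "finite K"
  shows "ent (sc T ** kr c d) i (j, k)
  = (\<Sum>j'\<in>J. \<Sum>k'\<in>K. ent T i (j', k') *\<^sub>C (ent c j' j * ent d k' k))"
proof -
  have "ent (sc T ** kr c d) i (j, k) = (\<Sum>x\<in>J \<times> K. ent (sc T) i x * ent (kr c d) x (j, k))"
  proof (rule ent_mm)
  fix x assume "x \<notin> J \<times> K"
  then have "x \<notin> cols T" using assms(1,2) by (cases x) force
  then show "ent (sc T) i x * ent (kr c d) x (j, k) = 0" by (simp add: ent_sc ent_cols)
  qed (use assms in simp)
  also have "... = (\<Sum>x\<in>J \<times> K. case x of (j', k') => ent T i (j', k') *\<^sub>C (ent c j' j * ent d k' k))"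
  by (rule sum.cong) (auto simp: ent_sc ent_kr mult_scaleC_left)
  finally show ?thesis by (simp add: sum.cartesian_product)
qed

lemma bendr_mm_right:
  fixes T :: "('i, 'j \<times> 'k) cmat" and c :: "('j, 'l, 'c::complex_star_algebra) fmat"
  assumes K: "snd ` cols T <= K" "finite K"
  shows "bendr (sc T ** kr c (idm K)) = sc (bendr T) ** c"
proof (rule fmat_eqI, clarify)
  fix i k j
  let ?J = "fst ` cols T"
  have "ent (bendr (sc T ** kr c (idm K))) (i, k) j
   = (\<Sum>j'\<in>?J. \<Sum>k'\<in>K. ent T i (j', k') *\<^sub>C (ent c j' j * ent (idm K) k' k))"
  unfolding ent_bendr by (rule ent_sc_mm_kr) (use K in auto)
  also have "... = (\<Sum>j'\<in>?J. \<Sum>k'\<in>K. if k = k' then ent T i (j', k) *\<^sub>C ent c j' j else 0)"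
  by (intro sum.cong refl) (auto simp: ent_idm K)
  also have "... = (\<Sum>j'\<in>?J. ent T i (j', k) *\<^sub>C ent c j' j)"
  proof (rule sum.cong[OF refl])
  fix j'
  have "ent T i (j', k) = 0" if "k \<notin> K" using that K(1) by (intro ent_cols) force
  then show "(\<Sum>k'\<in>K. if k = k' then ent T i (j', k) *\<^sub>C ent c j' j else 0) = ent T i (j', k) *\<^sub>C ent c j' j"
   using K(2) by auto
  qed
  also have "... = (\<Sum>j'\<in>?J. ent (sc (bendr T)) (i, k) j' * ent c j' j)"
  by (simp add: ent_sc ent_bendr mult_scaleC_left)
  also have "... = ent (sc (bendr T) ** c) (i, k) j"
  proof (rule ent_mm[symmetric])
  fix j' assume "j' \<notin> ?J"
  then have "ent T i (j', k) = 0" by (intro ent_cols) force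
  then show "ent (sc (bendr T)) (i, k) j' * ent c j' j = 0" by (simp add: ent_sc ent_bendr)
  qed simp
  finally show "ent (bendr (sc T ** kr c (idm K))) (i, k) j = ent (sc (bendr T) ** c) (i, k) j" .
qed

text \<open>A factor acting on the bent leg comes out transposed on the other side, so
  \<open>ad a\<close> before bending is the entrywise conjugate \<open>cj a\<close> after it. This
  is where conjugate corepresentations come from.\<close>

lemma bendr_mm_left:
  fixes T :: "('i, 'j \<times> 'k) cmat" and a :: "('l, 'k, 'c::complex_star_algebra) fmat"
  assumes J: "fst ` cols T <= J" "finite J"
  shows "bendr (b ** (sc T ** kr (idm J) (ad a))) = kr b (cj a) ** sc (bendr T)"
proof (rule fmat_eqI, clarify)
  fix i k j
  let ?K = "snd ` cols T"
  have 1: "ent (sc T ** kr (idm J) (ad a)) i' (j, k) = (\<Sum>k'\<in>?K. ent T i' (j, k') *\<^sub>C star (ent a k k'))" for i'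
  proof -
  have "ent (sc T ** kr (idm J) (ad a)) i' (j, k)
    = (\<Sum>j'\<in>J. \<Sum>k'\<in>?K. ent T i' (j', k') *\<^sub>C (ent (idm J) j' j * ent (ad a) k' k))"
   by (rule ent_sc_mm_kr) (use J in auto)
  also have "... = (\<Sum>j'\<in>J. if j = j' then (\<Sum>k'\<in>?K. ent T i' (j, k') *\<^sub>C star (ent a k k')) else 0)"
   by (rule sum.cong) (auto simp: ent_idm J ent_ad)
  also have "... = (\<Sum>k'\<in>?K. ent T i' (j, k') *\<^sub>C star (ent a k k'))"
  proof -
   have "ent T i' (j, k') = 0" if "j \<notin> J" for k' using that J(1) by (intro ent_cols) force
   then show ?thesis using J(2) by auto
  qed
  finally show ?thesis .
  qed
  have "ent (bendr (b ** (sc T ** kr (idm J) (ad a)))) (i, k) j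
   = (\<Sum>i'\<in>cols b. \<Sum>k'\<in>?K. ent T i' (j, k') *\<^sub>C (ent b i i' * star (ent a k k')))"
  by (simp add: ent_bendr ent_mm0[of b] 1 sum_distrib_left mult_scaleC_right)
  also have "... = (\<Sum>x\<in>cols b \<times> ?K. ent (kr b (cj a)) (i, k) x * ent (sc (bendr T)) x j)"
  unfolding sum.cartesian_product
  by (rule sum.cong) (auto simp: ent_kr ent_cj ent_sc ent_bendr mult_scaleC_right)
  also have "... = ent (kr b (cj a) ** sc (bendr T)) (i, k) j"
  proof (rule ent_mm[symmetric])
  fix x assume x: "x \<notin> cols b \<times> ?K"
  obtain i' k' where x': "x = (i', k')" by (cases x)
  show "ent (kr b (cj a)) (i, k) x * ent (sc (bendr T)) x j = 0"
  proof (cases "i' \<in> cols b")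
   case True
   then have "(j, k') \<notin> cols T" using x x' by force
   then show ?thesis by (simp add: x' ent_sc ent_bendr ent_cols)
  qed (simp add: x' ent_kr ent_cols)
  qed simp
  finally show "ent (bendr (b ** (sc T ** kr (idm J) (ad a)))) (i, k) j
   = ent (kr b (cj a) ** sc (bendr T)) (i, k) j" .
qed

lemma bendl_mm_right:
  fixes T :: "('i, 'j \<times> 'k) cmat" and a :: "('j, 'l, 'c::complex_star_algebra) fmat"
  assumes I: "rows T <= I" "finite I"
  shows "bendl (sc T ** kr (cj a) m) = kr (ad a) (idm I) ** (sc (bendl T) ** m)"
proof (rule fmat_eqI, clarify)
  fix j i k
  let ?J = "fst ` cols T" and ?K = "snd ` cols T"
  have 1: "ent (sc (bendl T) ** m) (j', i) k = (\<Sum>k'\<in>?K. ent T i (j', k') *\<^sub>C ent m k' k)" for j'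
  proof -
  have "ent (sc (bendl T) ** m) (j', i) k = (\<Sum>k'\<in>?K. ent (sc (bendl T)) (j', i) k' * ent m k' k)"
  proof (rule ent_mm)
   fix k' assume "k' \<notin> ?K"
   then have "ent T i (j', k') = 0" by (intro ent_cols) force
   then show "ent (sc (bendl T)) (j', i) k' * ent m k' k = 0" by (simp add: ent_sc ent_bendl)
  qed simp
  then show ?thesis by (simp add: ent_sc ent_bendl mult_scaleC_left)
  qed
  have 2: "ent (sc (bendl T) ** m) (j', i') k = 0" if "i' \<notin> I \<or> j' \<notin> ?J" for i' j'
  proof -
  have "ent (sc (bendl T) :: (_, _, 'c) fmat) (j', i') k' = 0" for k'
  proof (cases "i' \<in> I")
   case True
   then have "(j', k') \<notin> cols T" using that by force
   then show ?thesis by (simp add: ent_sc ent_bendl ent_cols)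
  next
   case False
   then have "i' \<notin> rows T" using I by blast
   then show ?thesis by (simp add: ent_sc ent_bendl ent_rows)
  qed
  then show ?thesis by (simp add: ent_mm0)
  qed
  have "ent (bendl (sc T ** kr (cj a) m)) (j, i) k
   = (\<Sum>j'\<in>?J. \<Sum>k'\<in>?K. ent T i (j', k') *\<^sub>C (ent (cj a) j' j * ent m k' k))"
  unfolding ent_bendl by (rule ent_sc_mm_kr) auto
  also have "... = (\<Sum>j'\<in>?J. star (ent a j' j) * ent (sc (bendl T) ** m) (j', i) k)"
  by (simp add: 1 sum_distrib_left mult_scaleC_right ent_cj)
  also have "... = (\<Sum>j'\<in>?J. \<Sum>i'\<in>I. if i = i' then star (ent a j' j) * ent (sc (bendl T) ** m) (j', i) k else 0)"
  by (rule sum.cong) (use I(2) 2 in auto)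
  also have "... = (\<Sum>x\<in>?J \<times> I. ent (kr (ad a) (idm I)) (j, i) x * ent (sc (bendl T) ** m) x k)"
  unfolding sum.cartesian_product
  by (rule sum.cong) (auto simp: ent_kr ent_ad ent_idm I)
  also have "... = ent (kr (ad a) (idm I) ** (sc (bendl T) ** m)) (j, i) k"
  proof (rule ent_mm[symmetric])
  fix x assume "x \<notin> ?J \<times> I"
  then show "ent (kr (ad a) (idm I)) (j, i) x * ent (sc (bendl T) ** m) x k = 0"
   using 2[of "snd x" "fst x"] by (cases x) auto
  qed (use I in simp)
  finally show "ent (bendl (sc T ** kr (cj a) m)) (j, i) k = ent (kr (ad a) (idm I) ** (sc (bendl T) ** m)) (j, i) k" .
qed

lemma bendl_mm_left:
  fixes T :: "('i, 'j \<times> 'k) cmat" and n :: "('l, 'i, 'c::complex_star_algebra) fmat"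
  assumes J: "fst ` cols T <= J" "finite J"
  shows "bendl (n ** sc T) = kr (idm J) n ** sc (bendl T)"
proof (rule fmat_eqI, clarify)
  fix j i k
  have 0: "ent T i' (j, k) = 0" if "j \<notin> J" for i' using that J(1) by (intro ent_cols) force
  have "ent (kr (idm J) n ** sc (bendl T)) (j, i) k
   = (\<Sum>x\<in>J \<times> cols n. ent (kr (idm J) n) (j, i) x * ent (sc (bendl T)) x k)"
  proof (rule ent_mm)
  fix x assume x: "x \<notin> J \<times> cols n"
  then show "ent (kr (idm J) n) (j, i) x * ent (sc (bendl T)) x k = 0"
   using J(2) by (cases x; cases "fst x \<in> J") (auto simp: ent_kr ent_cols ent_idm)
  qed (use J in simp)
  also have "... = (\<Sum>j'\<in>J. \<Sum>i'\<in>cols n. if j = j' then ent n i i' * (ent T i' (j, k) *\<^sub>C 1) else 0)"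
  unfolding sum.cartesian_product
  by (rule sum.cong) (auto simp: ent_kr ent_idm J ent_sc ent_bendl)
  also have "... = (\<Sum>j'\<in>J. if j = j' then \<Sum>i'\<in>cols n. ent n i i' * (ent T i' (j, k) *\<^sub>C 1) else 0)"
  by (rule sum.cong) auto
  also have "... = (\<Sum>i'\<in>cols n. ent n i i' * (ent T i' (j, k) *\<^sub>C 1))"
  using 0 J(2) by auto
  also have "... = ent (bendl (n ** sc T)) (j, i) k" by (simp add: ent_bendl ent_mm0 ent_sc)
  finally show "ent (bendl (n ** sc T)) (j, i) k = ent (kr (idm J) n ** sc (bendl T)) (j, i) k" by simp
qed

lemma idm_mm_absorb: "finite S ==> rows A <= S ==> idm S ** A = A"
  by (auto simp: idm_mm_iff intro: ent_rows)

lemma mm_idm_absorb: "finite S ==> cols A <= S ==> A ** idm S = A"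
  by (auto simp: mm_idm_iff intro: ent_cols)

lemma idm_mm_sc_absorb: "finite S ==> rows A <= S ==> idm S ** sc A = sc A"
  by (auto simp: idm_mm_iff ent_sc intro: ent_rows)

lemma mm_sc_idm_absorb: "finite S ==> cols A <= S ==> sc A ** idm S = sc A"
  by (auto simp: mm_idm_iff ent_sc intro: ent_cols)

lemma mm_absorb_right: "T ** A = T ==> A ** B = A ==> T ** B = T"
  by (metis mm_assoc)

lemma mm_absorb_left: "A ** T = T ==> B ** A = A ==> B ** T = T"
  by (metis mm_assoc)

lemma mm_kr_idm_absorb:
  assumes "fst ` cols T <= J" "snd ` cols T <= K" "finite J" "finite K"
  shows "T ** kr (idm J) (idm K) = T"
proof -
  have "cols T <= J \<times> K" using assms(1,2) by force
  then show ?thesis by (simp add: kr_idm assms(3,4) mm_idm_absorb)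
qed

context discrete_quantum_group
begin

text \<open>Unitarity of \<open>A\<close> allows \<open>cor A\<close> to be moved to the other side
  of the intertwining relation as its adjoint, and bending turns the adjoint into the conjugate. The
  operators sit on the left factor, which stays in place.\<close>

lemma QHom_bendr:
  fixes C :: "('j, 'a, 'x) qobj" and B :: "('i, 'a, 'x) qobj" and A :: "('k, 'a, 'y) qobj"
  assumes C: "cobj X C" and B: "cobj X B" and A: "uobj ({} :: 'y set) iv A"
  shows "T \<in> QHom X (qtens C A) B \<longleftrightarrow> bendr T \<in> QHom X C (qtens B (qconj A))"
proof -
  note C' = cobjD[OF C] and B' = cobjD[OF B] and A' = uobjD[OF A]
  have Pa: "pr A ** pr A = pr A" "ad (pr A) = pr A" using projD[OF A'(1)] by simp_all
  \<comment> \<open>\<open>J\<close> and \<open>K\<close> are chosen large enough for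
    \<open>idm J\<close> and \<open>idm K\<close> to act as identities wherever they meet the
    matrices below.\<close>
  define J where "J = fst ` cols T \<union> rows (pr C) \<union> cols (pr C) \<union> rows (cor C) \<union> (rows (cor C))"
  define K where "K = snd ` cols T \<union> rows (pr A) \<union> cols (pr A) \<union> rows (cor A) \<union> cols (cor A)"
  have J: "finite J" "fst ` cols T <= J" "rows (pr C) <= J" "cols (pr C) <= J" "rows (cor C) <= J" by (auto simp: J_def)
  have K: "finite K" "snd ` cols T <= K" "rows (pr A) <= K" "cols (pr A) <= K" "rows (cor A) <= K"
  "cols (cor A) <= K"
  by (auto simp: K_def)
  let ?J = "idm J :: ('j, 'j) cmat" and ?K = "idm K :: ('k, 'k) cmat"
  let ?JH = "idm J :: ('j, 'j, 'a) fmat" and ?KH = "idm K :: ('k, 'k, 'a) fmat"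
  have idC: "?J ** pr C = pr C" "pr C ** ?J = pr C" "?JH ** cor C = cor C"
  using J by (simp_all add: idm_mm_absorb mm_idm_absorb)
  have idA: "?K ** pr A = pr A" "pr A ** ?K = pr A" "?KH ** cor A = cor A" "cor A ** ?KH = cor A"
  "?KH ** sc (pr A) = sc (pr A)" "sc (pr A) ** ?KH = sc (pr A)"
  using K by (simp_all add: idm_mm_absorb mm_idm_absorb idm_mm_sc_absorb mm_sc_idm_absorb)
  have TJK: "T ** kr ?J ?K = T" by (rule mm_kr_idm_absorb) (use J K in auto)
  have e1: "bendr (T ** kr (pr C) ?K) = bendr T ** pr C"
  using bendr_mm_right[OF K(2,1), of "pr C"] by simp
  have e2: "bendr (pr B ** (T ** kr ?J (pr A))) = kr (pr B) (cj (pr A)) ** bendr T"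
  using bendr_mm_left[OF J(2,1), of "pr B" "pr A"] by (simp add: Pa)
  have proj_iff: "pr B ** T = T \<and> T ** kr (pr C) (pr A) = T
   \<longleftrightarrow> kr (pr B) (cj (pr A)) ** bendr T = bendr T \<and> bendr T ** pr C = bendr T"
  unfolding e1[symmetric] e2[symmetric] bendr_inject
  proof
  assume h: "pr B ** T = T \<and> T ** kr (pr C) (pr A) = T"
  have "T ** kr ?J (pr A) = T"
   by (rule mm_absorb_right[of _ "kr (pr C) (pr A)"]) (use h idC Pa in \<open>simp_all add: kr_mm_complex\<close>)
  moreover have "T ** kr (pr C) ?K = T"
   by (rule mm_absorb_right[of _ "kr (pr C) (pr A)"]) (use h idA C'(7) in \<open>simp_all add: kr_mm_complex\<close>)
  ultimately show "pr B ** (T ** kr ?J (pr A)) = T \<and> T ** kr (pr C) ?K = T" using h by simp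
  next
  assume h: "pr B ** (T ** kr ?J (pr A)) = T \<and> T ** kr (pr C) ?K = T"
  have "pr B ** (pr B ** (T ** kr ?J (pr A))) = pr B ** (T ** kr ?J (pr A))"
   using B'(7) by (simp flip: mm_assoc)
  then have 1: "pr B ** T = T" using h by simp
  have "(pr B ** (T ** kr ?J (pr A))) ** kr ?J (pr A) = pr B ** (T ** kr ?J (pr A))"
   using Pa J(1) by (simp add: mm_assoc kr_mm_complex)
  then have 2: "T ** kr ?J (pr A) = T" using h by simp
  have "T ** kr (pr C) (pr A) = T ** kr (pr C) ?K ** kr ?J (pr A)"
   using idC idA by (simp add: mm_assoc kr_mm_complex)
  then show "pr B ** T = T \<and> T ** kr (pr C) (pr A) = T" using 1 2 h by simp
  qed
  have cor_iff: "sc T ** kr (cor C) (cor A) = cor B ** sc T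
   \<longleftrightarrow> sc (bendr T) ** cor C = kr (cor B) (cj (cor A)) ** sc (bendr T)"
  and opr_iff: "x \<in> X ==> T ** kr (opr C x) (pr A) = opr B x ** T
   \<longleftrightarrow> bendr T ** opr C x = kr (opr B x) (cj (pr A)) ** bendr T"
  if h: "T ** kr (pr C) (pr A) = T" for x
  proof -
  have TA: "T ** kr ?J (pr A) = T"
   by (rule mm_absorb_right[of _ "kr (pr C) (pr A)"]) (use h idC Pa in \<open>simp_all add: kr_mm_complex\<close>)
  have TA': "sc T ** kr ?JH (sc (pr A)) = sc T"
   using arg_cong[OF TA, of sc] J(1) by (simp add: sc_mm sc_kr)
  have f: "bendr (sc T ** kr (cor C) ?KH) = sc (bendr T) ** cor C"
   "bendr (cor B ** (sc T ** kr ?JH (ad (cor A)))) = kr (cor B) (cj (cor A)) ** sc (bendr T)"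
   using bendr_mm_right[OF K(2,1)] bendr_mm_left[OF J(2,1)] by blast+
  have K': "kr u ?KH ** kr v w = kr (u ** v) (?KH ** w)" for u v :: "('j, 'j, 'a) fmat" and w :: "('k, 'k, 'a) fmat"
   using kr_mm_sc1[of u ?K v w] K(1) by simp
  have J': "kr v w ** kr ?JH u = kr (v ** ?JH) (w ** u)" for v :: "('j, 'j, 'a) fmat" and u w :: "('k, 'k, 'a) fmat"
   using kr_mm_sc2[of v w ?J u] J(1) by simp
  have TcA: "sc T ** kr (cor C) (sc (pr A)) = sc T ** kr (cor C) ?KH"
  proof -
   have "sc T ** kr (cor C) ?KH = sc T ** (kr ?JH (sc (pr A)) ** kr (cor C) ?KH)"
    using TA' by (simp flip: mm_assoc)
   then show ?thesis using idC idA by (simp add: kr_mm_sc1)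
  qed
  have corJ: "cor C ** ?JH = cor C"
  proof -
   have "cor C ** ?JH = cor C ** (sc (pr C) ** sc ?J)" using C'(4) J(1) by (simp flip: mm_assoc)
   then show ?thesis using idC C'(4) by (simp flip: sc_mm)
  qed
  show "sc T ** kr (cor C) (cor A) = cor B ** sc T
   \<longleftrightarrow> sc (bendr T) ** cor C = kr (cor B) (cj (cor A)) ** sc (bendr T)"
   unfolding f[symmetric] bendr_inject
  proof
   assume e: "sc T ** kr (cor C) (cor A) = cor B ** sc T"
   have "sc T ** kr (cor C) ?KH = sc T ** kr (cor C) (sc (pr A))" by (simp add: TcA)
   also have "... = (sc T ** kr (cor C) (cor A)) ** kr ?JH (ad (cor A))"
    using A'(5) corJ by (simp add: mm_assoc J')
   finally show "sc T ** kr (cor C) ?KH = cor B ** (sc T ** kr ?JH (ad (cor A)))"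
    by (simp add: e mm_assoc)
  next
   assume e: "sc T ** kr (cor C) ?KH = cor B ** (sc T ** kr ?JH (ad (cor A)))"
   have "sc T ** kr (cor C) (cor A) = (sc T ** kr (cor C) ?KH) ** kr ?JH (cor A)"
    using idA corJ by (simp add: mm_assoc K')
   also have "... = cor B ** (sc T ** kr ?JH (sc (pr A)))"
    using A'(4) J(1) by (simp add: e mm_assoc J')
   finally show "sc T ** kr (cor C) (cor A) = cor B ** sc T" by (simp add: TA')
  qed
  assume x: "x \<in> X"
  have e1': "bendr (T ** kr (opr C x) ?K) = bendr T ** opr C x"
   using bendr_mm_right[OF K(2,1), of "opr C x"] by simp
  have e2': "bendr (opr B x ** (T ** kr ?J (pr A))) = kr (opr B x) (cj (pr A)) ** bendr T"
   using bendr_mm_left[OF J(2,1), of "opr B x" "pr A"] by (simp add: Pa)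
  have "T ** kr (opr C x) ?K = T ** kr (pr C) (pr A) ** kr (opr C x) ?K" using h by simp
  also have "... = T ** (kr (pr C) (pr A) ** kr (opr C x) (pr A))"
   using idA Pa by (simp add: mm_assoc kr_mm_complex)
  also have "... = T ** kr (opr C x) (pr A)" using h by (simp flip: mm_assoc)
  finally have "T ** kr (opr C x) ?K = T ** kr (opr C x) (pr A)" .
  then show "T ** kr (opr C x) (pr A) = opr B x ** T
   \<longleftrightarrow> bendr T ** opr C x = kr (opr B x) (cj (pr A)) ** bendr T"
   unfolding e1'[symmetric] e2'[symmetric] bendr_inject TA by simp
  qed
  show ?thesis
  unfolding QHom_iff using proj_iff cor_iff opr_iff by auto
qed

lemma qdim_bendr:
  fixes C :: "('j, 'a, 'x) qobj" and B :: "('i, 'a, 'x) qobj" and A :: "('k, 'a, 'y) qobj"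
  assumes C: "cobj X C" and B: "cobj X B" and A: "uobj ({} :: 'y set) iv A"
  shows "qdim X C (qtens B (qconj A)) = qdim X (qtens C A) B"
  unfolding homdim_def
  by (rule cdim_bij[where f = bendr and g = unbendr])
  (auto simp: lin_bendr Hom_subspace QHom_bendr[OF assms])

text \<open>The left factor is the one on which operators act, so it is bent only for bare
  corepresentations; hence the empty label set.\<close>

lemma QHom_bendl:
  fixes M :: "('k, 'a, 'x) qobj" and N :: "('i, 'a, 'x) qobj" and A :: "('j, 'a, 'x) qobj"
  assumes M: "cobj ({} :: 'x set) M" and N: "cobj ({} :: 'x set) N" and A: "uobj ({} :: 'x set) iv A"
  shows "T \<in> QHom {} (qtens (qconj A) M) N \<longleftrightarrow> bendl T \<in> QHom {} M (qtens A N)"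
proof -
  note M' = cobjD[OF M] and N' = cobjD[OF N] and A' = uobjD[OF A]
  have Pa: "pr A ** pr A = pr A" "ad (pr A) = pr A" using projD[OF A'(1)] by simp_all
  define J where "J = fst ` cols T \<union> rows (pr A) \<union> cols (pr A) \<union> rows (cor A) \<union> cols (cor A)"
  define I where "I = rows T \<union> rows (pr N) \<union> cols (pr N) \<union> rows (cor N) \<union> cols (cor N)"
  have J: "finite J" "fst ` cols T <= J" "rows (pr A) <= J" "cols (pr A) <= J" "rows (cor A) <= J" "cols (cor A) <= J"
  by (auto simp: J_def)
  have I: "finite I" "rows T <= I" "rows (pr N) <= I" "cols (pr N) <= I" "rows (cor N) <= I" "cols (cor N) <= I"
  by (auto simp: I_def)
  let ?J = "idm J :: ('j, 'j) cmat" and ?I = "idm I :: ('i, 'i) cmat"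
  let ?JH = "idm J :: ('j, 'j, 'a) fmat" and ?IH = "idm I :: ('i, 'i, 'a) fmat"
  let ?T = "bendl T"
  have idA: "?J ** pr A = pr A" "pr A ** ?J = pr A" "?JH ** cor A = cor A" "cor A ** ?JH = cor A"
  "sc (pr A) ** ?JH = sc (pr A)" "?JH ** sc (pr A) = sc (pr A)"
  using J by (simp_all add: idm_mm_absorb mm_idm_absorb idm_mm_sc_absorb mm_sc_idm_absorb)
  have idN: "?I ** pr N = pr N" "pr N ** ?I = pr N" "?IH ** cor N = cor N" "cor N ** ?IH = cor N"
  using I by (simp_all add: idm_mm_absorb mm_idm_absorb)
  have f1: "bendl (T ** kr (cj (pr A)) (pr M)) = kr (pr A) ?I ** (?T ** pr M)"
  using bendl_mm_right[OF I(2,1), of "pr A" "pr M"] by (simp add: Pa)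
  have f2: "bendl (pr N ** T) = kr ?J (pr N) ** ?T"
  using bendl_mm_left[OF J(2,1), of "pr N"] by simp
  have proj_iff: "pr N ** T = T \<and> T ** kr (cj (pr A)) (pr M) = T
   \<longleftrightarrow> kr (pr A) (pr N) ** ?T = ?T \<and> ?T ** pr M = ?T" (is "?l \<longleftrightarrow> ?r")
  proof -
  have "?l \<longleftrightarrow> kr ?J (pr N) ** ?T = ?T \<and> kr (pr A) ?I ** (?T ** pr M) = ?T"
   by (simp only: f1[symmetric] f2[symmetric] bendl_inject)
  also have "... \<longleftrightarrow> ?r"
  proof
   assume h: "kr ?J (pr N) ** ?T = ?T \<and> kr (pr A) ?I ** (?T ** pr M) = ?T"
   have "kr (pr A) ?I ** (kr (pr A) ?I ** (?T ** pr M)) = kr (pr A) ?I ** (?T ** pr M)"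
    using Pa I(1) by (simp add: kr_mm_complex flip: mm_assoc)
   then have 1: "kr (pr A) ?I ** ?T = ?T" using h by simp
   have "kr (pr A) ?I ** (?T ** pr M) ** pr M = kr (pr A) ?I ** (?T ** pr M)"
    using M'(7) by (simp add: mm_assoc)
   then have 2: "?T ** pr M = ?T" using h by simp
   have "kr (pr A) (pr N) ** ?T = kr (pr A) ?I ** (kr ?J (pr N) ** ?T)"
    using idA idN by (simp add: kr_mm_complex flip: mm_assoc)
   then show ?r using 1 2 h by simp
  next
   assume h: ?r
   have 1: "kr ?J (pr N) ** ?T = ?T"
    by (rule mm_absorb_left[of "kr (pr A) (pr N)"]) (use h idA N'(7) in \<open>simp_all add: kr_mm_complex\<close>)
   have "kr (pr A) ?I ** ?T = ?T"
    by (rule mm_absorb_left[of "kr (pr A) (pr N)"]) (use h idN Pa in \<open>simp_all add: kr_mm_complex\<close>)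
   with 1 h show "kr ?J (pr N) ** ?T = ?T \<and> kr (pr A) ?I ** (?T ** pr M) = ?T" by simp
  qed
  finally show ?thesis .
  qed
  have cor_iff: "sc T ** kr (cj (cor A)) (cor M) = cor N ** sc T
   \<longleftrightarrow> sc ?T ** cor M = kr (cor A) (cor N) ** sc ?T"
  if h: "kr (pr A) (pr N) ** ?T = ?T"
  proof -
  have "kr (pr A) ?I ** ?T = ?T"
   by (rule mm_absorb_left[of "kr (pr A) (pr N)"]) (use h idN Pa in \<open>simp_all add: kr_mm_complex\<close>)
  from arg_cong[OF this, of sc] have TA: "kr (sc (pr A)) ?IH ** sc ?T = sc ?T"
   using I(1) by (simp add: sc_mm sc_kr)
  have f: "bendl (sc T ** kr (cj (cor A)) (cor M)) = kr (ad (cor A)) ?IH ** (sc ?T ** cor M)"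
   "bendl (cor N ** sc T) = kr ?JH (cor N) ** sc ?T"
   using bendl_mm_right[OF I(2,1)] bendl_mm_left[OF J(2,1)] by blast+
  have I': "kr u ?IH ** kr v w = kr (u ** v) (?IH ** w)" for u v :: "('j, 'j, 'a) fmat" and w :: "('i, 'i, 'a) fmat"
   using kr_mm_sc1[of u ?I v w] I(1) by simp
  have "sc T ** kr (cj (cor A)) (cor M) = cor N ** sc T
    \<longleftrightarrow> kr (ad (cor A)) ?IH ** (sc ?T ** cor M) = kr ?JH (cor N) ** sc ?T"
   by (simp only: f[symmetric] bendl_inject)
  also have "... \<longleftrightarrow> sc ?T ** cor M = kr (cor A) (cor N) ** sc ?T"
  proof
   assume e: "kr (ad (cor A)) ?IH ** (sc ?T ** cor M) = kr ?JH (cor N) ** sc ?T"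
   have "sc ?T ** cor M = kr (sc (pr A)) ?IH ** (sc ?T ** cor M)"
    using TA by (simp flip: mm_assoc)
   also have "... = kr (cor A) ?IH ** (kr (ad (cor A)) ?IH ** (sc ?T ** cor M))"
    using A'(5) I(1) by (simp add: I' flip: mm_assoc)
   also have "... = kr (cor A) (cor N) ** sc ?T"
    unfolding e using idA idN by (simp add: I' flip: mm_assoc)
   finally show "sc ?T ** cor M = kr (cor A) (cor N) ** sc ?T" .
  next
   assume e: "sc ?T ** cor M = kr (cor A) (cor N) ** sc ?T"
   have "kr (ad (cor A)) ?IH ** (sc ?T ** cor M) = kr (sc (pr A)) (cor N) ** sc ?T"
    unfolding e using A'(4) idN by (simp add: I' flip: mm_assoc)
   also have "... = kr ?JH (cor N) ** (kr (sc (pr A)) ?IH ** sc ?T)"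
    using idA idN by (simp add: kr_mm_sc2 flip: mm_assoc)
   finally show "kr (ad (cor A)) ?IH ** (sc ?T ** cor M) = kr ?JH (cor N) ** sc ?T" by (simp add: TA)
  qed
  finally show ?thesis .
  qed
  show ?thesis unfolding QHom_iff using proj_iff cor_iff by auto
qed

lemma qdim_bendl:
  fixes M :: "('k, 'a, 'x) qobj" and N :: "('i, 'a, 'x) qobj" and A :: "('j, 'a, 'x) qobj"
  assumes M: "cobj ({} :: 'x set) M" and N: "cobj ({} :: 'x set) N" and A: "uobj ({} :: 'x set) iv A"
  shows "qdim ({} :: 'x set) M (qtens A N) = qdim {} (qtens (qconj A) M) N"
  unfolding homdim_def
  by (rule cdim_bij[where f = bendl and g = unbendl])
  (auto simp: lin_bendl Hom_subspace QHom_bendl[OF assms])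

lemma cobj_qconj:
  assumes "uobj {} iv A"
  shows "cobj {} (qconj A)"
proof -
  note A' = uobjD[OF assms]
  note c = corepmD[OF A'(8)]
  have "mapm (comult G) (cj (cor A)) = cj (mapm (comult G) (cor A))"
  by (rule fmat_eqI) (simp add: ent_cj ent_mapm comult_star)
  also have "... = cj (mapm leg1 (cor A)) ** cj (mapm leg2 (cor A))"
  unfolding c(4) by (rule cj_mm) (simp add: ent_mapm tensor_times)
  also have "cj (mapm leg1 (cor A)) = mapm leg1 (cj (cor A))"
  by (rule fmat_eqI) (simp add: ent_cj ent_mapm tensor_star)
  also have "cj (mapm leg2 (cor A)) = mapm leg2 (cj (cor A))"
  by (rule fmat_eqI) (simp add: ent_cj ent_mapm tensor_star)
  finally have 1: "mapm (comult G) (cj (cor A)) = mapm leg1 (cj (cor A)) ** mapm leg2 (cj (cor A))" .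
  \<comment> \<open>Compatibility of the counit with \<open>star\<close> on these entries follows
    from \<open>ad u ** u = sc P\<close> and multiplicativity of the counit.\<close>
  have 2: "mapm (counit G) (ad (cor A)) = pr A"
  proof -
  have "sc (pr A) = (ad (cor A) ** cor A)" using A'(4) by simp
  then have "mapm (counit G) (sc (pr A)) = mapm (counit G) (ad (cor A)) ** mapm (counit G) (cor A)"
   by (simp add: mapm_mm lin_counit counit_mult)
  moreover have "mapm (counit G) (sc (pr A)) = pr A"
   using mapm_sc[OF lin_counit counit_one, of "pr A"] by simp
  moreover have "mapm (counit G) (ad (cor A)) ** pr A = mapm (counit G) (ad (cor A) ** sc (pr A))"
   using mapm_mm_sc[OF lin_counit, of "ad (cor A)" "pr A"] by simp
  moreover have "ad (cor A) ** sc (pr A) = ad (cor A)"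
   using arg_cong[OF A'(2), of ad] projD[OF A'(1)] by (simp add: ad_mm ad_sc)
  ultimately show ?thesis using c(5) by simp
  qed
  have 3: "mapm (counit G) (cj (cor A)) = cj (pr A)"
  proof (rule fmat_eqI)
  fix i j
  have "ent (mapm (counit G) (cj (cor A))) i j = ent (mapm (counit G) (ad (cor A))) j i"
   by (simp add: ent_mapm ent_cj ent_ad)
  also have "... = ent (ad (pr A)) j i" using projD[OF A'(1)] by (simp add: 2)
  finally show "ent (mapm (counit G) (cj (cor A))) i j = ent (cj (pr A)) i j"
   by (simp add: ent_ad ent_cj)
  qed
  have "sc (cj (pr A)) ** cj (cor A) = cj (cor A)" "cj (cor A) ** sc (cj (pr A)) = cj (cor A)"
  using A'(2,3) by (simp_all flip: cj_mm_sc1 cj_mm_sc2)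
  moreover have "cj (pr A) ** cj (opr A x) = cj (opr A x)" for x
  using A'(6)[of x] by (simp flip: cj_mm_complex)
  ultimately show ?thesis using proj_cj[OF A'(1)] 1 3 by (simp add: cobj_def corepm_def)
qed

lemma qequiv_qconj:
  assumes "qequiv ({} :: 'x set) (M :: ('i, 'a, 'x) qobj) (N :: ('j, 'a, 'x) qobj)"
  shows "qequiv ({} :: 'x set) (qconj M) (qconj N)"
proof -
  obtain U U' where U: "U \<in> QHom {} M N" "U' \<in> QHom {} N M" "U' ** U = pr M" "U ** U' = pr N"
  using assms by (auto simp: equivf_def)
  show ?thesis
  proof (rule qequivI[of "cj U" _ _ _ "cj U'"])
  show "cj U \<in> QHom {} (qconj M) (qconj N)" "cj U' \<in> QHom {} (qconj N) (qconj M)"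
   using U(1,2) by (simp_all add: QHom_iff flip: cj_mm_complex cj_mm_sc1 cj_mm_sc2)
  qed (simp_all add: U(3,4) flip: cj_mm_complex)
qed

section \<open>Counting irreducible constituents\<close>

definition transversal :: "'x set => ('x => 'x) => 'k set => ('k => ('i, 'a, 'x) qobj) => bool" where
  "transversal X iv I V \<longleftrightarrow> (\<forall>a\<in>I. uobj X iv (V a) \<and> qirr X (V a))
   \<and> (\<forall>a\<in>I. \<forall>b\<in>I. qequiv X (V a) (V b) \<longrightarrow> a = b)"

lemma transversalD:
  assumes "transversal X iv I V" "a \<in> I"
  shows "uobj X iv (V a)" "qirr X (V a)" "b \<in> I ==> qequiv X (V a) (V b) ==> a = b"
  "star_family (ix X) (ivq iv) (fam (V a))" "cobj X (V a)"
  using assms by (auto simp: transversal_def intro: star_family_fam uobj_cobj)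

lemma qdim_transversal:
  assumes "transversal X iv I V" "a \<in> I" "b \<in> I"
  shows "qdim X (V a) (V b) = (if a = b then 1 else 0)"
  using homdim_irr[of "ix X" "ivq iv" "fam (V a)" "fam (V b)"] transversalD[OF assms(1)] assms(2,3)
  equivf_refl by metis

text \<open>A sum over irreducible summands whose terms depend only on the class is regrouped by
  class; each class occurs as often as its multiplicity says.\<close>

lemma class_sum:
  assumes T: "transversal X iv I V" and M: "uobj X iv M" and F: "qsplits X M F p"
  and irrF: "!!i. i \<in> F ==> irr (ix X) (sub (p i) (fam M))"
  and cov: "!!i. i \<in> F ==> \<exists>a\<in>I. qequiv X (V a) (qsub (p i) M)"
  and h: "!!i a. i \<in> F ==> a \<in> I ==> qequiv X (V a) (qsub (p i) M) ==> h i = (g a :: nat)"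
  shows "(\<Sum>i\<in>F. h i) = (\<Sum>a | a \<in> I \<and> qdim X (V a) M ~= 0. qdim X (V a) M * g a)"
proof -
  note F' = splitsD[OF F]
  have Mi: "star_family (ix X) (ivq iv) (sub (p i) (fam M))" if "i \<in> F" for i
  using star_family_sub[OF star_family_fam[OF M]] F' that by blast
  have "\<forall>i\<in>F. \<exists>a. a \<in> I \<and> qequiv X (V a) (qsub (p i) M)" using cov by blast
  from bchoice[OF this] obtain c where c: "!!i. i \<in> F ==> c i \<in> I"
  "!!i. i \<in> F ==> qequiv X (V (c i)) (qsub (p i) M)" by blast
  have ceq: "c i = a \<longleftrightarrow> qequiv X (V a) (qsub (p i) M)" if "i \<in> F" "a \<in> I" for i a
  using transversalD(3)[OF T c(1)[OF that(1)] that(2)] equivf_trans[OF c(2)[OF that(1)] equivf_sym] c(2)[OF that(1)]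
  by metis
  have dim: "qdim X (V a) M = card {i \<in> F. c i = a}" if a: "a \<in> I" for a
  proof -
  have "qdim X (V a) M = card {i \<in> F. Hom (ix X) (fam (V a)) (sub (p i) (fam M)) ~= {0}}"
   by (rule homdim_splits_irr[OF transversalD(4,2)[OF T a] star_family_fam[OF M] F irrF])
  also have "{i \<in> F. Hom (ix X) (fam (V a)) (sub (p i) (fam M)) ~= {0}} = {i \<in> F. c i = a}"
   using irr_equivf_iff[OF transversalD(4,2)[OF T a] Mi irrF] ceq a by (auto simp: fam_qsub)
  finally show ?thesis .
  qed
  have im: "{a. a \<in> I \<and> qdim X (V a) M ~= 0} = c ` F"
  using c(1) F'(1) by (auto simp: dim card_gt_0_iff)
  have "(\<Sum>i\<in>F. h i) = (\<Sum>i\<in>F. g (c i))" using h c by (intro sum.cong) auto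
  also have "... = (\<Sum>a\<in>c ` F. \<Sum>i | i \<in> F \<and> c i = a. g (c i))"
  by (rule sum.image_gen[OF F'(1)])
  also have "... = (\<Sum>a\<in>c ` F. qdim X (V a) M * g a)"
  proof (rule sum.cong[OF refl])
  fix a assume "a \<in> c ` F"
  then have "a \<in> I" using c by blast
  have "(\<Sum>i | i \<in> F \<and> c i = a. g (c i)) = (\<Sum>i | i \<in> F \<and> c i = a. g a)" by (rule sum.cong) auto
  then show "(\<Sum>i | i \<in> F \<and> c i = a. g (c i)) = qdim X (V a) M * g a"
   using dim[OF \<open>a \<in> I\<close>] by simp
  qed
  finally show ?thesis unfolding im .
qed

text \<open>Distinct classes of constituents are matched with distinct summands of one finite
  decomposition.\<close>

lemma finite_constituents:
  assumes T: "transversal X iv I V" and M: "uobj X iv M"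
  shows "finite {a \<in> I. qdim X (V a) M ~= 0}"
proof -
  obtain F where F: "qsplits X M F (%p. p)" "!!p. p \<in> F ==> irr (ix X) (sub p (fam M))"
  using complete_reducibility[OF star_family_fam[OF M]] by blast
  note F' = splitsD[OF F(1)]
  have Mp: "star_family (ix X) (ivq iv) (sub p (fam M))" if "p \<in> F" for p
  using star_family_sub[OF star_family_fam[OF M]] F'(2,3) that by blast
  have "\<exists>p. p \<in> F \<and> equivf (ix X) (fam (V a)) (sub p (fam M))" if a: "a \<in> I" "qdim X (V a) M ~= 0" for a
  proof -
  have "card {p \<in> F. Hom (ix X) (fam (V a)) (sub p (fam M)) ~= {0}} ~= 0"
   using homdim_splits_irr[OF transversalD(4,2)[OF T a(1)] star_family_fam[OF M] F] a(2) by simp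
  then have "{p \<in> F. Hom (ix X) (fam (V a)) (sub p (fam M)) ~= {0}} ~= {}"
   by (metis card.empty)
  then obtain p where "p \<in> F" "Hom (ix X) (fam (V a)) (sub p (fam M)) ~= {0}" by blast
  then show ?thesis
   using irr_equivf_iff[OF transversalD(4,2)[OF T a(1)] Mp F(2)] by blast
  qed
  then have "\<forall>a\<in>{a \<in> I. qdim X (V a) M ~= 0}. \<exists>p. p \<in> F \<and> equivf (ix X) (fam (V a)) (sub p (fam M))"
  by blast
  from bchoice[OF this] obtain f where f: "!!a. a \<in> I ==> qdim X (V a) M ~= 0 ==> f a \<in> F"
  "!!a. a \<in> I ==> qdim X (V a) M ~= 0 ==> equivf (ix X) (fam (V a)) (sub (f a) (fam M))" by blast
  have "inj_on f {a \<in> I. qdim X (V a) M ~= 0}"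
  proof (rule inj_onI)
  fix a b assume ab: "a \<in> {a \<in> I. qdim X (V a) M ~= 0}" "b \<in> {a \<in> I. qdim X (V a) M ~= 0}" "f a = f b"
  have "qequiv X (V a) (V b)"
   by (rule equivf_trans[OF f(2) equivf_sym]) (use f(2)[of b] ab in auto)
  then show "a = b" using transversalD(3)[OF T] ab by blast
  qed
  then show ?thesis
  by (rule finite_imageD[rotated]) (rule finite_subset[OF _ F'(1)], use f(1) in auto)
qed

text \<open>Together with its left counterpart this expands the multiplicities in a triple tensor
  product in two ways; their agreement is the associativity of the module action.\<close>

lemma qdim_qtens_right:
  fixes I :: "'k set" and V :: "'k => ('l, 'a, 'y) qobj" and N :: "('j, 'a, 'y) qobj"
  assumes T: "transversal {} jv I V" and N: "uobj {} jv N" and C: "uobj X iv C" and B: "uobj X iv B" "qirr X B"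
  and cov: "!!p. proj p ==> p \<in> QHom {} N N ==> qirr {} (qsub p N) ==> \<exists>a\<in>I. qequiv {} (V a) (qsub p N)"
  shows "qdim X B (qtens C N)
  = (\<Sum>a | a \<in> I \<and> qdim {} (V a) N ~= 0. qdim {} (V a) N * qdim X B (qtens C (V a)))"
proof -
  obtain F where F: "qsplits {} N F (%p. p)" "!!p. p \<in> F ==> irr (ix {}) (sub p (fam N))"
  using complete_reducibility[OF star_family_fam[OF N]] by blast
  note F' = splitsD[OF F(1)]
  have cC: "cobj X C" using C by (rule uobj_cobj)
  have "qdim X B (qtens C N) = (\<Sum>p\<in>F. homdim (ix X) (fam B) (sub (kr (pr C) p) (fam (qtens C N))))"
  by (rule homdim_splits[OF star_family_fam[OF B(1)] B(2) star_family_fam[OF uobj_qtens[OF C N]]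
     qsplits_qtens_right[OF cC F(1)]])
  also have "... = (\<Sum>p\<in>F. qdim X B (qtens C (qsub p N)))"
  proof (rule sum.cong[OF refl])
  fix p assume "p \<in> F"
  then have "p ** pr N = p" using F'(3)[of p] by (simp add: Hom_def)
  then show "homdim (ix X) (fam B) (sub (kr (pr C) p) (fam (qtens C N))) = qdim X B (qtens C (qsub p N))"
   by (simp add: qsub_qtens_right[OF cC] flip: fam_qsub)
  qed
  also have "... = (\<Sum>a | a \<in> I \<and> qdim {} (V a) N ~= 0. qdim {} (V a) N * qdim X B (qtens C (V a)))"
  proof (rule class_sum[OF T N F])
  show "\<exists>a\<in>I. qequiv {} (V a) (qsub p N)" if "p \<in> F" for p
   using cov F' F(2) that by (simp add: fam_qsub)
  show "qdim X B (qtens C (qsub p N)) = qdim X B (qtens C (V a))"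
   if "p \<in> F" "a \<in> I" "qequiv {} (V a) (qsub p N)" for p a
   by (rule homdim_equiv[OF equivf_refl[OF star_family_fam[OF B(1)]]
      qequiv_qtens[OF cobj_refl[OF cC] equivf_sym[OF that(3)]]])
  qed
  finally show ?thesis .
qed

lemma qdim_qtens_left:
  fixes J :: "'k set" and D :: "'k => ('l, 'a, 'x) qobj" and N :: "('j, 'a, 'y) qobj"
  assumes T: "transversal X iv J D" and N: "uobj {} jv N" and C: "uobj X iv C" and B: "uobj X iv B" "qirr X B"
  and cov: "!!p. proj p ==> p \<in> QHom X C C ==> qirr X (qsub p C) ==> \<exists>a\<in>J. qequiv X (D a) (qsub p C)"
  shows "qdim X B (qtens C N)
  = (\<Sum>a | a \<in> J \<and> qdim X (D a) C ~= 0. qdim X (D a) C * qdim X B (qtens (D a) N))"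
proof -
  obtain F where F: "qsplits X C F (%p. p)" "!!p. p \<in> F ==> irr (ix X) (sub p (fam C))"
  using complete_reducibility[OF star_family_fam[OF C]] by blast
  note F' = splitsD[OF F(1)]
  have cN: "cobj {} N" using N by (rule uobj_cobj)
  have "qdim X B (qtens C N) = (\<Sum>p\<in>F. homdim (ix X) (fam B) (sub (kr p (pr N)) (fam (qtens C N))))"
  by (rule homdim_splits[OF star_family_fam[OF B(1)] B(2) star_family_fam[OF uobj_qtens[OF C N]]
     qsplits_qtens_left[OF F(1) cN]])
  also have "... = (\<Sum>p\<in>F. qdim X B (qtens (qsub p C) N))"
  by (simp add: qsub_qtens_left[OF cN] flip: fam_qsub)
  also have "... = (\<Sum>a | a \<in> J \<and> qdim X (D a) C ~= 0. qdim X (D a) C * qdim X B (qtens (D a) N))"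
  proof (rule class_sum[OF T C F])
  show "\<exists>a\<in>J. qequiv X (D a) (qsub p C)" if "p \<in> F" for p
   using cov F' F(2) that by (simp add: fam_qsub)
  show "qdim X B (qtens (qsub p C) N) = qdim X B (qtens (D a) N)"
   if "p \<in> F" "a \<in> J" "qequiv X (D a) (qsub p C)" for p a
   by (rule homdim_equiv[OF equivf_refl[OF star_family_fam[OF B(1)]]
      qequiv_qtens[OF equivf_sym[OF that(3)] cobj_refl[OF cN]]])
  qed
  finally show ?thesis .
qed

end

section \<open>Based modules from multiplicities\<close>

text \<open>The bilinear extension of structure constants, in the very form used for the product of
  \<open>Fus\<close>. The finiteness conditions below ensure that the function given to
  \<open>Abs_poly_mapping\<close> is finitely supported.\<close>

definition bilin :: "'c set => ('a => 'b => 'c => nat) => ('a \<Rightarrow>\<^sub>0 int) => ('b \<Rightarrow>\<^sub>0 int) => ('c \<Rightarrow>\<^sub>0 int)" where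
  "bilin K n x y = Poly_Mapping.Abs_poly_mapping (%c. if c \<in> K
   then \<Sum>a\<in>Poly_Mapping.keys x. \<Sum>b\<in>Poly_Mapping.keys y.
    Poly_Mapping.lookup x a * Poly_Mapping.lookup y b * int (n a b c) else 0)"

lemma lookup_bilin:
  assumes fin: "\<forall>a\<in>I. \<forall>b\<in>J. finite {c \<in> K. n a b c ~= 0}"
  and x: "x \<in> free_Z I" and y: "y \<in> free_Z J"
  shows "Poly_Mapping.lookup (bilin K n x y) c = (if c \<in> K
   then \<Sum>a\<in>Poly_Mapping.keys x. \<Sum>b\<in>Poly_Mapping.keys y.
    Poly_Mapping.lookup x a * Poly_Mapping.lookup y b * int (n a b c) else 0)"
proof -
  let ?f = "%c. if c \<in> K then \<Sum>a\<in>Poly_Mapping.keys x. \<Sum>b\<in>Poly_Mapping.keys y.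
    Poly_Mapping.lookup x a * Poly_Mapping.lookup y b * int (n a b c) else 0"
  have "{c. ?f c ~= 0} <= (\<Union>a\<in>Poly_Mapping.keys x. \<Union>b\<in>Poly_Mapping.keys y. {c \<in> K. n a b c ~= 0})"
  proof
  fix c assume "c \<in> {c. ?f c ~= 0}"
  then have c: "?f c ~= 0" by simp
  then have "c \<in> K" by (auto split: if_splits)
  show "c \<in> (\<Union>a\<in>Poly_Mapping.keys x. \<Union>b\<in>Poly_Mapping.keys y. {c \<in> K. n a b c ~= 0})"
  proof (rule ccontr)
   assume "\<not> ?thesis"
   then have "!!a b. a \<in> Poly_Mapping.keys x ==> b \<in> Poly_Mapping.keys y ==> n a b c = 0"
    using \<open>c \<in> K\<close> by blast
   then have "?f c = 0" by simp
   with c show False by blast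
  qed
  qed
  moreover have "finite (\<Union>a\<in>Poly_Mapping.keys x. \<Union>b\<in>Poly_Mapping.keys y. {c \<in> K. n a b c ~= 0})"
  using fin x y by (auto simp: free_Z_def)
  ultimately have "finite {c. ?f c ~= 0}" by (rule finite_subset)
  then show ?thesis unfolding bilin_def by (simp add: Abs_poly_mapping_inverse)
qed

lemma sum_keys_superset:
  assumes "finite S" "Poly_Mapping.keys x <= S"
  shows "(\<Sum>a\<in>Poly_Mapping.keys x. Poly_Mapping.lookup x a * g a) = (\<Sum>a\<in>S. Poly_Mapping.lookup x a * (g a :: int))"
  by (rule sum.mono_neutral_left) (use assms in \<open>auto simp: in_keys_iff\<close>)

lemma sum_keys_add:
  "(\<Sum>a\<in>Poly_Mapping.keys (x + y). Poly_Mapping.lookup (x + y) a * g a)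
  = (\<Sum>a\<in>Poly_Mapping.keys x. Poly_Mapping.lookup x a * g a)
   + (\<Sum>a\<in>Poly_Mapping.keys y. Poly_Mapping.lookup y a * (g a :: int))"
proof -
  let ?S = "Poly_Mapping.keys x \<union> Poly_Mapping.keys y"
  have *: "(\<Sum>a\<in>Poly_Mapping.keys z. Poly_Mapping.lookup z a * g a) = (\<Sum>a\<in>?S. Poly_Mapping.lookup z a * g a)"
  if "z \<in> {x, y, x + y}" for z
  by (rule sum_keys_superset) (use that Poly_Mapping.keys_add[of x y] in auto)
  have "(\<Sum>a\<in>Poly_Mapping.keys (x + y). Poly_Mapping.lookup (x + y) a * g a)
   = (\<Sum>a\<in>?S. Poly_Mapping.lookup (x + y) a * g a)" by (rule *) simp
  also have "... = (\<Sum>a\<in>?S. Poly_Mapping.lookup x a * g a) + (\<Sum>a\<in>?S. Poly_Mapping.lookup y a * g a)"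
  by (simp add: lookup_add distrib_right sum.distrib)
  finally show ?thesis using *[of x] *[of y] by simp
qed

lemma free_Z_add: "x \<in> free_Z I ==> y \<in> free_Z I ==> x + y \<in> free_Z I"
  using Poly_Mapping.keys_add[of x y] by (auto simp: free_Z_def)

lemma free_Z_zero [simp]: "0 \<in> free_Z I" by (simp add: free_Z_def)

lemma free_Z_single: "i \<in> I ==> Poly_Mapping.single i z \<in> free_Z I"
  by (simp add: free_Z_def)

lemma free_Z_sum: "(!!k. k \<in> S ==> f k \<in> free_Z I) ==> (\<Sum>k\<in>S. f k) \<in> free_Z I"
  by (induction S rule: infinite_finite_induct) (auto intro: free_Z_add)

lemma poly_mapping_expand: "(\<Sum>k\<in>Poly_Mapping.keys x. Poly_Mapping.single k (Poly_Mapping.lookup x k)) = (x :: 'i \<Rightarrow>\<^sub>0 int)"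
  by (rule poly_mapping_eqI)
  (auto simp: lookup_sum lookup_single when_def in_keys_iff sum.delta split: if_splits)

lemma additive_ext:
  fixes f g :: "('i \<Rightarrow>\<^sub>0 int) => 'b::ab_group_add"
  assumes f: "!!x y. x \<in> free_Z I ==> y \<in> free_Z I ==> f (x + y) = f x + f y"
  and g: "!!x y. x \<in> free_Z I ==> y \<in> free_Z I ==> g (x + y) = g x + g y"
  and b: "!!i. i \<in> I ==> f (basis_elem i) = g (basis_elem i)" and x: "x \<in> free_Z I"
  shows "f x = g x"
proof -
  have f0: "f 0 = 0" and g0: "g 0 = 0" using f[of 0 0] g[of 0 0] by simp_all
  have s: "f (Poly_Mapping.single i z) = g (Poly_Mapping.single i z)" if i: "i \<in> I" for i z
  proof (induction z rule: int_induct[where k = 0])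
  case base show ?case by (simp add: f0 g0)
  next
  case (step1 z)
  have "Poly_Mapping.single i (z + 1) = Poly_Mapping.single i z + basis_elem i" by (simp add: single_add)
  then show ?case using step1 f g b i by (simp add: free_Z_single)
  next
  case (step2 z)
  have "Poly_Mapping.single i z = Poly_Mapping.single i (z - 1) + basis_elem i"
   by (simp add: single_add[symmetric])
  then have "f (Poly_Mapping.single i (z - 1)) + f (basis_elem i) = g (Poly_Mapping.single i (z - 1)) + g (basis_elem i)"
   using step2 f[of "Poly_Mapping.single i (z - 1)" "basis_elem i"]
    g[of "Poly_Mapping.single i (z - 1)" "basis_elem i"] i by (simp add: free_Z_single)
  then show ?case using b[OF i] by simp
  qed
  have "f (\<Sum>k\<in>S. Poly_Mapping.single k (Poly_Mapping.lookup x k))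
   = g (\<Sum>k\<in>S. Poly_Mapping.single k (Poly_Mapping.lookup x k))" if "finite S" "S <= I" for S
  using that
  proof (induction S rule: finite_induct)
  case (insert k S)
  then show ?case
   by (simp add: f g free_Z_single free_Z_sum subset_iff s)
  qed (simp add: f0 g0)
  from this[of "Poly_Mapping.keys x"] show ?thesis
  using x by (simp add: poly_mapping_expand free_Z_def)
qed

lemma bilin_biadditive:
  assumes fin: "\<forall>a\<in>I. \<forall>b\<in>J. finite {c \<in> K. n a b c ~= 0}"
  shows "biadditive_on (free_Z I) (free_Z J) (free_Z K) (bilin K n)"
  unfolding biadditive_on_def
proof (intro conjI ballI)
  note L = lookup_bilin[of I J K n, OF fin]
  fix x y assume x: "x \<in> free_Z I" and y: "y \<in> free_Z J"
  show "bilin K n x y \<in> free_Z K"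
  using L[OF x y] by (auto simp: free_Z_def in_keys_iff split: if_splits)
  fix x' assume x': "x' \<in> free_Z I"
  show "bilin K n (x + x') y = bilin K n x y + bilin K n x' y"
  by (rule poly_mapping_eqI)
   (simp add: lookup_add[of "bilin K n x y"] L x y x' free_Z_add mult.assoc sum_keys_add flip: sum_distrib_left)
next
  note L = lookup_bilin[of I J K n, OF fin]
  fix x y y' assume x: "x \<in> free_Z I" and y: "y \<in> free_Z J" and y': "y' \<in> free_Z J"
  show "bilin K n x (y + y') = bilin K n x y + bilin K n x y'"
  by (rule poly_mapping_eqI)
   (simp add: lookup_add[of "bilin K n x y"] L x y y' free_Z_add mult.assoc sum_keys_add distrib_left sum.distrib
    flip: sum_distrib_left)
qed

lemma lookup_bilin_basis:
  assumes fin: "\<forall>a\<in>I. \<forall>b\<in>J. finite {c \<in> K. n a b c ~= 0}" and "a \<in> I" "b \<in> J"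
  shows "Poly_Mapping.lookup (bilin K n (basis_elem a) (basis_elem b)) c = (if c \<in> K then int (n a b c) else 0)"
  using lookup_bilin[of I J K n, OF fin free_Z_single[OF assms(2)] free_Z_single[OF assms(3)]] by simp

lemma sum_keys_bilin_basis:
  assumes fin: "\<forall>a\<in>I. \<forall>b\<in>J. finite {c \<in> K. n a b c ~= 0}" and "a \<in> I" "b \<in> J"
  shows "(\<Sum>c\<in>Poly_Mapping.keys (bilin K n (basis_elem a) (basis_elem b)).
    Poly_Mapping.lookup (bilin K n (basis_elem a) (basis_elem b)) c * g c)
   = (\<Sum>c | c \<in> K \<and> n a b c ~= 0. int (n a b c) * g c)"
proof -
  have "Poly_Mapping.keys (bilin K n (basis_elem a) (basis_elem b)) = {c \<in> K. n a b c ~= 0}"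
  using lookup_bilin_basis[of I J K n, OF fin assms(2,3)] by (auto simp: in_keys_iff split: if_splits)
  then show ?thesis
  using lookup_bilin_basis[of I J K n, OF fin assms(2,3)] by (auto intro!: sum.cong)
qed

text \<open>Numerical data of a based module, with \<open>n a x y\<close> the coefficient of
  \<open>y\<close> in \<open>a \<otimes> x\<close>. \<open>dual\<close> is Frobenius reciprocity in
  the module and \<open>N_dual\<close> in the ring; \<open>fin_form\<close> says that the internal
  form has finitely supported values.\<close>

locale multiplicities =
  fixes R :: "'i based_ring" and J :: "'j set"
  and N :: "'i => 'i => 'i => nat" and n :: "'i => 'j => 'j => nat"
  assumes rmult: "rmult R = bilin (rbasis R) N"
  and one: "runit R \<in> rbasis R"
  and rbar: "a \<in> rbasis R ==> rbar R a \<in> rbasis R" "a \<in> rbasis R ==> rbar R (rbar R a) = a"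
   "rbar R (runit R) = runit R"
  and finN: "a \<in> rbasis R ==> b \<in> rbasis R ==> finite {c \<in> rbasis R. N a b c ~= 0}"
  and fin_act: "a \<in> rbasis R ==> x \<in> J ==> finite {y \<in> J. n a x y ~= 0}"
  and fin_form: "x \<in> J ==> y \<in> J ==> finite {a \<in> rbasis R. n a y x ~= 0}"
  and n_one: "x \<in> J ==> y \<in> J ==> n (runit R) x y = (if x = y then 1 else 0)"
  and N_one: "b \<in> rbasis R ==> c \<in> rbasis R ==> N (runit R) b c = (if b = c then 1 else 0)"
  and assoc: "a \<in> rbasis R ==> b \<in> rbasis R ==> x \<in> J ==> y \<in> J ==>
   (\<Sum>g | g \<in> rbasis R \<and> N a b g ~= 0. N a b g * n g x y)
    = (\<Sum>z | z \<in> J \<and> n a z y ~= 0. n a z y * n b x z)"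
  and dual: "a \<in> rbasis R ==> x \<in> J ==> y \<in> J ==> n (rbar R a) x y = n a y x"
  and N_dual: "a \<in> rbasis R ==> b \<in> rbasis R ==> c \<in> rbasis R ==> N (rbar R a) c b = N a b c"
begin

abbreviation "I \<equiv> rbasis R"

text \<open>The form is forced: the coefficient of \<open>a\<close> in the form of \<open>b\<close>
  and \<open>c\<close> has to be the multiplicity of \<open>b\<close> in
  \<open>a \<otimes> c\<close>, that is \<open>n a c b\<close>.\<close>

definition M :: "('i, 'j) based_module" where
  "M = \<lparr>mbasis = J, act = bilin J n, form = bilin I (%b c a. n a c b)\<rparr>"

lemma M_simps [simp]: "mbasis M = J" "act M = bilin J n" "form M = bilin I (%b c a. n a c b)"
  by (simp_all add: M_def)

lemma assoc': "a \<in> I ==> b \<in> I ==> x \<in> J ==> y \<in> J ==>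
  (\<Sum>g | g \<in> I \<and> N a b g ~= 0. int (N a b g) * int (n g x y))
   = (\<Sum>z | z \<in> J \<and> n b x z ~= 0. int (n b x z) * int (n a z y))"
proof -
  assume *: "a \<in> I" "b \<in> I" "x \<in> J" "y \<in> J"
  have fin: "finite {z \<in> J. n a z y ~= 0}"
  proof -
  have "{z \<in> J. n a z y ~= 0} = {z \<in> J. n (rbar R a) y z ~= 0}" using dual * by auto
  then show ?thesis using fin_act[OF rbar(1)[OF *(1)] *(4)] by simp
  qed
  have "(\<Sum>g | g \<in> I \<and> N a b g ~= 0. int (N a b g) * int (n g x y))
   = int (\<Sum>z | z \<in> J \<and> n a z y ~= 0. n a z y * n b x z)"
  unfolding assoc[OF *, symmetric] by simp
  also have "... = (\<Sum>z | z \<in> J \<and> n a z y ~= 0. int (n a z y) * int (n b x z))" by simp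
  also have "... = (\<Sum>z | z \<in> J \<and> n a z y ~= 0 \<and> n b x z ~= 0. int (n a z y) * int (n b x z))"
  by (rule sum.mono_neutral_right) (use fin in auto)
  also have "... = (\<Sum>z | z \<in> J \<and> n b x z ~= 0. int (n b x z) * int (n a z y))"
  by (rule sum.mono_neutral_cong_left) (use fin_act[OF *(2,3)] in auto)
  finally show ?thesis .
qed

lemma fins: "\<forall>a\<in>I. \<forall>b\<in>I. finite {c \<in> I. N a b c ~= 0}"
  "\<forall>a\<in>I. \<forall>b\<in>J. finite {c \<in> J. n a b c ~= 0}"
  "\<forall>b\<in>J. \<forall>c\<in>J. finite {a \<in> I. n a c b ~= 0}"
  using finN fin_act fin_form by simp_all

lemma act_additive: "biadditive_on (free_Z I) (free_Z J) (free_Z J) (bilin J n)"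
  by (rule bilin_biadditive) (rule fins)

lemma form_additive: "biadditive_on (free_Z J) (free_Z J) (free_Z I) (bilin I (%b c a. n a c b))"
  by (rule bilin_biadditive) (rule fins)

lemma mult_additive: "biadditive_on (free_Z I) (free_Z I) (free_Z I) (bilin I N)"
  by (rule bilin_biadditive) (rule fins)

lemmas act_basis = lookup_bilin_basis[of I J J n, OF fins(2)]
lemmas form_basis = lookup_bilin_basis[of J J I "%b c a. n a c b", OF fins(3)]
lemmas mult_basis = lookup_bilin_basis[of I I I N, OF fins(1)]
lemmas lookup_act = lookup_bilin[of I J J n, OF fins(2)]
lemmas lookup_form = lookup_bilin[of J J I "%b c a. n a c b", OF fins(3)]
lemmas lookup_mult = lookup_bilin[of I I I N, OF fins(1)]

lemma act_in: "a \<in> I ==> b \<in> J ==> bilin J n (basis_elem a) (basis_elem b) \<in> free_Z J"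
  and form_in: "b \<in> J ==> c \<in> J ==> bilin I (%b c a. n a c b) (basis_elem b) (basis_elem c) \<in> free_Z I"
  and mult_in: "a \<in> I ==> a' \<in> I ==> bilin I N (basis_elem a) (basis_elem a') \<in> free_Z I"
  using act_additive form_additive mult_additive by (simp_all add: biadditive_on_def free_Z_single)

lemma act_mult_basis:
  assumes "a \<in> I" "b \<in> I" "x \<in> J"
  shows "bilin J n (bilin I N (basis_elem a) (basis_elem b)) (basis_elem x)
  = bilin J n (basis_elem a) (bilin J n (basis_elem b) (basis_elem x))"
proof (rule poly_mapping_eqI)
  fix c
  have "(\<Sum>g\<in>Poly_Mapping.keys (bilin I N (basis_elem a) (basis_elem b)).
   Poly_Mapping.lookup (bilin I N (basis_elem a) (basis_elem b)) g * int (n g x c))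
  = (\<Sum>d\<in>Poly_Mapping.keys (bilin J n (basis_elem b) (basis_elem x)).
   Poly_Mapping.lookup (bilin J n (basis_elem b) (basis_elem x)) d * int (n a d c))" if "c \<in> J"
  using sum_keys_bilin_basis[of I I I N, OF fins(1) assms(1,2)] sum_keys_bilin_basis[of I J J n, OF fins(2) assms(2,3)]
   assoc'[OF assms that] by simp
  then show "Poly_Mapping.lookup (bilin J n (bilin I N (basis_elem a) (basis_elem b)) (basis_elem x)) c
   = Poly_Mapping.lookup (bilin J n (basis_elem a) (bilin J n (basis_elem b) (basis_elem x))) c"
  using assms by (simp add: lookup_act act_in mult_in free_Z_single)
qed

text \<open>Reciprocity in the ring replaces \<open>a\<close> by \<open>rbar R a\<close>,
  associativity is applied there, and reciprocity in the module turns \<open>rbar R a\<close> back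
  into \<open>a\<close>.\<close>

lemma form_act_basis:
  assumes "a \<in> I" "b \<in> J" "c \<in> J"
  shows "bilin I (%b c a. n a c b) (bilin J n (basis_elem a) (basis_elem b)) (basis_elem c)
  = bilin I N (basis_elem a) (bilin I (%b c a. n a c b) (basis_elem b) (basis_elem c))"
proof (rule poly_mapping_eqI)
  fix g
  let ?F = "bilin I (%b c a. n a c b)"
  have "(\<Sum>d\<in>Poly_Mapping.keys (bilin J n (basis_elem a) (basis_elem b)).
   Poly_Mapping.lookup (bilin J n (basis_elem a) (basis_elem b)) d * int (n g c d))
  = (\<Sum>h\<in>Poly_Mapping.keys (?F (basis_elem b) (basis_elem c)).
   Poly_Mapping.lookup (?F (basis_elem b) (basis_elem c)) h * int (N a h g))" if g: "g \<in> I"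
  proof -
  have "(\<Sum>h | h \<in> I \<and> n h c b ~= 0. int (n h c b) * int (N a h g))
    = (\<Sum>h | h \<in> I \<and> n h c b ~= 0. int (N (rbar R a) g h) * int (n h c b))"
   by (rule sum.cong) (use N_dual assms g in auto)
  also have "... = (\<Sum>h | h \<in> I \<and> n h c b ~= 0 \<and> N (rbar R a) g h ~= 0. int (N (rbar R a) g h) * int (n h c b))"
   by (rule sum.mono_neutral_right) (use fin_form[OF assms(2,3)] in auto)
  also have "... = (\<Sum>h | h \<in> I \<and> N (rbar R a) g h ~= 0. int (N (rbar R a) g h) * int (n h c b))"
   by (rule sum.mono_neutral_left) (use finN[OF rbar(1)[OF assms(1)] g] in auto)
  also have "... = (\<Sum>z | z \<in> J \<and> n g c z ~= 0. int (n g c z) * int (n (rbar R a) z b))"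
   by (rule assoc') (use assms g rbar in auto)
  also have "... = (\<Sum>z | z \<in> J \<and> n g c z ~= 0. int (n a b z) * int (n g c z))"
   by (rule sum.cong) (use dual assms in auto)
  also have "... = (\<Sum>z | z \<in> J \<and> n g c z ~= 0 \<and> n a b z ~= 0. int (n a b z) * int (n g c z))"
   by (rule sum.mono_neutral_right) (use fin_act[OF g assms(3)] in auto)
  also have "... = (\<Sum>z | z \<in> J \<and> n a b z ~= 0. int (n a b z) * int (n g c z))"
   by (rule sum.mono_neutral_left) (use fin_act[OF assms(1,2)] in auto)
  finally show ?thesis
   using sum_keys_bilin_basis[of J J I "%b c a. n a c b", OF fins(3) assms(2,3)]
    sum_keys_bilin_basis[of I J J n, OF fins(2) assms(1,2)] by simp
  qed
  then show "Poly_Mapping.lookup (?F (bilin J n (basis_elem a) (basis_elem b)) (basis_elem c)) g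
  = Poly_Mapping.lookup (bilin I N (basis_elem a) (?F (basis_elem b) (basis_elem c))) g"
  using assms by (simp add: lookup_form lookup_mult act_in form_in free_Z_single)
qed

lemma lookup_bar: "x \<in> free_Z I ==> a \<in> I ==> Poly_Mapping.lookup (bar R x) a = Poly_Mapping.lookup x (rbar R a)"
proof -
  assume x: "x \<in> free_Z I" and a: "a \<in> I"
  have "Poly_Mapping.lookup (bar R x) a
   = (\<Sum>i\<in>Poly_Mapping.keys x. if i = rbar R a then Poly_Mapping.lookup x i else 0)"
  unfolding bar_def linear_ext_def lookup_sum
  proof (rule sum.cong[OF refl])
  fix i assume "i \<in> Poly_Mapping.keys x"
  then have "i \<in> I" using x by (auto simp: free_Z_def)
  then have "rbar R i = a \<longleftrightarrow> i = rbar R a" using rbar a by metis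
  then show "Poly_Mapping.lookup (Poly_Mapping.single (rbar R i) (Poly_Mapping.lookup x i)) a
    = (if i = rbar R a then Poly_Mapping.lookup x i else 0)"
   by (simp add: lookup_single when_def)
  qed
  then show ?thesis by (simp add: sum.delta in_keys_iff)
qed

lemma bar_in: "x \<in> free_Z I ==> bar R x \<in> free_Z I"
  unfolding bar_def linear_ext_def
  by (rule free_Z_sum) (auto simp: free_Z_def[of I] intro!: free_Z_single[unfolded free_Z_def, simplified] rbar(1))

text \<open>Reading off the coefficient of the unit recovers the multiplicities; this yields
  nonnegativity and turns connectedness into a condition on \<open>n\<close>.\<close>

lemma tau_mult_form:
  assumes "a \<in> I" "b \<in> J" "c \<in> J"
  shows "tau R (bilin I N (basis_elem a) (bilin I (%b c a. n a c b) (basis_elem b) (basis_elem c))) = int (n a b c)"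
proof -
  have "tau R (bilin I N (basis_elem a) (bilin I (%b c a. n a c b) (basis_elem b) (basis_elem c)))
   = (\<Sum>d\<in>Poly_Mapping.keys (bilin J n (basis_elem a) (basis_elem b)).
     Poly_Mapping.lookup (bilin J n (basis_elem a) (basis_elem b)) d * int (n (runit R) c d))"
  unfolding form_act_basis[OF assms, symmetric] tau_def
  using assms one by (simp add: lookup_form act_in free_Z_single)
  also have "... = (\<Sum>d | d \<in> J \<and> n a b d ~= 0. int (n a b d) * int (n (runit R) c d))"
  by (rule sum_keys_bilin_basis[of I J J n, OF fins(2) assms(1,2)])
  also have "... = (\<Sum>d | d \<in> J \<and> n a b d ~= 0. if d = c then int (n a b d) else 0)"
  by (rule sum.cong) (use n_one assms in auto)
  also have "... = int (n a b c)"
  using fin_act[OF assms(1,2)] assms(3) by (simp add: sum.delta)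
  finally show ?thesis .
qed

lemma cofinite: "cofinite_based_module R M"
proof
  note A = act_additive[unfolded biadditive_on_def] and B = mult_additive[unfolded biadditive_on_def]
  show "biadditive_on (free_Z (rbasis R)) (free_Z (mbasis M)) (free_Z (mbasis M)) (act M)"
  using act_additive by simp
  show "biadditive_on (free_Z (mbasis M)) (free_Z (mbasis M)) (free_Z (rbasis R)) (form M)"
  using form_additive by simp
  show "act M (basis_elem (runit R)) m = m" if "m \<in> free_Z (mbasis M)" for m
  proof (rule additive_ext[of J "act M (basis_elem (runit R))" "%m. m"])
  show "act M (basis_elem (runit R)) (basis_elem i) = basis_elem i" if "i \<in> J" for i
   by (rule poly_mapping_eqI)
    (use that in \<open>auto simp: act_basis one n_one lookup_single when_def\<close>)
  qed (use A one that in \<open>auto simp: free_Z_single\<close>)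
  show "act M (rmult R x y) m = act M x (act M y m)"
  if "x \<in> free_Z (rbasis R)" "y \<in> free_Z (rbasis R)" "m \<in> free_Z (mbasis M)" for x y m
  proof -
  have 1: "bilin J n (bilin I N (basis_elem a) (basis_elem b)) m
    = bilin J n (basis_elem a) (bilin J n (basis_elem b) m)" if "a \<in> I" "b \<in> I" "m \<in> free_Z J" for a b m
   by (rule additive_ext[of J]) (use that A mult_in act_mult_basis in \<open>auto simp: free_Z_single\<close>)
  have 2: "bilin J n (bilin I N (basis_elem a) y) m
    = bilin J n (basis_elem a) (bilin J n y m)" if "a \<in> I" "y \<in> free_Z I" "m \<in> free_Z J" for a y m
   by (rule additive_ext[of I "%y. bilin J n (bilin I N (basis_elem a) y) m"])
    (use that A B 1 in \<open>auto simp: free_Z_single\<close>)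
  have 3: "bilin J n (bilin I N x y) m = bilin J n x (bilin J n y m)"
   if "x \<in> free_Z I" "y \<in> free_Z I" "m \<in> free_Z J" for x y m
   by (rule additive_ext[of I "%x. bilin J n (bilin I N x y) m"])
    (use that A B 2 in \<open>auto simp: free_Z_single\<close>)
  show ?thesis using 3 that by (simp add: rmult)
  qed
  fix \<alpha> b c assume "\<alpha> \<in> rbasis R" "b \<in> mbasis M" "c \<in> mbasis M"
  then have *: "\<alpha> \<in> I" "b \<in> J" "c \<in> J" by simp_all
  show "form M (act M (basis_elem \<alpha>) (basis_elem b)) (basis_elem c)
   = rmult R (basis_elem \<alpha>) (form M (basis_elem b) (basis_elem c))"
  using form_act_basis[OF *] by (simp add: rmult)
  show "tau R (rmult R (basis_elem \<alpha>) (form M (basis_elem b) (basis_elem c))) \<ge> 0"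
  using tau_mult_form[OF *] by (simp add: rmult)
next
  fix b c assume "b \<in> mbasis M" "c \<in> mbasis M"
  then have *: "b \<in> J" "c \<in> J" by simp_all
  show "form M (basis_elem b) (basis_elem c) = bar R (form M (basis_elem c) (basis_elem b))"
  proof (rule poly_mapping_eqI)
  fix a
  show "Poly_Mapping.lookup (form M (basis_elem b) (basis_elem c)) a
    = Poly_Mapping.lookup (bar R (form M (basis_elem c) (basis_elem b))) a"
  proof (cases "a \<in> I")
   case True
   then show ?thesis
    using * rbar(1)[OF True] dual[OF True] by (simp add: lookup_bar form_in form_basis)
  next
   case False
   then show ?thesis
    using * bar_in[OF form_in[OF *(2,1)]] by (auto simp: form_basis free_Z_def in_keys_iff)
  qed
  qed
  show "tau R (form M (basis_elem b) (basis_elem c)) = (if b = c then 1 else 0)"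
  using * one n_one[of c b] by (auto simp: tau_def form_basis)
qed

lemma connected:
  assumes "!!b c. b \<in> J ==> c \<in> J ==> \<exists>a\<in>I. n a b c ~= 0"
  shows "connected_module R M"
  unfolding connected_module_def
proof (intro ballI)
  fix b c assume "b \<in> mbasis M" "c \<in> mbasis M"
  then have *: "b \<in> J" "c \<in> J" by simp_all
  then obtain a where "a \<in> I" "n a b c ~= 0" using assms by blast
  then show "\<exists>\<alpha>\<in>rbasis R. tau R (rmult R (basis_elem \<alpha>) (form M (basis_elem b) (basis_elem c))) ~= 0"
  using tau_mult_form[of a b c] * by (intro bexI[of _ a]) (simp_all add: rmult)
qed

text \<open>The basis element \<open>e\<close> matched with the unit of the standard module has form
  1 \<otimes> 1 = 1, and the coefficients of its form are the numbers
  \<open>n a e e\<close>.\<close>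

lemma standard_generator:
  assumes "isomorphic_modules R M (standard_module R)"
  obtains e where "e \<in> J" "!!a. a \<in> I ==> n a e e = (if a = runit R then 1 else 0)"
proof -
  obtain f where f: "bij_betw f J I"
  "!!m m'. m \<in> free_Z J ==> m' \<in> free_Z J ==>
    rmult R (linear_ext f m) (bar R (linear_ext f m')) = form M m m'"
  using assms by (auto simp: isomorphic_modules_def standard_module_def)
  have "runit R \<in> f ` J" using f(1) one by (simp add: bij_betw_def)
  then obtain e where e: "e \<in> J" "f e = runit R" by auto
  have "linear_ext f (basis_elem e) = basis_elem (runit R)" using e by (simp add: linear_ext_def)
  moreover have "bar R (basis_elem (runit R)) = basis_elem (runit R)"
  using rbar(3) by (simp add: bar_def linear_ext_def)
  ultimately have "bilin I N (basis_elem (runit R)) (basis_elem (runit R)) = form M (basis_elem e) (basis_elem e)"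
  using f(2)[of "basis_elem e" "basis_elem e"] e by (simp add: free_Z_single rmult)
  then have *: "Poly_Mapping.lookup (bilin I N (basis_elem (runit R)) (basis_elem (runit R))) a
   = Poly_Mapping.lookup (form M (basis_elem e) (basis_elem e)) a" for a by simp
  have "n a e e = (if a = runit R then 1 else 0)" if "a \<in> I" for a
  using *[of a] that e one N_one[OF one that] by (auto simp: mult_basis form_basis split: if_splits)
  with e that show thesis by blast
qed

end

section \<open>Corepresentations as matrices\<close>

lemma sum_fun_apply: "(\<Sum>k\<in>S. f k) i = (\<Sum>k\<in>S. f k i)"
  by (induction S rule: infinite_finite_induct) simp_all

lemma scaleC_fun_apply: "(c *\<^sub>C f) i = c *\<^sub>C f i"
  by (simp add: scaleC_fun_def)

lemma ebasis_Cpow: "j < n ==> ebasis j \<in> Cpow n"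
  by (auto simp: ebasis_def Cpow_def)

lemma Cpow_subspace: "csubspace (Cpow n :: (nat => 'b::complex_vector) set)"
  by (auto simp: complex_vector.subspace_def Cpow_def scaleC_fun_apply)

lemma sum_ebasis: "(\<Sum>j<n. ebasis k j *\<^sub>C f j) = (if k < n then f k else (0::'b::complex_vector))"
proof -
  have "(\<Sum>j<n. ebasis k j *\<^sub>C f j) = (\<Sum>j<n. if j = k then f j else 0)"
  by (rule sum.cong) (auto simp: ebasis_def scaleC_one)
  then show ?thesis by simp
qed

lemma Cpow_expand:
  assumes "xi \<in> Cpow n"
  shows "xi = (\<Sum>j<n. xi j *\<^sub>C ebasis j)"
proof
  fix i
  have "(\<Sum>j<n. xi j *\<^sub>C ebasis j) i = (\<Sum>j<n. xi j * (if i = j then 1 else 0))"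
  by (simp add: sum_fun_apply scaleC_fun_apply ebasis_def scaleC_complex_def)
  also have "... = (\<Sum>j<n. if j = i then xi j else 0)" by (rule sum.cong) auto
  finally show "xi i = (\<Sum>j<n. xi j *\<^sub>C ebasis j) i" using assms by (auto simp: Cpow_def)
qed

lemma clinear_on_sum:
  assumes f: "clinear_on V W f" and V: "csubspace V" and b: "!!j. j \<in> S ==> b j \<in> V" and "finite S"
  shows "f (\<Sum>j\<in>S. c j *\<^sub>C b j) = (\<Sum>j\<in>S. c j *\<^sub>C f (b j))"
  using \<open>finite S\<close> b
proof (induction S rule: finite_induct)
  case empty
  have "f (0 + 0) = f 0 + f 0" using f complex_vector.subspace_0[OF V] unfolding clinear_on_def by blast
  then show ?case by simp
next
  case (insert j S)
  have "c j *\<^sub>C b j \<in> V" "(\<Sum>j\<in>S. c j *\<^sub>C b j) \<in> V"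
  using insert.prems V by (auto intro!: complex_vector.subspace_sum complex_vector.subspace_scale)
  then show ?case using insert f by (simp add: clinear_on_def)
qed

lemma clinear_on_expand:
  assumes "clinear_on (Cpow n) W f" "xi \<in> Cpow n"
  shows "f xi = (\<Sum>j<n. xi j *\<^sub>C f (ebasis j))"
  by (subst Cpow_expand[OF assms(2)]) (rule clinear_on_sum[OF assms(1) Cpow_subspace], auto simp: ebasis_Cpow)

lemma clinear_on_in: "clinear_on V W f ==> x \<in> V ==> f x \<in> W"
  by (simp add: clinear_on_def)

text \<open>Column \<open>j\<close> holds \<delta>(e_j). The label type \<open>unit\<close> with
  zero operators is a placeholder: a bare corepresentation is used with the empty label set.\<close>

definition obc :: "'a::complex_star_algebra corep => (nat, 'a, unit) qobj" where
  "obc V = (idm {..<fst V}, mk {..<fst V} {..<fst V} (%i j. snd V (ebasis j) i), %_. 0)"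

definition corep_of :: "nat => (nat, nat, 'a::complex_star_algebra) fmat => 'a corep" where
  "corep_of n u = (n, %xi i. if i < n then \<Sum>j<n. xi j *\<^sub>C ent u i j else 0)"

abbreviation lincorep :: "'a::complex_star_algebra corep => bool" where
  "lincorep V \<equiv> clinear_on (Cpow (fst V)) (Cpow (fst V)) (snd V)"

text \<open>Zero outside \<open>Cpow n\<close>, as the elements of \<open>Mor\<close> are.\<close>

definition fun_of :: "nat => (nat, nat) cmat => cvec => cvec" where
  "fun_of n M xi = (if xi \<in> Cpow n then (%i. \<Sum>j<n. xi j * ent M i j) else 0)"

lemma obc_simps [simp]: "pr (obc V) = idm {..<fst V}" "opr (obc V) x = 0"
  by (simp_all add: obc_def)

lemma ent_obc: "ent (cor (obc V)) i j = (if i < fst V \<and> j < fst V then snd V (ebasis j) i else 0)"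
  by (simp add: obc_def ent_mk)

lemma obc_supp: "idm {..<fst V} ** cor (obc V) = cor (obc V)" "cor (obc V) ** idm {..<fst V} = cor (obc V)"
  by (auto simp: idm_mm_iff mm_idm_iff ent_obc)

lemma obc_corep_of:
  assumes "idm {..<n} ** u = u" "u ** idm {..<n} = u"
  shows "cor (obc (corep_of n u)) = u" "fst (corep_of n u) = n"
  using assms by (auto intro!: fmat_eqI simp: ent_obc corep_of_def sum_ebasis idm_mm_iff mm_idm_iff)

lemma lincorep_corep_of: "lincorep (corep_of n u)"
  by (auto simp: clinear_on_def corep_of_def Cpow_def fun_eq_iff scaleC_fun_apply scaleC_add_left
   sum.distrib scaleC_sum_right scaleC_scaleC scaleC_complex_def)

lemma ent_sc_mm_supp:
  fixes n :: nat
  assumes "M ** idm {..<n} = M"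
  shows "ent (sc M ** u) i k = (\<Sum>j<n. ent M i j *\<^sub>C ent u j k)"
proof -
  have "ent (sc M ** u) i k = (\<Sum>j<n. ent (sc M) i j * ent u j k)"
  by (rule ent_mm) (use assms in \<open>auto simp: mm_idm_iff ent_sc\<close>)
  then show ?thesis by (simp add: ent_sc mult_scaleC_left)
qed

lemma ent_mm_sc_supp:
  fixes n :: nat
  assumes "idm {..<n} ** M = M"
  shows "ent (u ** sc M) i k = (\<Sum>j<n. ent M j k *\<^sub>C ent u i j)"
proof -
  have "ent (u ** sc M) i k = (\<Sum>j<n. ent u i j * ent (sc M) j k)"
  by (rule ent_mm) (use assms in \<open>auto simp: idm_mm_iff ent_sc\<close>)
  then show ?thesis by (simp add: ent_sc mult_scaleC_right)
qed

lemma ent_mm_supp: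
  fixes n :: nat
  assumes "idm {..<n} ** B = B"
  shows "ent (A ** B) i k = (\<Sum>j<n. ent A i j * ent B j k)"
  by (rule ent_mm) (use assms in \<open>auto simp: idm_mm_iff\<close>)

lemma fun_of_Cpow: "idm {..<m} ** M = M ==> fun_of n M xi \<in> Cpow m"
  by (auto simp: fun_of_def Cpow_def idm_mm_iff)

lemma fun_of_ebasis: "k < n ==> fun_of n M (ebasis k) i = ent M i k"
  using sum_ebasis[where k = k and n = n and f = "%j. ent M i j"] by (simp add: fun_of_def ebasis_Cpow scaleC_complex_def)

lemma clinear_fun_of: "idm {..<m} ** M = M ==> clinear_on (Cpow n) (Cpow m) (fun_of n M)"
  by (simp add: clinear_on_def fun_of_Cpow)
  (simp add: fun_of_def complex_vector.subspace_add[OF Cpow_subspace] fun_eq_iff scaleC_fun_apply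
   complex_vector.subspace_scale[OF Cpow_subspace] distrib_right sum.distrib scaleC_complex_def
   sum_distrib_left mult.assoc)

lemma fun_of_mm:
  assumes "idm {..<m} ** M = M" "M ** idm {..<n} = M" "xi \<in> Cpow n"
  shows "fun_of m A (fun_of n M xi) = fun_of n (A ** M) xi"
proof
  fix i
  have "fun_of m A (fun_of n M xi) i = (\<Sum>j<m. (\<Sum>k<n. xi k * ent M j k) * ent A i j)"
  using fun_of_Cpow[OF assms(1), where n = n and xi = xi] assms(3) by (simp add: fun_of_def)
  also have "... = (\<Sum>k<n. \<Sum>j<m. xi k * ent M j k * ent A i j)"
  by (simp add: sum_distrib_right) (rule sum.swap)
  also have "... = fun_of n (A ** M) xi i"
  using assms(3) by (simp add: fun_of_def ent_mm_supp[OF assms(1)] sum_distrib_left ac_simps)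
  finally show "fun_of m A (fun_of n M xi) i = fun_of n (A ** M) xi i" .
qed

lemma fun_of_idm: "xi \<in> Cpow n ==> fun_of n (idm {..<n}) xi = xi"
proof
  fix i assume xi: "xi \<in> Cpow n"
  have "fun_of n (idm {..<n}) xi i = (\<Sum>j<n. xi j * (if i < n \<and> i = j then 1 else 0))"
  using xi by (simp add: fun_of_def ent_idm)
  also have "... = (\<Sum>j<n. if j = i then xi j else 0)" by (rule sum.cong) auto
  finally show "fun_of n (idm {..<n}) xi i = xi i" using xi by (auto simp: Cpow_def)
qed

lemma Mor_iff:
  assumes V: "lincorep V" and W: "lincorep W"
  and M: "idm {..<fst W} ** M = M" "M ** idm {..<fst V} = M"
  shows "fun_of (fst V) M \<in> Mor V W \<longleftrightarrow> M \<in> QHom {} (obc V) (obc W)"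
proof -
  obtain n \<delta> where V': "V = (n, \<delta>)" by (cases V)
  obtain m \<delta>' where W': "W = (m, \<delta>')" by (cases W)
  let ?T = "fun_of n M" and ?u = "cor (obc V)" and ?w = "cor (obc W)"
  note lV = V[unfolded V', simplified] and lW = W[unfolded W', simplified]
  note M' = M[unfolded V' W', simplified]
  have uV: "idm {..<n} ** ?u = ?u" using obc_supp(1)[of V] by (simp add: V')
  have 1: "\<delta>' (?T xi) i = (\<Sum>k<n. xi k *\<^sub>C ent (?w ** sc M) i k)" if "xi \<in> Cpow n" for xi i
  proof -
  have T: "?T xi \<in> Cpow m" by (rule fun_of_Cpow[OF M'(1)])
  have "\<delta>' (?T xi) i = (\<Sum>l<m. ?T xi l *\<^sub>C \<delta>' (ebasis l) i)"
   by (subst clinear_on_expand[OF lW T]) (simp add: sum_fun_apply scaleC_fun_apply)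
  also have "... = (\<Sum>l<m. ?T xi l *\<^sub>C ent ?w i l)"
  proof (cases "i < m")
   case False
   have "\<delta>' (ebasis l) i = 0" if "l < m" for l
    using clinear_on_in[OF lW ebasis_Cpow[OF that]] False by (simp add: Cpow_def)
   then show ?thesis using False by (simp add: ent_obc W')
  qed (simp add: ent_obc W')
  also have "... = (\<Sum>l<m. \<Sum>k<n. xi k *\<^sub>C ent M l k *\<^sub>C ent ?w i l)"
   using that by (simp add: fun_of_def scaleC_sum_left scaleC_scaleC)
  also have "... = (\<Sum>k<n. \<Sum>l<m. xi k *\<^sub>C ent M l k *\<^sub>C ent ?w i l)" by (rule sum.swap)
  also have "... = (\<Sum>k<n. xi k *\<^sub>C ent (?w ** sc M) i k)"
   by (simp add: ent_mm_sc_supp[OF M'(1)] scaleC_sum_right)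
  finally show ?thesis .
  qed
  have 2: "map_tensor_id n ?T (\<delta> xi) i = (\<Sum>k<n. xi k *\<^sub>C ent (sc M ** ?u) i k)" if "xi \<in> Cpow n" for xi i
  proof -
  have "map_tensor_id n ?T (\<delta> xi) i = (\<Sum>j<n. ent M i j *\<^sub>C \<delta> xi j)"
   by (simp add: map_tensor_id_def sum_fun_apply elem_tensor_def fun_of_ebasis)
  also have "... = (\<Sum>j<n. ent M i j *\<^sub>C (\<Sum>k<n. xi k *\<^sub>C ent ?u j k))"
   by (subst clinear_on_expand[OF lV that]) (simp add: sum_fun_apply scaleC_fun_apply ent_obc V')
  also have "... = (\<Sum>j<n. \<Sum>k<n. xi k *\<^sub>C ent M i j *\<^sub>C ent ?u j k)"
   by (simp add: scaleC_sum_right scaleC_scaleC mult.commute)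
  also have "... = (\<Sum>k<n. \<Sum>j<n. xi k *\<^sub>C ent M i j *\<^sub>C ent ?u j k)" by (rule sum.swap)
  also have "... = (\<Sum>k<n. xi k *\<^sub>C ent (sc M ** ?u) i k)"
   by (simp add: ent_sc_mm_supp[OF M'(2)] scaleC_sum_right)
  finally show ?thesis .
  qed
  have supp: "ent (?w ** sc M) i k = 0" "ent (sc M ** ?u) i k = 0" if "\<not> k < n" for i k
  using that M'(2) obc_supp(2)[of V] by (auto simp: V' ent_mm0 ent_sc mm_idm_iff ent_obc)
  have "fun_of n M \<in> Mor V W \<longleftrightarrow> (\<forall>xi\<in>Cpow n. \<delta>' (?T xi) = map_tensor_id n ?T (\<delta> xi))"
  using clinear_fun_of[OF M'(1)] by (auto simp: Mor_def V' W' fun_of_def)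
  also have "... \<longleftrightarrow> sc M ** ?u = ?w ** sc M"
  proof
  assume h: "\<forall>xi\<in>Cpow n. \<delta>' (?T xi) = map_tensor_id n ?T (\<delta> xi)"
  show "sc M ** ?u = ?w ** sc M"
  proof (rule fmat_eqI)
   fix i k
   show "ent (sc M ** ?u) i k = ent (?w ** sc M) i k"
   proof (cases "k < n")
    case True
    then have "\<delta>' (?T (ebasis k)) i = map_tensor_id n ?T (\<delta> (ebasis k)) i"
     using h ebasis_Cpow by auto
    then show ?thesis
     using 1[OF ebasis_Cpow[OF True]] 2[OF ebasis_Cpow[OF True]] True by (simp add: sum_ebasis)
   qed (simp add: supp)
  qed
  next
  assume "sc M ** ?u = ?w ** sc M"
  then show "\<forall>xi\<in>Cpow n. \<delta>' (?T xi) = map_tensor_id n ?T (\<delta> xi)" by (auto simp: 1 2)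
  qed
  finally show ?thesis using M' by (simp add: QHom_iff V' W')
qed

lemma Mor_fun_of:
  assumes "T \<in> Mor V W"
  obtains M where "T = fun_of (fst V) M" "idm {..<fst W} ** M = M" "M ** idm {..<fst V} = M"
  "!!i j. j < fst V ==> ent M i j = T (ebasis j) i"
proof -
  obtain n \<delta> where V': "V = (n, \<delta>)" by (cases V)
  obtain m \<delta>' where W': "W = (m, \<delta>')" by (cases W)
  have T: "clinear_on (Cpow n) (Cpow m) T" "!!xi. xi \<notin> Cpow n ==> T xi = 0"
  using assms by (auto simp: Mor_def V' W')
  define M where "M = mk {..<m} {..<n} (%i j. T (ebasis j) i)"
  have e: "ent M i j = T (ebasis j) i" if "j < n" for i j
  using clinear_on_in[OF T(1) ebasis_Cpow[OF that]] that by (auto simp: M_def ent_mk Cpow_def)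
  have "T xi = fun_of n M xi" for xi
  proof (cases "xi \<in> Cpow n")
  case True
  have "T xi = (\<Sum>j<n. xi j *\<^sub>C T (ebasis j))" by (rule clinear_on_expand[OF T(1) True])
  then show ?thesis
   using True by (auto simp: fun_of_def fun_eq_iff sum_fun_apply scaleC_fun_apply scaleC_complex_def e)
  qed (simp add: T(2) fun_of_def)
  moreover have "idm {..<m} ** M = M" "M ** idm {..<n} = M"
  by (auto simp: idm_mm_iff mm_idm_iff M_def ent_mk)
  ultimately show thesis using that[of M] e by (auto simp: V' W')
qed

lemma fun_of_inject:
  assumes "fun_of n M = fun_of n M'" "M ** idm {..<n} = M" "M' ** idm {..<n} = M'"
  shows "M = M'"
proof (rule fmat_eqI)
  fix i j
  show "ent M i j = ent M' i j"
  using assms fun_of_ebasis[of j n M i] fun_of_ebasis[of j n M' i]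
  by (cases "j < n") (auto simp: mm_idm_iff)
qed

lemma cdim_Mor:
  assumes "lincorep V" "lincorep W"
  shows "cdim (Mor V W) = qdim {} (obc V) (obc W)"
  unfolding homdim_def
proof -
  have supp: "idm {..<fst W} ** M = M" "M ** idm {..<fst V} = M" if "M \<in> QHom {} (obc V) (obc W)" for M
  using that by (simp_all add: QHom_iff)
  have l: "lin (fun_of (fst V))"
  by (rule linI) (auto simp: fun_of_def fun_eq_iff ent_add ent_scaleC distrib_left sum.distrib
    scaleC_fun_apply scaleC_complex_def sum_distrib_left ac_simps)
  have "Mor V W = fun_of (fst V) ` QHom {} (obc V) (obc W)"
  proof
  show "Mor V W <= fun_of (fst V) ` QHom {} (obc V) (obc W)"
  proof
   fix T assume T: "T \<in> Mor V W"
   then obtain M where "T = fun_of (fst V) M" "idm {..<fst W} ** M = M" "M ** idm {..<fst V} = M"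
    by (rule Mor_fun_of)
   then show "T \<in> fun_of (fst V) ` QHom {} (obc V) (obc W)"
    using T Mor_iff[OF assms] by blast
  qed
  show "fun_of (fst V) ` QHom {} (obc V) (obc W) <= Mor V W"
   using Mor_iff[OF assms] supp by blast
  qed
  moreover have "cdim (fun_of (fst V) ` QHom {} (obc V) (obc W)) = cdim (QHom {} (obc V) (obc W))"
  proof (rule cdim_semilinear_image[where \<sigma> = "%c. c"])
  fix M assume M: "M \<in> QHom {} (obc V) (obc W)" "fun_of (fst V) M = 0"
  have "fun_of (fst V) (0 :: (nat, nat) cmat) = 0" by (rule lin_zero[OF l])
  then show "M = 0" using fun_of_inject[of "fst V" M 0] M supp(2)[OF M(1)] by simp
  qed (use l in \<open>auto simp: lin_def Hom_subspace\<close>)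
  ultimately show "cdim (Mor V W) = cdim (QHom {} (obc V) (obc W))" by simp
qed

lemma equivalent_corep_iff:
  assumes V: "lincorep V" and W: "lincorep W"
  shows "equivalent_corep V W \<longleftrightarrow> qequiv {} (obc V) (obc W)"
proof
  let ?n = "fst V" and ?m = "fst W"
  assume "equivalent_corep V W"
  then obtain T where T: "T \<in> Mor V W" "bij_betw T (Cpow ?n) (Cpow ?m)" by (auto simp: equivalent_corep_def)
  obtain M where M: "T = fun_of ?n M" "idm {..<?m} ** M = M" "M ** idm {..<?n} = M"
  using Mor_fun_of[OF T(1)] by metis
  have MH: "M \<in> QHom {} (obc V) (obc W)" using Mor_iff[OF V W M(2,3)] T(1) M(1) by simp
  have lT: "clinear_on (Cpow ?n) (Cpow ?m) T" unfolding M(1) by (rule clinear_fun_of[OF M(2)])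
  define S where "S = inv_into (Cpow ?n) T"
  have S: "S eta \<in> Cpow ?n" "T (S eta) = eta" if "eta \<in> Cpow ?m" for eta
  using that T(2) unfolding S_def bij_betw_def by (auto simp: inv_into_into f_inv_into_f)
  define M' where "M' = mk {..<?n} {..<?m} (%i j. S (ebasis j) i)"
  have M'supp: "idm {..<?n} ** M' = M'" "M' ** idm {..<?m} = M'"
  by (auto simp: idm_mm_iff mm_idm_iff M'_def ent_mk)
  have M'e: "fun_of ?m M' (ebasis j) = S (ebasis j)" if "j < ?m" for j
  using S(1)[OF ebasis_Cpow[OF that]] that by (auto simp: fun_eq_iff fun_of_ebasis M'_def ent_mk Cpow_def)
  have MM': "M ** M' = idm {..<?m}"
  proof (rule fmat_eqI)
  fix i j
  show "ent (M ** M') i j = ent (idm {..<?m}) i j"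
  proof (cases "j < ?m")
   case True
   have "ent (M ** M') i j = fun_of ?m (M ** M') (ebasis j) i" using True by (simp add: fun_of_ebasis)
   also have "... = T (S (ebasis j)) i"
    using fun_of_mm[OF M'supp(1,2) ebasis_Cpow[OF True], of M] M'e[OF True] by (simp add: M(1))
   also have "... = ebasis j i" using S(2)[OF ebasis_Cpow[OF True]] by simp
   finally show ?thesis using True by (auto simp: ebasis_def ent_idm)
  next
   case False
   then show ?thesis using M'supp(2) by (auto simp: ent_idm ent_mm0 mm_idm_iff)
  qed
  qed
  have M'M: "M' ** M = idm {..<?n}"
  proof -
  have "fun_of ?n (M' ** M) xi = xi" if xi: "xi \<in> Cpow ?n" for xi
  proof -
   let ?eta = "fun_of ?n (M' ** M) xi"
   have e: "?eta \<in> Cpow ?n" by (rule fun_of_Cpow) (simp add: M'supp flip: mm_assoc)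
   have "T ?eta = fun_of ?n (M ** (M' ** M)) xi"
    unfolding M(1) by (rule fun_of_mm[OF _ _ xi]) (simp_all add: M'supp M mm_assoc mm_eq_assoc[OF M'supp(1)])
   also have "M ** (M' ** M) = M" using MM' M(2) by (simp flip: mm_assoc)
   finally have "T ?eta = T xi" using M(1) by simp
   then show ?thesis using T(2) e xi by (auto simp: bij_betw_def inj_on_def)
  qed
  then have "fun_of ?n (M' ** M) = fun_of ?n (idm {..<?n})"
   by (metis (no_types, lifting) ext fun_of_def fun_of_idm)
  then show ?thesis by (rule fun_of_inject) (simp_all add: M mm_assoc)
  qed
  have h: "cor (obc W) ** sc M = sc M ** cor (obc V)" using MH by (simp add: QHom_iff)
  have "sc M' ** cor (obc W) = sc M' ** cor (obc W) ** (sc M ** sc M')"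
  using obc_supp(2)[of W] MM' by (simp add: mm_assoc flip: sc_mm)
  also have "... = (sc M' ** sc M) ** cor (obc V) ** sc M'"
  by (simp add: mm_assoc mm_eq_assoc[OF h])
  also have "... = cor (obc V) ** sc M'"
  using obc_supp(1)[of V] M'M by (simp flip: sc_mm)
  finally have "M' \<in> QHom {} (obc W) (obc V)" using M'supp by (simp add: QHom_iff)
  then show "qequiv {} (obc V) (obc W)" by (rule qequivI[OF MH]) (simp_all add: MM' M'M)
next
  let ?n = "fst V" and ?m = "fst W"
  assume "qequiv {} (obc V) (obc W)"
  then obtain U U' where U: "U \<in> QHom {} (obc V) (obc W)" "U' \<in> QHom {} (obc W) (obc V)"
  "U' ** U = idm {..<?n}" "U ** U' = idm {..<?m}" by (auto simp: equivf_def)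
  have s: "idm {..<?m} ** U = U" "U ** idm {..<?n} = U" "idm {..<?n} ** U' = U'" "U' ** idm {..<?m} = U'"
  using U(1,2) by (simp_all add: QHom_iff)
  have "bij_betw (fun_of ?n U) (Cpow ?n) (Cpow ?m)"
  by (rule bij_betw_byWitness[where f' = "fun_of ?m U'"])
   (auto simp: fun_of_mm s U(3,4) fun_of_idm fun_of_Cpow)
  then show "equivalent_corep V W"
  unfolding equivalent_corep_def using Mor_iff[OF V W s(1,2)] U(1) by blast
qed

text \<open>The numbering of index pairs is inverted by \<open>div\<close> and \<open>mod\<close>; a
  positive dimension of \<open>W\<close> makes \<open>l < n * m\<close> equivalent to
  \<open>l div m < n\<close>.\<close>

lemma qequiv_tensor_corep:
  assumes "fst W ~= 0"
  shows "qequiv {} (qtens (obc V) (obc W)) (obc (tensor_corep V W))"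
  and "lincorep (tensor_corep V W)"
proof -
  obtain n \<delta> where V': "V = (n, \<delta>)" by (cases V)
  obtain m \<delta>' where W': "W = (m, \<delta>')" by (cases W)
  have m: "m > 0" using assms by (simp add: W')
  let ?g = "%l. (l div m, l mod m)"
  have g: "inj ?g" by (rule injI) (metis div_mult_mod_eq fst_conv snd_conv)
  have lm: "l div m < n \<longleftrightarrow> l < n * m" for l using m by (simp add: div_less_iff_less_mult)
  let ?M = "qtens (obc V) (obc W)"
  have e1: "rr ?g (cr ?g (pr ?M)) = idm {..<n * m}"
  proof (rule fmat_eqI)
  fix k l
  have "k div m = l div m \<and> k mod m = l mod m \<longleftrightarrow> k = l" by (metis div_mult_mod_eq)
  then show "ent (rr ?g (cr ?g (pr ?M))) k l = ent (idm {..<n * m}) k l"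
   using m by (auto simp: ent_rr[OF g] ent_cr[OF g] ent_kr ent_idm V' W' lm)
  qed
  have e2: "rr ?g (cr ?g (cor ?M)) = cor (obc (tensor_corep V W))"
  proof (rule fmat_eqI)
  fix k l
  show "ent (rr ?g (cr ?g (cor ?M))) k l = ent (cor (obc (tensor_corep V W))) k l"
   using m by (simp add: ent_rr[OF g] ent_cr[OF g] ent_kr ent_obc V' W' lm tensor_corep_def sum_ebasis)
  qed
  have e3: "rr ?g (cr ?g (opr ?M x)) = opr (obc (tensor_corep V W)) x" for x
  by (rule fmat_eqI) (simp add: ent_rr[OF g] ent_cr[OF g])
  have c: "cols (pr ?M) <= range ?g"
  proof
  fix x assume "x \<in> cols (pr ?M)"
  then obtain y where "ent (pr ?M) y x ~= 0" by (auto simp: cols_def ent_def in_keys_iff)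
  then have "snd x < m" by (cases x; cases y) (auto simp: ent_kr ent_idm W' split: if_splits)
  then have "x = ?g (fst x * m + snd x)" by (cases x) (simp add: m)
  then show "x \<in> range ?g" by (rule range_eqI)
  qed
  have c2: "cols (cor ?M) <= range ?g"
  proof
  fix x assume "x \<in> cols (cor ?M)"
  then obtain y where "ent (cor ?M) y x ~= 0" by (auto simp: cols_def ent_def in_keys_iff)
  then have "snd x < m" by (cases x; cases y) (auto simp: ent_kr ent_obc W' split: if_splits)
  then have "x = ?g (fst x * m + snd x)" by (cases x) (simp add: m)
  then show "x \<in> range ?g" by (rule range_eqI)
  qed
  have eq: "qre ?g ?M = obc (tensor_corep V W)"
  using e1 e2 e3 by (intro prod_eqI ext) (simp_all add: tensor_corep_def V' W')
  have PM: "pr ?M ** pr ?M = pr ?M" "sc (pr ?M) ** cor ?M = cor ?M" "cor ?M ** sc (pr ?M) = cor ?M"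
  using obc_supp[of V] obc_supp[of W] kr_mm_sc1[of "sc (idm {..<n})" "idm {..<m}" "cor (obc V)" "cor (obc W)"]
   kr_mm_sc2[of "cor (obc V)" "cor (obc W)" "idm {..<n}" "sc (idm {..<m})"]
  by (simp_all add: V' W' kr_mm_complex sc_kr)
  have "qequiv {} ?M (qre ?g ?M)"
  proof (rule qequivI)
  have c3: "cols (sc (pr ?M) :: (_, _, 'a) fmat) <= range ?g" by (rule subset_trans[OF cols_sc c])
  note s = rr_mm[OF g] mm_cr[OF g] cr_rr_mm[OF g] sc_rr[OF g] sc_cr[OF g] cr_rr[OF g g]
  show "rr ?g (pr ?M) \<in> QHom {} ?M (qre ?g ?M)" using PM c c2
   by (simp add: QHom_iff s del: qtens_simps)
  show "cr ?g (pr ?M) \<in> QHom {} (qre ?g ?M) ?M" using PM c c3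
   by (simp add: QHom_iff s del: qtens_simps)
  show "cr ?g (pr ?M) ** rr ?g (pr ?M) = pr ?M" "rr ?g (pr ?M) ** cr ?g (pr ?M) = pr (qre ?g ?M)"
   using PM c by (simp_all add: s del: qtens_simps)
  qed
  then show "qequiv {} ?M (obc (tensor_corep V W))" by (simp add: eq)
  show "lincorep (tensor_corep V W)"
  by (auto simp: clinear_on_def tensor_corep_def V' W' Cpow_def fun_eq_iff scaleC_fun_apply
    scaleC_add_left sum.distrib scaleC_sum_right scaleC_scaleC scaleC_complex_def)
qed

text \<open>Drops the operators, as required wherever a morphism between objects with operators has
  to be bent on the left.\<close>

definition fgt :: "('i, 'a::complex_star_algebra, 'x) qobj => ('i, 'a, unit) qobj" where
  "fgt M = (pr M, cor M, %_. 0)"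

lemma fgt_simps [simp]: "pr (fgt M) = pr M" "cor (fgt M) = cor M" "opr (fgt M) x = 0"
  by (simp_all add: fgt_def)

section \<open>Comparison of corepresentations with their matrices\<close>

context discrete_quantum_group
begin

lemma corepresentation_corepm:
  assumes "corepresentation G V"
  shows "corepm (idm {..<fst V}) (cor (obc V))" "lincorep V"
proof -
  obtain n \<delta> where V': "V = (n, \<delta>)" by (cases V)
  have l: "clinear_on (Cpow n) (Cpow n) \<delta>"
  and D: "!!xi. xi \<in> Cpow n ==> comult G \<circ> \<delta> xi = coact_tensor_id n \<delta> (\<delta> xi)"
  and e: "!!xi. xi \<in> Cpow n ==> counit G \<circ> \<delta> xi = xi"
  using assms by (auto simp: corepresentation_def V')
  show "lincorep V" using l by (simp add: V')
  let ?u = "cor (obc V)"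
  note s = obc_supp[of V, unfolded V' fst_conv]
  have 0: "\<delta> (ebasis j) i = 0" if "j < n" "\<not> i < n" for i j
  using clinear_on_in[OF l ebasis_Cpow[OF that(1)]] that(2) by (simp add: Cpow_def)
  have "mapm (comult G) ?u = mapm leg1 ?u ** mapm leg2 ?u"
  proof (rule fmat_eqI)
  fix i j
  have "ent (mapm leg1 ?u ** mapm leg2 ?u) i j = (\<Sum>k<n. ent ?u i k \<otimes> ent ?u k j)"
  proof -
   have "ent (mapm leg1 ?u ** mapm leg2 ?u) i j = (\<Sum>k<n. ent (mapm leg1 ?u) i k * ent (mapm leg2 ?u) k j)"
    by (rule ent_mm) (auto simp: ent_mapm ent_obc V')
   then show ?thesis by (simp add: ent_mapm tensor_times)
  qed
  moreover have "comult G (\<delta> (ebasis j) i) = (\<Sum>k<n. \<delta> (ebasis k) i \<otimes> \<delta> (ebasis j) k)" if "j < n" for i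
   using fun_cong[OF D[OF ebasis_Cpow[OF that]], of i] by (simp add: coact_tensor_id_def)
  ultimately show "ent (mapm (comult G) ?u) i j = ent (mapm leg1 ?u ** mapm leg2 ?u) i j"
   by (auto simp: ent_mapm ent_obc V')
  qed
  moreover have "mapm (counit G) ?u = idm {..<n}"
  proof (rule fmat_eqI)
  fix i j
  have "counit G (\<delta> (ebasis j) i) = ebasis j i" if "j < n" for i
   using fun_cong[OF e[OF ebasis_Cpow[OF that]], of i] by simp
  then show "ent (mapm (counit G) ?u) i j = ent (idm {..<n}) i j"
   by (auto simp: ent_mapm ent_obc V' ent_idm ebasis_def)
  qed
  ultimately show "corepm (idm {..<fst V}) ?u" using s by (simp add: corepm_def V')
qed

lemma unitary_corep_uobj:
  assumes "unitary_corep G V"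
  shows "uobj {} iv (obc V)" "lincorep V"
proof -
  obtain n \<delta> where V': "V = (n, \<delta>)" by (cases V)
  have u: "!!xi eta. xi \<in> Cpow n ==> eta \<in> Cpow n ==> (\<Sum>i<n. star (\<delta> xi i) * \<delta> eta i) = inner_prod n xi eta *\<^sub>C 1"
  and c: "corepresentation G V"
  using assms by (auto simp: unitary_corep_def V')
  show "lincorep V" by (rule corepresentation_corepm(2)[OF c])
  let ?u = "cor (obc V)"
  have "ad ?u ** ?u = idm {..<n}"
  proof (rule fmat_eqI)
  fix i j
  have "ent (ad ?u ** ?u) i j = (\<Sum>k<n. star (ent ?u k i) * ent ?u k j)"
   by (subst ent_mm[of "{..<n}"]) (auto simp: ent_ad ent_obc V')
  moreover have "(\<Sum>k<n. star (\<delta> (ebasis i) k) * \<delta> (ebasis j) k) = (if i = j then 1 else 0)"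
   if "i < n" "j < n"
  proof -
   have "inner_prod n (ebasis i) (ebasis j) = (\<Sum>k<n. if k = i then (if i = j then 1 else 0) else 0)"
    unfolding inner_prod_def by (rule sum.cong) (auto simp: ebasis_def)
   also have "... = (if i = j then 1 else 0)" using that by simp
   finally show ?thesis using u[OF ebasis_Cpow[OF that(1)] ebasis_Cpow[OF that(2)]] by (simp add: scaleC_one)
  qed
  ultimately show "ent (ad ?u ** ?u) i j = ent (idm {..<n}) i j"
   by (cases "i < n"; cases "j < n") (simp_all add: ent_obc V' ent_idm)
  qed
  then have "ucorepm (idm {..<n}) ?u" using corepresentation_corepm(1)[OF c] by (simp add: ucorepm_def V')
  then show "uobj {} iv (obc V)" by (simp add: uobj_def star_family_def V')
qed

lemma uobj_unitary_corep:
  fixes N :: "(nat, 'a, 'x) qobj"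
  assumes N: "uobj {} iv N" and n: "pr N = idm {..<n}"
  shows "unitary_corep G (corep_of n (cor N))"
  "cor (obc (corep_of n (cor N))) = cor N" "pr (obc (corep_of n (cor N))) = pr N"
proof -
  let ?u = "cor N"
  note U = uobjD[OF N, unfolded n]
  have s: "idm {..<n} ** ?u = ?u" "?u ** idm {..<n} = ?u" using U(2,3) by simp_all
  show c: "cor (obc (corep_of n (cor N))) = cor N" "pr (obc (corep_of n (cor N))) = pr N"
  using obc_corep_of[OF s] n by simp_all
  define \<delta> where "\<delta> = snd (corep_of n ?u)"
  have V': "corep_of n ?u = (n, \<delta>)" by (simp add: \<delta>_def corep_of_def)
  have l: "clinear_on (Cpow n) (Cpow n) \<delta>" using lincorep_corep_of[of n ?u] by (simp add: V')
  have de: "\<delta> xi i = (\<Sum>j<n. xi j *\<^sub>C ent ?u i j)" for xi i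
  using s(1) by (auto simp: \<delta>_def corep_of_def idm_mm_iff)
  have deb: "\<delta> (ebasis k) i = ent ?u i k" if "k < n" for k i
  using that by (simp add: de sum_ebasis)
  have D: "comult G (ent ?u i j) = (\<Sum>k<n. ent ?u i k \<otimes> ent ?u k j)" for i j
  proof -
  have "comult G (ent ?u i j) = ent (mapm leg1 ?u ** mapm leg2 ?u) i j"
   using arg_cong[OF corepmD(4)[OF U(8)], of "%A. ent A i j"] by (simp add: ent_mapm)
  also have "... = (\<Sum>k<n. ent (mapm leg1 ?u) i k * ent (mapm leg2 ?u) k j)"
   by (rule ent_mm) (use s in \<open>auto simp: ent_mapm mm_idm_iff\<close>)
  finally show ?thesis by (simp add: ent_mapm tensor_times)
  qed
  have "comult G \<circ> \<delta> xi = coact_tensor_id n \<delta> (\<delta> xi)" for xi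
  proof
  fix i
  have "(comult G \<circ> \<delta> xi) i = (\<Sum>j<n. \<Sum>k<n. xi j *\<^sub>C (ent ?u i k \<otimes> ent ?u k j))"
   by (simp add: de lin_sum[OF lin_comult] lin_scale[OF lin_comult] D scaleC_sum_right)
  also have "... = (\<Sum>k<n. \<Sum>j<n. ent ?u i k \<otimes> (xi j *\<^sub>C ent ?u k j))"
   by (subst sum.swap) (simp add: tensor_linear)
  also have "... = coact_tensor_id n \<delta> (\<delta> xi) i"
  proof -
   have "x \<otimes> (\<Sum>j\<in>S. f j) = (\<Sum>j\<in>S. x \<otimes> f j)" for x :: 'a and f :: "nat => 'a" and S
    by (induction S rule: infinite_finite_induct) (simp_all add: tensor_linear)
   moreover have "coact_tensor_id n \<delta> (\<delta> xi) i = (\<Sum>k<n. ent ?u i k \<otimes> \<delta> xi k)"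
    unfolding coact_tensor_id_def by (rule sum.cong) (simp_all add: deb)
   ultimately show ?thesis by (simp add: de)
  qed
  finally show "(comult G \<circ> \<delta> xi) i = coact_tensor_id n \<delta> (\<delta> xi) i" .
  qed
  moreover have "counit G \<circ> \<delta> xi = xi" if "xi \<in> Cpow n" for xi
  proof
  fix i
  have "counit G (ent ?u i j) = ent (idm {..<n}) i j" for j
   using arg_cong[OF corepmD(5)[OF U(8)], of "%A. ent A i j"] by (simp add: ent_mapm)
  then have "(counit G \<circ> \<delta> xi) i = (\<Sum>j<n. xi j * ent (idm {..<n}) i j)"
   by (simp add: de lin_sum[OF lin_counit] lin_scale[OF lin_counit] scaleC_complex_def)
  also have "... = fun_of n (idm {..<n}) xi i" using that by (simp add: fun_of_def)
  finally show "(counit G \<circ> \<delta> xi) i = xi i" using fun_of_idm[OF that] by simp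
  qed
  moreover have "(\<Sum>i<n. star (\<delta> xi i) * \<delta> eta i) = inner_prod n xi eta *\<^sub>C 1" for xi eta
  proof -
  have uu: "(\<Sum>i<n. star (ent ?u i j) * ent ?u i k) = ent (idm {..<n}) j k" for j k
  proof -
   have "ent (ad ?u ** ?u) j k = (\<Sum>i<n. ent (ad ?u) j i * ent ?u i k)"
    by (rule ent_mm) (use s in \<open>auto simp: idm_mm_iff\<close>)
   then show ?thesis using U(4) by (simp add: ent_ad)
  qed
  have "(\<Sum>i<n. star (\<delta> xi i) * \<delta> eta i)
    = (\<Sum>i<n. \<Sum>j<n. \<Sum>k<n. (cnj (xi j) * eta k) *\<^sub>C (star (ent ?u i j) * ent ?u i k))"
   by (simp add: de star_sum star_scaleC sum_product mult_scaleC_left mult_scaleC_right scaleC_scaleC mult.commute)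
  also have "... = (\<Sum>j<n. \<Sum>i<n. \<Sum>k<n. (cnj (xi j) * eta k) *\<^sub>C (star (ent ?u i j) * ent ?u i k))"
   by (rule sum.swap)
  also have "... = (\<Sum>j<n. \<Sum>k<n. \<Sum>i<n. (cnj (xi j) * eta k) *\<^sub>C (star (ent ?u i j) * ent ?u i k))"
   by (intro sum.cong refl sum.swap)
  also have "... = (\<Sum>j<n. \<Sum>k<n. (cnj (xi j) * eta k) *\<^sub>C ent (idm {..<n}) j k)"
   by (simp add: uu flip: scaleC_sum_right)
  also have "... = (\<Sum>j<n. \<Sum>k<n. if k = j then (cnj (xi j) * eta k) *\<^sub>C 1 else 0)"
   by (intro sum.cong refl) (auto simp: ent_idm)
  also have "... = inner_prod n xi eta *\<^sub>C 1" by (simp add: inner_prod_def scaleC_sum_left)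
  finally show ?thesis .
  qed
  ultimately show "unitary_corep G (corep_of n (cor N))"
  using l by (simp add: V' unitary_corep_def corepresentation_def)
qed

text \<open>Invariant subspaces of a unitary corepresentation are reducing: the antipode, applied
  entrywise to the invariance relation, gives the same relation for
  \<open>ad (cor M)\<close>.\<close>

lemma proj_commutes:
  assumes M: "uobj X iv M" and p: "proj p" "sc p ** cor M ** sc p = cor M ** sc p"
  shows "sc p ** cor M = cor M ** sc p"
proof -
  have "sc p ** mapm (antipode G) (cor M) ** sc p = mapm (antipode G) (sc p ** cor M ** sc p)"
  by (simp add: mapm_sc_mm mapm_mm_sc lin_antipode)
  also have "... = mapm (antipode G) (cor M) ** sc p"
  unfolding p(2) by (rule mapm_mm_sc[OF lin_antipode])
  finally have "sc p ** ad (cor M) ** sc p = ad (cor M) ** sc p" by (simp add: uobjD(9)[OF M])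
  from arg_cong[OF this, of ad] have "sc p ** cor M ** sc p = sc p ** cor M"
  by (simp add: ad_mm ad_sc projD[OF p(1)] mm_assoc)
  with p(2) show ?thesis by simp
qed

text \<open>A non-scalar endomorphism yields a reducing projection and so a proper invariant
  subspace. Conversely, the projection onto an invariant subspace commutes with the corepresentation
  by \<open>proj_commutes\<close>; being scalar, it is 0 or the identity.\<close>

lemma irreducible_corep_iff:
  assumes V: "unitary_corep G V"
  shows "irreducible_corep V \<longleftrightarrow> qirr {} (obc V)"
proof -
  obtain n \<delta> where V': "V = (n, \<delta>)" by (cases V)
  note U = unitary_corep_uobj(1)[OF V, of id] unitary_corep_uobj(2)[OF V]
  note l = U(2)[unfolded V' fst_conv snd_conv]
  let ?M = "obc V"
  have prM: "pr ?M = idm {..<n}" by (simp add: V')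
  have ent_u: "\<delta> xi i = (\<Sum>j<n. xi j *\<^sub>C ent (cor ?M) i j)" if "xi \<in> Cpow n" for xi i
  proof -
  have "\<delta> (ebasis j) i = ent (cor ?M) i j" if "j < n" for j
   using clinear_on_in[OF l ebasis_Cpow[OF that]] that by (auto simp: ent_obc V' Cpow_def)
  then show ?thesis by (subst clinear_on_expand[OF l that]) (simp add: sum_fun_apply scaleC_fun_apply)
  qed
  have idm0: "idm {..<n} = (0 :: (nat, nat) cmat) \<longleftrightarrow> n = 0"
  proof
  assume z: "idm {..<n} = (0 :: (nat, nat) cmat)"
  have "trace (idm {..<n} :: (nat, nat) cmat) = of_nat n" by simp
  then show "n = 0" using z by simp
  next
  assume "n = 0"
  then show "idm {..<n} = (0 :: (nat, nat) cmat)" by (intro fmat_eqI) (simp add: ent_idm)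
  qed
  show ?thesis
  proof
  assume irr: "irreducible_corep V"
  show "qirr {} ?M"
  proof (rule ccontr)
   assume "\<not> qirr {} ?M"
   moreover have "n ~= 0" using irr by (simp add: irreducible_corep_def V')
   ultimately have "\<not> (\<forall>T\<in>QHom {} ?M ?M. \<exists>c. T = c *\<^sub>C pr ?M)"
    by (simp only: irr_def fam_simps prM idm0) simp
   then obtain T where T: "T \<in> QHom {} ?M ?M" "\<nexists>c. T = c *\<^sub>C pr ?M" by blast
   obtain p where p: "proj p" "p \<in> QHom {} ?M ?M" "p ~= 0" "p ~= pr ?M"
    using reducible_projection[OF star_family_fam[OF U(1)] _ T(1)] T(2) \<open>n ~= 0\<close> idm0 prM
    by (metis fam_simps(1))
   have ps: "idm {..<n} ** p = p" "p ** idm {..<n} = p" using p(2) by (simp_all add: QHom_iff V')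
   let ?T = "fun_of n p"
   have TM: "?T \<in> Mor V V" using Mor_iff[OF U(2,2), of p] p(2) ps by (simp add: V')
   define W where "W = ?T ` Cpow n"
   have TT: "?T (?T xi) = ?T xi" if "xi \<in> Cpow n" for xi
    using fun_of_mm[OF ps that, of p] projD(2)[OF p(1)] by simp
   have lT: "clinear_on (Cpow n) (Cpow n) ?T" by (rule clinear_fun_of[OF ps(1)])
   have W: "csubspace W" "W <= Cpow n"
   proof -
    show "W <= Cpow n" using clinear_on_in[OF lT] by (auto simp: W_def)
    have fixW: "w \<in> W \<longleftrightarrow> w \<in> Cpow n \<and> ?T w = w" for w
     using TT clinear_on_in[OF lT] unfolding W_def by (auto intro: rev_image_eqI)
    show "csubspace W"
    proof (rule complex_vector.subspaceI)
     show "0 \<in> W" using Cpow_subspace[of n, where 'b = complex]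
      by (auto simp: fixW fun_of_def fun_eq_iff complex_vector.subspace_0)
     show "x + y \<in> W" if "x \<in> W" "y \<in> W" for x y
      using that lT by (simp add: fixW clinear_on_def complex_vector.subspace_add[OF Cpow_subspace])
     show "c *\<^sub>C x \<in> W" if "x \<in> W" for c x
      using that lT by (simp add: fixW clinear_on_def complex_vector.subspace_scale[OF Cpow_subspace])
    qed
   qed
   have "\<delta> xi \<in> cspan {elem_tensor w x | w x. w \<in> W}" if xi: "xi \<in> W" for xi
   proof -
    have xi': "xi \<in> Cpow n" "?T xi = xi" using xi TT W by (auto simp: W_def)
    have "\<delta> (?T xi) = map_tensor_id n ?T (\<delta> xi)" using TM xi'(1) by (simp add: Mor_def V')
    then have "\<delta> xi = (\<Sum>j<n. elem_tensor (?T (ebasis j)) (\<delta> xi j))"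
     using xi'(2) by (simp add: map_tensor_id_def)
    moreover have "elem_tensor (?T (ebasis j)) (\<delta> xi j) \<in> {elem_tensor w x | w x. w \<in> W}" if "j < n" for j
     using ebasis_Cpow[OF that] by (auto simp: W_def)
    ultimately show ?thesis
     by (metis (no_types, lifting) complex_vector.span_sum complex_vector.span_base lessThan_iff)
   qed
   then have "W = {0} \<or> W = Cpow n" using irr W by (simp add: irreducible_corep_def V')
   then show False
   proof
    assume "W = {0}"
    then have "?T xi = 0" if "xi \<in> Cpow n" for xi using that by (auto simp: W_def)
    then have "ent p i j = 0" if "j < n" for i j
     using fun_of_ebasis[OF that, of p i] ebasis_Cpow[OF that] by simp
    then have "p = 0" using ps(2) by (intro fmat_eqI) (auto simp: mm_idm_iff)
    then show False using p(3) by simp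
   next
    assume "W = Cpow n"
    then have "?T xi = xi" if "xi \<in> Cpow n" for xi using that TT unfolding W_def by (metis imageE)
    then have "fun_of n p xi = fun_of n (idm {..<n}) xi" for xi
     by (cases "xi \<in> Cpow n") (simp_all add: fun_of_idm, simp add: fun_of_def)
    then have "fun_of n p = fun_of n (idm {..<n})" by blast
    then have "p = idm {..<n}" by (rule fun_of_inject) (simp_all add: ps)
    then show False using p(4) prM by simp
   qed
  qed
  next
  assume qi: "qirr {} ?M"
  show "irreducible_corep V"
   unfolding irreducible_corep_def V' prod.case
  proof (intro conjI allI impI)
   show "n ~= 0" using qi idm0 by (auto simp: irr_def V')
   fix W assume W: "csubspace W \<and> W <= Cpow n \<and> (\<forall>xi\<in>W. \<delta> xi \<in> cspan {elem_tensor w x | w x. w \<in> W})"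
   let ?W = "{w :: (nat, unit) cmat. idm {..<n} ** w = w \<and> (%i. ent w i ()) \<in> W}"
   have Wsub: "csubspace ?W"
    using W by (auto simp: complex_vector.subspace_def mm_linear zero_fun_def plus_fun_def
      scaleC_fun_def ent_add ent_scaleC)
   obtain r and Z :: "(nat, nat) cmat" where Z: "ad Z ** Z = idm {..<r}" "Z ** idm {..<r} = Z"
    "proj (Z ** ad Z)" "!!w. Z ** ad Z ** w \<in> ?W" "!!w. w \<in> ?W ==> Z ** ad Z ** w = w"
    by (rule proj_onto_subspace[of "{..<n}" ?W]) (use Wsub in auto)
   define p where "p = Z ** ad Z"
   have p: "proj p" "!!w. p ** w \<in> ?W" "!!w. w \<in> ?W ==> p ** w = w" using Z by (simp_all add: p_def)
   have ps: "idm {..<n} ** p = p" by (rule column_ext) (use p(2) in \<open>simp add: mm_assoc\<close>)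
   have ps': "p ** idm {..<n} = p" using arg_cong[OF ps, of ad] projD[OF p(1)] by (simp add: ad_mm)
   have pW: "(%i. ent p i k) \<in> W" for k
    using p(2)[of "unitm k ()"] by (simp add: ent_mm_unitm)
   have pfix: "(\<Sum>j<n. ent p i j * w j) = w i" if "w \<in> W" for w i
   proof -
    define c :: "(nat, unit) cmat" where "c = mk {..<n} UNIV (%i _. w i)"
    have w0: "w i = 0" if "\<not> i < n" for i using \<open>w \<in> W\<close> W that by (auto simp: Cpow_def)
    then have ec: "ent c i u = w i" for i u by (auto simp: c_def ent_mk)
    have "idm {..<n} ** c = c" using w0 by (auto simp: idm_mm_iff ec)
    then have "c \<in> ?W" using that by (simp add: ec)
    then have "ent (p ** c) i () = ent c i ()" using p(3) by simp
    moreover have "ent (p ** c) i () = (\<Sum>j<n. ent p i j * ent c j ())"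
     by (rule ent_mm_supp) (rule \<open>idm {..<n} ** c = c\<close>)
    ultimately show ?thesis by (simp add: ec)
   qed
   \<comment> \<open>The map p \<otimes> id fixes W \<otimes> \<complex>[\<Gamma>], which will be
     applied to the columns of \<open>cor ?M ** sc p\<close>.\<close>
   have pspan: "(\<Sum>j<n. ent p i j *\<^sub>C s j) = s i" if "s \<in> cspan {elem_tensor w x | w x. w \<in> W}" for s :: "nat => 'a" and i
    using that
   proof (induction rule: complex_vector.span_induct_alt)
    case base then show ?case by simp
   next
    case (step c y z)
    then obtain w x where y: "y = elem_tensor w x" "w \<in> W" by auto
    have "(\<Sum>j<n. ent p i j *\<^sub>C y j) = (\<Sum>j<n. ent p i j * w j) *\<^sub>C x"
     by (simp add: y elem_tensor_def scaleC_sum_left scaleC_scaleC)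
    then have 1: "(\<Sum>j<n. ent p i j *\<^sub>C y j) = y i" using pfix[OF y(2)] by (simp add: y elem_tensor_def)
    have "(\<Sum>j<n. ent p i j *\<^sub>C (c *\<^sub>C y + z) j)
      = c *\<^sub>C (\<Sum>j<n. ent p i j *\<^sub>C y j) + (\<Sum>j<n. ent p i j *\<^sub>C z j)"
     by (simp add: scaleC_fun_apply scaleC_add_right sum.distrib scaleC_sum_right scaleC_scaleC mult.commute)
    then show ?case using 1 step by (simp add: scaleC_fun_apply)
   qed
   have up: "ent (cor ?M ** sc p) i k = \<delta> (%i. ent p i k) i" for i k
    using ent_u[of "%i. ent p i k" i] pW[of k] W by (auto simp: ent_mm_sc_supp[OF ps])
   have "sc p ** (cor ?M ** sc p) = cor ?M ** sc p"
   proof (rule fmat_eqI)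
    fix i k
    have "\<delta> (%i. ent p i k) \<in> cspan {elem_tensor w x | w x. w \<in> W}" using pW W by blast
    from pspan[OF this, of i] show "ent (sc p ** (cor ?M ** sc p)) i k = ent (cor ?M ** sc p) i k"
     by (simp only: ent_sc_mm_supp[OF ps'] up)
   qed
   then have "sc p ** cor ?M = cor ?M ** sc p"
    using proj_commutes[OF U(1) p(1)] by (simp add: mm_assoc)
   then have "p \<in> QHom {} ?M ?M" using ps ps' by (simp add: QHom_iff V')
   then obtain c where c: "p = c *\<^sub>C idm {..<n}" using qi by (auto simp: irr_def V')
   have "p = 0 \<or> p = idm {..<n}"
   proof (cases "n = 0")
    case False
    have "c *\<^sub>C c *\<^sub>C idm {..<n} = c *\<^sub>C (idm {..<n} :: (nat, nat) cmat)"
     using projD(2)[OF p(1)] by (simp add: c mm_linear)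
    then have "(c * c - c) *\<^sub>C (idm {..<n} :: (nat, nat) cmat) = 0"
     by (simp add: scaleC_scaleC complex_vector.scale_left_diff_distrib)
    then have "c * (c - 1) = 0" using False idm0 by (simp add: algebra_simps)
    then have "c = 0 \<or> c = 1" by simp
    then show ?thesis using c by (auto simp: scaleC_one)
   qed (use c idm0 in auto)
   then show "W = {0} \<or> W = Cpow n"
   proof
    assume "p = 0"
    then have "w = 0" if "w \<in> W" for w using pfix[OF that] by (auto simp: fun_eq_iff)
    then show ?thesis using W complex_vector.subspace_0 by auto
   next
    assume pi: "p = idm {..<n}"
    have "w \<in> W" if w: "w \<in> Cpow n" for w
    proof -
     have "w = (\<Sum>j<n. w j *\<^sub>C (%i. ent p i j))"
     proof
      fix i
      have "fun_of n p w i = w i" using fun_of_idm[OF w] by (simp add: pi)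
      then show "w i = (\<Sum>j<n. w j *\<^sub>C (%i. ent p i j)) i"
       using w by (simp add: fun_of_def sum_fun_apply scaleC_fun_apply scaleC_complex_def)
     qed
     moreover have "(\<Sum>j<n. w j *\<^sub>C (%i. ent p i j)) \<in> W"
      using W pW by (intro complex_vector.subspace_sum complex_vector.subspace_scale) auto
     ultimately show ?thesis by simp
    qed
    then show ?thesis using W by blast
   qed
  qed
  qed
qed

section \<open>The fusion ring\<close>

abbreviation irrs :: "'a corep set set" where "irrs \<equiv> rbasis (Fus G)"

text \<open>The same choice of representative as in \<open>fusion_coeff\<close>, so that the
  structure constants refer to exactly these objects.\<close>

definition rep :: "'a corep set => (nat, 'a, unit) qobj" where
  "rep a = obc (SOME V. V \<in> a)"

lemma irrs_def': "irrs = irr_coreps G // irr_equiv G"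
  by (simp add: Fus_def)

lemma irr_coreps_iff: "V \<in> irr_coreps G \<longleftrightarrow> unitary_corep G V \<and> qirr {} (obc V)"
  by (auto simp: irr_coreps_def irreducible_corep_iff)

lemma irr_equiv_iff:
  "(V, W) \<in> irr_equiv G \<longleftrightarrow> V \<in> irr_coreps G \<and> W \<in> irr_coreps G \<and> qequiv {} (obc V) (obc W)"
  by (auto simp: irr_equiv_def irr_coreps_iff equivalent_corep_iff unitary_corep_uobj(2))

lemma irr_coreps_uobj: "V \<in> irr_coreps G ==> uobj {} iv (obc V)"
  by (simp add: irr_coreps_iff unitary_corep_uobj(1))

lemma obc_refl: "V \<in> irr_coreps G ==> qequiv {} (obc V) (obc V)"
  by (rule equivf_refl[OF star_family_fam[OF irr_coreps_uobj[of _ id]]])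

lemma equiv_irr_equiv: "equiv (irr_coreps G) (irr_equiv G)"
proof (rule equivI)
  show "irr_equiv G <= irr_coreps G \<times> irr_coreps G" by (auto simp: irr_equiv_iff)
  show "refl_on (irr_coreps G) (irr_equiv G)" by (auto simp: refl_on_def irr_equiv_iff obc_refl)
  show "sym (irr_equiv G)" by (auto simp: sym_def irr_equiv_iff intro: equivf_sym)
  show "trans (irr_equiv G)" by (auto simp: trans_def irr_equiv_iff intro: equivf_trans)
qed

lemma irrs_rep:
  assumes "a \<in> irrs"
  obtains V where "V \<in> irr_coreps G" "rep a = obc V" "V \<in> a" "V = (SOME V. V \<in> a)"
  "!!W. W \<in> a \<longleftrightarrow> W \<in> irr_coreps G \<and> qequiv {} (obc V) (obc W)"
proof -
  have a: "a \<in> irr_coreps G // irr_equiv G" using assms by (simp add: irrs_def')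
  obtain V0 where V0: "V0 \<in> irr_coreps G" "a = irr_equiv G `` {V0}" using a by (auto simp: quotient_def)
  have ne: "V0 \<in> a" using V0 obc_refl by (simp add: irr_equiv_iff)
  define V where "V = (SOME V. V \<in> a)"
  have V: "V \<in> a" unfolding V_def by (rule someI[of _ V0]) (rule ne)
  have "a = irr_equiv G `` {V}"
  using V0 V equiv_class_eq[OF equiv_irr_equiv] by auto
  then have 1: "W \<in> a \<longleftrightarrow> W \<in> irr_coreps G \<and> qequiv {} (obc V) (obc W)" for W
  using V V0 by (auto simp: irr_equiv_iff)
  have 2: "V \<in> irr_coreps G" using V V0 by (auto simp: irr_equiv_iff)
  show thesis
  proof (rule that[OF 2 _ V V_def 1])
  show "rep a = obc V" by (simp add: rep_def V_def)
  qed
qed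

lemma transversal_rep: "transversal {} iv irrs rep"
  unfolding transversal_def
proof (intro conjI ballI impI)
  fix a assume a: "a \<in> irrs"
  show "uobj {} iv (rep a)" "qirr {} (rep a)"
  using irrs_rep[OF a] unitary_corep_uobj(1) by (metis irr_coreps_iff)+
  fix b assume b: "b \<in> irrs" and e: "qequiv {} (rep a) (rep b)"
  obtain V where V: "V \<in> irr_coreps G" "rep a = obc V" "V \<in> a" "V = (SOME V. V \<in> a)"
  "!!W. W \<in> a \<longleftrightarrow> W \<in> irr_coreps G \<and> qequiv {} (obc V) (obc W)" using irrs_rep[OF a] by blast
  obtain W where W: "W \<in> irr_coreps G" "rep b = obc W" "W \<in> b" "W = (SOME W. W \<in> b)"
  "!!U. U \<in> b \<longleftrightarrow> U \<in> irr_coreps G \<and> qequiv {} (obc W) (obc U)" using irrs_rep[OF b] by blast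
  have "qequiv {} (obc V) (obc W)" using e V(2) W(2) by simp
  then have "qequiv {} (obc V) (obc U) \<longleftrightarrow> qequiv {} (obc W) (obc U)" for U
  using equivf_trans equivf_sym by blast
  then show "a = b" using V(5) W(5) by blast
qed

text \<open>An irreducible object that is not unitary is first replaced by an equivalent unitary
  one. This is what assigns a class to a conjugate.\<close>

lemma irr_class:
  fixes M :: "('i, 'a, unit) qobj"
  assumes M: "cobj {} M" "qirr {} M"
  obtains a where "a \<in> irrs" "qequiv {} (rep a) M"
proof -
  obtain n and N :: "(nat, 'a, unit) qobj" where N: "uobj {} id N" "pr N = idm {..<n}" "qequiv {} M N"
  using unitary_equivalent[OF cobjD(1)[OF M(1)]] by blast
  define V where "V = corep_of n (cor N)"
  note U = uobj_unitary_corep[OF N(1,2), folded V_def]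
  have NV: "qequiv {} N (obc V)"
  proof (rule qequivI)
  show "pr N \<in> QHom {} N (obc V)" "pr N \<in> QHom {} (obc V) N"
   using U(2,3) uobjD[OF N(1)] by (simp_all add: QHom_iff projD)
  qed (use U(3) uobjD(1)[OF N(1)] in \<open>simp_all add: projD\<close>)
  have MV: "qequiv {} M (obc V)" by (rule equivf_trans[OF N(3) NV])
  have V: "V \<in> irr_coreps G" using U(1) irr_equiv_invariant[OF MV M(2)] by (simp add: irr_coreps_iff)
  let ?a = "irr_equiv G `` {V}"
  have a: "?a \<in> irrs" using V by (auto simp: irrs_def' intro: quotientI)
  obtain W where W: "rep ?a = obc W" "W \<in> ?a" using irrs_rep[OF a] by blast
  have "qequiv {} (obc V) (obc W)" using W(2) by (simp add: irr_equiv_iff)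
  then have "qequiv {} (rep ?a) M" using W(1) MV equivf_sym equivf_trans by metis
  with a that show thesis by blast
qed

lemma trivial_obc: "obc (trivial_corep 1) = (idm {..<1}, idm {..<1}, %_. 0)"
  by (intro prod_eqI fmat_eqI ext) (auto simp: obc_def trivial_corep_def ent_mk ent_idm elem_tensor_def ebasis_def scaleC_one)

lemmas trivial_obc' = trivial_obc[unfolded One_nat_def]

lemma unit_irr: "trivial_corep 1 \<in> irr_coreps G"
proof -
  have "lincorep (trivial_corep 1 :: 'a corep)"
  by (auto simp: trivial_corep_def clinear_on_def Cpow_def elem_tensor_def fun_eq_iff scaleC_add_left
    scaleC_fun_apply scaleC_scaleC scaleC_complex_def)
  let ?I = "idm {..<1} :: (nat, nat) cmat"
  have I: "idm {..<1} = (sc ?I :: (nat, nat, 'a) fmat)" by simp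
  have m: "mapm f (idm {..<1}) = (idm {..<1} :: (nat, nat, ('a, 'a) tensor) fmat)"
  if "f = comult G \<or> f = leg1 \<or> f = leg2" for f
  unfolding I using that mapm_sc[of f ?I] lin_comult lin_leg1 lin_leg2 by (auto simp: comult_one tensor_one)
  have e: "mapm (counit G) (idm {..<1}) = ?I"
  unfolding I using mapm_sc[OF lin_counit counit_one, of ?I] by simp
  have "ucorepm ?I (idm {..<1})" using m e by (simp add: ucorepm_def corepm_def)
  then have "uobj {} id (?I, idm {..<1} :: (nat, nat, 'a) fmat, %_ :: unit. 0)"
  by (simp add: uobj_def star_family_def)
  from uobj_unitary_corep(1)[OF this, of 1]
  have u: "unitary_corep G (corep_of 1 (idm {..<1}))" by simp
  have c: "snd (corep_of 1 (idm {..<1}) :: 'a corep) xi = snd (trivial_corep 1) xi" if "xi \<in> Cpow 1" for xi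
  proof
  fix i
  show "snd (corep_of 1 (idm {..<1}) :: 'a corep) xi i = snd (trivial_corep 1) xi i"
   using that by (cases "i = 0") (auto simp: corep_of_def trivial_corep_def elem_tensor_def ent_idm Cpow_def)
  qed
  have "unitary_corep G (trivial_corep 1)"
  proof -
  let ?V = "corep_of 1 (idm {..<1}) :: 'a corep" and ?W = "trivial_corep 1 :: 'a corep"
  have f: "fst ?V = 1" "fst ?W = 1" by (simp_all add: corep_of_def trivial_corep_def)
  have d: "coact_tensor_id 1 (snd ?V) s = coact_tensor_id 1 (snd ?W) s" for s :: "nat => 'a"
   using c[OF ebasis_Cpow[of 0 1]] by (simp add: coact_tensor_id_def)
  show ?thesis using u c d \<open>lincorep ?W\<close> unfolding unitary_corep_def corepresentation_def
   by (simp add: case_prod_unfold f del: One_nat_def)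
  qed
  moreover have "qirr {} (obc (trivial_corep 1 :: 'a corep))"
  unfolding irr_def
  proof (intro conjI ballI)
  have "ent ?I 0 0 ~= 0" by (simp add: ent_idm)
  then show "fst (fam (obc (trivial_corep 1 :: 'a corep))) ~= 0"
   by (auto simp: trivial_obc simp del: One_nat_def)
  fix T assume "T \<in> QHom {} (obc (trivial_corep 1 :: 'a corep)) (obc (trivial_corep 1))"
  then have s: "idm {..<1} ** T = T" "T ** idm {..<1} = T"
   by (simp_all add: QHom_iff trivial_corep_def)
  then have "T = ent T 0 0 *\<^sub>C ?I"
   by (intro fmat_eqI) (auto simp: ent_scaleC ent_idm scaleC_complex_def idm_mm_iff mm_idm_iff neq0_conv[symmetric] simp del: neq0_conv)
  then show "\<exists>c. T = c *\<^sub>C fst (fam (obc (trivial_corep 1 :: 'a corep)))"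
   by (auto simp: trivial_corep_def)
  qed
  ultimately show ?thesis by (simp add: irr_coreps_iff)
qed

abbreviation unit_class :: "'a corep set" where "unit_class \<equiv> runit (Fus G)"

lemma unit_class: "unit_class \<in> irrs" "qequiv {} (rep unit_class) (obc (trivial_corep 1))"
proof -
  show 1: "unit_class \<in> irrs" using unit_irr by (auto simp: Fus_def intro: quotientI)
  obtain V where "rep unit_class = obc V" "V \<in> unit_class" using irrs_rep[OF 1] by blast
  then show "qequiv {} (rep unit_class) (obc (trivial_corep 1))"
  by (auto simp: Fus_def irr_equiv_iff intro: equivf_sym)
qed

lemma qtens_trivial:
  assumes M: "cobj X M"
  shows "qequiv X (qtens M (obc (trivial_corep 1))) M"
proof -
  let ?g = "%i. (i, 0 :: nat)"
  have g: "inj ?g" by (simp add: inj_def)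
  have "qre ?g (qtens M (obc (trivial_corep 1))) = M"
  by (intro prod_eqI fmat_eqI ext) (simp_all add: trivial_obc trivial_obc' ent_rr[OF g] ent_cr[OF g] ent_kr ent_idm)
  moreover have "cobj {} (obc (trivial_corep 1))"
  by (rule uobj_cobj[OF irr_coreps_uobj[OF unit_irr, of id]])
  moreover have "cols (pr (qtens M (obc (trivial_corep 1)))) <= range ?g"
  proof
  fix x assume "x \<in> cols (pr (qtens M (obc (trivial_corep 1))))"
  then obtain y where "ent (pr (qtens M (obc (trivial_corep 1)))) y x ~= 0" by (auto simp: cols_def ent_def in_keys_iff)
  then show "x \<in> range ?g" by (cases x; cases y) (auto simp: ent_kr ent_idm trivial_corep_def split: if_splits)
  qed
  ultimately show ?thesis
  using qequiv_qre[OF cobj_qtens[OF M] g] by metis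
qed

lemma qequiv_qtens_unit:
  assumes M: "cobj X M"
  shows "qequiv X (qtens M (rep unit_class)) M"
  using equivf_trans[OF qequiv_qtens[OF cobj_refl[OF M] unit_class(2)] qtens_trivial[OF M]] .

text \<open>On a unitary corepresentation the antipode of an entry is \<open>star\<close> of the
  transposed entry, so the dual corepresentation has the entrywise conjugate matrix. It is
  irreducible but possibly not unitary, and \<open>irr_class\<close> finds its class
  \<open>b\<close>.\<close>

lemma rbar_class:
  assumes a: "a \<in> irrs"
  shows "rbar (Fus G) a \<in> irrs" "qequiv {} (qconj (rep a)) (rep (rbar (Fus G) a))"
proof -
  obtain V where V: "V \<in> irr_coreps G" "rep a = obc V" "V \<in> a" "V = (SOME V. V \<in> a)"
  "!!W. W \<in> a \<longleftrightarrow> W \<in> irr_coreps G \<and> qequiv {} (obc V) (obc W)" using irrs_rep[OF a] by blast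
  have dual: "obc (dual_corep G W) = qconj (obc W)" "lincorep (dual_corep G W)" if W: "W \<in> irr_coreps G" for W
  proof -
  obtain n \<delta> where W': "W = (n, \<delta>)" by (cases W)
  have u: "uobj {} id (obc W)" using W unitary_corep_uobj(1) by (auto simp: irr_coreps_iff)
  have S: "antipode G (ent (cor (obc W)) j i) = star (ent (cor (obc W)) i j)" for i j
   using arg_cong[OF uobjD(9)[OF u], of "%A. ent A j i"]
   by (simp add: ent_mapm lin_zero[OF lin_antipode] ent_ad)
  have e: "ent (cor (obc (dual_corep G W))) i j = star (ent (cor (obc W)) i j)" for i j
   using S[of j i] by (auto simp: ent_obc W' dual_corep_def sum_ebasis)
  show "obc (dual_corep G W) = qconj (obc W)"
   by (intro prod_eqI fmat_eqI ext) (simp_all add: e ent_cj, simp_all add: W' dual_corep_def ent_idm)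
  show "lincorep (dual_corep G W)"
   by (auto simp: clinear_on_def dual_corep_def W' Cpow_def fun_eq_iff scaleC_fun_apply
     scaleC_add_left sum.distrib scaleC_sum_right scaleC_scaleC scaleC_complex_def)
  qed
  have uV: "uobj {} id (obc V)" "qirr {} (obc V)" using V(1) unitary_corep_uobj(1) by (auto simp: irr_coreps_iff)
  have ci: "qirr {} (qconj (obc V))"
  unfolding irr_def
  proof (intro conjI ballI)
  show "fst (fam (qconj (obc V))) ~= 0" using uV(2) cj_cj[of "pr (obc V)"] by (auto simp: irr_def)
  fix T assume "T \<in> QHom {} (qconj (obc V)) (qconj (obc V))"
  then have T: "cj (pr (obc V)) ** T = T" "T ** cj (pr (obc V)) = T"
   "sc T ** cj (cor (obc V)) = cj (cor (obc V)) ** sc T" by (simp_all add: QHom_iff)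
  have "cj T \<in> QHom {} (obc V) (obc V)"
   using arg_cong[OF T(1), of cj] arg_cong[OF T(2), of cj] arg_cong[OF T(3), of cj]
   by (simp add: QHom_iff cj_mm_complex cj_mm_sc1 cj_mm_sc2 del: obc_simps)
  then obtain c where "cj T = c *\<^sub>C pr (obc V)" using uV(2) by (auto simp: irr_def)
  from arg_cong[OF this, of cj] have "T = cnj c *\<^sub>C cj (pr (obc V))"
   by (intro fmat_eqI) (metis cj_cj ent_cj ent_scaleC star_scaleC)
  then show "\<exists>c. T = c *\<^sub>C fst (fam (qconj (obc V)))" by auto
  qed
  obtain b where b: "b \<in> irrs" "qequiv {} (rep b) (qconj (obc V))"
  using irr_class[OF cobj_qconj[OF uV(1)] ci] by blast
  obtain U where U: "U \<in> irr_coreps G" "rep b = obc U" "U \<in> b" "U = (SOME V. V \<in> b)"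
  "!!W. W \<in> b \<longleftrightarrow> W \<in> irr_coreps G \<and> qequiv {} (obc U) (obc W)" using irrs_rep[OF b(1)] by blast
  have "rbar (Fus G) a = b"
  proof (rule set_eqI)
  fix W
  have "W \<in> rbar (Fus G) a \<longleftrightarrow> W \<in> irr_coreps G \<and> (\<exists>V'\<in>a. equivalent_corep W (dual_corep G V'))"
   by (simp add: Fus_def)
  also have "... \<longleftrightarrow> W \<in> irr_coreps G \<and> (\<exists>V'\<in>a. qequiv {} (obc W) (qconj (obc V')))"
  proof -
   have "equivalent_corep W (dual_corep G V') \<longleftrightarrow> qequiv {} (obc W) (qconj (obc V'))"
    if "W \<in> irr_coreps G" "V' \<in> a" for V'
   proof -
    have "lincorep W" using that(1) by (simp add: irr_coreps_iff unitary_corep_uobj(2))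
    moreover have "V' \<in> irr_coreps G" using that(2) V(5) by blast
    ultimately show ?thesis using equivalent_corep_iff[of W "dual_corep G V'"] dual[of V'] by simp
   qed
   then show ?thesis by blast
  qed
  also have "... \<longleftrightarrow> W \<in> irr_coreps G \<and> qequiv {} (obc W) (qconj (obc V))"
  proof -
   have "qequiv {} (qconj (obc V)) (qconj (obc V'))" if "V' \<in> a" for V'
    using V(5) that qequiv_qconj by blast
   then show ?thesis using V(3) equivf_trans[OF _ equivf_sym] by blast
  qed
  also have "... \<longleftrightarrow> W \<in> b"
  proof -
   have e: "qequiv {} (obc U) (qconj (obc V))" using b(2) U(2) by simp
   have "qequiv {} (obc W) (qconj (obc V)) \<longleftrightarrow> qequiv {} (obc U) (obc W)"
    using equivf_trans[OF e equivf_sym] equivf_trans[OF equivf_sym e] equivf_sym by blast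
   then show ?thesis using U(5) by blast
  qed
  finally show "W \<in> rbar (Fus G) a \<longleftrightarrow> W \<in> b" .
  qed
  then show "rbar (Fus G) a \<in> irrs" "qequiv {} (qconj (rep a)) (rep (rbar (Fus G) a))"
  using b(1) equivf_sym[OF b(2)] V(2) by auto
qed

end

section \<open>Connected components and the module over the fusion ring\<close>

context discrete_quantum_group
begin

text \<open>As \<open>cdim\<close> is 0 for infinite-dimensional spaces too, positivity is read off
  the count of constituents rather than from a nonzero element alone.\<close>

lemma qdim_nonzero:
  assumes C: "uobj X iv C" "qirr X C" and M: "uobj X iv M" and T: "T \<in> QHom X C M" "T ~= 0"
  shows "qdim X C M ~= 0"
proof -
  obtain F where F: "qsplits X M F (%p. p)" "!!p. p \<in> F ==> irr (ix X) (sub p (fam M))"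
  using complete_reducibility[OF star_family_fam[OF M]] by blast
  note F' = splitsD[OF F(1)]
  have "T = (\<Sum>p\<in>F. p ** T)" by (rule splits_expand[OF F(1) HomD(1)[OF T(1)]])
  then obtain p where p: "p \<in> F" "p ** T ~= 0" using T(2) by (metis sum.neutral)
  have "p ** T \<in> Hom (ix X) (fam C) (sub p (fam M))"
  unfolding Hom_to_sub[OF F'(3)[OF p(1)] F'(2)[OF p(1)]]
  using Hom_comp[OF T(1) F'(3)[OF p(1)]] projD(3)[OF F'(2)[OF p(1)]] by simp
  then have "p \<in> {p \<in> F. Hom (ix X) (fam C) (sub p (fam M)) ~= {0}}" using p by blast
  then show ?thesis
  using homdim_splits_irr[OF star_family_fam[OF C(1)] C(2) star_family_fam[OF M] F] F'(1)
  by (metis (no_types, lifting) card_0_eq empty_iff finite_subset mem_Collect_eq subsetI)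
qed

lemma qdim_nonzeroE:
  assumes "qdim X C M ~= 0"
  obtains T where "T \<in> QHom X C M" "T ~= 0"
proof -
  have "QHom X C M ~= {0}"
  proof
  assume "QHom X C M = {0}"
  then have "qdim X C M = 0"
   by (simp add: homdim_def complex_vector.dim_unique[of "{}" "{0}" 0] complex_vector.independent_empty)
  then show False using assms by simp
  qed
  then show thesis using that Hom_zero by blast
qed

lemma rep_D:
  assumes "a \<in> irrs"
  shows "uobj {} iv (rep a)" "qirr {} (rep a)" "cobj {} (rep a)"
  using transversalD[OF transversal_rep assms] uobj_cobj by blast+

text \<open>Bending the right factor exchanges \<open>B\<close> and \<open>C\<close> at the cost of
  conjugating \<open>a\<close>.\<close>

lemma qdim_rbar:
  assumes a: "a \<in> irrs" and B: "uobj X iv B" and C: "uobj X iv C"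
  shows "qdim X B (qtens C (rep (rbar (Fus G) a))) = qdim X C (qtens B (rep a))"
proof -
  note cB = uobj_cobj[OF B] and cC = uobj_cobj[OF C]
  have "qdim X B (qtens C (rep (rbar (Fus G) a))) = qdim X B (qtens C (qconj (rep a)))"
  by (rule homdim_equiv[OF cobj_refl[OF cB] qequiv_qtens[OF cobj_refl[OF cC] equivf_sym[OF rbar_class(2)[OF a]]]])
  also have "... = qdim X (qtens B (rep a)) C" by (rule qdim_bendr[OF cB cC rep_D(1)[OF a, of id]])
  also have "... = qdim X C (qtens B (rep a))"
  by (rule homdim_sym[OF star_family_fam[OF uobj_qtens[OF B rep_D(1)[OF a, of id]]] star_family_fam[OF C]])
  finally show ?thesis .
qed

text \<open>\<open>C\<close> occurs in \<open>B\<close> tensored with an irreducible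
  corepresentation. On irreducible objects this is an equivalence relation whose classes are the
  connected components.\<close>

definition linked :: "'x set => ('i, 'a, 'x) qobj => ('j, 'a, 'x) qobj => bool" where
  "linked X C B \<longleftrightarrow> (\<exists>a\<in>irrs. qdim X C (qtens B (rep a)) ~= 0)"

lemma linked_sym:
  assumes "uobj X iv B" "uobj X iv C" "linked X C B"
  shows "linked X B C"
proof -
  obtain a where a: "a \<in> irrs" "qdim X C (qtens B (rep a)) ~= 0" using assms(3) by (auto simp: linked_def)
  then have "qdim X B (qtens C (rep (rbar (Fus G) a))) ~= 0" using qdim_rbar[OF a(1) assms(1,2)] by simp
  then show ?thesis using rbar_class(1)[OF a(1)] by (auto simp: linked_def)
qed

lemma sub_irr_class:
  assumes N: "uobj {} iv (N :: ('i, 'a, unit) qobj)" and p: "proj p" "p \<in> QHom {} N N" "qirr {} (qsub p N)"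
  shows "\<exists>a\<in>irrs. qequiv {} (rep a) (qsub p N)"
  using irr_class[OF uobj_cobj[OF uobj_qsub[OF N p(1,2)]] p(3)] by blast

lemma linkedI:
  assumes B: "uobj X iv B" and C: "uobj X iv C" "qirr X C" and N: "uobj {} jv (N :: ('l, 'a, unit) qobj)"
  and T: "T \<in> QHom X C (qtens B N)" "T ~= 0"
  shows "linked X C B"
proof -
  have "qdim X C (qtens B N) ~= 0"
  by (rule qdim_nonzero[OF C uobj_qtens[OF B N] T])
  also have "qdim X C (qtens B N)
  = (\<Sum>a | a \<in> irrs \<and> qdim {} (rep a) N ~= 0. qdim {} (rep a) N * qdim X C (qtens B (rep a)))"
  by (rule qdim_qtens_right[OF transversal_rep[of jv] N B C sub_irr_class[OF N]])
  finally obtain a where "a \<in> irrs" "qdim X C (qtens B (rep a)) ~= 0"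
  by (metis (no_types, lifting) mem_Collect_eq mult_0_right sum.neutral)
  then show ?thesis by (auto simp: linked_def)
qed

text \<open>The composite of the embeddings through \<open>C\<close> might vanish a priori. It does
  not: \<open>ad T ** T\<close> is a nonzero multiple of the identity of \<open>C\<close>, so
  \<open>T\<close> tensored with an identity kills nothing in the image of \<open>S\<close>.\<close>

lemma linked_trans:
  assumes B: "uobj X iv B" and C: "uobj X iv C" "qirr X C" and D: "uobj X iv D" "qirr X D"
  and DC: "linked X D C" and CB: "linked X C B"
  shows "linked X D B"
proof -
  obtain a where a: "a \<in> irrs" "qdim X D (qtens C (rep a)) ~= 0" using DC by (auto simp: linked_def)
  obtain b where b: "b \<in> irrs" "qdim X C (qtens B (rep b)) ~= 0" using CB by (auto simp: linked_def)
  obtain S where S: "S \<in> QHom X D (qtens C (rep a))" "S ~= 0" using qdim_nonzeroE[OF a(2)] by blast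
  obtain T where T: "T \<in> QHom X C (qtens B (rep b))" "T ~= 0" using qdim_nonzeroE[OF b(2)] by blast
  note ra = rep_D[OF a(1)] and rb = rep_D[OF b(1)]
  have Bb: "uobj X iv (qtens B (rep b))" by (rule uobj_qtens[OF B rb(1)])
  have "ad T ** T \<in> QHom X C C"
  by (rule Hom_comp[OF T(1) Hom_ad[OF star_family_fam[OF C(1)] star_family_fam[OF Bb] T(1)]])
  then obtain c where c: "ad T ** T = c *\<^sub>C pr C" using C(2) by (auto simp: irr_def)
  have c0: "c ~= 0" using c T(2) ad_mm_self_zero[of T] by auto
  let ?K = "kr T (pr (rep a))"
  have K: "?K \<in> QHom X (qtens C (rep a)) (qtens (qtens B (rep b)) (rep a))"
  by (rule QHom_kr[OF T(1) cobj_QHom_id[OF ra(3)]])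
  have KS: "?K ** S \<in> QHom X D (qtens (qtens B (rep b)) (rep a))" by (rule Hom_comp[OF S(1) K])
  have "?K ** S ~= 0"
  proof
  assume z: "?K ** S = 0"
  have "ad ?K ** ?K = c *\<^sub>C kr (pr C) (pr (rep a))"
   using c cobjD(7,8)[OF ra(3)] by (simp add: ad_kr_complex kr_mm_complex kr_scale_left)
  moreover have "ad ?K ** ?K ** S = 0" using z by (simp add: mm_assoc)
  moreover have "kr (pr C) (pr (rep a)) ** S = S" using HomD(1)[OF S(1)] by simp
  ultimately have "c *\<^sub>C S = 0" by (simp add: mm_scale_left)
  then show False using c0 S(2) by simp
  qed
  moreover obtain U U' where U: "U \<in> QHom X (qtens (qtens B (rep b)) (rep a)) (qtens B (qtens (rep b) (rep a)))"
  "U' ** U = pr (qtens (qtens B (rep b)) (rep a))"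
  using qequiv_qtens_assoc[OF uobj_cobj[OF B] rb(3) ra(3)] by (auto simp: equivf_def)
  ultimately have "U ** (?K ** S) ~= 0"
  using HomD(1)[OF KS] mm_eq_assoc[OF U(2), of "?K ** S"] by auto
  then show ?thesis
  using linkedI[OF B D uobj_qtens[OF rb(1)[of id] ra(1)[of id]] Hom_comp[OF KS U(1)]] by blast
qed

lemma linked_refl:
  assumes C: "uobj X iv C" "qirr X C"
  shows "linked X C C"
proof -
  obtain U U' where U: "U' \<in> QHom X C (qtens C (rep unit_class))" "U ** U' = pr C"
  using qequiv_qtens_unit[OF uobj_cobj[OF C(1)]] by (auto simp: equivf_def)
  have "pr C ~= 0" using C(2) by (simp add: irr_def)
  then have "U' ~= 0" using U(2) by auto
  then have "qdim X C (qtens C (rep unit_class)) ~= 0"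
  using qdim_nonzero[OF C uobj_qtens[OF C(1) rep_D(1)[OF unit_class(1), of id]] U(1)] by blast
  then show ?thesis using unit_class(1) by (auto simp: linked_def)
qed

lemma fusion_coeff_qdim:
  assumes "a \<in> irrs" "b \<in> irrs" "c \<in> irrs"
  shows "fusion_coeff a b c = qdim {} (rep c) (qtens (rep a) (rep b))"
proof -
  obtain A where A: "A \<in> irr_coreps G" "rep a = obc A" "A = (SOME V. V \<in> a)" using irrs_rep[OF assms(1)] by metis
  obtain B where B: "B \<in> irr_coreps G" "rep b = obc B" "B = (SOME V. V \<in> b)" using irrs_rep[OF assms(2)] by metis
  obtain C where C: "C \<in> irr_coreps G" "rep c = obc C" "C = (SOME V. V \<in> c)" using irrs_rep[OF assms(3)] by metis
  have l: "lincorep A" "lincorep B" "lincorep C"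
  using A(1) B(1) C(1) by (simp_all add: irr_coreps_iff unitary_corep_uobj(2))
  have B0: "fst B ~= 0" using B(1) by (auto simp: irr_coreps_def irreducible_corep_def)
  note t = qequiv_tensor_corep[OF B0, of A]
  have "fusion_coeff a b c = cdim (Mor C (tensor_corep A B))"
  by (simp add: fusion_coeff_def flip: A(3) B(3) C(3))
  also have "... = qdim {} (obc C) (obc (tensor_corep A B))" by (rule cdim_Mor[OF l(3) t(2)])
  also have "... = qdim {} (obc C) (qtens (obc A) (obc B))"
  by (rule homdim_equiv[OF obc_refl[OF C(1)] equivf_sym[OF t(1)]])
  finally show ?thesis by (simp add: A B C)
qed

lemma rmult_Fus: "rmult (Fus G) = bilin irrs fusion_coeff"
  by (simp add: Fus_def bilin_def fun_eq_iff)

text \<open>Here the hypothesis on the fusion ring enters. \<open>E\<close> is the basis object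
  matched with the unit of the standard module, so it occurs once in \<open>E \<otimes> c\<close>
  for the trivial class \<open>c\<close> and never otherwise. It is returned as an explicit summand
  of \<open>b0 \<otimes> a\<close>, so that properties stable under tensoring and compression pass
  from \<open>b0\<close> to \<open>E\<close>.\<close>

theorem trivial_multiplicity_object:
  fixes b0 :: "('i, 'a, 'x) qobj"
  assumes stf: "strongly_torsion_free G" and b0: "uobj X iv b0" "qirr X b0"
  obtains E :: "('i \<times> nat, 'a, 'x) qobj" and p and a where "uobj X iv E" "qirr X E" "a \<in> irrs"
  "proj p" "p \<in> QHom X (qtens b0 (rep a)) (qtens b0 (rep a))" "E = qsub p (qtens b0 (rep a))"
  "linked X b0 E" "!!c. c \<in> irrs ==> qdim X E (qtens E (rep c)) = (if c = unit_class then 1 else 0)"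
proof -
  let ?M = "%a. qtens b0 (rep a)"
  have uM: "uobj X iv (?M a)" if "a \<in> irrs" for a by (rule uobj_qtens[OF b0(1) rep_D(1)[OF that, of id]])
  have "\<forall>a\<in>irrs. \<exists>F. qsplits X (?M a) F (%p. p) \<and> (\<forall>p\<in>F. irr (ix X) (sub p (fam (?M a))))"
  using complete_reducibility[OF star_family_fam[OF uM]] by metis
  from bchoice[OF this] obtain F where F: "!!a. a \<in> irrs ==> qsplits X (?M a) (F a) (%p. p)"
  "!!a p. a \<in> irrs ==> p \<in> F a ==> irr (ix X) (sub p (fam (?M a)))" by blast
  have "\<forall>a\<in>irrs. \<exists>h :: nat => _. bij_betw h {0..<card (F a)} (F a)"
  using ex_bij_betw_nat_finite splitsD(1)[OF F(1)] by blast
  from bchoice[OF this] obtain h where h: "!!a. a \<in> irrs ==> bij_betw (h a :: nat => _) {0..<card (F a)} (F a)" by blast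
  \<comment> \<open>Torsion-freeness speaks of bases inside classes \<times> nat; numbering the
    summands of each \<open>b0 \<otimes> a\<close> fits this type.\<close>
  define K where "K = Sigma irrs (%a. {0..<card (F a)})"
  define D where "D k = qsub (h (fst k) (snd k)) (?M (fst k))" for k
  have hK: "fst k \<in> irrs" "h (fst k) (snd k) \<in> F (fst k)" if "k \<in> K" for k
  using that bij_betwE[OF h[of "fst k"]] by (auto simp: K_def)
  have hH: "proj (h (fst k) (snd k))" "h (fst k) (snd k) \<in> QHom X (?M (fst k)) (?M (fst k))" if "k \<in> K" for k
  using splitsD(2,3)[OF F(1)[OF hK(1)[OF that]] hK(2)[OF that]] by blast+
  have D: "uobj X iv (D k)" "qirr X (D k)" if "k \<in> K" for k
  using uobj_qsub[OF uM[OF hK(1)[OF that]] hH[OF that]] F(2)[OF hK[OF that]]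
  by (simp_all add: D_def fam_qsub)
  have D_linked: "linked X (D k) b0" if k: "k \<in> K" for k
  proof -
  let ?p = "h (fst k) (snd k)"
  have "?p \<in> QHom X (D k) (?M (fst k))"
   unfolding D_def fam_qsub Hom_from_sub[OF hH(2)[OF k] hH(1)[OF k]]
   using hH[OF k] projD(2) by blast
  moreover have "?p ~= 0" using D(2)[OF k] by (simp add: irr_def D_def)
  ultimately show ?thesis
   by (rule linkedI[OF b0(1) D[OF k] rep_D(1)[OF hK(1)[OF k], of id]])
  qed
  have cover: "\<exists>k\<in>K. qequiv X (D k) C" if C: "uobj X iv C" "qirr X C" "linked X C b0" for C :: "('l, 'a, 'x) qobj"
  proof -
  obtain a where a: "a \<in> irrs" "qdim X C (?M a) ~= 0" using C(3) by (auto simp: linked_def)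
  have "card {p \<in> F a. Hom (ix X) (fam C) (sub p (fam (?M a))) ~= {0}} ~= 0"
   using homdim_splits_irr[OF star_family_fam[OF C(1)] C(2) star_family_fam[OF uM[OF a(1)]] F(1)[OF a(1)] F(2)[OF a(1)]] a(2)
   by simp
  then have "{p \<in> F a. Hom (ix X) (fam C) (sub p (fam (?M a))) ~= {0}} ~= {}" by (metis card.empty)
  then obtain p where p: "p \<in> F a" "Hom (ix X) (fam C) (sub p (fam (?M a))) ~= {0}" by blast
  have "p \<in> h a ` {0..<card (F a)}" using h[OF a(1)] p(1) by (simp add: bij_betw_def)
  then obtain i where i: "i < card (F a)" "h a i = p" by auto
  have k: "(a, i) \<in> K" using a(1) i(1) by (simp add: K_def)
  have "Hom (ix X) (fam C) (fam (D (a, i))) ~= {0}" using p(2) i(2) by (simp add: D_def fam_qsub)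
  then have "qequiv X C (D (a, i))"
   using irr_equivf_iff[OF star_family_fam[OF C(1)] C(2) star_family_fam[OF D(1)[OF k]] D(2)[OF k]] by blast
  then show ?thesis using k equivf_sym by blast
  qed
  \<comment> \<open>One index per equivalence class: equivalent objects satisfy the same predicate,
    so \<open>SOME\<close> picks the same index for them.\<close>
  define c where "c k = (SOME k'. k' \<in> K \<and> qequiv X (D k') (D k))" for k
  have c: "c k \<in> K" "qequiv X (D (c k)) (D k)" if "k \<in> K" for k
  proof -
  have "\<exists>k'. k' \<in> K \<and> qequiv X (D k') (D k)" using that equivf_refl[OF star_family_fam[OF D(1)[OF that]]] by blast
  from someI_ex[OF this] show "c k \<in> K" "qequiv X (D (c k)) (D k)" unfolding c_def by blast+
  qed
  have c_eq: "c k = c k'" if "qequiv X (D k) (D k')" for k k'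
  proof -
  have "(k'' \<in> K \<and> qequiv X (D k'') (D k)) = (k'' \<in> K \<and> qequiv X (D k'') (D k'))" for k''
   using that equivf_trans equivf_sym by blast
  then show ?thesis unfolding c_def by presburger
  qed
  define J where "J = c ` K"
  have JK: "J <= K" using c by (auto simp: J_def)
  have T: "transversal X iv J D"
  unfolding transversal_def
  proof (intro conjI ballI impI)
  show "uobj X iv (D k)" "qirr X (D k)" if "k \<in> J" for k using D that JK by blast+
  fix j j' assume j: "j \<in> J" "j' \<in> J" "qequiv X (D j) (D j')"
  obtain k k' where k: "k \<in> K" "j = c k" "k' \<in> K" "j' = c k'" using j by (auto simp: J_def)
  have "qequiv X (D k) (D k')"
   using c(2)[OF k(1)] c(2)[OF k(3)] j(3) k(2,4) equivf_trans equivf_sym by metis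
  then show "j = j'" using c_eq k by blast
  qed
  note TJ = transversalD[OF T]
  have coverJ: "\<exists>j\<in>J. qequiv X (D j) C" if C: "uobj X iv C" "qirr X C" "linked X C b0" for C :: "('l, 'a, 'x) qobj"
  proof -
  obtain k where k: "k \<in> K" "qequiv X (D k) C" using cover[OF C] by blast
  then show ?thesis using c[OF k(1)] equivf_trans by (metis J_def imageI)
  qed
  \<comment> \<open>Corepresentations act from the right while based modules are left modules. By
    \<open>n_dual\<close> this number is also the multiplicity of \<open>D y\<close> in
    \<open>D x\<close> tensored with the conjugate of \<open>a\<close>, and conjugation reverses
    products, which turns the right action into a left one.\<close>
  define n where "n a x y = qdim X (D x) (qtens (D y) (rep a))" for a x y
  have n_dual: "n (rbar (Fus G) a) x y = n a y x" if "a \<in> irrs" "x \<in> J" "y \<in> J" for a x y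
  unfolding n_def by (rule qdim_rbar[OF that(1) TJ(1)[OF that(2)] TJ(1)[OF that(3)]])
  have fin1: "finite {y \<in> J. n a y x ~= 0}" if "a \<in> irrs" "x \<in> J" for a x
  unfolding n_def by (rule finite_constituents[OF T uobj_qtens[OF TJ(1)[OF that(2)] rep_D(1)[OF that(1), of id]]])
  have N_dual: "fusion_coeff (rbar (Fus G) a) z b = fusion_coeff a b z"
  if "a \<in> irrs" "b \<in> irrs" "z \<in> irrs" for a b z
  proof -
  note ra = rep_D[OF that(1)] and rb = rep_D[OF that(2)] and rz = rep_D[OF that(3)]
  have a': "rbar (Fus G) a \<in> irrs" using rbar_class(1)[OF that(1)] .
  have "fusion_coeff a b z = qdim {} (rep z) (qtens (rep a) (rep b))" by (rule fusion_coeff_qdim[OF that])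
  also have "... = qdim {} (qtens (qconj (rep a)) (rep z)) (rep b)"
   by (rule qdim_bendl[OF rz(3) rb(3) ra(1)[of id]])
  also have "... = qdim {} (qtens (rep (rbar (Fus G) a)) (rep z)) (rep b)"
   by (rule homdim_equiv[OF qequiv_qtens[OF rbar_class(2)[OF that(1)] cobj_refl[OF rz(3)]] cobj_refl[OF rb(3)]])
  also have "... = qdim {} (rep b) (qtens (rep (rbar (Fus G) a)) (rep z))"
   by (rule homdim_sym[OF star_family_fam[OF uobj_qtens[OF rep_D(1)[OF a', of id] rz(1)[of id]]]
      star_family_fam[OF rb(1)[of id]]])
  also have "... = fusion_coeff (rbar (Fus G) a) z b"
   by (rule fusion_coeff_qdim[OF a' that(3,2), symmetric])
  finally show ?thesis ..
  qed
  have mult: "multiplicities (Fus G) J fusion_coeff n"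
  proof
  show "rmult (Fus G) = bilin irrs fusion_coeff" by (rule rmult_Fus)
  show one: "unit_class \<in> irrs" by (rule unit_class(1))
  fix a assume a: "a \<in> irrs"
  show a': "rbar (Fus G) a \<in> irrs" by (rule rbar_class(1)[OF a])
  show "rbar (Fus G) (rbar (Fus G) a) = a"
  proof -
   have cc: "qconj (qconj (rep a)) = rep a"
    by (intro prod_eqI fmat_eqI ext) (simp_all add: rep_def)
   have "qequiv {} (qconj (rep (rbar (Fus G) a))) (qconj (qconj (rep a)))"
    by (rule qequiv_qconj[OF equivf_sym[OF rbar_class(2)[OF a]]])
   then have "qequiv {} (rep (rbar (Fus G) (rbar (Fus G) a))) (rep a)"
    using rbar_class(2)[OF a'] equivf_trans equivf_sym unfolding cc by blast
   then show ?thesis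
    using transversalD(3)[OF transversal_rep[of id] rbar_class(1)[OF a'] a] by blast
  qed
  show "finite {y \<in> J. n a x y ~= 0}" if x: "x \<in> J" for x
  proof -
   have "{y \<in> J. n a x y ~= 0} = {y \<in> J. n (rbar (Fus G) a) y x ~= 0}"
    using n_dual[OF a _ x] by auto
   then show ?thesis using fin1[OF a' x] by simp
  qed
  show "n (rbar (Fus G) a) x y = n a y x" if "x \<in> J" "y \<in> J" for x y by (rule n_dual[OF a that])
  fix b assume b: "b \<in> irrs"
  show "finite {z \<in> irrs. fusion_coeff a b z ~= 0}"
  proof -
   have "{z \<in> irrs. fusion_coeff a b z ~= 0} = {z \<in> irrs. qdim {} (rep z) (qtens (rep a) (rep b)) ~= 0}"
    using fusion_coeff_qdim[OF a b] by auto
   then show ?thesis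
    using finite_constituents[OF transversal_rep[of id] uobj_qtens[OF rep_D(1)[OF a] rep_D(1)[OF b, of id]]]
    by simp
  qed
  show "fusion_coeff (rbar (Fus G) a) z b = fusion_coeff a b z" if "z \<in> irrs" for z
   by (rule N_dual[OF a b that])
  show "(\<Sum>g | g \<in> irrs \<and> fusion_coeff a b g ~= 0. fusion_coeff a b g * n g x y)
    = (\<Sum>z | z \<in> J \<and> n a z y ~= 0. n a z y * n b x z)" if x: "x \<in> J" and y: "y \<in> J" for x y
  proof -
   note ra = rep_D[OF a] and rb = rep_D[OF b]
   have ab: "uobj {} id (qtens (rep a) (rep b))" by (rule uobj_qtens[OF ra(1) rb(1)])
   have ya: "uobj X iv (qtens (D y) (rep a))" by (rule uobj_qtens[OF TJ(1)[OF y] ra(1)[of id]])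
   have "(\<Sum>g | g \<in> irrs \<and> fusion_coeff a b g ~= 0. fusion_coeff a b g * n g x y)
    = (\<Sum>g | g \<in> irrs \<and> qdim {} (rep g) (qtens (rep a) (rep b)) ~= 0.
      qdim {} (rep g) (qtens (rep a) (rep b)) * qdim X (D x) (qtens (D y) (rep g)))"
    by (rule sum.cong) (auto simp: fusion_coeff_qdim[OF a b] n_def)
   also have "... = qdim X (D x) (qtens (D y) (qtens (rep a) (rep b)))"
    by (rule qdim_qtens_right[OF transversal_rep[of id] ab TJ(1)[OF y] TJ(1)[OF x] TJ(2)[OF x] sub_irr_class[OF ab], symmetric])
   also have "... = qdim X (D x) (qtens (qtens (D y) (rep a)) (rep b))"
    by (rule homdim_equiv[OF cobj_refl[OF TJ(5)[OF x]] equivf_sym[OF qequiv_qtens_assoc[OF TJ(5)[OF y] ra(3) rb(3)]]])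
   also have "... = (\<Sum>z | z \<in> J \<and> qdim X (D z) (qtens (D y) (rep a)) ~= 0.
     qdim X (D z) (qtens (D y) (rep a)) * qdim X (D x) (qtens (D z) (rep b)))"
   proof (rule qdim_qtens_left[OF T rb(1)[of id] ya TJ(1)[OF x] TJ(2)[OF x]])
    fix p assume p: "proj p" "p \<in> QHom X (qtens (D y) (rep a)) (qtens (D y) (rep a))"
     "qirr X (qsub p (qtens (D y) (rep a)))"
    let ?C = "qsub p (qtens (D y) (rep a))"
    have uC: "uobj X iv ?C" by (rule uobj_qsub[OF ya p(1,2)])
    have "p \<in> QHom X ?C (qtens (D y) (rep a))"
     unfolding fam_qsub Hom_from_sub[OF p(2,1)] using p projD(2) by blast
    moreover have "p ~= 0" using p(3) by (simp add: irr_def)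
    ultimately have "linked X ?C (D y)"
     by (rule linkedI[OF TJ(1)[OF y] uC p(3) ra(1)[of id]])
    then have "linked X ?C b0"
     using linked_trans[OF b0(1) TJ(1)[OF y] TJ(2)[OF y] uC p(3)] D_linked y JK by blast
    then show "\<exists>z\<in>J. qequiv X (D z) ?C" by (rule coverJ[OF uC p(3)])
   qed
   finally show ?thesis by (simp add: n_def)
  qed
  next
  have "qequiv {} (qconj (obc (trivial_corep 1 :: 'a corep))) (rep (rbar (Fus G) unit_class))"
   by (rule equivf_trans[OF qequiv_qconj[OF equivf_sym[OF unit_class(2)]] rbar_class(2)[OF unit_class(1)]])
  moreover have "qconj (obc (trivial_corep 1 :: 'a corep)) = obc (trivial_corep 1)"
   by (intro prod_eqI fmat_eqI ext) (simp_all add: trivial_obc trivial_obc' ent_cj ent_idm)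
  ultimately have "qequiv {} (rep unit_class) (rep (rbar (Fus G) unit_class))"
   using equivf_trans[OF unit_class(2)] by simp
  then show "rbar (Fus G) unit_class = unit_class"
   using transversalD(3)[OF transversal_rep[of id] unit_class(1) rbar_class(1)[OF unit_class(1)]] by simp
  next
  fix x y assume x: "x \<in> J" and y: "y \<in> J"
  \<comment> \<open>A morphism from \<open>D y\<close> to \<open>D x \<otimes> a\<close> bends to
    one from the conjugate of \<open>D x\<close> tensored with \<open>D y\<close> into
    \<open>a\<close>. Hence only the finitely many constituents of this single object, made unitary
    as \<open>N\<close>, can occur.\<close>
  show "finite {a \<in> irrs. n a y x ~= 0}"
  proof -
   have Dx: "uobj {} id (fgt (D x))" and Dy: "uobj {} id (fgt (D y))"
    using TJ(1)[OF x] TJ(1)[OF y] by (simp_all add: uobj_def star_family_def)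
   have c: "corepm (pr (qtens (qconj (fgt (D x))) (fgt (D y)))) (cor (qtens (qconj (fgt (D x))) (fgt (D y))))"
    by (rule cobjD(1)[OF cobj_qtens[OF cobj_qconj[OF Dx] uobj_cobj[OF Dy]]])
   obtain m and N :: "(nat, 'a, unit) qobj" where N: "uobj {} id N" "pr N = idm {..<m}"
    "qequiv {} (qtens (qconj (fgt (D x))) (fgt (D y))) N"
    using unitary_equivalent[OF c] by blast
   have "{a \<in> irrs. n a y x ~= 0} <= {a \<in> irrs. qdim {} (rep a) N ~= 0}"
   proof clarify
    fix a assume a: "a \<in> irrs" "n a y x > 0"
    then have "qdim X (D y) (qtens (D x) (rep a)) ~= 0" by (simp add: n_def)
    then obtain S where S: "S \<in> QHom X (D y) (qtens (D x) (rep a))" "S ~= 0" by (rule qdim_nonzeroE)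
    then have "bendl (unbendl S) \<in> QHom {} (fgt (D y)) (qtens (fgt (D x)) (rep a))"
     by (simp add: QHom_iff)
    then have 1: "unbendl S \<in> QHom {} (qtens (qconj (fgt (D x))) (fgt (D y))) (rep a)"
     by (simp only: QHom_bendl[OF uobj_cobj[OF Dy] rep_D(3)[OF a(1)] Dx])
    have 2: "unbendl S ~= 0"
    proof
     assume "unbendl S = 0"
     then have "bendl (unbendl S) = 0" by (simp only: lin_zero[OF lin_bendl])
     then show False using S(2) by simp
    qed
    obtain U U' where U: "U' \<in> QHom {} N (qtens (qconj (fgt (D x))) (fgt (D y)))"
     "U' ** U = pr (qtens (qconj (fgt (D x))) (fgt (D y)))" using N(3) by (auto simp: equivf_def)
    have 3: "unbendl S ** U' \<in> QHom {} N (rep a)" by (rule Hom_comp[OF U(1) 1])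
    have 4: "unbendl S ** U' ~= 0"
    proof
     assume "unbendl S ** U' = 0"
     then have "unbendl S ** (U' ** U) = 0" by (simp flip: mm_assoc)
     then show False using 2 HomD(2)[OF 1] U(2) by simp
    qed
    have "ad (unbendl S ** U') \<in> QHom {} (rep a) N"
     by (rule Hom_ad[OF star_family_fam[OF N(1)] star_family_fam[OF rep_D(1)[OF a(1)]] 3])
    moreover have "ad (unbendl S ** U') ~= 0" using 4 by (metis ad_ad ad_zero)
    ultimately have "qdim {} (rep a) N ~= 0"
     by (rule qdim_nonzero[OF rep_D(1,2)[OF a(1)] N(1)])
    then show "qdim {} (rep a) N > 0" by simp
   qed
   then show ?thesis by (rule finite_subset) (rule finite_constituents[OF transversal_rep[of id] N(1)])
  qed
  show "n unit_class x y = (if x = y then 1 else 0)"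
  proof -
   have "n unit_class x y = qdim X (D x) (D y)"
    unfolding n_def by (rule homdim_equiv[OF cobj_refl[OF TJ(5)[OF x]] qequiv_qtens_unit[OF TJ(5)[OF y]]])
   then show ?thesis using qdim_transversal[OF T x y] by simp
  qed
  next
  fix b z assume b: "b \<in> irrs" and z: "z \<in> irrs"
  have "fusion_coeff unit_class b z = fusion_coeff (rbar (Fus G) unit_class) z b"
   by (rule N_dual[OF unit_class(1) b z, symmetric])
  show "fusion_coeff unit_class b z = (if b = z then 1 else 0)"
  proof -
   let ?t = "obc (trivial_corep 1 :: 'a corep)"
   let ?g = "%i. (0 :: nat, i :: nat)"
   have g: "inj ?g" by (simp add: inj_def)
   have t: "cobj {} ?t" by (rule uobj_cobj[OF irr_coreps_uobj[OF unit_irr, of id]])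
   have "qre ?g (qtens ?t (rep b)) = rep b"
    by (intro prod_eqI fmat_eqI ext)
     (simp_all add: trivial_obc trivial_obc' ent_rr[OF g] ent_cr[OF g] ent_kr ent_idm rep_def)
   moreover have "cols (pr (qtens ?t (rep b))) <= range ?g"
   proof
    fix w assume "w \<in> cols (pr (qtens ?t (rep b)))"
    then obtain v where "ent (pr (qtens ?t (rep b))) v w ~= 0" by (auto simp: cols_def ent_def in_keys_iff)
    then show "w \<in> range ?g"
     by (cases w; cases v) (auto simp: ent_kr ent_idm trivial_corep_def split: if_splits)
   qed
   ultimately have "qequiv {} (qtens ?t (rep b)) (rep b)"
    using qequiv_qre[OF cobj_qtens[OF t rep_D(3)[OF b]] g] by simp
   then have e: "qequiv {} (qtens (rep unit_class) (rep b)) (rep b)"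
    by (rule equivf_trans[OF qequiv_qtens[OF unit_class(2) cobj_refl[OF rep_D(3)[OF b]]]])
   have "fusion_coeff unit_class b z = qdim {} (rep z) (rep b)"
    unfolding fusion_coeff_qdim[OF unit_class(1) b z]
    by (rule homdim_equiv[OF cobj_refl[OF rep_D(3)[OF z]] e])
   then show ?thesis using qdim_transversal[OF transversal_rep[of id] z b] by simp
  qed
  qed
  interpret multiplicities "Fus G" J fusion_coeff n by (rule mult)
  have "J ~= {}"
  using coverJ[OF b0 linked_refl[OF b0]] by blast
  moreover have "connected_module (Fus G) M"
  proof (rule connected)
  fix x y assume x: "x \<in> J" and y: "y \<in> J"
  have lx: "linked X (D x) b0" "linked X (D y) b0" using D_linked x y JK by blast+
  have "linked X b0 (D y)" by (rule linked_sym[OF b0(1) TJ(1)[OF y] lx(2)])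
  then have "linked X (D x) (D y)"
   using linked_trans[OF TJ(1)[OF y] b0 TJ(1)[OF x] TJ(2)[OF x] lx(1)] by blast
  then show "\<exists>a\<in>irrs. n a x y ~= 0" by (simp add: linked_def n_def)
  qed
  ultimately have "isomorphic_modules (Fus G) M (standard_module (Fus G))"
  using stf cofinite unfolding strongly_torsion_free_def torsion_free_ring_def by auto
  then obtain e where e: "e \<in> J" "!!a. a \<in> irrs ==> n a e e = (if a = unit_class then 1 else 0)"
  by (rule standard_generator) (simp add: Fus_def)
  have eK: "e \<in> K" using e(1) JK by blast
  show thesis
  proof (rule that)
  show "uobj X iv (D e)" "qirr X (D e)" using D[OF eK] .
  show "fst e \<in> irrs" by (rule hK(1)[OF eK])
  show "proj (h (fst e) (snd e))" "h (fst e) (snd e) \<in> QHom X (?M (fst e)) (?M (fst e))" using hH[OF eK] .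
  show "D e = qsub (h (fst e) (snd e)) (?M (fst e))" by (simp add: D_def)
  show "linked X b0 (D e)" by (rule linked_sym[OF b0(1) D(1)[OF eK] D_linked[OF eK]])
  show "qdim X (D e) (qtens (D e) (rep c)) = (if c = unit_class then 1 else 0)" if "c \<in> irrs" for c
   using e(2)[OF that] by (simp add: n_def)
  qed
qed

end

section \<open>Finite-dimensional C*-algebras\<close>

text \<open>An idempotent and the orthogonal projection onto its range absorb each other from the
  left, so cyclicity gives them the same trace.\<close>

lemma idempotent_trace:
  fixes E :: "('i, 'i) cmat"
  assumes E: "E ** E = E"
  obtains n where "trace E = of_nat n" "n = 0 \<longleftrightarrow> E = 0"
proof -
  let ?W = "{w :: ('i, unit) cmat. E ** w = w}"
  have W: "csubspace ?W" by (auto simp: complex_vector.subspace_def mm_linear)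
  have rW: "idm (rows E) ** w = w" if "w \<in> ?W" for w
  using that mm_eq_assoc[OF rows_idm[of E], of w] by simp
  obtain V :: "('i, nat) cmat" where P: "proj (V ** ad V)" "!!w. V ** ad V ** w \<in> ?W"
  "!!w. w \<in> ?W ==> V ** ad V ** w = w"
  by (rule proj_onto_subspace[OF finite_rows W rW], assumption) (rule that, assumption+)
  let ?P = "V ** ad V"
  have EP: "E ** ?P = ?P" by (rule column_ext) (use P(2) in \<open>simp add: mm_assoc\<close>)
  have PE: "?P ** E = E"
  proof (rule column_ext)
  fix w :: "('i, unit) cmat"
  have "E ** w \<in> ?W" using E by (simp flip: mm_assoc)
  from P(3)[OF this] show "?P ** E ** w = E ** w" by (simp add: mm_assoc)
  qed
  obtain n where n: "trace ?P = of_nat n" "n = 0 \<longleftrightarrow> ?P = 0" by (rule proj_trace[OF P(1)])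
  have "trace E = trace ?P" using trace_comm[of ?P E] EP PE by simp
  moreover have "?P = 0 \<longleftrightarrow> E = 0" using EP PE by auto
  ultimately show thesis using that n by simp
qed

context fd_cstar_algebra
begin

abbreviation VA :: "cvec set" where "VA \<equiv> Cpow (adim A)"
abbreviation mult_A (infixl "\<cdot>" 70) where "x \<cdot> y \<equiv> amult A x y"
abbreviation adj_A ("_\<^sup>\<star>" [1000] 999) where "x\<^sup>\<star> \<equiv> astar A x"

lemma in_VA [simp]:
  "x \<in> VA ==> y \<in> VA ==> x \<cdot> y \<in> VA" "x \<in> VA ==> x\<^sup>\<star> \<in> VA" "aone A \<in> VA"
  "x \<in> VA ==> y \<in> VA ==> x + y \<in> VA" "x \<in> VA ==> y \<in> VA ==> x - y \<in> VA"
  "x \<in> VA ==> c *\<^sub>C x \<in> VA" "0 \<in> VA"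
  using mult_bilinear star_antilinear one_in
  by (auto simp: cbilinear_on_def clinear_on_def antilinear_on_def
   complex_vector.subspace_add[OF Cpow_subspace] complex_vector.subspace_diff[OF Cpow_subspace]
   complex_vector.subspace_scale[OF Cpow_subspace] complex_vector.subspace_0[OF Cpow_subspace])

lemma A_add:
  "x \<in> VA ==> y \<in> VA ==> z \<in> VA ==> (x + y) \<cdot> z = x \<cdot> z + y \<cdot> z"
  "x \<in> VA ==> y \<in> VA ==> z \<in> VA ==> x \<cdot> (y + z) = x \<cdot> y + x \<cdot> z"
  "x \<in> VA ==> y \<in> VA ==> (x + y)\<^sup>\<star> = x\<^sup>\<star> + y\<^sup>\<star>"
  using mult_bilinear star_antilinear by (auto simp: cbilinear_on_def clinear_on_def antilinear_on_def)

lemma A_scale: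
  "x \<in> VA ==> z \<in> VA ==> (c *\<^sub>C x) \<cdot> z = c *\<^sub>C (x \<cdot> z)"
  "x \<in> VA ==> z \<in> VA ==> x \<cdot> (c *\<^sub>C z) = c *\<^sub>C (x \<cdot> z)"
  "x \<in> VA ==> (c *\<^sub>C x)\<^sup>\<star> = cnj c *\<^sub>C x\<^sup>\<star>"
  using mult_bilinear star_antilinear by (auto simp: cbilinear_on_def clinear_on_def antilinear_on_def)

lemma A_diff:
  assumes "x \<in> VA" "y \<in> VA"
  shows "z \<in> VA ==> (x - y) \<cdot> z = x \<cdot> z - y \<cdot> z" "z \<in> VA ==> z \<cdot> (x - y) = z \<cdot> x - z \<cdot> y"
  "(x - y)\<^sup>\<star> = x\<^sup>\<star> - y\<^sup>\<star>"
  using A_add(1)[of "x - y" y z] A_add(2)[of z "x - y" y] A_add(3)[of "x - y" y] assms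
  by (simp_all add: algebra_simps)

lemma A_zero [simp]: "x \<in> VA ==> 0 \<cdot> x = 0" "x \<in> VA ==> x \<cdot> 0 = 0" "0\<^sup>\<star> = 0"
  using A_scale(1)[of 0 x 0] A_scale(2)[of x 0 0] A_scale(3)[of 0 0] by simp_all

lemma clinear_mult: "x \<in> VA ==> clinear_on VA VA (amult A x)" "x \<in> VA ==> clinear_on VA VA (%y. y \<cdot> x)"
  using mult_bilinear by (auto simp: cbilinear_on_def)

text \<open>The C*-norm enters through this consequence of the C*-identity; the positivity of the
  trace below rests on it.\<close>

lemma adj_mult_self_nonzero: "x \<in> VA ==> x\<^sup>\<star> \<cdot> x = 0 ==> x = 0"
  using cstar_norm by (metis in_VA(7) power_eq_0_iff)

definition lm :: "cvec => (nat, nat) cmat" where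
  "lm x = mk {..<adim A} {..<adim A} (%i j. (x \<cdot> ebasis j) i)"

lemma ent_lm: "ent (lm x) i j = (if i < adim A \<and> j < adim A then (x \<cdot> ebasis j) i else 0)"
  by (simp add: lm_def ent_mk)

lemma lm_supp [simp]: "idm {..<adim A} ** lm x = lm x" "lm x ** idm {..<adim A} = lm x"
  by (simp_all add: idm_mm_iff mm_idm_iff ent_lm)

lemma mult_expand: "x \<in> VA ==> y \<in> VA ==> (x \<cdot> y) i = (\<Sum>j<adim A. y j * (x \<cdot> ebasis j) i)"
  by (subst clinear_on_expand[OF clinear_mult(1)]) (simp_all add: sum_fun_apply scaleC_fun_apply scaleC_complex_def)

lemma lm_mult: "x \<in> VA ==> y \<in> VA ==> lm (x \<cdot> y) = lm x ** lm y"
proof (rule fmat_eqI)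
  fix i k assume x: "x \<in> VA" and y: "y \<in> VA"
  show "ent (lm (x \<cdot> y)) i k = ent (lm x ** lm y) i k"
  using x y mult_expand[OF x, of "y \<cdot> ebasis k" i]
  by (auto simp: ent_mm_supp[OF lm_supp(1)] ent_lm mult_assoc ebasis_Cpow mult.commute)
qed

lemma lm_add: "x \<in> VA ==> y \<in> VA ==> lm (x + y) = lm x + lm y"
  and lm_scale: "x \<in> VA ==> lm (c *\<^sub>C x) = c *\<^sub>C lm x"
  by (rule fmat_eqI; simp add: ent_lm ent_add ent_scaleC A_add A_scale ebasis_Cpow scaleC_fun_apply)+

lemma lm_one: "lm (aone A) = idm {..<adim A}"
  by (rule fmat_eqI) (simp add: ent_lm ent_idm mult_one ebasis_Cpow, simp add: ebasis_def)

lemma lm_zero_imp: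
  assumes x: "x \<in> VA" and z: "lm x = 0"
  shows "x = 0"
proof -
  have "(x \<cdot> ebasis j) i = 0" if "i < adim A" "j < adim A" for i j
  using that z ent_lm[of x i j] by simp
  then have "(x \<cdot> aone A) i = 0" if "i < adim A" for i using that x by (simp add: mult_expand)
  then have "x i = 0" if "i < adim A" for i using that x by (simp add: mult_one)
  then show ?thesis using x by (auto simp: Cpow_def fun_eq_iff) (metis not_le)
qed

text \<open>The trace of the regular representation. Left multiplication need not carry
  \<open>astar A\<close> to the adjoint for the standard inner product, so positivity is not
  evident; it is derived from spectral idempotents, whose trace is a rank.\<close>

definition tr :: "cvec => complex" where "tr x = trace (lm x)"

lemma tr_add: "x \<in> VA ==> y \<in> VA ==> tr (x + y) = tr x + tr y"
  and tr_scale: "x \<in> VA ==> tr (c *\<^sub>C x) = c * tr x"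
  by (simp_all add: tr_def lm_add lm_scale trace_add trace_scale)

lemma tr_comm: "x \<in> VA ==> y \<in> VA ==> tr (x \<cdot> y) = tr (y \<cdot> x)"
  using trace_comm[of "lm x" "lm y"] by (simp add: tr_def lm_mult)

lemma tr_idempotent:
  assumes e: "e \<in> VA" "e \<cdot> e = e"
  obtains n where "tr e = of_nat n" "n = 0 \<longleftrightarrow> e = 0"
proof -
  have "lm e ** lm e = lm e" using e by (simp flip: lm_mult)
  then obtain n where "trace (lm e) = of_nat n" "n = 0 \<longleftrightarrow> lm e = 0" by (rule idempotent_trace)
  moreover have "lm e = 0 \<longleftrightarrow> e = 0" using lm_zero_imp[OF e(1)] lm_scale[OF e(1), of 0] by auto
  ultimately show thesis using that by (simp add: tr_def)
qed

text \<open>Peels off one eigenprojection of a self-adjoint element: the idempotent is a multiple of an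
  eigenvector of \<open>amult A p\<close> that lies in the algebra generated by \<open>p\<close>.\<close>

lemma eigenprojection:
  assumes p: "p \<in> VA" "p\<^sup>\<star> = p" "p ~= 0" and f: "f \<in> VA" "f \<cdot> p = p"
  obtains e and \<mu> :: real where "e \<in> VA" "e\<^sup>\<star> = e" "e \<cdot> e = e" "e ~= 0" "p \<cdot> e = of_real \<mu> *\<^sub>C e" "\<mu> ~= 0" "f \<cdot> e = e"
proof -
  let ?S = "range (%i. (amult A p ^^ i) p)"
  have base: "(amult A p ^^ i) p \<in> VA" for i by (induction i) (use p in auto)
  have SV: "z \<in> VA" if "z \<in> cspan ?S" for z
  proof -
  have "?S <= VA" using base by blast
  then show ?thesis using complex_vector.span_minimal[OF _ Cpow_subspace, of ?S "adim A"] that by blast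
  qed
  have VA_span: "VA <= cspan (ebasis ` {..<adim A})"
  proof
  fix x assume "x \<in> VA"
  moreover have "(\<Sum>j<adim A. x j *\<^sub>C ebasis j) \<in> cspan (ebasis ` {..<adim A})"
   by (intro complex_vector.span_sum complex_vector.span_scale complex_vector.span_base imageI)
  ultimately show "x \<in> cspan (ebasis ` {..<adim A})" using Cpow_expand by metis
  qed
  obtain \<mu> y where y: "y \<in> cspan ?S" "y \<in> VA" "y ~= 0" "p \<cdot> y = \<mu> *\<^sub>C y"
  by (rule eigenvector_exists[OF finite_imageI[OF finite_lessThan] VA_span Cpow_subspace, of "amult A p" p])
   (use p in \<open>auto simp: A_add A_scale\<close>)
  have ind: "Q z"
  if z: "z \<in> cspan ?S" and Q: "Q 0" "!!i. Q ((amult A p ^^ i) p)"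
   "!!c x z. x \<in> VA ==> z \<in> VA ==> Q x ==> Q z ==> Q (c *\<^sub>C x + z)" for Q z
  proof -
  have "z \<in> VA \<and> Q z"
   by (rule complex_vector.span_induct_alt[OF z, where h = "%z. z \<in> VA \<and> Q z"]) (use Q base in auto)
  then show ?thesis ..
  qed
  \<comment> \<open>The algebra generated by \<open>p\<close> acts on an eigenvector by scalars, and
    these vanish together with \<mu>. This is how \<mu> \<noteq> 0 is obtained in the end.\<close>
  have left: "\<exists>s. z \<cdot> w = s *\<^sub>C w \<and> (\<mu> = 0 \<longrightarrow> s = 0)"
  if "z \<in> cspan ?S" and w: "w \<in> VA" "p \<cdot> w = \<mu> *\<^sub>C w" for z w
  using that(1)
  proof (rule ind)
  show "\<exists>s. 0 \<cdot> w = s *\<^sub>C w \<and> (\<mu> = 0 \<longrightarrow> s = 0)"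
   using A_zero(1)[OF w(1)] complex_vector.scale_zero_left by metis
  have "(amult A p ^^ i) p \<cdot> w = (\<mu> ^ Suc i) *\<^sub>C w" for i
   by (induction i) (use w p base in \<open>simp_all add: mult_assoc A_scale scaleC_scaleC mult.commute\<close>)
  then show "\<exists>s. (amult A p ^^ i) p \<cdot> w = s *\<^sub>C w \<and> (\<mu> = 0 \<longrightarrow> s = 0)" for i by auto
  fix c x z assume xz: "x \<in> VA" "z \<in> VA" "\<exists>s. x \<cdot> w = s *\<^sub>C w \<and> (\<mu> = 0 \<longrightarrow> s = 0)"
   "\<exists>s. z \<cdot> w = s *\<^sub>C w \<and> (\<mu> = 0 \<longrightarrow> s = 0)"
  then obtain s t where "x \<cdot> w = s *\<^sub>C w" "z \<cdot> w = t *\<^sub>C w" "\<mu> = 0 \<longrightarrow> s = 0 \<and> t = 0" by blast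
  then show "\<exists>s. (c *\<^sub>C x + z) \<cdot> w = s *\<^sub>C w \<and> (\<mu> = 0 \<longrightarrow> s = 0)"
   using xz(1,2) w by (intro exI[of _ "c * s + t"]) (simp add: A_add A_scale scaleC_scaleC scaleC_add_left)
  qed
  have star: "\<exists>s. z\<^sup>\<star> \<cdot> y = s *\<^sub>C y" if "z \<in> cspan ?S" for z
  using that
  proof (rule ind)
  show "\<exists>s. 0\<^sup>\<star> \<cdot> y = s *\<^sub>C y"
   using A_zero(1)[OF y(2)] A_zero(3) complex_vector.scale_zero_left by metis
  have "((amult A p ^^ i) p)\<^sup>\<star> \<cdot> y = (\<mu> ^ Suc i) *\<^sub>C y" for i
   by (induction i) (use y p base in \<open>simp_all add: mult_assoc star_mult A_scale scaleC_scaleC mult.commute\<close>)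
  then show "\<exists>s. ((amult A p ^^ i) p)\<^sup>\<star> \<cdot> y = s *\<^sub>C y" for i by blast
  fix c x z assume xz: "x \<in> VA" "z \<in> VA" "\<exists>s. x\<^sup>\<star> \<cdot> y = s *\<^sub>C y" "\<exists>s. z\<^sup>\<star> \<cdot> y = s *\<^sub>C y"
  then obtain s t where "x\<^sup>\<star> \<cdot> y = s *\<^sub>C y" "z\<^sup>\<star> \<cdot> y = t *\<^sub>C y" by blast
  then have "(c *\<^sub>C x + z)\<^sup>\<star> \<cdot> y = (cnj c * s + t) *\<^sub>C y"
   using xz(1,2) y by (simp add: A_add A_scale scaleC_scaleC scaleC_add_left)
  then show "\<exists>s. (c *\<^sub>C x + z)\<^sup>\<star> \<cdot> y = s *\<^sub>C y" by blast
  qed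
  obtain s where s: "y\<^sup>\<star> \<cdot> y = s *\<^sub>C y" using star[OF y(1)] by blast
  define g where "g = y\<^sup>\<star> \<cdot> y"
  have g0: "g ~= 0" using adj_mult_self_nonzero[OF y(2)] y(3) by (auto simp: g_def)
  have gV: "g \<in> VA" and gg: "g\<^sup>\<star> = g" using y by (simp_all add: g_def star_mult star_star)
  have gs: "g \<in> cspan ?S" using s y(1) by (simp add: g_def complex_vector.span_scale)
  have pg: "p \<cdot> g = \<mu> *\<^sub>C g" using s y p by (simp add: g_def A_scale scaleC_scaleC mult.commute)
  obtain r where r: "g \<cdot> g = r *\<^sub>C g" "\<mu> = 0 \<longrightarrow> r = 0" using left[OF gs gV pg] by blast
  have r0: "r ~= 0" using adj_mult_self_nonzero[OF gV] g0 gg r(1) by auto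
  have "cnj r *\<^sub>C g = r *\<^sub>C g"
  using star_mult[OF gV gV] gV unfolding gg r(1) by (simp add: A_scale gg)
  then have rr: "cnj r = r" using g0 by (simp add: complex_vector.scale_right_imp_eq)
  \<comment> \<open>\<open>g\<close> is selfadjoint and its square is \<open>r *\<^sub>C g\<close>
    for a nonzero real \<open>r\<close>, so dividing by \<open>r\<close> gives a projection.\<close>
  define e where "e = (1 / r) *\<^sub>C g"
  have e: "e \<in> VA" "e\<^sup>\<star> = e" "e \<cdot> e = e" "e ~= 0" "p \<cdot> e = \<mu> *\<^sub>C e"
  using gV gg r0 rr g0 r(1) pg p by (simp_all add: e_def A_scale scaleC_scaleC)
  have "(e \<cdot> (p \<cdot> e))\<^sup>\<star> = e \<cdot> (p \<cdot> e)" using e(1,2) p by (simp add: star_mult mult_assoc)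
  then have "cnj \<mu> *\<^sub>C e = \<mu> *\<^sub>C e" using e by (simp add: A_scale)
  then have "cnj \<mu> = \<mu>" using e(4) by (simp add: complex_vector.scale_right_imp_eq)
  then have \<mu>: "\<mu> = of_real (Re \<mu>)" by (simp add: complex_eq_iff)
  have "f \<cdot> (amult A p ^^ i) p = (amult A p ^^ i) p" for i
  by (cases i) (use f p base in \<open>simp_all flip: mult_assoc\<close>)
  with f have "f \<cdot> z = z" if "z \<in> cspan ?S" for z
  by (simp_all add: ind[OF that, where Q = "%z. f \<cdot> z = z"] A_add A_scale)
  from this[OF gs] have "f \<cdot> e = e" using f gV by (simp add: e_def A_scale)
  moreover have "Re \<mu> ~= 0" using r(2) r0 \<mu> by auto
  ultimately show thesis using that e \<mu> by metis
qed

text \<open>Induction on the rank of a projection \<open>f\<close> that fixes \<open>p\<close>. With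
  an eigenprojection \<open>e\<close> split off, the square of \<open>p\<close> is the square of
  \<open>p - \<mu> e\<close> plus a positive multiple of \<open>e\<close>, and \<open>f - e\<close>
  has smaller rank.\<close>

lemma tr_square_aux:
  assumes "tr f = of_nat n" and f: "f \<in> VA" "f\<^sup>\<star> = f" "f \<cdot> f = f" and p: "p \<in> VA" "p\<^sup>\<star> = p" "f \<cdot> p = p"
  shows "\<exists>r::real. tr (p \<cdot> p) = of_real r \<and> r \<ge> 0 \<and> (r = 0 \<longrightarrow> p = 0)"
  using assms
proof (induction n arbitrary: f p rule: less_induct)
  case (less n)
  note f = less.prems(2-4) and p = less.prems(5-7)
  show ?case
  proof (cases "p = 0")
  case True
  have "tr 0 = 0" using tr_scale[of 0 0] by simp
  then have "tr (p \<cdot> p) = of_real 0" using True A_zero(1)[OF in_VA(7)] by (metis of_real_0)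
  then show ?thesis using True by blast
  next
  case False
  obtain e and \<mu> :: real where e: "e \<in> VA" "e\<^sup>\<star> = e" "e \<cdot> e = e" "e ~= 0" "p \<cdot> e = of_real \<mu> *\<^sub>C e"
   "\<mu> ~= 0" "f \<cdot> e = e" by (rule eigenprojection[OF p(1,2) False f(1) p(3)])
  have ep: "e \<cdot> p = of_real \<mu> *\<^sub>C e"
  proof -
   have "e \<cdot> p = (p \<cdot> e)\<^sup>\<star>" using e(1,2) p by (simp add: star_mult)
   then show ?thesis unfolding e(5) using e(1,2) by (simp add: A_scale)
  qed
  have ef: "e \<cdot> f = e" using star_mult[OF f(1) e(1)] e(2,7) f(2) by simp
  obtain m where m: "tr e = of_nat m" "m = 0 \<longleftrightarrow> e = 0" by (rule tr_idempotent[OF e(1,3)])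
  let ?f = "f - e" and ?p = "p - of_real \<mu> *\<^sub>C e"
  have f': "?f \<in> VA" "?f\<^sup>\<star> = ?f" "?f \<cdot> ?f = ?f" using f e ef by (simp_all add: A_diff)
  have p': "?p \<in> VA" "?p\<^sup>\<star> = ?p" "?f \<cdot> ?p = ?p" using f p e ep by (simp_all add: A_diff A_scale)
  obtain k where k: "tr ?f = of_nat k" by (rule tr_idempotent[OF f'(1,3)])
  have "tr f = tr ?f + tr e" using tr_add[OF f'(1) e(1)] by simp
  then have "(of_nat n :: complex) = of_nat (k + m)" using less.prems(1) m k by simp
  then have "k < n" using m(2) e(4) by (simp only: of_nat_eq_iff) simp
  from less.IH[OF this k f' p'] obtain r where r: "tr (?p \<cdot> ?p) = of_real r" "r \<ge> 0" by blast
  have "p \<cdot> p = ?p \<cdot> ?p + (of_real (\<mu> * \<mu>)) *\<^sub>C e"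
   using p e ep by (simp add: A_diff A_scale scaleC_scaleC)
  then have "tr (p \<cdot> p) = of_real r + of_real (\<mu> * \<mu>) * of_nat m"
   using p'(1) e(1) r m by (simp add: tr_add tr_scale)
  also have "... = of_real (r + \<mu> * \<mu> * of_nat m)" by simp
  finally have "tr (p \<cdot> p) = of_real (r + \<mu> * \<mu> * of_nat m)" .
  moreover have "\<mu> * \<mu> * of_nat m > (0 :: real)"
   using m(2) e(4,6) by (simp add: zero_less_mult_iff) (metis linorder_neqE_linordered_idom)
  ultimately show ?thesis using r(2) by (intro exI[of _ "r + \<mu> * \<mu> * of_nat m"]) simp
  qed
qed

lemma tr_square:
  assumes "p \<in> VA" "p\<^sup>\<star> = p"
  shows "\<exists>r::real. tr (p \<cdot> p) = of_real r \<and> r \<ge> 0 \<and> (r = 0 \<longrightarrow> p = 0)"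
proof -
  have "(aone A)\<^sup>\<star> = aone A"
  proof -
  have "(aone A)\<^sup>\<star> = (aone A)\<^sup>\<star> \<cdot> aone A" by (simp add: mult_one)
  also have "... = ((aone A)\<^sup>\<star> \<cdot> aone A)\<^sup>\<star>" by (simp add: star_mult star_star)
  also have "... = aone A" by (simp add: mult_one star_star)
  finally show ?thesis .
  qed
  moreover obtain n where "tr (aone A) = of_nat n" by (rule tr_idempotent[of "aone A"]) (auto simp: mult_one)
  ultimately show ?thesis using tr_square_aux[of "aone A" n p] assms by (simp add: mult_one)
qed

text \<open>For \<open>x = p + \<i> q\<close> with selfadjoint \<open>p\<close> and \<open>q\<close>
  the mixed terms form a commutator, on which the trace vanishes.\<close>

lemma tr_positive:
  assumes x: "x \<in> VA" "x ~= 0"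
  shows "Re (tr (x\<^sup>\<star> \<cdot> x)) > 0"
proof -
  define p where "p = (1/2) *\<^sub>C (x + x\<^sup>\<star>)"
  define q where "q = (-\<i>/2) *\<^sub>C (x - x\<^sup>\<star>)"
  have p: "p \<in> VA" "p\<^sup>\<star> = p" using x by (simp_all add: p_def A_scale A_add star_star add.commute)
  have q: "q \<in> VA" "q\<^sup>\<star> = q"
  using x by (simp_all add: q_def A_scale A_diff star_star complex_vector.scale_right_diff_distrib)
  have "\<i> *\<^sub>C q = (1/2) *\<^sub>C (x - x\<^sup>\<star>)" by (simp add: q_def scaleC_scaleC)
  then have xpq: "x = p + \<i> *\<^sub>C q" "x\<^sup>\<star> = p - \<i> *\<^sub>C q"
  by (simp_all add: p_def fun_eq_iff scaleC_fun_apply scaleC_complex_def field_simps)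
  have "x\<^sup>\<star> \<cdot> x = (p \<cdot> p + q \<cdot> q) + \<i> *\<^sub>C (p \<cdot> q + (-1) *\<^sub>C (q \<cdot> p))"
  proof -
  have "(p - \<i> *\<^sub>C q) \<cdot> (p + \<i> *\<^sub>C q) = (p \<cdot> p + q \<cdot> q) + \<i> *\<^sub>C (p \<cdot> q + (-1) *\<^sub>C (q \<cdot> p))"
   using p q by (simp add: A_add A_diff A_scale scaleC_scaleC scaleC_add_right algebra_simps)
  then show ?thesis using xpq by simp
  qed
  then have "tr (x\<^sup>\<star> \<cdot> x) = tr (p \<cdot> p) + tr (q \<cdot> q)"
  using p q tr_comm[OF p(1) q(1)] by (simp add: tr_add tr_scale del: complex_vector.scale_minus_left complex_vector.scale_one)
  moreover have "p ~= 0 \<or> q ~= 0" using xpq x by auto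
  ultimately show ?thesis using tr_square[OF p] tr_square[OF q] by auto
qed

end

section \<open>Commutants\<close>

lemma tensor_sum_right: "a \<otimes> (\<Sum>i\<in>I. f i) = (\<Sum>i\<in>I. a \<otimes> f i)"
  by (induction I rule: infinite_finite_induct) (simp_all add: tensor_linear)

text \<open>Matrices become columns, so that the inner product is that of Hilbert-Schmidt and left
  multiplication by \<open>A\<close> becomes \<open>kr A (idm S)\<close>.\<close>

definition vec :: "('i, 'j) cmat => ('i \<times> 'j, unit) cmat" where
  "vec B = mk (rows B \<times> cols B) UNIV (%(i, j) _. ent B i j)"

lemma ent_vec: "ent (vec B) (i, j) u = ent B i j"
  by (cases "i \<in> rows B"; cases "j \<in> cols B") (simp_all add: vec_def ent_mk ent_rows ent_cols)

lemma vec_linear: "vec (A + B) = vec A + vec B" "vec (c *\<^sub>C A) = c *\<^sub>C vec A" "vec 0 = 0"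
  by (rule fmat_eqI; clarsimp simp: ent_vec ent_add ent_scaleC)+

lemma vec_inject: "vec A = vec B \<longleftrightarrow> A = B"
  by (metis ent_vec fmat_eqI)

lemma subspace_vec: "csubspace U ==> csubspace (vec ` U)"
proof (rule complex_vector.subspaceI)
  assume U: "csubspace U"
  show "0 \<in> vec ` U" using imageI[OF complex_vector.subspace_0[OF U], of vec] by (simp add: vec_linear)
  show "x + y \<in> vec ` U" if "x \<in> vec ` U" "y \<in> vec ` U" for x y
  using that complex_vector.subspace_add[OF U] by (auto simp flip: vec_linear)
  show "c *\<^sub>C x \<in> vec ` U" if "x \<in> vec ` U" for x c
  using that complex_vector.subspace_scale[OF U] by (auto simp flip: vec_linear)
qed

lemma ent_kr_idm_mm:
  assumes "finite S"
  shows "ent (kr A (idm S) ** B) (i, j) r = (if j \<in> S then \<Sum>m\<in>cols A. ent A i m * ent B (m, j) r else 0)"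
proof -
  have "ent (kr A (idm S) ** B) (i, j) r
  = (\<Sum>p\<in>cols A \<times> S. ent (kr A (idm S)) (i, j) p * ent B p r)"
  proof (rule ent_mm)
  fix p assume "p \<notin> cols A \<times> S"
  then show "ent (kr A (idm S)) (i, j) p * ent B p r = 0"
   using assms by (cases p; cases "fst p \<in> cols A") (auto simp: ent_kr ent_cols ent_idm)
  qed (use assms in simp)
  also have "... = (\<Sum>m\<in>cols A. \<Sum>l\<in>S. if l = j then ent A i m * ent B (m, j) r else 0)"
  unfolding sum.cartesian_product
  by (rule sum.cong) (use assms in \<open>auto simp: ent_kr ent_idm\<close>)
  finally show ?thesis using assms by simp
qed

lemma ent_mm_kr_idm:
  assumes "finite S"
  shows "ent (B ** kr A (idm S)) r (k, l) = (if l \<in> S then \<Sum>m\<in>rows A. ent B r (m, l) * ent A m k else 0)"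
proof -
  have "ent (B ** kr A (idm S)) r (k, l)
  = (\<Sum>p\<in>rows A \<times> S. ent B r p * ent (kr A (idm S)) p (k, l))"
  proof (rule ent_mm)
  fix p assume "p \<notin> rows A \<times> S"
  then show "ent B r p * ent (kr A (idm S)) p (k, l) = 0"
   using assms by (cases p; cases "fst p \<in> rows A") (auto simp: ent_kr ent_rows ent_idm)
  qed (use assms in simp)
  also have "... = (\<Sum>m\<in>rows A. \<Sum>j\<in>S. if j = l then ent B r (m, l) * ent A m k else 0)"
  unfolding sum.cartesian_product
  by (rule sum.cong) (use assms in \<open>auto simp: ent_kr ent_idm\<close>)
  finally show ?thesis using assms by simp
qed

lemma rr_kr_idm_mm:
  "finite S ==> j \<in> S ==> rr (%i. (i, j)) (kr A (idm S) ** B) = A ** rr (%i. (i, j)) B"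
  by (rule fmat_eqI) (simp add: ent_rr inj_def ent_kr_idm_mm ent_mm0[of A])

lemma kr_vec:
  assumes "finite S" "B ** idm S = B"
  shows "kr A (idm S) ** vec B = vec (A ** B)"
proof (rule fmat_eqI)
  fix p u
  show "ent (kr A (idm S) ** vec B) p u = ent (vec (A ** B)) p u"
  proof (cases p)
  case (Pair i j)
  have "ent B m j = 0" if "j \<notin> S" for m using assms that by (simp add: mm_idm_iff)
  then show ?thesis
   by (simp add: Pair ent_kr_idm_mm[OF assms(1)] ent_vec ent_mm0[of A])
  qed
qed

text \<open>A block with respect to the second tensor factor: if an operator commutes with
  \<open>kr A (idm S)\<close>, its blocks with indices in \<open>S\<close> commute with
  \<open>A\<close>.\<close>

definition blk :: "'j => 'j => ('i \<times> 'j, 'i \<times> 'j, 'c::zero) fmat => ('i, 'i, 'c) fmat" where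
  "blk j l p = rr (%i. (i, j)) (cr (%i. (i, l)) p)"

lemma ent_blk: "ent (blk j l p) i k = ent p (i, j) (k, l)"
  by (simp add: blk_def ent_rr ent_cr inj_def)

lemma blk_kr: "finite S ==> j \<in> S ==> blk j l (kr A (idm S) ** p) = A ** blk j l p"
  "finite S ==> l \<in> S ==> blk j l (p ** kr A (idm S)) = blk j l p ** A"
proof -
  show "finite S ==> j \<in> S ==> blk j l (kr A (idm S) ** p) = A ** blk j l p"
  by (rule fmat_eqI) (simp add: ent_blk ent_kr_idm_mm ent_mm0[of A])
  assume "finite S" "l \<in> S"
  then show "blk j l (p ** kr A (idm S)) = blk j l p ** A"
  by (intro fmat_eqI, subst ent_mm[of "rows A"]) (simp_all add: ent_blk ent_mm_kr_idm ent_rows)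
qed

text \<open>The bicommutant theorem: the orthogonal projection onto the algebra, viewed as a subspace of
  matrices, commutes with left multiplication by the algebra, so its blocks lie in the commutant.\<close>

lemma bicommutant:
  fixes M :: "('i, 'x) sfam"
  assumes M: "star_family X iv M" and U: "csubspace (snd M ` X)" "fst M \<in> snd M ` X"
  "!!x y. x \<in> X ==> y \<in> X ==> snd M x ** snd M y \<in> snd M ` X"
  and K: "fst M ** K = K" "K ** fst M = K" "!!T. T \<in> Hom X M M ==> T ** K = K ** T"
  shows "K \<in> snd M ` X"
proof -
  define P where "P = fst M"
  note D = star_familyD[OF M, folded P_def]
  define S where "S = rows P"
  have S: "finite S" by (simp add: S_def)
  have SP: "idm S ** P = P" by (simp add: S_def rows_idm)
  have PS: "P ** idm S = P" using arg_cong[OF SP, of ad] D(7) S by (simp add: ad_mm)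
  have BS: "B ** idm S = B" if "B ** P = B" for B :: "('i, 'i) cmat"
  using that PS by (metis mm_assoc)
  define k where "k A = kr A (idm S :: ('i, 'i) cmat)" for A :: "('i, 'i) cmat"
  have k_mm: "k A ** k B = k (A ** B)" for A B using S by (simp add: k_def kr_mm_complex)
  define W where "W = vec ` (snd M ` X)"
  have kW: "k (snd M x) ** w \<in> W" if x: "x \<in> X" and w: "w \<in> W" for x w
  proof -
  obtain y where y: "y \<in> X" "w = vec (snd M y)" using w by (auto simp: W_def)
  have "k (snd M x) ** w = vec (snd M x ** snd M y)" using kr_vec[OF S BS[OF D(4)[OF y(1)]]] y(2) by (simp add: k_def)
  then show ?thesis using U(3)[OF x y(1)] by (simp add: W_def)
  qed
  have kP: "k P ** w = w" if "w \<in> W" for w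
  using that by (auto simp: W_def k_def kr_vec[OF S BS[OF D(4)]] D(3))
  have WS: "idm (S \<times> S) ** w = w" if "w \<in> W" for w
  proof -
  have "kr (idm S) (idm S) ** (k P ** w) = k P ** w"
   using S SP by (simp add: k_def kr_mm_complex flip: mm_assoc)
  then show ?thesis using kP[OF that] S by (simp add: kr_idm)
  qed
  obtain V :: "('i \<times> 'i, nat) cmat" where pV: "proj (V ** ad V)"
   "!!w. V ** ad V ** w \<in> W" "!!w. w \<in> W ==> V ** ad V ** w = w"
  by (rule proj_onto_subspace[OF finite_cartesian_product[OF S S] subspace_vec[OF U(1), folded W_def] WS], assumption)
   (rule that, assumption+)
  define p where "p = V ** ad V"
  note p = pV[folded p_def]
  have pk: "p ** k (snd M x) ** p = k (snd M x) ** p" if x: "x \<in> X" for x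
  by (rule column_ext) (use p kW[OF x] in \<open>simp add: mm_assoc\<close>)
  have comm: "k (snd M x) ** p = p ** k (snd M x)" if x: "x \<in> X" for x
  proof -
  have "ad (k (snd M (iv x))) = k (snd M x)"
   using D(2,5)[OF x] S by (metis ad_ad ad_idm ad_kr_complex k_def)
  then have "p ** (k (snd M x) ** p) = p ** k (snd M x)"
   using arg_cong[OF pk[OF D(2)[OF x]], of ad] projD(1)[OF p(1)] by (simp add: ad_mm)
  then show ?thesis using pk[OF x] by (simp add: mm_assoc)
  qed
  have kPp: "k P ** p = p" by (rule column_ext) (use kP p(2) in \<open>simp add: mm_assoc\<close>)
  have pkP: "p ** k P = p"
  using arg_cong[OF kPp, of ad] projD(1)[OF p(1)] D(7) S by (simp add: ad_mm k_def ad_kr_complex)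
  have T: "blk j l p \<in> Hom X M M" if "j \<in> S" "l \<in> S" for j l
  using that blk_kr[OF S, where p = p] kPp pkP comm
  by (auto simp: Hom_def k_def P_def[symmetric]) metis+
  have z: "ent p (i, j) r = 0 \<and> ent p r (i, j) = 0" if "j \<notin> S" for i j r
  using that ent_kr_idm_mm[OF S, of P p i j r] ent_mm_kr_idm[OF S, of p P r i j] kPp pkP by (simp add: k_def)
  have "p ** k K = k K ** p"
  proof (rule fmat_eqI)
  fix a b :: "'i \<times> 'i"
  obtain i j c l where ab: "a = (i, j)" "b = (c, l)" by (cases a; cases b)
  show "ent (p ** k K) a b = ent (k K ** p) a b"
  proof (cases "j \<in> S \<and> l \<in> S")
   case True
   then have "blk j l (p ** k K) = blk j l (k K ** p)" by (simp add: k_def blk_kr[OF S] K(3)[OF T])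
   from arg_cong[OF this, of "%B. ent B i c"] show ?thesis by (simp add: ent_blk ab)
  qed (auto simp: ab k_def ent_kr_idm_mm[OF S] ent_mm_kr_idm[OF S] z)
  qed
  \<comment> \<open>The unit serves as a cyclic vector: \<open>k K\<close> commutes with
    \<open>p\<close> and sends \<open>vec P\<close>, which \<open>p\<close> fixes, to
    \<open>vec K\<close>; so \<open>p\<close> fixes \<open>vec K\<close> too.\<close>
  moreover have vP: "vec P \<in> W" using U(2) by (simp add: W_def P_def)
  moreover have "k K ** vec P = vec K" using kr_vec[OF S PS, of K] K(2) by (simp add: k_def P_def)
  ultimately have "vec K = p ** vec K" using p(3)[OF vP] by (metis mm_assoc)
  then have "vec K \<in> W" using p(2) by metis
  then show ?thesis by (auto simp: W_def vec_inject)
qed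

text \<open>A matrix of the form P \<otimes> w keeps this form when the second factor is changed by
  \<open>U\<close>: the vector \<open>w\<close> becomes \<open>U w\<close>.\<close>

lemma ent_kr_mm_product:
  assumes P: "P ** P = P" and Y: "!!k s. ent Y (k, s) j = ent P k j * w s"
  shows "ent (kr P U ** Y) (i, r) j = ent P i j * (\<Sum>s\<in>cols U. ent U r s * (w s :: complex))"
proof -
  have "ent (kr P U ** Y) (i, r) j = (\<Sum>p\<in>cols P \<times> cols U. ent (kr P U) (i, r) p * ent Y p j)"
  proof (rule ent_mm)
  fix p assume "p \<notin> cols P \<times> cols U"
  then show "ent (kr P U) (i, r) p * ent Y p j = 0"
   by (cases p; cases "fst p \<in> cols P") (auto simp: ent_kr ent_cols)
  qed simp
  also have "... = (\<Sum>k\<in>cols P. \<Sum>s\<in>cols U. (ent P i k * ent P k j) * (ent U r s * w s))"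
  unfolding sum.cartesian_product by (rule sum.cong) (auto simp: ent_kr Y)
  also have "... = ent (P ** P) i j * (\<Sum>s\<in>cols U. ent U r s * w s)"
  by (simp add: sum_product ent_mm0)
  finally show ?thesis by (simp add: P)
qed

context discrete_quantum_group
begin

text \<open>Only trivial constituents of \<open>N\<close> receive nonzero morphisms from
  \<open>E\<close>, and into such a constituent a morphism is an endomorphism of \<open>E\<close>,
  that is a scalar. Summing over the constituents gives the form P \<otimes> w.\<close>

lemma trivial_morphism:
  fixes E :: "('i, 'a, 'x) qobj" and N :: "('l, 'a, unit) qobj"
  assumes E: "uobj X iv E" "qirr X E"
  and triv: "!!c. c \<in> irrs ==> qdim X E (qtens E (rep c)) = (if c = unit_class then 1 else 0)"
  and N: "uobj {} jv N" and T: "T \<in> QHom X E (qtens E N)"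
  shows "\<exists>w. \<forall>i r j. ent T (i, r) j = ent (pr E) i j * w r"
proof -
  let ?P = "pr E"
  note DE = uobjD[OF E(1)] and cE = uobj_cobj[OF E(1)]
  have PP: "?P ** ?P = ?P" by (rule projD(2)[OF DE(1)])
  obtain F where F: "qsplits {} N F (%p. p)" "!!p. p \<in> F ==> irr (ix {}) (sub p (fam N))"
  using complete_reducibility[OF star_family_fam[OF N]] by blast
  note F' = splitsD[OF F(1)]
  have "\<exists>w. \<forall>i r j. ent (kr ?P p ** T) (i, r) j = ent ?P i j * w r" if p: "p \<in> F" for p
  proof -
  have Np: "uobj {} jv (qsub p N)" "qirr {} (qsub p N)"
   using uobj_qsub[OF N F'(2,3)[OF p]] F(2)[OF p] by (simp_all add: fam_qsub)
  have pQ: "p \<in> QHom {} N (qsub p N)"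
   unfolding fam_qsub Hom_to_sub[OF F'(3)[OF p] F'(2)[OF p]] using F'(3)[OF p] projD(2)[OF F'(2)[OF p]] by blast
  have Tp: "kr ?P p ** T \<in> QHom X E (qtens E (qsub p N))"
   by (rule Hom_comp[OF T QHom_kr[OF cobj_QHom_id[OF cE] pQ]])
  obtain c where c: "c \<in> irrs" "qequiv {} (rep c) (qsub p N)"
   using irr_class[OF uobj_cobj[OF Np(1)] Np(2)] by blast
  show ?thesis
  proof (cases "c = unit_class")
   case False
   have "qdim X E (qtens E (qsub p N)) = qdim X E (qtens E (rep c))"
    by (rule homdim_equiv[OF cobj_refl[OF cE] equivf_sym[OF qequiv_qtens[OF cobj_refl[OF cE] c(2)]]])
   then have "qdim X E (qtens E (qsub p N)) = 0" using triv[OF c(1)] False by simp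
   then have "kr ?P p ** T = 0" using qdim_nonzero[OF E uobj_qtens[OF E(1) Np(1)] Tp] by blast
   then show ?thesis by (intro exI[of _ "%_. 0"]) simp
  next
   case True
   let ?t = "obc (trivial_corep 1 :: 'a corep)"
   have "qequiv {} ?t (qsub p N)"
    using equivf_trans[OF equivf_sym[OF unit_class(2)]] c(2) True by blast
   then obtain U U' where U: "U \<in> QHom {} ?t (qsub p N)" "U' \<in> QHom {} (qsub p N) ?t" "U ** U' = p"
    by (auto simp: equivf_def)
   \<comment> \<open>\<open>U'\<close> carries the constituent to the trivial object, whose single
     index 0 is then stripped off by reindexing.\<close>
   define Y where "Y = kr ?P U' ** (kr ?P p ** T)"
   have Y: "Y \<in> QHom X E (qtens E ?t)"
    unfolding Y_def by (rule Hom_comp[OF Tp QHom_kr[OF cobj_QHom_id[OF cE] U(2)]])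
   have t: "pr ?t = idm {..<1}" "cor ?t = idm {..<1}" by (simp_all add: trivial_obc del: One_nat_def)
   let ?g = "%i :: 'i. (i, 0 :: nat)"
   have g: "inj ?g" by (simp add: inj_def)
   have YQ: "kr ?P (idm {..<1}) ** Y = Y" "Y ** ?P = Y"
    "sc Y ** cor E = kr (cor E) (idm {..<1}) ** sc Y"
    "x \<in> X ==> Y ** opr E x = kr (opr E x) (idm {..<1}) ** Y" for x
    using Y t by (simp_all add: QHom_iff del: One_nat_def)
   have scY: "sc (rr ?g Y) = (rr ?g (sc Y) :: ('i, 'i, 'a) fmat)"
    by (rule fmat_eqI) (simp add: ent_rr[OF g] ent_sc)
   have "rr ?g Y \<in> QHom X E E"
    unfolding QHom_iff
    using arg_cong[OF YQ(1), of "rr ?g"] arg_cong[OF YQ(3), of "rr ?g"] arg_cong[OF YQ(4), of _ "rr ?g"] YQ(2)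
    by (simp add: rr_kr_idm_mm rr_mm[OF g] scY)
   then obtain a where a: "rr ?g Y = a *\<^sub>C ?P" using E(2) by (auto simp: irr_def)
   have entY: "ent Y (k, s) j = ent ?P k j * (if s = 0 then a else 0)" for k s j
   proof (cases "s = 0")
    case True
    then have "ent Y (k, s) j = ent (rr ?g Y) k j" by (simp add: ent_rr[OF g])
    then show ?thesis using a True by (simp add: ent_scaleC scaleC_complex_def)
   next
    case False
    then show ?thesis using ent_kr_idm_mm[of "{..<1}" ?P Y k s j] YQ(1) by simp
   qed
   have "kr ?P U ** Y = kr ?P p ** T"
   proof -
    have "kr ?P U ** Y = kr ?P (p ** p) ** T"
     by (simp add: Y_def kr_mm_complex PP U(3) flip: mm_assoc)
    then show ?thesis by (simp add: projD(2)[OF F'(2)[OF p]])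
   qed
   then have "ent (kr ?P p ** T) (i, r) j = ent ?P i j * (\<Sum>s\<in>cols U. ent U r s * (if s = 0 then a else 0))" for i r j
    using ent_kr_mm_product[OF PP entY, of U i r j] by simp
   then show ?thesis by (intro exI[of _ "%r. \<Sum>s\<in>cols U. ent U r s * (if s = 0 then a else 0)"]) blast
  qed
  qed
  then obtain w where w: "!!p i r j. p \<in> F ==> ent (kr ?P p ** T) (i, r) j = ent ?P i j * w p r" by metis
  have "T = kr ?P (\<Sum>p\<in>F. p) ** T" using HomD(1)[OF T] F'(5) by simp
  then have "T = (\<Sum>p\<in>F. kr ?P p ** T)" by (simp add: kr_sum_right mm_sum_left)
  then have "ent T (i, r) j = (\<Sum>p\<in>F. ent (kr ?P p ** T) (i, r) j)" for i r j by (metis ent_sum)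
  then have "ent T (i, r) j = ent ?P i j * (\<Sum>p\<in>F. w p r)" for i r j by (simp add: w sum_distrib_left)
  then show ?thesis by (intro exI[of _ "%r. \<Sum>p\<in>F. w p r"]) blast
qed

text \<open>The commutant of the operations carries the coaction \<open>T \<mapsto> u\<^sup>*(T \<otimes> 1)u\<close>, whose corepresentation
  matrix \<open>v\<close> is taken with respect to a Hilbert-Schmidt orthonormal basis \<open>T 0, ..., T (n - 1)\<close>. The basis
  itself is a morphism from \<open>E\<close> to \<open>E\<close> tensored with \<open>v\<close>.\<close>

lemma commutant_scalar:
  fixes E :: "('i, 'a, 'x) qobj"
  assumes E: "uobj X iv E" "qirr X E"
  and triv: "!!c. c \<in> irrs ==> qdim X E (qtens E (rep c)) = (if c = unit_class then 1 else 0)"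
  and eqv: "!!x. x \<in> X ==> \<exists>\<Lambda>. cor E ** sc (opr E x) = \<Lambda> ** cor E \<and> \<Lambda> ** sc (pr E) = \<Lambda>
   \<and> (\<forall>T\<in>Hom X (pr E, opr E) (pr E, opr E). sc T ** \<Lambda> = \<Lambda> ** sc T)"
  shows "irr X (pr E, opr E)"
proof -
  define P where "P = pr E"
  define u where "u = cor E"
  note DE = uobjD[OF E(1), folded P_def u_def]
  have PP: "P ** P = P" and adP: "ad P = P" using projD[OF DE(1)] by simp_all
  define C where "C = Hom X (pr E, opr E) (pr E, opr E)"
  define S where "S = rows P"
  have S: "finite S" by (simp add: S_def)
  have SP: "idm S ** P = P" by (simp add: S_def rows_idm)
  have PS: "P ** idm S = P" using arg_cong[OF SP, of ad] adP S by (simp add: ad_mm)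
  have CD: "P ** T = T" "T ** P = T" "x \<in> X ==> T ** opr E x = opr E x ** T" if "T \<in> C" for T x
  using that by (simp_all add: C_def Hom_def P_def)
  have CS: "ent T i j = 0" if "T \<in> C" "i \<notin> S \<or> j \<notin> S" for T i j
  proof -
  have "idm S ** T = T" "T ** idm S = T"
   using mm_eq_assoc[OF SP, of T] mm_assoc[of T P "idm S"] PS CD(1,2)[OF that(1)] by simp_all
  then show ?thesis using that(2) S by (auto simp: idm_mm_iff mm_idm_iff)
  qed
  have uS: "ent u i j = 0" if "i \<notin> S \<or> j \<notin> S" for i j
  proof -
  have "idm S ** u = u" "u ** idm S = u"
   using arg_cong[OF SP, of "%A. sc A ** u"] arg_cong[OF PS, of "%A. u ** sc A"] DE(2,3) S
   by (simp_all add: sc_mm mm_assoc) (metis mm_assoc)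
  then show ?thesis using that S by (auto simp: idm_mm_iff mm_idm_iff)
  qed
  have WS: "idm (S \<times> S) ** w = w" if "w \<in> vec ` C" for w
  using that CS S by (auto simp: idm_mm_iff ent_vec)
  obtain n and V :: "('i \<times> 'i, nat) cmat" where V: "ad V ** V = idm {..<n}" "V ** idm {..<n} = V" "proj (V ** ad V)"
   "!!w. V ** ad V ** w \<in> vec ` C" "!!w. w \<in> vec ` C ==> V ** ad V ** w = w"
  by (rule proj_onto_subspace[OF finite_cartesian_product[OF S S] subspace_vec[OF Hom_subspace[of X "(pr E, opr E)" "(pr E, opr E)"], folded C_def] WS], assumption)
   (rule that, assumption+)
  define t where "t q = mk S S (%i j. ent V (i, j) q)" for q
  have tC: "t q \<in> C" and ent_t: "ent (t q) i j = ent V (i, j) q" for q i j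
  proof -
  have "V ** ad V ** (V ** unitm q ()) = V ** unitm q ()"
   using V(1,2) by (metis mm_assoc)
  then have "V ** unitm q () \<in> vec ` C" using V(4) by metis
  then obtain B where B: "B \<in> C" "V ** unitm q () = vec B" by blast
  have BV: "ent V (i, j) q = ent B i j" for i j
   using arg_cong[OF B(2), of "%A. ent A (i, j) ()"] by (simp add: ent_mm_unitm ent_vec)
  have "t q = B" by (rule fmat_eqI) (use CS[OF B(1)] S in \<open>auto simp: t_def ent_mk BV\<close>)
  then show "t q \<in> C" "ent (t q) i j = ent V (i, j) q" using B(1) BV by simp_all
  qed
  have expand: "ent T i j = (\<Sum>q<n. (\<Sum>k\<in>S. \<Sum>l\<in>S. cnj (ent (t q) k l) * ent T k l) * ent (t q) i j)"
  if T: "T \<in> C" for T i j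
  proof -
  have inner: "ent (ad V ** vec T) q () = (\<Sum>k\<in>S. \<Sum>l\<in>S. cnj (ent (t q) k l) * ent T k l)" for q
   unfolding sum.cartesian_product
  proof (subst ent_mm[of "S \<times> S"])
   fix r assume "r \<notin> S \<times> S"
   then show "ent (ad V) q r * ent (vec T) r () = 0" using CS[OF T] by (cases r) (simp add: ent_vec)
  qed (use S in \<open>auto simp: ent_ad ent_vec ent_t star_complex_def intro!: sum.cong\<close>)
  have "ent T i j = ent (V ** (ad V ** vec T)) (i, j) ()"
   using V(5)[of "vec T"] T by (simp add: ent_vec mm_assoc)
  also have "... = (\<Sum>q<n. ent V (i, j) q * ent (ad V ** vec T) q ())"
   by (rule ent_mm) (use V(2) in \<open>auto simp: mm_idm_iff\<close>)
  finally show ?thesis by (simp add: inner ent_t mult.commute)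
  qed
  have ortho: "(\<Sum>k\<in>S. \<Sum>l\<in>S. cnj (ent (t q) k l) * ent (t p) k l) = (if p = q then 1 else 0)" if "p < n" "q < n" for p q
  proof -
  have "ent (ad V ** V) q p = (\<Sum>k\<in>S. \<Sum>l\<in>S. cnj (ent (t q) k l) * ent (t p) k l)"
   unfolding sum.cartesian_product
  proof (subst ent_mm[of "S \<times> S"])
   fix r assume "r \<notin> S \<times> S"
   then have "ent V r p = 0" using CS[OF tC[of p]] ent_t by (cases r) (metis SigmaI)
   then show "ent (ad V) q r * ent V r p = 0" by simp
  qed (use S in \<open>auto simp: ent_ad ent_t star_complex_def intro!: sum.cong\<close>)
  then show ?thesis using V(1) that by (auto simp: ent_idm)
  qed
  define A where "A p = ad u ** sc (t p) ** u" for p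
  \<comment> \<open>Slices of \<open>A p\<close> stay in the commutant: conjugation by
    \<open>u\<close> exchanges \<open>opr E x\<close> with the \<Lambda> of \<open>eqv\<close>, and
    \<Lambda> commutes with \<open>t p \<otimes> 1\<close>. So the coefficients of
    \<open>A p\<close> in the basis \<open>t\<close> exist and form \<open>v\<close>.\<close>
  have AC: "mapm f (A p) \<in> C" if f: "lin f" for f :: "'a => complex" and p
  proof -
  have "sc P ** ad u = ad u" using arg_cong[OF DE(3), of ad] adP by (simp add: ad_mm ad_sc)
  then have 1: "sc P ** A p = A p" "A p ** sc P = A p"
   using DE(3) by (simp_all add: A_def mm_assoc mm_eq_assoc[of "sc P" "ad u" "ad u"])
  have 2: "A p ** sc (opr E x) = sc (opr E x) ** A p" if x: "x \<in> X" for x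
  proof -
   obtain L where L: "u ** sc (opr E x) = L ** u" "L ** sc P = L" "sc (t p) ** L = L ** sc (t p)"
    using eqv[OF x] tC unfolding u_def P_def C_def by blast
   have adL: "ad u ** L = sc (opr E x) ** ad u"
   proof -
    have "ad u ** L = ad u ** (L ** u) ** ad u" using L(2) DE(5) by (simp add: mm_assoc)
    also have "... = (ad u ** u) ** sc (opr E x) ** ad u" by (simp add: mm_assoc flip: L(1))
    also have "... = sc (opr E x) ** ad u"
     using DE(6)[of x] by (simp add: DE(4) flip: sc_mm)
    finally show ?thesis .
   qed
   have "A p ** sc (opr E x) = ad u ** sc (t p) ** L ** u" by (simp add: A_def mm_assoc L(1))
   also have "... = (ad u ** L) ** sc (t p) ** u" by (simp add: mm_assoc mm_eq_assoc[OF L(3)])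
   finally show ?thesis by (simp add: adL A_def mm_assoc)
  qed
  have 3: "mapm f (A p) ** opr E x = opr E x ** mapm f (A p)" if "x \<in> X" for x
   using mapm_sc_mm[OF f, of "opr E x" "A p"] mapm_mm_sc[OF f, of "A p" "opr E x"] 2[OF that] by simp
  show ?thesis
   unfolding C_def Hom_def
   using mapm_sc_mm[OF f, of P "A p"] mapm_mm_sc[OF f, of "A p" P] 1 3
   by (auto simp: P_def)
  qed
  define v where "v = mk {..<n} {..<n} (%p q. \<Sum>k\<in>S. \<Sum>l\<in>S. cnj (ent (t q) k l) *\<^sub>C ent (A p) k l)"
  have ent_v: "ent v p q = (\<Sum>k\<in>S. \<Sum>l\<in>S. cnj (ent (t q) k l) *\<^sub>C ent (A p) k l)" if "p < n" "q < n" for p q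
  using that by (simp add: v_def ent_mk)
  have A_v: "ent (A p) i j = (\<Sum>q<n. ent (t q) i j *\<^sub>C ent v p q)" if p: "p < n" for p i j
  proof (rule functional_ext)
  fix f :: "'a => complex" assume f: "lin f"
  note e = expand[OF AC[OF f, of p], of i j]
  show "f (ent (A p) i j) = f (\<Sum>q<n. ent (t q) i j *\<^sub>C ent v p q)"
   using e p by (simp add: ent_mapm lin_zero[OF f] lin_sum[OF f] lin_scale[OF f] ent_v scaleC_complex_def mult.commute)
  qed
  have ent_A: "ent (A p) i j = (\<Sum>k\<in>S. \<Sum>l\<in>S. ent (t p) k l *\<^sub>C (ent (ad u) i k * ent u l j))" for p i j
  proof -
  have "ent (A p) i j = (\<Sum>k\<in>S. ent (ad u) i k * ent (sc (t p) ** u) k j)"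
   unfolding A_def mm_assoc by (rule ent_mm) (use S uS in \<open>auto simp: ent_ad\<close>)
  moreover have "ent (sc (t p) ** u) k j = (\<Sum>l\<in>S. ent (t p) k l *\<^sub>C ent u l j)" for k
   by (subst ent_mm[of S]) (use S uS in \<open>auto simp: ent_sc mult_scaleC_left\<close>)
  ultimately show ?thesis by (simp add: sum_distrib_left mult_scaleC_right)
  qed
  \<comment> \<open>\<Delta> turns \<open>A p\<close> into its copy in the first leg conjugated by
    \<open>u\<close> in the second; expanding the first leg in the basis leaves \<open>A q\<close>
    in the second.\<close>
  have comA: "comult G (ent (A p) i j) = (\<Sum>q<n. ent v p q \<otimes> ent (A q) i j)" if p: "p < n" for p i j
  proof -
  let ?l1 = "mapm leg1" and ?l2 = "mapm leg2"
  have Du: "mapm (comult G) u = ?l1 u ** ?l2 u" by (rule corepmD(4)[OF DE(8)])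
  have l2: "mapm leg2 (ad u) = ad (?l2 u)" "mapm leg1 (ad u) = ad (?l1 u)"
   by (rule mapm_ad[OF lin_leg2], simp add: tensor_star) (rule mapm_ad[OF lin_leg1], simp add: tensor_star)
  have "mapm (comult G) (ad u) = ?l2 (ad u) ** ?l1 (ad u)"
   using mapm_ad[OF lin_comult, of u] by (simp add: comult_star Du ad_mm l2)
  then have "mapm (comult G) (A p) = ?l2 (ad u) ** ?l1 (ad u) ** sc (t p) ** ?l1 u ** ?l2 u"
   by (simp add: A_def mapm_mm[OF lin_comult comult_mult] mapm_sc[OF lin_comult comult_one] Du mm_assoc)
  also have "... = ?l2 (ad u) ** (?l1 (A p) ** ?l2 u)"
   by (simp add: A_def mapm_mm[OF lin_leg1 leg1_mult] mapm_sc[OF lin_leg1] tensor_one mm_assoc)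
  finally have "comult G (ent (A p) i j) = ent (?l2 (ad u) ** (?l1 (A p) ** ?l2 u)) i j"
   by (metis comult_zero ent_mapm)
  also have "... = (\<Sum>k\<in>S. leg2 (ent (ad u) i k) * ent (?l1 (A p) ** ?l2 u) k j)"
   by (subst ent_mm[of S]) (use S uS in \<open>auto simp: ent_mapm ent_ad\<close>)
  also have "... = (\<Sum>k\<in>S. \<Sum>l\<in>S. leg2 (ent (ad u) i k) * (leg1 (ent (A p) k l) * leg2 (ent u l j)))"
   by (rule sum.cong[OF refl], subst ent_mm[of S]) (use S uS in \<open>auto simp: ent_mapm sum_distrib_left\<close>)
  also have "... = (\<Sum>k\<in>S. \<Sum>l\<in>S. ent (A p) k l \<otimes> (ent (ad u) i k * ent u l j))"
   by (simp add: tensor_times)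
  also have "... = (\<Sum>k\<in>S. \<Sum>l\<in>S. \<Sum>q<n. ent v p q \<otimes> (ent (t q) k l *\<^sub>C (ent (ad u) i k * ent u l j)))"
   by (simp add: A_v[OF p] tensor_sum_left tensor_linear)
  also have "... = (\<Sum>q<n. \<Sum>k\<in>S. \<Sum>l\<in>S. ent v p q \<otimes> (ent (t q) k l *\<^sub>C (ent (ad u) i k * ent u l j)))"
   by (subst sum.swap[of _ S "{..<n}"], rule sum.cong[OF refl], rule sum.swap)
  also have "... = (\<Sum>q<n. ent v p q \<otimes> ent (A q) i j)"
   by (simp add: ent_A tensor_sum_right)
  finally show ?thesis .
  qed
  have epsA: "mapm (counit G) (A p) = t p" for p
  proof -
  have e: "mapm (counit G) u = P" by (rule corepmD(5)[OF DE(8)])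
  have "mapm (counit G) (ad u) = mapm (counit G) (ad u) ** P"
   using mapm_mm_sc[OF lin_counit, of "ad u" P] arg_cong[OF DE(2), of ad] adP by (simp add: ad_mm ad_sc)
  also have "... = mapm (counit G) (ad u ** u)" by (simp add: mapm_mm[OF lin_counit counit_mult] e)
  also have "... = P" using mapm_sc[OF lin_counit counit_one, of P] by (simp add: DE(4))
  finally show ?thesis
   using CD(1,2)[OF tC, of p] mapm_sc[OF lin_counit counit_one, of "t p"]
   by (simp add: A_def mapm_mm[OF lin_counit counit_mult] e mm_assoc)
  qed
  have cv: "corepm (idm {..<n}) v"
  unfolding corepm_def
  proof (intro conjI)
  show "mapm (comult G) v = mapm leg1 v ** mapm leg2 v"
  proof (rule fmat_eqI)
   fix p r
   have "ent (mapm leg1 v ** mapm leg2 v) p r = (\<Sum>q<n. ent v p q \<otimes> ent v q r)"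
    by (subst ent_mm[of "{..<n}"]) (auto simp: ent_mapm v_def ent_mk tensor_times)
   moreover have "comult G (ent v p r) = (\<Sum>q<n. ent v p q \<otimes> ent v q r)" if "p < n" "r < n"
   proof -
    have "comult G (ent v p r) = (\<Sum>k\<in>S. \<Sum>l\<in>S. \<Sum>q<n. cnj (ent (t r) k l) *\<^sub>C (ent v p q \<otimes> ent (A q) k l))"
     using that by (simp add: ent_v[OF that] lin_sum[OF lin_comult] lin_scale[OF lin_comult] comA scaleC_sum_right)
    also have "... = (\<Sum>q<n. \<Sum>k\<in>S. \<Sum>l\<in>S. cnj (ent (t r) k l) *\<^sub>C (ent v p q \<otimes> ent (A q) k l))"
     by (subst sum.swap[of _ S "{..<n}"], rule sum.cong[OF refl], rule sum.swap)
    also have "... = (\<Sum>q<n. ent v p q \<otimes> ent v q r)"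
     using that by (intro sum.cong refl) (simp add: ent_v[of _ r] tensor_sum_right tensor_linear)
    finally show ?thesis .
   qed
   ultimately show "ent (mapm (comult G) v) p r = ent (mapm leg1 v ** mapm leg2 v) p r"
    by (cases "p < n \<and> r < n") (auto simp: ent_mapm v_def ent_mk)
  qed
  show "mapm (counit G) v = idm {..<n}"
  proof (rule fmat_eqI)
   fix p q
   have "counit G (ent (A p) k l) = ent (t p) k l" for k l by (metis counit_zero ent_mapm epsA)
   then have "counit G (ent v p q) = (if p = q then 1 else 0)" if "p < n" "q < n"
    using ortho[OF that] that
    by (simp add: ent_v lin_sum[OF lin_counit] lin_scale[OF lin_counit] scaleC_complex_def)
   then show "ent (mapm (counit G) v) p q = ent (idm {..<n}) p q"
    by (cases "p < n \<and> q < n") (auto simp: ent_mapm v_def ent_mk ent_idm)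
  qed
  qed (auto simp: idm_mm_iff mm_idm_iff v_def ent_mk)
  \<comment> \<open>The basis stacked into one matrix. Its intertwining relation with
    \<open>u\<close> and \<open>v\<close> amounts to \<open>u ** A p = sc (t p) ** u\<close>, which
    is unitarity of \<open>u\<close>.\<close>
  define T' where "T' = mk (S \<times> {..<n}) S (%(i, p) j. ent (t p) i j)"
  have ent_T': "ent T' (i, p) j = (if p < n then ent (t p) i j else 0)" for i p j
  using CS[OF tC[of p]] S by (auto simp: T'_def ent_mk)
  define Nv :: "(nat, 'a, unit) qobj" where "Nv = (idm {..<n}, v, %_. 0)"
  have T'mor: "T' \<in> QHom X E (qtens E Nv)"
  unfolding QHom_iff
  proof (intro conjI ballI)
  have left: "kr B (idm {..<n}) ** T' = T' ** B" if "!!q. B ** t q = t q ** B" for B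
  proof (rule fmat_eqI)
   fix r :: "'i \<times> nat" and j :: 'i
   obtain i p where r: "r = (i, p)" by (cases r)
   have "ent (T' ** B) (i, p) j = (if p < n then ent (t p ** B) i j else 0)"
    by (subst (1 2) ent_mm[of "rows B"]) (auto simp: ent_rows ent_T')
   then show "ent (kr B (idm {..<n}) ** T') r j = ent (T' ** B) r j"
    by (auto simp: r ent_kr_idm_mm ent_T' ent_mm0[of B] simp flip: that)
  qed
  have T'P: "T' ** P = T'"
  proof (rule fmat_eqI)
   fix r :: "'i \<times> nat" and j :: 'i
   obtain i p where r: "r = (i, p)" by (cases r)
   have "ent (T' ** P) (i, p) j = (if p < n then ent (t p ** P) i j else 0)"
    by (subst (1 2) ent_mm[of "rows P"]) (auto simp: ent_rows ent_T')
   then show "ent (T' ** P) r j = ent T' r j" by (simp add: r CD(2)[OF tC] ent_T')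
  qed
  then show "T' ** pr E = T'" by (simp add: P_def)
  show "pr (qtens E Nv) ** T' = T'"
   using left[of P] T'P CD(1,2)[OF tC] by (simp add: Nv_def P_def)
  show "T' ** opr E x = opr (qtens E Nv) x ** T'" if "x \<in> X" for x
   using left[of "opr E x"] CD(3)[OF tC that] by (simp add: Nv_def)
  show "sc T' ** cor E = cor (qtens E Nv) ** sc T'"
  proof (rule fmat_eqI)
   fix r :: "'i \<times> nat" and j :: 'i
   obtain i p where r: "r = (i, p)" by (cases r)
   have 1: "ent (sc T' ** u) (i, p) j = (if p < n then ent (sc (t p) ** u) i j else 0)"
    by (subst (1 2) ent_mm[of S]) (use S uS in \<open>auto simp: ent_sc ent_T'\<close>)
   have "ent (kr u v ** sc T') (i, p) j = (\<Sum>z\<in>S \<times> {..<n}. ent (kr u v) (i, p) z * ent (sc T') z j)"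
   proof (rule ent_mm)
    fix z assume "z \<notin> S \<times> {..<n}"
    then show "ent (kr u v) (i, p) z * ent (sc T') z j = 0"
     using uS by (cases z; cases "fst z \<in> S") (auto simp: ent_kr v_def ent_mk)
   qed (use S in simp)
   also have "... = (\<Sum>k\<in>S. \<Sum>q<n. ent u i k * (ent (t q) k j *\<^sub>C ent v p q))"
    unfolding sum.cartesian_product
    by (rule sum.cong) (auto simp: ent_kr ent_sc ent_T' mult_scaleC_right mult_scaleC_left)
   also have "... = (if p < n then ent (u ** A p) i j else 0)"
    by (subst ent_mm[of S]) (use S uS in \<open>auto simp: A_v sum_distrib_left v_def ent_mk\<close>)
   also have "u ** A p = sc (t p) ** u"
   proof -
    have "u ** A p = (u ** ad u) ** (sc (t p) ** u)" by (simp add: A_def mm_assoc)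
    also have "... = sc (P ** t p) ** u" by (simp add: DE(5) sc_mm mm_assoc)
    finally show ?thesis by (simp add: CD(1)[OF tC])
   qed
   finally show "ent (sc T' ** cor E) r j = ent (cor (qtens E Nv) ** sc T') r j"
    using 1 by (simp add: r Nv_def u_def)
  qed
  qed
  \<comment> \<open>\<open>v\<close> is not known to be unitary, while
    \<open>trivial_morphism\<close> asks for a unitary object; \<open>U\<close> leads to an
    equivalent one and \<open>U'\<close> back.\<close>
  obtain m and N :: "(nat, 'a, unit) qobj" where N: "uobj {} id N" "pr N = idm {..<m}" "qequiv {} Nv N"
  by (rule unitary_equivalent[of Nv id]) (use cv in \<open>simp add: Nv_def\<close>)
  obtain U U' where U: "U \<in> QHom {} Nv N" "U' ** U = idm {..<n}"
  using N(3) by (auto simp: equivf_def Nv_def)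
  have "kr P U ** T' \<in> QHom X E (qtens E N)"
  unfolding P_def by (rule Hom_comp[OF T'mor QHom_kr[OF cobj_QHom_id[OF uobj_cobj[OF E(1)]] U(1)]])
  from trivial_morphism[OF E triv N(1) this] obtain w where
  w: "!!i r j. ent (kr P U ** T') (i, r) j = ent P i j * w r" by (auto simp: P_def)
  have "kr P U' ** (kr P U ** T') = T'"
  using HomD(1)[OF T'mor] U(2) by (simp add: kr_mm_complex PP[unfolded P_def] Nv_def P_def flip: mm_assoc)
  then have T'w: "ent T' (i, p) j = ent P i j * (\<Sum>s\<in>cols U'. ent U' p s * w s)" for i p j
  using ent_kr_mm_product[OF PP w, of U' i p j] by simp
  define a where "a p = (\<Sum>s\<in>cols U'. ent U' p s * w s)" for p
  have a: "ent (t p) i j = ent P i j * a p" if "p < n" for p i j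
  using T'w[of i p j] ent_T'[of i p j] that by (simp add: a_def)
  have "\<exists>c. T = c *\<^sub>C P" if T: "T \<in> C" for T
  proof
  show "T = (\<Sum>q<n. (\<Sum>k\<in>S. \<Sum>l\<in>S. cnj (ent (t q) k l) * ent T k l) * a q) *\<^sub>C P"
   by (rule fmat_eqI) (subst expand[OF T],
    simp add: a ent_scaleC scaleC_complex_def sum_distrib_left sum_distrib_right mult_ac)
  qed
  moreover have "P ~= 0" using E(2) by (simp add: irr_def P_def)
  ultimately show ?thesis by (simp add: irr_def C_def P_def)
qed

end

section \<open>Equivariant representations\<close>

locale quantum_group_coaction = discrete_quantum_group G + fd_cstar_algebra A
  for G :: "'a::complex_star_algebra quantum_group" and A +
  fixes \<alpha> :: "cvec => nat => 'a"
  assumes coaction: "coaction G A \<alpha>"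
begin

lemma coact_corep: "corepresentation G (adim A, \<alpha>)"
  and coact_one: "\<alpha> (aone A) = elem_tensor (aone A) 1"
  and coact_mult: "x \<in> VA ==> y \<in> VA ==> \<alpha> (x \<cdot> y) = ext2 (adim A) (adim A) (amult A) (\<alpha> x) (\<alpha> y)"
  and coact_star: "x \<in> VA ==> \<alpha> (x\<^sup>\<star>) = map_tensor_id (adim A) (astar A) (star \<circ> \<alpha> x)"
  using coaction by (simp_all add: coaction_def)

lemma coact_linear: "clinear_on VA (Cpow (adim A)) \<alpha>"
  using coact_corep by (simp add: corepresentation_def)

text \<open>The left action of \<open>t\<close> (an element of the algebra tensored with the quantum group algebra) on \<open>M\<close>.\<close>

definition spread :: "('i, 'a, cvec) qobj => (nat => 'a) => ('i, 'i, 'a) fmat" where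
  "spread M t = (\<Sum>k<adim A. mapm (%c. c *\<^sub>C t k) (opr M (ebasis k)))"

text \<open>A representation \<pi> by operators that respects adjoints, on a unitary
  corepresentation \<open>u\<close>, with the covariance relation u(\<pi>(x) \<otimes> 1) = (\<pi>
  \<otimes> id)(\<alpha>(x)) u.\<close>

definition equivariant_rep :: "('i, 'a, cvec) qobj => bool" where
  "equivariant_rep M \<longleftrightarrow> uobj VA (astar A) M
   \<and> (\<forall>x\<in>VA. \<forall>y\<in>VA. opr M (x \<cdot> y) = opr M x ** opr M y \<and> opr M (x + y) = opr M x + opr M y)
   \<and> (\<forall>c. \<forall>x\<in>VA. opr M (c *\<^sub>C x) = c *\<^sub>C opr M x) \<and> opr M (aone A) = pr M
   \<and> (\<forall>x\<in>VA. cor M ** sc (opr M x) = spread M (\<alpha> x) ** cor M)"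

lemma equivariant_repD:
  assumes "equivariant_rep M"
  shows "uobj VA (astar A) M" "x \<in> VA ==> y \<in> VA ==> opr M (x \<cdot> y) = opr M x ** opr M y"
  "x \<in> VA ==> y \<in> VA ==> opr M (x + y) = opr M x + opr M y" "x \<in> VA ==> opr M (c *\<^sub>C x) = c *\<^sub>C opr M x"
  "opr M (aone A) = pr M" "x \<in> VA ==> cor M ** sc (opr M x) = spread M (\<alpha> x) ** cor M"
  "x \<in> VA ==> ad (opr M x) = opr M (x\<^sup>\<star>)"
  using assms by (simp_all add: equivariant_rep_def uobj_def star_family_def)

lemma lin_scaleC_right: "lin (%c :: complex. c *\<^sub>C (h :: 'a))"
  by (rule linI) (simp_all add: scaleC_add_left scaleC_scaleC scaleC_complex_def)

lemma ent_spread: "ent (spread M t) i j = (\<Sum>k<adim A. ent (opr M (ebasis k)) i j *\<^sub>C t k)"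
  by (simp add: spread_def ent_sum ent_mapm)

lemma spread_qtens: "spread (qtens M N) t = kr (spread M t) (sc (pr N))"
  by (rule kr_eqI) (simp add: ent_spread ent_kr ent_sc sum_distrib_right mult_scaleC_left mult_scaleC_right
   scaleC_scaleC scaleC_sum_right mult.commute)

lemma spread_commutes:
  assumes "!!k. k < adim A ==> T ** opr M (ebasis k) = opr N (ebasis k) ** T"
  shows "sc T ** spread M t = spread N t ** sc T"
  using assms by (simp add: spread_def mm_sum_left mm_sum_right flip: mapm_sc_mm[OF lin_scaleC_right] mapm_mm_sc[OF lin_scaleC_right])

lemma spread_pr:
  assumes "uobj VA (astar A) M"
  shows "sc (pr M) ** spread M t = spread M t" "spread M t ** sc (pr M) = spread M t"
  using uobjD(6,7)[OF assms]
  by (simp_all add: spread_def mm_sum_left mm_sum_right ebasis_Cpow flip: mapm_sc_mm[OF lin_scaleC_right] mapm_mm_sc[OF lin_scaleC_right])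

lemma equivariant_rep_qtens:
  fixes M :: "('i, 'a, cvec) qobj"
  assumes M: "equivariant_rep M" and N: "uobj X jv (N :: ('j, 'a, 'x) qobj)"
  shows "equivariant_rep (qtens M N)"
proof -
  note D = equivariant_repD[OF M] and DN = uobjD[OF N]
  have "kr (cor M) (cor N) ** sc (kr (opr M x) (pr N)) = kr (spread M (\<alpha> x)) (sc (pr N)) ** kr (cor M) (cor N)"
  if "x \<in> VA" for x
  using D(6)[OF that] DN(2,3) by (simp add: sc_kr kr_mm_sc1 kr_mm_sc2)
  then show ?thesis
  unfolding equivariant_rep_def
  using uobj_qtens[OF D(1) N] D projD(2)[OF DN(1)]
  by (simp add: kr_mm_complex kr_add_left kr_scale_left spread_qtens)
qed

lemma equivariant_rep_qsub:
  assumes M: "equivariant_rep M" and p: "proj p" "p \<in> QHom VA M M"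
  shows "equivariant_rep (qsub p M)"
proof -
  note D = equivariant_repD[OF M]
  have pc: "p ** pr M = p" "sc p ** cor M = cor M ** sc p" "x \<in> VA ==> p ** opr M x = opr M x ** p" for x
  using p(2) by (auto simp: QHom_iff)
  have pp: "p ** p = p" by (rule projD(2)[OF p(1)])
  have s: "spread (qsub p M) t = sc p ** spread M t" for t
  by (simp add: spread_def mm_sum_right flip: mapm_sc_mm[OF lin_scaleC_right])
  have spp: "sc p ** (sc p ** B) = sc p ** B" for B :: "(_, _, 'a) fmat"
  using mm_eq_assoc[of "sc p" "sc p" "sc p :: (_, _, 'a) fmat" B] pp by (simp flip: sc_mm)
  have pS: "sc p ** spread M t = spread M t ** sc p" for t
  by (rule spread_commutes) (simp add: pc ebasis_Cpow)
  have "sc p ** cor M ** sc (p ** opr M x) = sc p ** spread M (\<alpha> x) ** (sc p ** cor M)" if x: "x \<in> VA" for x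
  proof -
  have "sc p ** cor M ** sc (p ** opr M x) = sc p ** (sc p ** cor M) ** sc (opr M x)"
   by (simp add: sc_mm mm_assoc mm_eq_assoc[OF pc(2)])
  also have "... = sc p ** spread M (\<alpha> x) ** cor M" using D(6)[OF x] by (simp add: spp mm_assoc)
  also have "... = sc p ** spread M (\<alpha> x) ** (sc p ** cor M)"
  proof -
   have "spread M (\<alpha> x) ** (sc p ** cor M) = sc p ** (spread M (\<alpha> x) ** cor M)"
    by (simp only: mm_assoc[symmetric] pS)
   then show ?thesis by (simp add: mm_assoc spp)
  qed
  finally show ?thesis .
  qed
  moreover have "p ** (opr M x ** opr M y) = p ** opr M x ** (p ** opr M y)" if "x \<in> VA" for x y
  by (simp add: mm_assoc pc(3)[OF that] mm_eq_assoc[OF pc(3)[OF that]] mm_eq_assoc[OF pp])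
  ultimately show ?thesis
  unfolding equivariant_rep_def using uobj_qsub[OF D(1) p] D pc(1) s
  by (simp add: mm_add_right mm_scale_right)
qed

lemma linear_expand:
  assumes "clinear_on VA UNIV B" "z \<in> VA" "x \<in> VA"
  shows "B (z \<cdot> x) = (\<Sum>j<adim A. x j *\<^sub>C B (z \<cdot> ebasis j))"
proof -
  have "clinear_on VA UNIV (%y. B (z \<cdot> y))"
  using assms by (auto simp: clinear_on_def A_add A_scale)
  from clinear_on_expand[OF this assms(3)] show ?thesis .
qed

lemma antilinear_expand:
  assumes B: "clinear_on VA UNIV (B :: cvec => complex)" and z: "z \<in> VA" and x: "x \<in> VA"
  shows "B (x\<^sup>\<star> \<cdot> z) = (\<Sum>j<adim A. cnj (x j) * B ((ebasis j)\<^sup>\<star> \<cdot> z))"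
proof -
  have "clinear_on VA UNIV (%y. cnj (B (y\<^sup>\<star> \<cdot> z)))"
  using B z by (auto simp: clinear_on_def A_add A_scale scaleC_complex_def)
  from arg_cong[OF clinear_on_expand[OF this x], of cnj] show ?thesis by (simp add: scaleC_complex_def)
qed

text \<open>On selfadjoint elements the trace is real: \<open>2 * tr p\<close> is a combination of
  the traces of the squares of \<open>p\<close>, of the unit and of their sum. The general case
  follows by splitting \<open>x\<close> into selfadjoint parts.\<close>

lemma tr_adj: "x \<in> VA ==> tr (x\<^sup>\<star>) = cnj (tr x)"
proof -
  have real: "cnj (tr p) = tr p" if p: "p \<in> VA" "p\<^sup>\<star> = p" for p
  proof -
  have one: "aone A \<in> VA" "(aone A)\<^sup>\<star> = aone A"
   using star_mult[of "(aone A)\<^sup>\<star>" "aone A"] by (simp_all add: mult_one star_star)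
  obtain r s t :: real where "tr (p \<cdot> p) = of_real r" "tr (aone A \<cdot> aone A) = of_real s"
   "tr ((p + aone A) \<cdot> (p + aone A)) = of_real t"
   using tr_square[OF p] tr_square[OF one] tr_square[of "p + aone A"] p one by (auto simp: A_add)
  moreover have "tr ((p + aone A) \<cdot> (p + aone A)) = (tr (p \<cdot> p) + tr p) + (tr p + tr (aone A \<cdot> aone A))"
  proof -
   have "(p + aone A) \<cdot> (p + aone A) = (p \<cdot> p + p) + (p + aone A \<cdot> aone A)"
    using p(1) one(1) A_add(1)[of p "aone A" "p + aone A"] A_add(2)[of p p "aone A"] A_add(2)[of "aone A" p "aone A"]
    by (simp only: in_VA mult_one[THEN conjunct1] mult_one[THEN conjunct2])
   then show ?thesis using p(1) one(1) by (simp only: tr_add in_VA)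
  qed
  ultimately have "2 * tr p + of_real (r + s) = of_real t" by simp
  then have "2 * tr p = of_real t - of_real (r + s)" by (rule eq_diff_eq[THEN iffD2])
  then have "tr p = of_real ((t - (r + s)) / 2)" by (simp add: mult.commute)
  then show ?thesis by (metis complex_cnj_complex_of_real)
  qed
  assume x: "x \<in> VA"
  have 1: "cnj (tr (x + x\<^sup>\<star>)) = tr (x + x\<^sup>\<star>)" by (rule real) (use x in \<open>simp_all add: A_add star_star add.commute\<close>)
  have 2: "cnj (tr (\<i> *\<^sub>C (x - x\<^sup>\<star>))) = tr (\<i> *\<^sub>C (x - x\<^sup>\<star>))"
  by (rule real) (use x in \<open>simp_all add: A_scale A_diff star_star algebra_simps\<close>)
  have d: "tr (x - x\<^sup>\<star>) = tr x - tr (x\<^sup>\<star>)" using tr_add[of "x - x\<^sup>\<star>" "x\<^sup>\<star>"] x by simp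
  show ?thesis using 1 2 x by (simp add: tr_add tr_scale d complex_eq_iff)
qed

lemma clinear_tr: "clinear_on VA UNIV tr"
  by (simp add: clinear_on_def tr_add tr_scale scaleC_complex_def)

text \<open>The regular representation, made unitary for the inner product \<open>(\<tau> \<otimes> h)(\<alpha>(x\<^sup>*y))\<close>, where \<open>\<tau>\<close> is the
  trace of the regular representation and \<open>h\<close> the Haar state.\<close>

lemma regular_object:
  obtains M :: "(nat, 'a, cvec) qobj" where "equivariant_rep M" "!!x. x \<in> VA ==> opr M x = 0 ==> x = 0"
proof -
  define d where "d = adim A"
  define e where "e i = ebasis i" for i
  have e: "i < d ==> e i \<in> VA" for i by (simp add: e_def d_def ebasis_Cpow)
  let ?I = "idm {..<d} :: (nat, nat) cmat"
  define v where "v = cor (obc (d, \<alpha>))"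
  have v: "corepm ?I v" using corepresentation_corepm(1)[OF coact_corep] by (simp add: v_def d_def)
  note Dv = corepmD[OF v]
  have ent_v: "ent v i j = (if i < d \<and> j < d then \<alpha> (e j) i else 0)" for i j
  by (simp add: v_def ent_obc e_def)
  have \<alpha>0: "\<alpha> x i = 0" if "x \<in> VA" "\<not> i < d" for x i
  using clinear_on_in[OF coact_linear that(1)] that(2) by (simp add: Cpow_def d_def)
  \<comment> \<open>Gram matrix of the inner product defined by the trace.\<close>
  define G0 where "G0 = mk {..<d} {..<d} (%i j. tr ((e i)\<^sup>\<star> \<cdot> e j))"
  have ent_G0: "ent G0 i j = (if i < d \<and> j < d then tr ((e i)\<^sup>\<star> \<cdot> e j) else 0)" for i j
  by (simp add: G0_def ent_mk)
  have G0s: "?I ** G0 = G0" "G0 ** ?I = G0" by (simp_all add: idm_mm_iff mm_idm_iff ent_G0)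
  have G0h: "ad G0 = G0"
  proof (rule fmat_eqI)
  fix i j
  have "i < d ==> j < d ==> cnj (tr ((e j)\<^sup>\<star> \<cdot> e i)) = tr ((e i)\<^sup>\<star> \<cdot> e j)"
   using e[of i] e[of j] by (simp add: star_mult star_star flip: tr_adj)
  then show "ent (ad G0) i j = ent G0 i j" by (auto simp: ent_ad ent_G0 star_complex_def)
  qed
  have pos: "Re (ent (ad w ** G0 ** w) () ()) > 0" if w: "?I ** w = w" "w ~= 0" for w :: "(nat, unit) cmat"
  proof -
  define x where "x i = ent w i ()" for i
  have x: "x \<in> VA" using w(1) by (auto simp: x_def Cpow_def idm_mm_iff d_def)
  have "x ~= 0" using w(2) by (auto simp: x_def fun_eq_iff intro!: fmat_eqI)
  have "ent (ad w ** (G0 ** w)) () () = (\<Sum>i<d. ent (ad w) () i * ent (G0 ** w) i ())"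
   by (rule ent_mm_supp) (simp add: G0s mm_eq_assoc)
  also have "... = (\<Sum>i<d. cnj (x i) * (\<Sum>j<d. ent G0 i j * x j))"
   by (simp add: ent_ad star_complex_def x_def ent_mm_supp[OF w(1)])
  also have "... = (\<Sum>i<d. cnj (x i) * tr ((e i)\<^sup>\<star> \<cdot> x))"
  proof (rule sum.cong[OF refl])
   fix i assume i: "i \<in> {..<d}"
   have "tr ((e i)\<^sup>\<star> \<cdot> x) = (\<Sum>j<d. x j * tr ((e i)\<^sup>\<star> \<cdot> e j))"
    using linear_expand[OF clinear_tr in_VA(2)[OF e] x] i by (simp add: d_def e_def scaleC_complex_def)
   then show "cnj (x i) * (\<Sum>j<d. ent G0 i j * x j) = cnj (x i) * tr ((e i)\<^sup>\<star> \<cdot> x)"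
    using i by (simp add: ent_G0 mult.commute)
  qed
  also have "... = tr (x\<^sup>\<star> \<cdot> x)" using antilinear_expand[OF clinear_tr x x] by (simp add: d_def e_def)
  finally show ?thesis using tr_positive[OF x \<open>x ~= 0\<close>] by (simp add: mm_assoc)
  qed
  let ?W = "{w :: (nat, unit) cmat. ?I ** w = w}"
  have W: "csubspace ?W" by (auto simp: complex_vector.subspace_def mm_linear)
  obtain r and V :: "(nat, nat) cmat" where V: "ad V ** G0 ** V = idm {..<r}" "V ** idm {..<r} = V"
  "!!x. V ** x \<in> ?W" "!!w. w \<in> ?W ==> V ** (ad V ** G0 ** w) = w"
  by (rule gram_schmidt[of "{..<d}" ?W G0]) (use W G0h pos in auto)
  \<comment> \<open>\<open>unitarize\<close> expects its form as \<open>ad t ** t\<close>;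
    Gram-Schmidt for \<open>G0\<close> supplies such a root, with left inverse
    \<open>V\<close>.\<close>
  define t where "t = ad V ** G0"
  have Vt: "V ** t = ?I"
  proof (rule column_ext)
  fix w :: "(nat, unit) cmat"
  have "V ** t ** w = V ** (ad V ** G0 ** (?I ** w))" by (simp add: t_def mm_assoc mm_eq_assoc[OF G0s(2)])
  also have "... = ?I ** w" by (rule V(4)) (simp add: mm_eq_assoc)
  finally show "V ** t ** w = ?I ** w" .
  qed
  have tt: "ad t ** t = G0"
  proof -
  have "ad t ** t = G0 ** (V ** t)" by (simp add: t_def ad_mm G0h mm_assoc)
  then show ?thesis using Vt G0s by simp
  qed
  obtain n and V1 :: "(nat, nat) cmat" where
  U0: "V1 ** (ad V1 ** mapm (haar G) (ad v ** sc (ad t ** t) ** v)) = ?I"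
  "(ad V1 ** mapm (haar G) (ad v ** sc (ad t ** t) ** v)) ** V1 = idm {..<n}"
  "?I ** V1 = V1" "V1 ** idm {..<n} = V1"
  "idm {..<n} ** (ad V1 ** mapm (haar G) (ad v ** sc (ad t ** t) ** v)) = ad V1 ** mapm (haar G) (ad v ** sc (ad t ** t) ** v)"
  "ucorepm (idm {..<n}) (sc (ad V1 ** mapm (haar G) (ad v ** sc (ad t ** t) ** v)) ** v ** sc V1)"
  "ad (mapm (haar G) (ad v ** sc (ad t ** t) ** v)) = mapm (haar G) (ad v ** sc (ad t ** t) ** v)"
  "mapm (haar G) (ad v ** sc (ad t ** t) ** v) ** ?I = mapm (haar G) (ad v ** sc (ad t ** t) ** v)"
  by (rule unitarize[OF v Vt])
  define Q where "Q = mapm (haar G) (ad v ** sc G0 ** v)"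
  define R where "R = ad V1 ** Q"
  note U = U0[unfolded tt, folded Q_def, folded R_def]
  \<comment> \<open>\<omega> is (\<tau> \<otimes> h)\<alpha>, and the averaged form \<open>Q\<close>
    is its Gram matrix. Moving \<open>x\<close> across the inner product then shows that left
    multiplication respects adjoints.\<close>
  define \<omega> where "\<omega> z = (\<Sum>m<d. tr (e m) * haar G (\<alpha> z m))" for z
  have l\<omega>: "clinear_on VA UNIV \<omega>"
  using coact_linear
  by (auto simp: clinear_on_def \<omega>_def lin_add[OF lin_haar] lin_scale[OF lin_haar] scaleC_fun_apply
    scaleC_complex_def distrib_left sum.distrib sum_distrib_left mult_ac)
  have ent_Q: "ent Q i j = \<omega> ((e i)\<^sup>\<star> \<cdot> e j)" if ij: "i < d" "j < d" for i j
  proof -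
  note ei = e[OF ij(1)] and ej = e[OF ij(2)]
  have tr_expand: "tr (x \<cdot> y) = (\<Sum>m<d. (x \<cdot> y) m * tr (e m))" if "x \<in> VA" "y \<in> VA" for x y
   using clinear_on_expand[OF clinear_tr in_VA(1)[OF that]] by (simp add: d_def e_def scaleC_complex_def)
  have "\<omega> ((e i)\<^sup>\<star> \<cdot> e j) = (\<Sum>m<d. \<Sum>p<d. \<Sum>q<d. tr (e m) * ((e p \<cdot> e q) m * haar G (\<alpha> ((e i)\<^sup>\<star>) p * \<alpha> (e j) q)))"
  proof -
   have "\<alpha> ((e i)\<^sup>\<star> \<cdot> e j) m = (\<Sum>p<d. \<Sum>q<d. (e p \<cdot> e q) m *\<^sub>C (\<alpha> ((e i)\<^sup>\<star>) p * \<alpha> (e j) q))" for m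
    unfolding coact_mult[OF in_VA(2)[OF ei] ej] by (simp add: ext2_def sum_fun_apply elem_tensor_def d_def e_def)
   then show ?thesis
    by (simp add: \<omega>_def lin_sum[OF lin_haar] lin_scale[OF lin_haar] scaleC_complex_def sum_distrib_left)
  qed
  also have "... = (\<Sum>p<d. \<Sum>q<d. \<Sum>m<d. tr (e m) * ((e p \<cdot> e q) m * haar G (\<alpha> ((e i)\<^sup>\<star>) p * \<alpha> (e j) q)))"
   by (subst sum.swap) (rule sum.cong[OF refl], rule sum.swap)
  also have "... = (\<Sum>p<d. \<Sum>q<d. tr (e p \<cdot> e q) * haar G (\<alpha> ((e i)\<^sup>\<star>) p * \<alpha> (e j) q))"
   by (intro sum.cong refl) (simp add: tr_expand e sum_distrib_left sum_distrib_right mult_ac)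
  also have "... = (\<Sum>p<d. \<Sum>q<d. \<Sum>k<d. (((e k)\<^sup>\<star>) p * tr (e p \<cdot> e q)) * haar G (star (\<alpha> (e i) k) * \<alpha> (e j) q))"
  proof -
   have "\<alpha> ((e i)\<^sup>\<star>) p = (\<Sum>k<d. ((e k)\<^sup>\<star>) p *\<^sub>C star (\<alpha> (e i) k))" for p
    unfolding coact_star[OF ei] by (simp add: map_tensor_id_def sum_fun_apply elem_tensor_def d_def e_def)
   then show ?thesis
    by (simp add: sum_distrib_right sum_distrib_left mult_scaleC_left lin_sum[OF lin_haar]
      lin_scale[OF lin_haar] scaleC_complex_def mult_ac)
  qed
  also have "... = (\<Sum>k<d. \<Sum>q<d. \<Sum>p<d. (((e k)\<^sup>\<star>) p * tr (e p \<cdot> e q)) * haar G (star (\<alpha> (e i) k) * \<alpha> (e j) q))"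
  proof -
   have "(\<Sum>p<d. \<Sum>q<d. \<Sum>k<d. f p q k) = (\<Sum>k<d. \<Sum>q<d. \<Sum>p<d. f p q k)" for f :: "nat => nat => nat => complex"
   proof -
    have "(\<Sum>p<d. \<Sum>q<d. \<Sum>k<d. f p q k) = (\<Sum>q<d. \<Sum>p<d. \<Sum>k<d. f p q k)" by (rule sum.swap)
    also have "... = (\<Sum>q<d. \<Sum>k<d. \<Sum>p<d. f p q k)" by (rule sum.cong[OF refl], rule sum.swap)
    also have "... = (\<Sum>k<d. \<Sum>q<d. \<Sum>p<d. f p q k)" by (rule sum.swap)
    finally show ?thesis .
   qed
   then show ?thesis .
  qed
  also have "... = (\<Sum>k<d. \<Sum>q<d. tr ((e k)\<^sup>\<star> \<cdot> e q) * haar G (star (\<alpha> (e i) k) * \<alpha> (e j) q))"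
  proof (intro sum.cong refl)
   fix k q assume kq: "k \<in> {..<d}" "q \<in> {..<d}"
   have "clinear_on VA UNIV (%x. tr (x \<cdot> e q))"
    using kq e by (auto simp: clinear_on_def A_add A_scale tr_add tr_scale scaleC_complex_def)
   from clinear_on_expand[OF this in_VA(2)[OF e]] kq
   have "tr ((e k)\<^sup>\<star> \<cdot> e q) = (\<Sum>p<d. ((e k)\<^sup>\<star>) p * tr (e p \<cdot> e q))" by (simp add: d_def e_def scaleC_complex_def)
   then show "(\<Sum>p<d. (((e k)\<^sup>\<star>) p * tr (e p \<cdot> e q)) * haar G (star (\<alpha> (e i) k) * \<alpha> (e j) q))
    = tr ((e k)\<^sup>\<star> \<cdot> e q) * haar G (star (\<alpha> (e i) k) * \<alpha> (e j) q)" by (simp add: sum_distrib_right)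
  qed
  also have "... = haar G (ent (ad v ** (sc G0 ** v)) i j)"
  proof -
   have "ent (ad v ** (sc G0 ** v)) i j = (\<Sum>k<d. ent (ad v) i k * ent (sc G0 ** v) k j)"
    by (rule ent_mm) (auto simp: ent_ad ent_v)
   also have "... = (\<Sum>k<d. \<Sum>q<d. tr ((e k)\<^sup>\<star> \<cdot> e q) *\<^sub>C (star (\<alpha> (e i) k) * \<alpha> (e j) q))"
    using ij by (simp add: ent_ad ent_v ent_sc_mm_supp[OF G0s(2)] ent_G0 sum_distrib_left mult_scaleC_right)
   finally show ?thesis by (simp add: lin_sum[OF lin_haar] lin_scale[OF lin_haar] scaleC_complex_def)
  qed
  finally show ?thesis by (simp add: Q_def ent_mapm lin_zero[OF lin_haar] mm_assoc)
  qed
  have Qs: "?I ** Q = Q" using arg_cong[OF U(8), of ad] U(7) by (simp add: ad_mm)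
  have lms: "?I ** lm x = lm x" "lm x ** ?I = lm x" for x using lm_supp by (simp_all add: d_def)
  have adjoint: "ad (lm x) ** Q = Q ** lm (x\<^sup>\<star>)" if x: "x \<in> VA" for x
  proof (rule fmat_eqI)
  fix i j
  have al: "?I ** ad (lm x) = ad (lm x)" using ad_mm[of "lm x" ?I] lms(2)[of x] by simp
  have supp: "?I ** (ad (lm x) ** Q) = ad (lm x) ** Q" "(ad (lm x) ** Q) ** ?I = ad (lm x) ** Q"
   "?I ** (Q ** lm (x\<^sup>\<star>)) = Q ** lm (x\<^sup>\<star>)" "(Q ** lm (x\<^sup>\<star>)) ** ?I = Q ** lm (x\<^sup>\<star>)"
   by (simp_all add: mm_assoc mm_eq_assoc[OF al] mm_eq_assoc[OF Qs] U(8) lms)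
  show "ent (ad (lm x) ** Q) i j = ent (Q ** lm (x\<^sup>\<star>)) i j"
  proof (cases "i < d \<and> j < d")
   case True
   then have ij: "i < d" "j < d" by simp_all
   have "ent (ad (lm x) ** Q) i j = (\<Sum>k<d. cnj ((x \<cdot> e i) k) * \<omega> ((e k)\<^sup>\<star> \<cdot> e j))"
    using ij by (simp add: ent_mm_supp[OF Qs] ent_ad ent_lm ent_Q star_complex_def e_def flip: d_def)
   also have "... = \<omega> ((x \<cdot> e i)\<^sup>\<star> \<cdot> e j)"
    using antilinear_expand[OF l\<omega> e[OF ij(2)] in_VA(1)[OF x e[OF ij(1)]]] by (simp add: d_def e_def)
   also have "... = \<omega> ((e i)\<^sup>\<star> \<cdot> (x\<^sup>\<star> \<cdot> e j))" using x e ij by (simp add: star_mult mult_assoc)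
   also have "... = (\<Sum>k<d. (x\<^sup>\<star> \<cdot> e j) k * \<omega> ((e i)\<^sup>\<star> \<cdot> e k))"
    using linear_expand[OF l\<omega> in_VA(2)[OF e[OF ij(1)]] in_VA(1)[OF in_VA(2)[OF x] e[OF ij(2)]]]
    by (simp add: d_def e_def scaleC_complex_def)
   also have "... = ent (Q ** lm (x\<^sup>\<star>)) i j"
    using ij by (simp add: ent_mm_supp[OF lms(1)] ent_Q ent_lm e_def mult.commute flip: d_def)
   finally show ?thesis .
  next
   case False
   then show ?thesis using supp by (auto simp: idm_mm_iff mm_idm_iff)
  qed
  qed
  \<comment> \<open>The regular representation in the orthonormal coordinates given by
    \<open>V1\<close>, with \<open>R\<close> the inverse change of coordinates.\<close>
  define M :: "(nat, 'a, cvec) qobj" where "M = (idm {..<n}, sc R ** v ** sc V1, %x. R ** lm x ** V1)"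
  have VR: "V1 ** (R ** B) = ?I ** B" for B :: "(nat, 'j) cmat" by (rule mm_eq_assoc[OF U(1)])
  have adM: "ad (opr M x) = opr M (x\<^sup>\<star>)" if "x \<in> VA" for x
  using adjoint[OF that] U(7) by (simp add: M_def R_def ad_mm mm_assoc mm_eq_assoc[OF adjoint[OF that]])
  have ns: "pr M ** opr M x = opr M x" "opr M x ** pr M = opr M x" for x
  by (simp_all add: M_def mm_assoc U(4) mm_eq_assoc[OF U(5)])
  have uM: "uobj VA (astar A) M"
  unfolding uobj_def star_family_def using U(6) ns adM by (simp add: M_def)
  have eq: "cor M ** sc (opr M x) = spread M (\<alpha> x) ** cor M" if x: "x \<in> VA" for x
  proof -
  define L where "L = (\<Sum>k<d. mapm (%c. c *\<^sub>C \<alpha> x k) (lm (e k)))"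
  have "mapm (%c. c *\<^sub>C h) (lm y) ** sc ?I = mapm (%c. c *\<^sub>C h) (lm y)" for h :: 'a and y
   using mapm_mm_sc[OF lin_scaleC_right[of h], of "lm y" ?I] lms(2)[of y] by simp
  then have Ls: "L ** sc ?I = L" by (simp only: L_def mm_sum_left)
  have "mapm (%c. c *\<^sub>C h) (R ** lm y ** V1) = sc R ** (mapm (%c. c *\<^sub>C h) (lm y) ** sc V1)" for h :: 'a and y
   using mapm_sc_mm[OF lin_scaleC_right[of h], of R "lm y ** V1"] mapm_mm_sc[OF lin_scaleC_right[of h], of "lm y" V1]
   by (simp add: mm_assoc)
  then have sp: "spread M (\<alpha> x) = sc R ** L ** sc V1"
   by (simp add: spread_def L_def M_def mm_sum_left mm_sum_right mm_assoc d_def e_def)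
  \<comment> \<open>Covariance of the regular representation is the multiplicativity of \<alpha> on
    products of \<open>x\<close> with basis vectors.\<close>
  have "v ** sc (lm x) = L ** v"
  proof (rule fmat_eqI)
   fix i j
   have l: "ent (v ** sc (lm x)) i j = (\<Sum>k<d. ent (lm x) k j *\<^sub>C ent v i k)" by (rule ent_mm_sc_supp[OF lms(1)])
   have r: "ent (L ** v) i j = (\<Sum>l<d. ent L i l * ent v l j)" by (rule ent_mm) (auto simp: ent_v)
   have entL: "ent L i l = (\<Sum>k<d. ent (lm (e k)) i l *\<^sub>C \<alpha> x k)" for l by (simp add: L_def ent_sum ent_mapm)
   show "ent (v ** sc (lm x)) i j = ent (L ** v) i j"
   proof (cases "i < d \<and> j < d")
    case True
    then have ij: "i < d" "j < d" by simp_all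
    have "ent (v ** sc (lm x)) i j = (\<Sum>k<d. (x \<cdot> e j) k *\<^sub>C \<alpha> (e k) i)"
     using ij unfolding l by (simp add: ent_lm ent_v e_def flip: d_def)
    also have "... = \<alpha> (x \<cdot> e j) i"
     using clinear_on_expand[OF coact_linear in_VA(1)[OF x e[OF ij(2)]]]
     by (simp add: sum_fun_apply scaleC_fun_apply d_def e_def)
    also have "... = (\<Sum>k<d. \<Sum>l<d. (e k \<cdot> e l) i *\<^sub>C (\<alpha> x k * \<alpha> (e j) l))"
     using x e[OF ij(2)] by (simp add: coact_mult ext2_def sum_fun_apply elem_tensor_def flip: d_def e_def)
    also have "... = (\<Sum>l<d. \<Sum>k<d. (e k \<cdot> e l) i *\<^sub>C (\<alpha> x k * \<alpha> (e j) l))" by (rule sum.swap)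
    also have "... = ent (L ** v) i j"
     using ij unfolding r by (simp add: entL ent_lm ent_v sum_distrib_right mult_scaleC_left flip: d_def e_def)
    finally show ?thesis .
   next
    case False
    then show ?thesis unfolding l r by (auto simp: ent_v ent_lm entL simp flip: d_def)
   qed
  qed
  note vL = this
  have "cor M ** sc (opr M x) = sc R ** (v ** ((sc V1 ** sc R) ** sc (lm x))) ** sc V1"
   by (simp add: M_def sc_mm mm_assoc)
  also have "(sc V1 ** sc R) ** sc (lm x) = sc (lm x)"
   by (simp only: sc_mm[symmetric] U(1) lms(1))
  also have "sc R ** (v ** sc (lm x)) ** sc V1 = sc R ** ((L ** sc ?I) ** v) ** sc V1"
   by (simp only: vL Ls)
  also have "sc ?I = sc V1 ** (sc R :: (nat, nat, 'a) fmat)" by (simp only: sc_mm[symmetric] U(1))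
  also have "sc R ** ((L ** (sc V1 ** sc R)) ** v) ** sc V1 = spread M (\<alpha> x) ** cor M"
   unfolding sp by (simp add: M_def mm_assoc)
  finally show ?thesis .
  qed
  have "equivariant_rep M"
  unfolding equivariant_rep_def
  proof (intro conjI ballI allI)
  fix x y assume x: "x \<in> VA" and y: "y \<in> VA"
  show "opr M (x \<cdot> y) = opr M x ** opr M y"
   using x y lms by (simp add: M_def lm_mult mm_assoc VR mm_eq_assoc[OF lms(1)])
  show "opr M (x + y) = opr M x + opr M y" using x y by (simp add: M_def lm_add mm_linear)
  next
  fix c x assume "x \<in> VA"
  then show "opr M (c *\<^sub>C x) = c *\<^sub>C opr M x" by (simp add: M_def lm_scale mm_linear)
  next
  show "opr M (aone A) = pr M" using U(2,3) by (simp add: M_def lm_one mm_assoc flip: d_def)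
  qed (use uM eq in auto)
  moreover have "x = 0" if x: "x \<in> VA" and z: "opr M x = 0" for x
  proof (rule lm_zero_imp[OF x])
  have "lm x = V1 ** (opr M x ** R)" using U(1) lms by (simp add: M_def mm_assoc VR)
  then show "lm x = 0" using z by simp
  qed
  ultimately show thesis using that by blast
qed

end

section \<open>The imprimitivity bimodule\<close>

lemma ent_mm_unit: "ent (v ** w) i j = ent v i () * ent w () j"
  by (subst ent_mm[of UNIV]) (auto simp: UNIV_unit)

context quantum_group_coaction
begin

lemma opr_sum:
  assumes M: "equivariant_rep M" and S: "finite S" "!!i. i \<in> S ==> y i \<in> VA"
  shows "(\<Sum>i\<in>S. y i) \<in> VA \<and> opr M (\<Sum>i\<in>S. y i) = (\<Sum>i\<in>S. opr M (y i))"
  using S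
proof (induction S rule: finite_induct)
  case empty
  show ?case using equivariant_repD(4)[OF M, of 0 0] in_VA(7) by (simp only: sum.empty complex_vector.scale_zero_left scaleC_zero_left)
next
  case (insert i S)
  then have "y i \<in> VA" "(\<Sum>i\<in>S. y i) \<in> VA" "opr M (\<Sum>i\<in>S. y i) = (\<Sum>i\<in>S. opr M (y i))" by blast+
  then show ?case
  using equivariant_repD(3)[OF M, of "y i" "\<Sum>i\<in>S. y i"] in_VA(4)[of "y i" "\<Sum>i\<in>S. y i"]
  by (simp only: sum.insert[OF insert(1,2)] simp_thms)
qed

lemma opr_expand:
  assumes M: "equivariant_rep M" and x: "x \<in> VA"
  shows "opr M x = (\<Sum>k<adim A. x k *\<^sub>C opr M (ebasis k))"
proof -
  have "clinear_on VA UNIV (opr M)" using equivariant_repD(3,4)[OF M] by (simp add: clinear_on_def)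
  from clinear_on_expand[OF this x] show ?thesis .
qed

text \<open>A faithful representation stays injective after tensoring with the quantum group
  algebra: slicing by functionals reduces this to faithfulness. Identities for \<alpha> can thus be
  checked on matrices.\<close>

lemma spread_inject:
  assumes M: "equivariant_rep M" and inj: "!!x. x \<in> VA ==> opr M x = 0 ==> x = 0"
  and s: "s \<in> Cpow (adim A)" and t: "t \<in> Cpow (adim A)" and eq: "spread M s = spread M t"
  shows "s = t"
proof
  fix k
  show "s k = t k"
  proof (rule functional_ext)
  fix f :: "'a => complex" assume f: "lin f"
  define x where "x k = f (s k) - f (t k)" for k
  have x: "x \<in> VA" using s t lin_zero[OF f] by (simp add: x_def Cpow_def)
  have "opr M x = 0"
  proof (rule fmat_eqI)
   fix i j
   have "f (ent (spread M s) i j) = f (ent (spread M t) i j)" by (simp add: eq)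
   then show "ent (opr M x) i j = ent 0 i j"
    by (simp add: opr_expand[OF M x] ent_sum ent_scaleC ent_spread lin_sum[OF f] lin_scale[OF f]
      scaleC_complex_def x_def left_diff_distrib sum_subtractf mult.commute)
  qed
  then have "x = 0" by (rule inj[OF x])
  then show "f (s k) = f (t k)" by (metis eq_iff_diff_eq_0 x_def zero_fun_apply)
  qed
qed

definition col :: "nat => cvec => (nat, unit) cmat" where
  "col n xi = mk {..<n} UNIV (%i _. xi i)"

definition uncol :: "(nat, unit) cmat => cvec" where
  "uncol w = (%i. ent w i ())"

lemma ent_col: "ent (col n xi) i u = (if i < n then xi i else 0)"
  by (simp add: col_def ent_mk)

lemma col_supp: "idm {..<n} ** col n xi = col n xi"
  by (simp add: idm_mm_iff ent_col)

lemma uncol_col: "xi \<in> Cpow n ==> uncol (col n xi) = xi"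
  by (auto simp: uncol_def ent_col Cpow_def fun_eq_iff)

lemma col_uncol: "idm {..<n} ** w = w ==> col n (uncol w) = w"
  by (rule fmat_eqI) (auto simp: uncol_def ent_col idm_mm_iff)

lemma uncol_Cpow: "idm {..<n} ** w = w ==> uncol w \<in> Cpow n"
  by (auto simp: uncol_def Cpow_def idm_mm_iff)

lemma col_linear: "col n (xi + eta) = col n xi + col n eta" "col n (c *\<^sub>C xi) = c *\<^sub>C col n xi"
  and uncol_linear: "uncol (v + w) = uncol v + uncol w" "uncol (c *\<^sub>C v) = c *\<^sub>C uncol v"
  by (auto intro!: fmat_eqI simp: ent_col ent_add ent_scaleC uncol_def fun_eq_iff scaleC_fun_apply)

lemma ent_mm_col: "B ** idm {..<n} = B ==> ent (B ** col n xi) i () = (\<Sum>j<n. ent B i j * xi j)"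
  by (subst ent_mm_supp[OF col_supp]) (simp add: ent_col)

lemma ent_mm_col_ebasis: "B ** idm {..<n} = B ==> j < n ==> uncol (B ** col n (ebasis j)) i = ent B i j"
  by (simp add: uncol_def ent_mm_col) (simp add: ebasis_def if_distrib cong: if_cong)

text \<open>Up to the choice of coordinates the bimodule is the sum of the blocks of a faithful
  representation whose range is the commutant of the block projections; then \<open>lin xi eta\<close> is the
  element acting as the block diagonal part of the rank one operator \<open>xieta\<^sup>*\<close>.\<close>

lemma bimodule_of_blocks:
  fixes M :: "(nat, 'a, cvec) qobj" and P :: "nat => (nat, nat) cmat"
  assumes M: "equivariant_rep M" and prM: "pr M = idm {..<n}"
  and inj0: "!!x. x \<in> VA ==> opr M x = 0 ==> x = 0"
  and P: "!!b. b < k ==> proj (P b)" "!!b. b < k ==> P b ~= 0" "!!b. b < k ==> P b \<in> QHom VA M M"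
   "!!b c. b < k ==> c < k ==> b ~= c ==> P b ** P c = 0" "(\<Sum>b<k. P b) = idm {..<n}"
  and dense: "!!K. idm {..<n} ** K = K ==> K ** idm {..<n} = K ==> (!!b. b < k ==> P b ** K = K ** P b)
   ==> \<exists>x\<in>VA. opr M x = K"
  shows "equivariantly_Morita_equivalent G A \<alpha> (C_sum k) (snd (trivial_corep k))"
proof -
  note D = equivariant_repD[OF M] and DU = uobjD[OF D(1)]
  let ?I = "idm {..<n} :: (nat, nat) cmat" and ?c = "col n" and ?d = "adim A"
  define u where "u = cor M"
  define L where "L = opr M"
  have LI: "?I ** L x = L x" "x \<in> VA ==> L x ** ?I = L x" for x
  using DU(6,7) by (simp_all add: L_def prM)
  have uI: "sc ?I ** u = u" "u ** sc ?I = u" "ad u ** u = sc ?I" "u ** ad u = sc ?I"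
  using DU(2,3,4,5) by (simp_all add: u_def prM del: sc_idm)
  have inj: "x = y" if "x \<in> VA" "y \<in> VA" "L x = L y" for x y
  proof -
  have "opr M (x - y) = 0" using D(3)[of "x - y" y] that by (simp add: L_def)
  then show ?thesis using inj0[of "x - y"] that by simp
  qed
  have PI: "?I ** P b = P b" "P b ** ?I = P b" and Pad: "ad (P b) = P b"
  and PP: "P b ** P b = P b" "!!B :: (nat, unit) cmat. P b ** (P b ** B) = P b ** B"
  and PL: "!!x. x \<in> VA ==> P b ** L x = L x ** P b" and Pu: "sc (P b) ** u = u ** sc (P b)" if "b < k" for b
  using P(1,3)[OF that] projD by (auto simp: QHom_iff prM L_def u_def)
  \<comment> \<open>The right action of \<open>C_sum k\<close>: coordinate \<open>b\<close> acts as
    a scalar on block \<open>b\<close>.\<close>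
  define Y where "Y y = (\<Sum>b<k. y b *\<^sub>C P b)" for y :: cvec
  have YI: "?I ** Y y = Y y" "Y y ** ?I = Y y" for y
  by (simp_all add: Y_def mm_sum_left mm_sum_right mm_linear PI)
  have PY: "P b ** Y y = y b *\<^sub>C P b" "Y y ** P b = y b *\<^sub>C P b" if b: "b < k" for b y
  proof -
  have "P b ** Y y = (\<Sum>c<k. if c = b then y b *\<^sub>C P b else 0)"
   unfolding Y_def mm_sum_right by (rule sum.cong) (use b P(4) PP in \<open>auto simp: mm_linear\<close>)
  moreover have "Y y ** P b = (\<Sum>c<k. if c = b then y b *\<^sub>C P b else 0)"
   unfolding Y_def mm_sum_left by (rule sum.cong) (use b P(4) PP in \<open>auto simp: mm_linear\<close>)
  ultimately show "P b ** Y y = y b *\<^sub>C P b" "Y y ** P b = y b *\<^sub>C P b" using b by simp_all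
  qed
  have YY: "Y x ** Y y = Y (%i. x i * y i)" for x y
  proof -
  have "Y x ** Y y = (\<Sum>b<k. x b *\<^sub>C (P b ** Y y))" by (simp add: Y_def[of x] mm_sum_left mm_linear)
  then show ?thesis by (simp add: PY scaleC_scaleC Y_def[of "%i. x i * y i"])
  qed
  have Ylin: "Y (x + y) = Y x + Y y" "Y (c *\<^sub>C x) = c *\<^sub>C Y x" for x y c
  by (simp_all add: Y_def scaleC_add_left sum.distrib scaleC_sum_right scaleC_scaleC scaleC_fun_apply scaleC_complex_def)
  have Yone: "Y (%i. if i < k then 1 else 0) = ?I" using P(5) by (simp add: Y_def scaleC_one)
  have YL: "Y y ** L x = L x ** Y y" if "x \<in> VA" for x y
  by (simp add: Y_def mm_sum_left mm_sum_right mm_linear PL that)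
  have Yu: "sc (Y y) ** u = u ** sc (Y y)" for y
  by (simp add: Y_def sc_sum sc_scale mm_sum_left mm_sum_right mm_linear Pu)
  define lact where "lact x xi = uncol (L x ** ?c xi)" for x xi
  define ract where "ract xi y = uncol (Y y ** ?c xi)" for xi y
  define rin where "rin xi eta b = (if b < k then ent (ad (?c xi) ** (P b ** ?c eta)) () () else 0)" for xi eta b
  \<comment> \<open>The block diagonal part of \<open>K\<close>. By \<open>dense\<close> it lies in
    the range of the representation, so \<open>lin\<close> can be chosen through its image.\<close>
  define E where "E K = (\<Sum>b<k. P b ** (K ** P b))" for K :: "(nat, nat) cmat"
  define lin where "lin xi eta = (SOME x. x \<in> VA \<and> L x = E (?c xi ** ad (?c eta)))" for xi eta
  have EP: "P b ** E K = P b ** (K ** P b)" "E K ** P b = P b ** (K ** P b)" if b: "b < k" for b K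
  proof -
  have "P b ** E K = (\<Sum>c<k. if c = b then P b ** (K ** P b) else 0)"
   unfolding E_def mm_sum_right
   by (rule sum.cong) (use b P(4) PP(1) in \<open>auto simp flip: mm_assoc\<close>)
  moreover have "E K ** P b = (\<Sum>c<k. if c = b then P b ** (K ** P b) else 0)"
   unfolding E_def mm_sum_left
   by (rule sum.cong) (use b P(4) PP(1) in \<open>auto simp: mm_assoc\<close>)
  ultimately show "P b ** E K = P b ** (K ** P b)" "E K ** P b = P b ** (K ** P b)" using b by simp_all
  qed
  have EI: "?I ** E K = E K" "E K ** ?I = E K" for K
  by (simp_all add: E_def mm_sum_left mm_sum_right mm_assoc PI mm_eq_assoc[OF PI(1)])
  have Elin: "E (K + K') = E K + E K'" "E (c *\<^sub>C K) = c *\<^sub>C E K" for K K' c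
  by (simp_all add: E_def mm_linear sum.distrib scaleC_sum_right)
  have lin: "lin xi eta \<in> VA" "L (lin xi eta) = E (?c xi ** ad (?c eta))" for xi eta
  proof -
  have "\<exists>x\<in>VA. opr M x = E (?c xi ** ad (?c eta))" by (rule dense) (simp_all add: EI EP)
  then have "\<exists>x. x \<in> VA \<and> L x = E (?c xi ** ad (?c eta))" by (auto simp: L_def)
  from someI_ex[OF this] show "lin xi eta \<in> VA" "L (lin xi eta) = E (?c xi ** ad (?c eta))" by (simp_all add: lin_def)
  qed
  have cl: "?c (lact x xi) = L x ** ?c xi" for x xi
  unfolding lact_def by (rule col_uncol) (simp add: mm_eq_assoc[OF LI(1)])
  have cr: "?c (ract xi y) = Y y ** ?c xi" for y xi
  unfolding ract_def by (rule col_uncol) (simp add: mm_eq_assoc[OF YI(1)])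
  have Vl: "lact x xi \<in> Cpow n" for x xi
  unfolding lact_def by (rule uncol_Cpow) (simp add: mm_eq_assoc[OF LI(1)])
  have Vr: "ract xi y \<in> Cpow n" for y xi
  unfolding ract_def by (rule uncol_Cpow) (simp add: mm_eq_assoc[OF YI(1)])
  have Csum: "adim (C_sum k) = k" "amult (C_sum k) = (%x y i. x i * y i)"
  "aone (C_sum k) = (%i. if i < k then 1 else 0)" "astar (C_sum k) = (%x i. cnj (x i))"
  by (simp_all add: C_sum_def)
  have Vn: "xi + eta \<in> Cpow n" "c *\<^sub>C xi \<in> Cpow n" if "xi \<in> Cpow n" "eta \<in> Cpow n" for xi eta :: cvec and c
  using that by (auto simp: Cpow_def scaleC_fun_apply)
  have rinV: "rin xi eta \<in> Cpow k" for xi eta by (simp add: rin_def Cpow_def)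
  have rin_self: "rin xi xi b = of_real (\<Sum>i\<in>rows (P b ** ?c xi). (cmod (ent (P b ** ?c xi) i ()))\<^sup>2)"
  and Pc: "ad (P b ** ?c xi) ** (P b ** ?c xi) = ad (?c xi) ** (P b ** ?c xi)" if b: "b < k" for b xi
  proof -
  show Pc: "ad (P b ** ?c xi) ** (P b ** ?c xi) = ad (?c xi) ** (P b ** ?c xi)"
   using b by (simp add: ad_mm Pad mm_assoc PP)
  show "rin xi xi b = of_real (\<Sum>i\<in>rows (P b ** ?c xi). (cmod (ent (P b ** ?c xi) i ()))\<^sup>2)"
   using ent_ad_mm_self[of "P b ** ?c xi" "()"] Pc b by (simp add: rin_def)
  qed
  have zero: "xi = 0" if xi: "xi \<in> Cpow n" and z: "!!b. b < k ==> P b ** ?c xi = 0" for xi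
  proof -
  have "?c xi = (\<Sum>b<k. P b) ** ?c xi" by (simp add: P(5) col_supp)
  also have "... = 0" by (simp add: mm_sum_left z)
  finally have "uncol (?c xi) = 0" by (simp add: uncol_def fun_eq_iff)
  then show ?thesis by (simp add: uncol_col[OF xi])
  qed
  define \<delta> where "\<delta> = snd (corep_of n u)"
  have \<delta>c: "ent (u ** sc (?c xi)) i () = \<delta> xi i" for xi i
  using uI(1) by (simp add: ent_mm_sc_supp[OF col_supp] ent_col \<delta>_def corep_of_def idm_mm_iff)
  have ucol0: "\<delta> xi i = 0" if "\<not> i < n" for xi i using that by (simp add: \<delta>_def corep_of_def)
  have ent_sc_mmc: "ent (sc B ** (u ** sc (?c xi))) i () = (\<Sum>j<n. ent B i j *\<^sub>C \<delta> xi j)"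
  if "B ** ?I = B" for B xi i
  using \<delta>c by (simp add: ent_sc_mm_supp[OF that])
  have bim: "equivariant_imprimitivity_bimodule G A \<alpha> (C_sum k) (snd (trivial_corep k)) n \<delta> lact ract lin rin"
  proof
  show "cbilinear_on VA (Cpow n) (Cpow n) lact"
   using D(3,4) Vl by (auto simp: cbilinear_on_def clinear_on_def lact_def L_def mm_linear col_linear uncol_linear)
  show "cbilinear_on (Cpow n) (Cpow (adim (C_sum k))) (Cpow n) ract"
   using Vr by (auto simp: cbilinear_on_def clinear_on_def ract_def Ylin mm_linear col_linear uncol_linear)
  show "lact (aone A) xi = xi" if "xi \<in> Cpow n" for xi
   using D(5) that by (simp add: lact_def L_def prM col_supp uncol_col)
  show "lact (x \<cdot> y) xi = lact x (lact y xi)" if "x \<in> VA" "y \<in> VA" for x y xi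
   using D(2)[OF that] unfolding lact_def[of _ "lact y xi"] cl by (simp add: lact_def L_def mm_assoc)
  show "ract xi (aone (C_sum k)) = xi" if "xi \<in> Cpow n" for xi
   using that by (simp add: ract_def Csum Yone col_supp uncol_col)
  show "ract xi (amult (C_sum k) x y) = ract (ract xi x) y" for xi x y
  proof -
   have "Y (%i. x i * y i) = Y y ** Y x" by (simp add: YY mult.commute)
   then show ?thesis unfolding ract_def[of "ract xi x"] cr by (simp add: ract_def Csum mm_assoc)
  qed
  show "ract (lact x xi) y = lact x (ract xi y)" if "x \<in> VA" for x xi y
   unfolding lact_def[of _ "ract xi y"] ract_def[of "lact x xi"] cr cl by (simp add: YL[OF that] flip: mm_assoc)
  show "clinear_on (Cpow n) VA (%xi. lin xi eta)" for eta
   unfolding clinear_on_def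
  proof (intro conjI ballI allI)
   fix xi xi' c
   show "lin xi eta \<in> VA" by (rule lin(1))
   show "lin (xi + xi') eta = lin xi eta + lin xi' eta"
    by (rule inj) (use lin D(3) in \<open>simp_all add: L_def col_linear mm_linear Elin\<close>)
   show "lin (c *\<^sub>C xi) eta = c *\<^sub>C lin xi eta"
    by (rule inj) (use lin D(4) in \<open>simp_all add: L_def col_linear mm_linear Elin\<close>)
  qed
  show linl: "lin (lact x xi) eta = x \<cdot> lin xi eta" if x: "x \<in> VA" for x xi eta
  proof (rule inj)
   have "L (x \<cdot> lin xi eta) = L x ** E (?c xi ** ad (?c eta))" using D(2)[OF x lin(1)] lin(2) by (simp add: L_def)
   also have "... = E (L x ** (?c xi ** ad (?c eta)))"
    unfolding E_def mm_sum_right by (rule sum.cong) (simp_all add: mm_assoc mm_eq_assoc[OF PL[OF _ x]])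
   finally show "L (lin (lact x xi) eta) = L (x \<cdot> lin xi eta)" by (simp add: lin(2) cl mm_assoc)
  qed (use x lin(1) in auto)
  show "(lin xi eta)\<^sup>\<star> = lin eta xi" for xi eta
  proof (rule inj)
   have "L ((lin xi eta)\<^sup>\<star>) = ad (E (?c xi ** ad (?c eta)))" using D(7)[OF lin(1)] lin(2) by (simp add: L_def)
   also have "... = E (?c eta ** ad (?c xi))"
    unfolding E_def ad_sum by (rule sum.cong) (simp_all add: ad_mm Pad mm_assoc)
   finally show "L ((lin xi eta)\<^sup>\<star>) = L (lin eta xi)" by (simp add: lin(2))
  qed (use lin(1) in auto)
  show "\<exists>x\<in>VA. lin xi xi = x\<^sup>\<star> \<cdot> x" for xi
  proof -
   define r where "r b = (\<Sum>i\<in>rows (P b ** ?c xi). (cmod (ent (P b ** ?c xi) i ()))\<^sup>2)" for b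
   have r0: "r b \<ge> 0" for b by (simp add: r_def sum_nonneg)
   define B where "B b = P b ** (?c xi ** ad (?c xi) ** P b)" for b
   have adB: "ad (B b) = B b" if "b < k" for b using that by (simp add: B_def ad_mm Pad mm_assoc)
   have PB: "P c ** B b = (if c = b then B b else 0)" "B b ** P c = (if c = b then B b else 0)" if "b < k" "c < k" for b c
    using that P(4)[of c b] P(4)[of b c] PP(1) mm_eq_assoc[of "P c" "P b"] unfolding B_def
    by (auto simp: mm_assoc) (metis mm_assoc mm_zero(2))+
   have BB: "B b ** B b = of_real (r b) *\<^sub>C B b" if b: "b < k" for b
   proof -
    have "B b ** B b = (P b ** ?c xi) ** (ad (?c xi) ** (P b ** ?c xi)) ** (ad (?c xi) ** P b)"
     using b by (simp add: B_def mm_assoc mm_eq_assoc[OF PP(1)])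
    also have "... = of_real (r b) *\<^sub>C ((P b ** ?c xi) ** (ad (?c xi) ** P b))"
     unfolding mm_scalar mm_linear using rin_self[OF b, of xi] b by (simp add: rin_def r_def)
    finally show ?thesis by (simp add: B_def mm_assoc)
   qed
   have B0: "B b = 0" if b: "b < k" "r b = 0" for b
   proof -
    have "ent (ad (P b ** ?c xi) ** (P b ** ?c xi)) () () = of_real (r b)"
     by (simp only: r_def ent_ad_mm_self)
    then have "ad (P b ** ?c xi) ** (P b ** ?c xi) = 0"
     by (intro fmat_eqI) (simp add: b)
    then have "P b ** ?c xi = 0" by (rule ad_mm_self_zero)
    then show ?thesis by (simp add: B_def flip: mm_assoc)
   qed
   \<comment> \<open>\<open>B b\<close> has rank at most one and square
     \<open>r b *\<^sub>C B b\<close>, so division by the root of \<open>r b\<close> gives a square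
     root of \<open>B b\<close>. For \<open>r b = 0\<close> the convention 1 / 0 = 0 fits, because
     then \<open>B b = 0\<close>.\<close>
   define X where "X = (\<Sum>b<k. of_real (1 / sqrt (r b)) *\<^sub>C B b)"
   have PX: "P b ** X = of_real (1 / sqrt (r b)) *\<^sub>C B b" "X ** P b = of_real (1 / sqrt (r b)) *\<^sub>C B b" if b: "b < k" for b
   proof -
    have "P b ** X = (\<Sum>c<k. if c = b then of_real (1 / sqrt (r b)) *\<^sub>C B b else 0)"
     unfolding X_def mm_sum_right by (rule sum.cong) (use b in \<open>auto simp: mm_linear PB\<close>)
    moreover have "X ** P b = (\<Sum>c<k. if c = b then of_real (1 / sqrt (r b)) *\<^sub>C B b else 0)"
     unfolding X_def mm_sum_left by (rule sum.cong) (use b in \<open>auto simp: mm_linear PB\<close>)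
    ultimately show "P b ** X = of_real (1 / sqrt (r b)) *\<^sub>C B b" "X ** P b = of_real (1 / sqrt (r b)) *\<^sub>C B b"
     using b by simp_all
   qed
   have BI: "?I ** B b = B b" "B b ** ?I = B b" if "b < k" for b
    using that by (simp_all add: B_def mm_assoc PI mm_eq_assoc[OF PI(1)])
   have "\<exists>x\<in>VA. opr M x = X"
   proof (rule dense)
    show "?I ** X = X" "X ** ?I = X" by (simp_all add: X_def mm_sum_left mm_sum_right mm_linear BI)
   qed (simp add: PX)
   then obtain x where x: "x \<in> VA" "L x = X" by (auto simp: L_def)
   have adX: "ad X = X" by (simp add: X_def ad_sum ad_scale adB)
   have "X ** X = (\<Sum>b<k. of_real (1 / sqrt (r b)) *\<^sub>C (B b ** X))"
    by (subst (1) X_def) (simp add: mm_sum_left mm_linear)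
   also have "... = (\<Sum>b<k. B b)"
   proof (rule sum.cong[OF refl])
    fix b assume "b \<in> {..<k}"
    then have b: "b < k" by simp
    have "B b ** X = B b ** (P b ** X)" using PB(2)[OF b b] by (simp flip: mm_assoc)
    also have "... = of_real (1 / sqrt (r b)) *\<^sub>C (of_real (r b) *\<^sub>C B b)" by (simp only: PX[OF b] mm_linear BB[OF b])
    finally have BX: "B b ** X = of_real (1 / sqrt (r b)) *\<^sub>C (of_real (r b) *\<^sub>C B b)" .
    have "of_real s *\<^sub>C (of_real s *\<^sub>C (of_real q *\<^sub>C Z)) = of_real (s * s * q) *\<^sub>C Z"
     for s q and Z :: "(nat, nat) cmat" by (simp add: scaleC_scaleC mult_ac)
    then have "of_real (1 / sqrt (r b)) *\<^sub>C (B b ** X) = of_real ((1 / sqrt (r b)) * (1 / sqrt (r b)) * r b) *\<^sub>C B b"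
     unfolding BX .
    moreover have "(1 / sqrt (r b)) * (1 / sqrt (r b)) * r b = 1" if "r b ~= 0"
     using that r0[of b] by (simp add: field_simps flip: power2_eq_square)
    ultimately show "of_real (1 / sqrt (r b)) *\<^sub>C (B b ** X) = B b"
     using B0[OF b] by (cases "r b = 0") (simp_all only: of_real_1 scaleC_one, simp_all)
   qed
   finally have XX: "X ** X = (\<Sum>b<k. B b)" .
   have "lin xi xi = x\<^sup>\<star> \<cdot> x"
   proof (rule inj)
    have "L (x\<^sup>\<star> \<cdot> x) = X ** X"
     using D(2)[OF in_VA(2)[OF x(1)] x(1), folded L_def] D(7)[OF x(1), folded L_def] x(2) adX by simp
    then show "L (lin xi xi) = L (x\<^sup>\<star> \<cdot> x)" by (simp add: XX lin(2) E_def B_def)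
   qed (use x lin(1) in auto)
   then show ?thesis using x(1) by blast
  qed
  show "xi = 0" if xi: "xi \<in> Cpow n" and z: "lin xi xi = 0" for xi
  proof (rule zero[OF xi])
   fix b assume b: "b < k"
   have "L 0 = 0" using D(4)[of 0 0] in_VA(7) unfolding L_def by (metis complex_vector.scale_zero_left)
   then have "E (?c xi ** ad (?c xi)) = 0" using lin(2)[of xi xi] z by metis
   then have "(P b ** ?c xi) ** ad (P b ** ?c xi) = 0"
    using EP(1)[OF b, of "?c xi ** ad (?c xi)"] b by (simp add: ad_mm Pad mm_assoc)
   then have "ad (P b ** ?c xi) = 0" using ad_mm_self_zero[of "ad (P b ** ?c xi)"] by simp
   then show "P b ** ?c xi = 0" by (metis ad_ad ad_zero)
  qed
  show "cspan {lin xi eta | xi eta. xi \<in> Cpow n \<and> eta \<in> Cpow n} = VA"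
  proof
   show "cspan {lin xi eta | xi eta. xi \<in> Cpow n \<and> eta \<in> Cpow n} <= VA"
    by (rule complex_vector.span_minimal[OF _ Cpow_subspace]) (use lin(1) in auto)
   show "VA <= cspan {lin xi eta | xi eta. xi \<in> Cpow n \<and> eta \<in> Cpow n}"
   proof
    fix x assume x: "x \<in> VA"
    \<comment> \<open>The rank one operators of the standard basis add up to the identity, so these
      inner products add up to the block diagonal part of \<open>L x\<close>, which is
      \<open>L x\<close> itself.\<close>
    let ?s = "\<Sum>i<n. lin (lact x (ebasis i)) (ebasis i)"
    have s: "?s \<in> VA" "L ?s = (\<Sum>i<n. L (lin (lact x (ebasis i)) (ebasis i)))"
     using opr_sum[OF M, of "{..<n}" "%i. lin (lact x (ebasis i)) (ebasis i)"] lin(1) by (simp_all add: L_def)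
    have I: "(\<Sum>i<n. ?c (ebasis i) ** ad (?c (ebasis i))) = ?I"
    proof (rule fmat_eqI)
     fix p q
     have "ent (\<Sum>i<n. ?c (ebasis i) ** ad (?c (ebasis i))) p q = (\<Sum>i<n. if i = p then (if p = q then 1 else 0) else 0)"
      unfolding ent_sum by (rule sum.cong) (auto simp: ent_mm_unit ent_ad ent_col ebasis_def star_complex_def)
     then show "ent (\<Sum>i<n. ?c (ebasis i) ** ad (?c (ebasis i))) p q = ent ?I p q" by (simp add: ent_idm)
    qed
    have "L ?s = E (\<Sum>i<n. L x ** (?c (ebasis i) ** ad (?c (ebasis i))))"
     unfolding s(2) E_def lin(2) cl by (simp add: mm_sum_left mm_sum_right mm_assoc) (rule sum.swap)
    also have "... = E (L x)" using LI(2)[OF x] by (simp add: I flip: mm_sum_right)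
    also have "... = (\<Sum>b<k. P b) ** L x"
     unfolding E_def mm_sum_left by (rule sum.cong) (simp_all add: PL[OF _ x] PP(1) mm_eq_assoc[OF PL[OF _ x]] mm_assoc)
    also have "... = L x" by (simp add: P(5) LI)
    finally have "?s = x" using inj s(1) x by blast
    moreover have "?s \<in> cspan {lin xi eta | xi eta. xi \<in> Cpow n \<and> eta \<in> Cpow n}"
     using Vl ebasis_Cpow by (intro complex_vector.span_sum complex_vector.span_base) blast
    ultimately show "x \<in> cspan {lin xi eta | xi eta. xi \<in> Cpow n \<and> eta \<in> Cpow n}" by simp
   qed
  qed
  show "clinear_on (Cpow n) (Cpow (adim (C_sum k))) (rin xi)" for xi
   using rinV by (auto simp: clinear_on_def Csum rin_def fun_eq_iff col_linear mm_linear ent_add ent_scaleC scaleC_fun_apply)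
  show "rin xi (ract eta y) = amult (C_sum k) (rin xi eta) y" for xi eta y
   by (auto simp: fun_eq_iff rin_def Csum cr mm_eq_assoc[OF PY(1)] mm_linear ent_scaleC scaleC_complex_def)
  show "astar (C_sum k) (rin xi eta) = rin eta xi" for xi eta
  proof
   fix b
   show "astar (C_sum k) (rin xi eta) b = rin eta xi b"
   proof (cases "b < k")
    case True
    then have "ad (ad (?c xi) ** (P b ** ?c eta)) = ad (?c eta) ** (P b ** ?c xi)" by (simp add: ad_mm Pad mm_assoc)
    from arg_cong[OF this, of "%B. ent B () ()"] True show ?thesis
     by (simp add: rin_def Csum ent_ad star_complex_def)
   qed (simp add: rin_def Csum)
  qed
  show "\<exists>y\<in>Cpow (adim (C_sum k)). rin xi xi = amult (C_sum k) (astar (C_sum k) y) y" for xi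
  proof -
   define r where "r b = (\<Sum>i\<in>rows (P b ** ?c xi). (cmod (ent (P b ** ?c xi) i ()))\<^sup>2)" for b
   have r0: "r b \<ge> 0" for b by (simp add: r_def sum_nonneg)
   let ?y = "%b. if b < k then complex_of_real (sqrt (r b)) else 0"
   have "rin xi xi b = cnj (?y b) * ?y b" for b
    using rin_self[of b xi] r0[of b] by (cases "b < k") (simp_all add: r_def rin_def flip: of_real_mult)
   then have "rin xi xi = amult (C_sum k) (astar (C_sum k) ?y) ?y" by (simp add: Csum fun_eq_iff)
   moreover have "?y \<in> Cpow (adim (C_sum k))" by (simp add: Cpow_def Csum)
   ultimately show ?thesis by blast
  qed
  show "xi = 0" if xi: "xi \<in> Cpow n" and z: "rin xi xi = 0" for xi
  proof (rule zero[OF xi])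
   fix b assume b: "b < k"
   have "rin xi xi b = 0" using z by simp
   then have "ad (P b ** ?c xi) ** (P b ** ?c xi) = 0"
    using b by (intro fmat_eqI) (simp add: Pc rin_def)
   then show "P b ** ?c xi = 0" by (rule ad_mm_self_zero)
  qed
  show "cspan {rin xi eta | xi eta. xi \<in> Cpow n \<and> eta \<in> Cpow n} = Cpow (adim (C_sum k))"
  proof
   let ?R = "{rin xi eta | xi eta. xi \<in> Cpow n \<and> eta \<in> Cpow n}"
   show "cspan ?R <= Cpow (adim (C_sum k))"
    by (rule complex_vector.span_minimal[OF _ Cpow_subspace]) (use rinV in \<open>auto simp: Csum\<close>)
   have eb: "ebasis b \<in> cspan ?R" if b: "b < k" for b
   proof -
    obtain w :: "(nat, unit) cmat" where w: "P b ** w ~= 0"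
     using P(2)[OF b] column_ext[of "P b" 0] by auto
    \<comment> \<open>A vector in the range of \<open>P b\<close> has its inner product with itself
      concentrated in coordinate \<open>b\<close>.\<close>
    let ?w = "P b ** w" and ?xi = "uncol (P b ** w)"
    have wI: "?I ** ?w = ?w" by (simp add: mm_eq_assoc[OF PI(1)[OF b]])
    have xi: "?xi \<in> Cpow n" "?c ?xi = ?w" using uncol_Cpow[OF wI] col_uncol[OF wI] by simp_all
    define c where "c = ent (ad ?w ** ?w) () ()"
    have c: "c ~= 0" using ad_mm_self_pos[OF w] by (auto simp: c_def)
    have "rin ?xi ?xi = c *\<^sub>C ebasis b"
    proof
     fix b'
     have "P b' ** (P b ** w) = 0" if "b' < k" "b' ~= b"
      using mm_eq_assoc[OF P(4)[OF that(1) b that(2)], of w] by simp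
     then show "rin ?xi ?xi b' = (c *\<^sub>C ebasis b) b'"
      by (cases "b' = b"; cases "b' < k")
       (simp_all add: rin_def xi(2) scaleC_fun_apply ebasis_def scaleC_complex_def c_def PP(2) b)
    qed
    then have "ebasis b = (1 / c) *\<^sub>C rin ?xi ?xi" using c by (simp add: scaleC_scaleC)
    moreover have "rin ?xi ?xi \<in> cspan ?R" using xi(1) by (intro complex_vector.span_base) blast
    ultimately show ?thesis using complex_vector.span_scale[of "rin ?xi ?xi" ?R "1 / c"] by simp
   qed
   show "Cpow (adim (C_sum k)) <= cspan ?R"
   proof
    fix y :: cvec assume "y \<in> Cpow (adim (C_sum k))"
    then have "y = (\<Sum>b<k. y b *\<^sub>C ebasis b)" using Cpow_expand[of y k] by (simp add: Csum)
    moreover have "(\<Sum>b<k. y b *\<^sub>C ebasis b) \<in> cspan ?R"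
     by (intro complex_vector.span_sum complex_vector.span_scale eb) simp
    ultimately show "y \<in> cspan ?R" by metis
   qed
  qed
  show "lact (lin xi eta) \<zeta> = ract xi (rin eta \<zeta>)" for xi eta \<zeta>
  proof -
   have "E (?c xi ** ad (?c eta)) ** ?c \<zeta> = Y (rin eta \<zeta>) ** ?c xi"
    unfolding E_def Y_def mm_sum_left
   proof (rule sum.cong[OF refl])
    fix b assume "b \<in> {..<k}"
    then have b: "b < k" by simp
    have "P b ** (?c xi ** ad (?c eta) ** P b) ** ?c \<zeta> = P b ** ?c xi ** (ad (?c eta) ** (P b ** ?c \<zeta>))"
     by (simp add: mm_assoc)
    also have "... = rin eta \<zeta> b *\<^sub>C (P b ** ?c xi)" using b by (simp only: mm_scalar) (simp add: rin_def)
    finally show "P b ** (?c xi ** ad (?c eta) ** P b) ** ?c \<zeta> = rin eta \<zeta> b *\<^sub>C P b ** ?c xi"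
     by (simp add: mm_linear)
   qed
   then show ?thesis by (simp add: lact_def ract_def lin(2))
  qed
  show "corepresentation G (n, \<delta>)"
  proof -
   have "uobj {} id M" by (rule uobj_forget[OF D(1)])
   from uobj_unitary_corep(1)[OF this prM] show ?thesis
    by (simp add: unitary_corep_def \<delta>_def corep_of_def u_def split: prod.splits)
  qed
  show "\<delta> (lact x xi) = ext2 ?d n lact (\<alpha> x) (\<delta> xi)" if x: "x \<in> VA" for x xi
  proof
   fix i
   have "\<delta> (lact x xi) i = ent (spread M (\<alpha> x) ** (u ** sc (?c xi))) i ()"
    using D(6)[OF x] by (simp add: cl sc_mm mm_assoc mm_eq_assoc[OF D(6)[OF x]] L_def u_def flip: \<delta>c)
   also have "... = (\<Sum>j<n. ent (spread M (\<alpha> x)) i j * \<delta> xi j)"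
    by (subst ent_mm[of "{..<n}"]) (auto simp: \<delta>c ucol0)
   also have "... = (\<Sum>j<n. \<Sum>l<?d. ent (L (ebasis l)) i j *\<^sub>C (\<alpha> x l * \<delta> xi j))"
    by (simp add: ent_spread sum_distrib_right mult_scaleC_left L_def)
   also have "... = (\<Sum>l<?d. \<Sum>j<n. ent (L (ebasis l)) i j *\<^sub>C (\<alpha> x l * \<delta> xi j))" by (rule sum.swap)
   also have "... = ext2 ?d n lact (\<alpha> x) (\<delta> xi) i"
    by (simp add: ext2_def sum_fun_apply elem_tensor_def lact_def ent_mm_col_ebasis LI ebasis_Cpow)
   finally show "\<delta> (lact x xi) i = ext2 ?d n lact (\<alpha> x) (\<delta> xi) i" .
  qed
  show "\<delta> (ract xi y) = ext2 n (adim (C_sum k)) ract (\<delta> xi) (snd (trivial_corep k) y)" for xi y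
  proof
   fix i
   have "\<delta> (ract xi y) i = ent (sc (Y y) ** (u ** sc (?c xi))) i ()"
    by (simp add: cr sc_mm mm_eq_assoc[OF Yu] mm_assoc flip: \<delta>c)
   also have "... = (\<Sum>j<n. \<Sum>b<k. (ent (P b) i j * y b) *\<^sub>C \<delta> xi j)"
    by (simp add: ent_sc_mmc YI) (simp add: Y_def ent_sum ent_scaleC scaleC_complex_def scaleC_sum_left mult.commute)
   also have "... = ext2 n (adim (C_sum k)) ract (\<delta> xi) (snd (trivial_corep k) y) i"
   proof -
    have "Y (ebasis b) = P b" if "b < k" for b
     using sum_ebasis[of b P k] that by (simp add: Y_def)
    then have "ract (ebasis j) (ebasis b) i = ent (P b) i j" if "b < k" "j < n" for b j
     using that by (simp add: ract_def ent_mm_col_ebasis PI)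
    then show ?thesis
     by (simp add: ext2_def sum_fun_apply elem_tensor_def trivial_corep_def Csum mult_scaleC_right scaleC_scaleC)
   qed
   finally show "\<delta> (ract xi y) i = ext2 n (adim (C_sum k)) ract (\<delta> xi) (snd (trivial_corep k) y) i" .
  qed
  \<comment> \<open>Compared in the faithful representation: by covariance the left side is the
    block diagonal part conjugated by \<open>u\<close>, and the block projections commute with
    \<open>u\<close>.\<close>
  show "\<alpha> (lin xi eta) = ext2 n n lin (\<delta> xi) (star \<circ> \<delta> eta)" for xi eta
  proof (rule spread_inject[OF M inj0])
   show "\<alpha> (lin xi eta) \<in> Cpow ?d" by (rule clinear_on_in[OF coact_linear lin(1)])
   show "ext2 n n lin (\<delta> xi) (star \<circ> \<delta> eta) \<in> Cpow ?d"
    using lin(1) by (simp add: Cpow_def ext2_def sum_fun_apply elem_tensor_def)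
   show "spread M (\<alpha> (lin xi eta)) = spread M (ext2 n n lin (\<delta> xi) (star \<circ> \<delta> eta))"
   proof (rule fmat_eqI)
    fix p q
    let ?x = "lin xi eta"
    let ?h = "%i j. \<delta> xi i * star (\<delta> eta j)"
    have "spread M (\<alpha> ?x) = spread M (\<alpha> ?x) ** (u ** ad u)"
     using spread_pr(2)[OF D(1), of "\<alpha> ?x"] by (simp add: uI(4) prM)
    also have "... = u ** sc (L ?x) ** ad u"
     using D(6)[OF lin(1)] by (simp add: u_def L_def flip: mm_assoc)
    also have "... = (\<Sum>b<k. sc (P b) ** ((u ** sc (?c xi)) ** ad (u ** sc (?c eta)) ** sc (P b)))"
     unfolding lin(2) E_def sc_sum mm_sum_right mm_sum_left
    proof (rule sum.cong[OF refl])
     fix b assume "b \<in> {..<k}"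
     then have b: "b < k" by simp
     have Pad_u: "sc (P b) ** ad u = ad u ** sc (P b)"
      using arg_cong[OF Pu[OF b], of ad] by (simp add: ad_mm ad_sc Pad[OF b])
     show "u ** sc (P b ** (?c xi ** ad (?c eta) ** P b)) ** ad u
      = sc (P b) ** ((u ** sc (?c xi)) ** ad (u ** sc (?c eta)) ** sc (P b))"
      by (simp add: sc_mm ad_mm ad_sc mm_assoc Pad_u mm_eq_assoc[OF Pu[OF b]])
    qed
    finally have "ent (spread M (\<alpha> ?x)) p q
     = (\<Sum>b<k. ent (sc (P b) ** ((u ** sc (?c xi)) ** ad (u ** sc (?c eta)) ** sc (P b))) p q)"
     by (simp add: ent_sum)
    also have "... = (\<Sum>b<k. \<Sum>i<n. \<Sum>j<n. (ent (P b) p i * ent (P b) j q) *\<^sub>C ?h i j)"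
    proof (rule sum.cong[OF refl])
     fix b assume "b \<in> {..<k}"
     then have b: "b < k" by simp
     have "ent ((u ** sc (?c xi)) ** ad (u ** sc (?c eta))) i j = ?h i j" for i j
      by (simp add: ent_mm_unit \<delta>c ent_ad)
     then show "ent (sc (P b) ** ((u ** sc (?c xi)) ** ad (u ** sc (?c eta)) ** sc (P b))) p q
      = (\<Sum>i<n. \<Sum>j<n. (ent (P b) p i * ent (P b) j q) *\<^sub>C ?h i j)"
      by (simp add: ent_sc_mm_supp[OF PI(2)[OF b]] ent_mm_sc_supp[OF PI(1)[OF b]] scaleC_sum_right scaleC_scaleC)
    qed
    also have "... = (\<Sum>i<n. \<Sum>j<n. \<Sum>b<k. (ent (P b) p i * ent (P b) j q) *\<^sub>C ?h i j)"
     by (subst sum.swap) (rule sum.cong[OF refl], rule sum.swap)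
    also have "... = (\<Sum>i<n. \<Sum>j<n. ent (L (lin (ebasis i) (ebasis j))) p q *\<^sub>C ?h i j)"
    proof (intro sum.cong refl)
     fix i j assume ij: "i \<in> {..<n}" "j \<in> {..<n}"
     have u: "?c (ebasis i) ** ad (?c (ebasis j)) = unitm i j"
      by (rule fmat_eqI) (use ij in \<open>auto simp: ent_mm_unit ent_ad ent_col ent_unitm ebasis_def star_complex_def\<close>)
     have "ent (P b ** (unitm i j ** P b)) p q = ent (P b) p i * ent (P b) j q" if b: "b < k" for b
     proof -
      have "ent (P b ** (unitm i j ** P b)) p q = (\<Sum>l<n. ent (P b) p l * ent (unitm i j ** P b) l q)"
       by (rule ent_mm) (use PI(2)[OF b] in \<open>auto simp: mm_idm_iff\<close>)
      also have "... = (\<Sum>l<n. if l = i then ent (P b) p i * ent (P b) j q else 0)"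
       by (rule sum.cong) (auto simp: ent_unitm_mm)
      finally show ?thesis using ij by simp
     qed
     then show "(\<Sum>b<k. (ent (P b) p i * ent (P b) j q) *\<^sub>C ?h i j) = ent (L (lin (ebasis i) (ebasis j))) p q *\<^sub>C ?h i j"
      by (simp add: lin(2) E_def u ent_sum scaleC_sum_left)
    qed
    also have "... = (\<Sum>i<n. \<Sum>j<n. \<Sum>m<?d. ent (L (ebasis m)) p q *\<^sub>C (lin (ebasis i) (ebasis j) m *\<^sub>C ?h i j))"
     using opr_expand[OF M lin(1)] by (simp add: L_def ent_sum ent_scaleC scaleC_complex_def scaleC_sum_left scaleC_scaleC mult.commute)
    also have "... = (\<Sum>m<?d. \<Sum>i<n. \<Sum>j<n. ent (L (ebasis m)) p q *\<^sub>C (lin (ebasis i) (ebasis j) m *\<^sub>C ?h i j))"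
    proof -
     have "(\<Sum>i<n. \<Sum>j<n. \<Sum>m<?d. f i j m) = (\<Sum>i<n. \<Sum>m<?d. \<Sum>j<n. f i j m)" for f :: "_ => _ => _ => 'a"
      by (rule sum.cong[OF refl], rule sum.swap)
     then show ?thesis by (simp only: sum.swap[of _ "{..<?d}" "{..<n}"])
    qed
    also have "... = ent (spread M (ext2 n n lin (\<delta> xi) (star \<circ> \<delta> eta))) p q"
     by (simp add: ent_spread ext2_def sum_fun_apply elem_tensor_def scaleC_sum_right L_def)
    finally show "ent (spread M (\<alpha> ?x)) p q = ent (spread M (ext2 n n lin (\<delta> xi) (star \<circ> \<delta> eta))) p q" .
   qed
  qed
  show "snd (trivial_corep k) (rin xi eta) = ext2 n n rin (star \<circ> \<delta> xi) (\<delta> eta)" for xi eta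
  proof
   fix b
   show "snd (trivial_corep k) (rin xi eta) b = ext2 n n rin (star \<circ> \<delta> xi) (\<delta> eta) b"
   proof (cases "b < k")
    case b: True
    let ?u = "u ** sc (?c xi)" and ?v = "u ** sc (?c eta)"
    have r: "rin (ebasis i) (ebasis j) b = ent (P b) i j" if ij: "i < n" "j < n" for i j
    proof -
     have "rin (ebasis i) (ebasis j) b = (\<Sum>l<n. cnj (ebasis i l) * uncol (P b ** ?c (ebasis j)) l)"
      using b by (simp add: rin_def uncol_def ent_col ent_ad star_complex_def
       ent_mm_supp[of n "P b ** ?c (ebasis j)"] mm_eq_assoc[OF PI(1)[OF b]])
     also have "... = (\<Sum>l<n. if l = i then ent (P b) i j else 0)"
      by (rule sum.cong) (use ij b in \<open>auto simp: ebasis_def ent_mm_col_ebasis[OF PI(2)[OF b], unfolded ebasis_def]\<close>)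
     finally show ?thesis using ij by simp
    qed
    have "ad ?u ** (sc (P b) ** ?v) = sc (ad (?c xi)) ** ((ad u ** u) ** sc (P b ** ?c eta))"
     by (simp add: ad_mm ad_sc sc_mm mm_assoc mm_eq_assoc[OF Pu[OF b]])
    also have "... = sc (ad (?c xi) ** (P b ** ?c eta))"
     using mm_eq_assoc[OF PI(1)[OF b], of "?c eta"] by (simp only: uI(3) flip: sc_mm)
    finally have "rin xi eta b *\<^sub>C 1 = ent (ad ?u ** (sc (P b) ** ?v)) () ()"
     using b by (simp add: rin_def ent_sc)
    also have "... = (\<Sum>i<n. star (\<delta> xi i) * (\<Sum>j<n. ent (P b) i j *\<^sub>C \<delta> eta j))"
     by (subst ent_mm[of "{..<n}"]) (auto simp: ent_ad \<delta>c ucol0 ent_sc_mmc PI b)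
    also have "... = ext2 n n rin (star \<circ> \<delta> xi) (\<delta> eta) b"
     by (simp add: ext2_def sum_fun_apply elem_tensor_def r sum_distrib_left mult_scaleC_right)
    finally show ?thesis by (simp add: trivial_corep_def elem_tensor_def)
   next
    case False
    then show ?thesis by (simp add: trivial_corep_def elem_tensor_def ext2_def sum_fun_apply rin_def)
   qed
  qed
  qed
  then show ?thesis unfolding equivariantly_Morita_equivalent_def by blast
qed

end

section \<open>Direct sums of representations\<close>

text \<open>All summands share one index type and are told apart by the first coordinate, so the
  direct sum is again a single matrix.\<close>

definition dsum :: "nat => (nat => ('i, 'j, 'c) fmat) => (nat \<times> 'i, nat \<times> 'j, 'c::complex_star_algebra) fmat" where
  "dsum k f = (\<Sum>b<k. kr (sc (unitm b b)) (f b))"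

lemma ent_dsum: "ent (dsum k f) (b, i) (c, j) = (if b = c \<and> b < k then ent (f b) i j else 0)"
proof -
  have "ent (dsum k f) (b, i) (c, j) = (\<Sum>a<k. if a = b then (if b = c then ent (f b) i j else 0) else 0)"
  unfolding dsum_def ent_sum
  by (rule sum.cong) (auto simp: ent_kr ent_sc ent_unitm scaleC_one)
  then show ?thesis by simp
qed

lemma dsum_mm: "dsum k f ** dsum k g = dsum k (%b. f b ** g b)"
proof -
  have u: "unitm b b ** unitm c c = (if b = c then unitm b b else (0 :: (nat, nat) cmat))" for b c :: nat
  by (rule fmat_eqI) (auto simp: ent_unitm_mm ent_unitm)
  have "kr (sc (unitm b b)) (f b) ** kr (sc (unitm c c)) (g c)
  = (if c = b then kr (sc (unitm b b)) (f b ** g b) else 0)" for b c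
  by (simp add: kr_mm_sc2 u flip: sc_mm)
  then show ?thesis by (simp add: dsum_def mm_sum_left mm_sum_right)
qed

lemma dsum_eqI: "(!!b i c j. ent A (b, i) (c, j) = (if b = c \<and> b < k then ent (f b) i j else 0)) ==> A = dsum k f"
  by (rule kr_eqI) (simp add: ent_dsum)

lemma ad_dsum: "ad (dsum k f) = dsum k (%b. ad (f b))"
  by (rule dsum_eqI) (auto simp: ent_ad ent_dsum)

lemma sc_dsum: "sc (dsum k f) = dsum k (%b. sc (f b))"
  by (rule dsum_eqI) (auto simp: ent_sc ent_dsum)

lemma mapm_dsum: "f 0 = 0 ==> mapm f (dsum k g) = dsum k (%b. mapm f (g b))"
  by (rule dsum_eqI) (auto simp: ent_mapm ent_dsum)

lemma dsum_cong: "(!!b. b < k ==> f b = g b) ==> dsum k f = dsum k g"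
  by (simp add: dsum_def)

definition block :: "nat => nat => (nat \<times> 'i, nat \<times> 'j, 'c::zero) fmat => ('i, 'j, 'c) fmat" where
  "block b c T = rr (%i. (b, i)) (cr (%i. (c, i)) T)"

lemma ent_block: "ent (block b c T) i j = ent T (b, i) (c, j)"
  by (simp add: block_def ent_rr ent_cr inj_def)

lemma ent_dsum_mm: "ent (dsum k f ** T) (b, i) r = (if b < k then \<Sum>m\<in>cols (f b). ent (f b) i m * ent T (b, m) r else 0)"
proof (cases "b < k")
  case True
  have "ent (dsum k f ** T) (b, i) r = (\<Sum>p\<in>{b} \<times> cols (f b). ent (dsum k f) (b, i) p * ent T p r)"
  proof (rule ent_mm)
  fix p assume "p \<notin> {b} \<times> cols (f b)"
  then show "ent (dsum k f) (b, i) p * ent T p r = 0"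
   by (cases p; cases "fst p = b") (auto simp: ent_dsum ent_cols)
  qed simp
  moreover have "{b} \<times> cols (f b) = Pair b ` cols (f b)" by auto
  ultimately show ?thesis using True by (simp add: ent_dsum sum.reindex inj_on_def)
next
  case False
  have "ent (dsum k f ** T) (b, i) r = (\<Sum>p\<in>{}. ent (dsum k f) (b, i) p * ent T p r)"
  by (rule ent_mm) (use False in \<open>auto simp: ent_dsum\<close>)
  then show ?thesis using False by simp
qed

lemma ent_mm_dsum: "ent (T ** dsum k f) r (c, j) = (if c < k then \<Sum>m\<in>rows (f c). ent T r (c, m) * ent (f c) m j else 0)"
proof (cases "c < k")
  case True
  have "ent (T ** dsum k f) r (c, j) = (\<Sum>p\<in>{c} \<times> rows (f c). ent T r p * ent (dsum k f) p (c, j))"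
  proof (rule ent_mm)
  fix p assume "p \<notin> {c} \<times> rows (f c)"
  then show "ent T r p * ent (dsum k f) p (c, j) = 0"
   by (cases p; cases "fst p = c") (auto simp: ent_dsum ent_rows)
  qed simp
  moreover have "{c} \<times> rows (f c) = Pair c ` rows (f c)" by auto
  ultimately show ?thesis using True by (simp add: ent_dsum sum.reindex inj_on_def)
next
  case False
  have "ent (T ** dsum k f) r (c, j) = (\<Sum>p\<in>{}. ent T r p * ent (dsum k f) p (c, j))"
  by (rule ent_mm) (use False in \<open>auto simp: ent_dsum\<close>)
  then show ?thesis using False by simp
qed

lemma block_dsum_mm: "b < k ==> block b c (dsum k f ** T) = f b ** block b c T"
  by (rule fmat_eqI) (simp add: ent_block ent_dsum_mm ent_mm0[of "f b"])

lemma block_mm_dsum: "c < k ==> block b c (T ** dsum k f) = block b c T ** f c"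
  by (rule fmat_eqI, subst ent_mm[of "rows (f c)"]) (simp_all add: ent_block ent_mm_dsum ent_rows)

context quantum_group_coaction
begin

lemma equivariant_rep_dsum:
  fixes E :: "nat => ('i, 'a, cvec) qobj"
  assumes E: "!!b. b < k ==> equivariant_rep (E b)"
  shows "equivariant_rep (dsum k (%b. pr (E b)), dsum k (%b. cor (E b)), %x. dsum k (%b. opr (E b) x))"
  (is "equivariant_rep ?D")
proof -
  note D = equivariant_repD[OF E] and U = uobjD[OF equivariant_repD(1)[OF E]]
  have c: "corepm (pr ?D) (cor ?D)"
  unfolding corepm_def proj_def fst_conv snd_conv ad_dsum sc_dsum dsum_mm
   mapm_dsum[of "comult G", OF comult_zero] mapm_dsum[of "counit G", OF counit_zero]
   mapm_dsum[of leg1, OF tensor_zero(1)] mapm_dsum[of leg2, OF tensor_zero(2)]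
  by (intro conjI dsum_cong) (use U(2,3) projD[OF U(1)] corepmD(4,5)[OF U(8)] in auto)
  have u: "ucorepm (pr ?D) (cor ?D)"
  unfolding ucorepm_def fst_conv snd_conv ad_dsum sc_dsum dsum_mm
  using c by (auto intro!: dsum_cong simp: U(4))
  have sf: "star_family VA (astar A) (pr ?D, opr ?D)"
  unfolding star_family_def proj_def fst_conv snd_conv ad_dsum dsum_mm
  by (intro conjI ballI dsum_cong in_VA) (use U(6,7) D(7) projD[OF U(1)] in auto)
  have sp: "spread ?D t = dsum k (%b. spread (E b) t)" for t
  proof (rule dsum_eqI)
  fix b i c j
  show "ent (spread ?D t) (b, i) (c, j) = (if b = c \<and> b < k then ent (spread (E b) t) i j else 0)"
   by (cases "b = c"; cases "b < k") (simp_all add: ent_spread ent_dsum)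
  qed
  have lin: "dsum k (%b. f b + g b) = dsum k f + dsum k g" "dsum k (%b. a *\<^sub>C f b) = a *\<^sub>C dsum k f"
  for f g :: "nat => ('i, 'i) cmat" and a
  by (rule dsum_eqI[symmetric], auto simp: ent_add ent_scaleC ent_dsum)+
  have pr: "pr ?D ** opr ?D x = opr ?D x" for x
  unfolding fst_conv snd_conv dsum_mm by (rule dsum_cong) (rule U(6))
  show ?thesis
  unfolding equivariant_rep_def uobj_def
  proof (intro conjI allI ballI u sf pr)
  fix x y assume "x \<in> VA" "y \<in> VA"
  then show "opr ?D (x \<cdot> y) = opr ?D x ** opr ?D y" "opr ?D (x + y) = opr ?D x + opr ?D y"
   unfolding fst_conv snd_conv dsum_mm by (auto intro!: dsum_cong simp: D(2,3) simp flip: lin)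
  next
  fix a x assume "x \<in> VA"
  then show "opr ?D (a *\<^sub>C x) = a *\<^sub>C opr ?D x"
   unfolding fst_conv snd_conv by (auto intro!: dsum_cong simp: D(4) simp flip: lin)
  next
  show "opr ?D (aone A) = pr ?D" unfolding fst_conv snd_conv by (rule dsum_cong) (rule D(5))
  next
  fix x assume x: "x \<in> VA"
  show "cor ?D ** sc (opr ?D x) = spread ?D (\<alpha> x) ** cor ?D"
   unfolding sp unfolding fst_conv snd_conv sc_dsum dsum_mm by (rule dsum_cong) (rule D(6)[OF _ x])
  qed
qed

text \<open>Conjugation by an isometry onto the object moves it to the coordinates
  \<open>{..<n}\<close>, the form in which an imprimitivity bimodule is asked for.\<close>

lemma equivariant_rep_compress:
  fixes M :: "('i, 'a, cvec) qobj" and V :: "('i, nat) cmat"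
  assumes M: "equivariant_rep M" and V: "ad V ** V = idm {..<n}" "V ** idm {..<n} = V" "V ** ad V = pr M" "pr M ** V = V"
  shows "equivariant_rep (idm {..<n}, sc (ad V) ** cor M ** sc V, %x. ad V ** opr M x ** V)"
  (is "equivariant_rep ?N")
proof -
  note D = equivariant_repD[OF M] and U = uobjD[OF D(1)]
  have Vad: "idm {..<n} ** ad V = ad V" using ad_mm[of V "idm {..<n}"] V(2) by simp
  have VP: "ad V ** pr M = ad V" using ad_mm[of "pr M" V] V(4) projD(1)[OF U(1)] by simp
  have Vs: "sc V ** sc (ad V) = (sc (pr M) :: ('i, 'i, 'a) fmat)" "sc (pr M) ** sc V = (sc V :: ('i, nat, 'a) fmat)"
  "sc (ad V) ** sc V = (sc (idm {..<n}) :: (nat, nat, 'a) fmat)"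
  by (simp_all only: sc_mm[symmetric] V)
  have c: "corepm (idm {..<n}) (sc (ad V) ** cor M ** sc V)"
  by (rule corepm_similar[OF U(8) V(3) V(1) _ Vad V(2)]) simp
  have "ad (cor ?N) ** cor ?N = sc (ad V) ** (ad (cor M) ** (sc V ** sc (ad V)) ** cor M) ** sc V"
  by (simp add: ad_mm ad_sc mm_assoc)
  also have "... = sc (ad V) ** (ad (cor M) ** cor M) ** sc V"
  unfolding Vs using U(2) by (simp add: mm_assoc mm_eq_assoc[OF U(2)])
  also have "... = sc (idm {..<n})" unfolding U(4) using Vs(2,3) by (simp add: mm_assoc)
  finally have u: "ucorepm (pr ?N) (cor ?N)" using c by (simp add: ucorepm_def)
  have prN: "pr ?N ** opr ?N x = opr ?N x" "opr ?N x ** pr ?N = opr ?N x" for x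
  by (simp_all add: mm_assoc V(2) mm_eq_assoc[OF Vad])
  have adN: "ad (opr ?N x) = opr ?N (x\<^sup>\<star>)" if "x \<in> VA" for x
  using D(7)[OF that] by (simp add: ad_mm mm_assoc)
  have uN: "uobj VA (astar A) ?N"
  unfolding uobj_def star_family_def using u prN adN by simp
  have VV: "V ** (ad V ** B) = pr M ** B" for B :: "('i, nat) cmat" by (rule mm_eq_assoc[OF V(3)])
  have sp: "spread ?N t = sc (ad V) ** spread M t ** sc V" for t
  proof -
  have "mapm (%c. c *\<^sub>C h) (ad V ** B ** V) = sc (ad V) ** (mapm (%c. c *\<^sub>C h) B ** sc V)" for h :: 'a and B
   using mapm_sc_mm[OF lin_scaleC_right[of h], of "ad V" "B ** V"] mapm_mm_sc[OF lin_scaleC_right[of h], of B V]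
   by (simp add: mm_assoc)
  then show ?thesis by (simp add: spread_def mm_sum_left mm_sum_right mm_assoc)
  qed
  show ?thesis
  unfolding equivariant_rep_def
  proof (intro conjI allI ballI uN)
  fix x y assume x: "x \<in> VA" and y: "y \<in> VA"
  show "opr ?N (x \<cdot> y) = opr ?N x ** opr ?N y" using D(2)[OF x y] by (simp add: mm_assoc VV mm_eq_assoc[OF U(6)])
  show "opr ?N (x + y) = opr ?N x + opr ?N y" using D(3)[OF x y] by (simp add: mm_linear)
  next
  fix a x assume "x \<in> VA"
  then show "opr ?N (a *\<^sub>C x) = a *\<^sub>C opr ?N x" using D(4) by (simp add: mm_linear)
  next
  show "opr ?N (aone A) = pr ?N" using D(5) V(1,4) by (simp add: mm_assoc)
  next
  fix x assume x: "x \<in> VA"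
  have "cor ?N ** sc (opr ?N x) = sc (ad V) ** (cor M ** (sc V ** sc (ad V))) ** sc (opr M x) ** sc V"
   by (simp add: sc_mm mm_assoc)
  also have "... = sc (ad V) ** (cor M ** sc (opr M x)) ** sc V" unfolding Vs U(3) by (simp add: mm_assoc)
  also have "... = sc (ad V) ** ((spread M (\<alpha> x) ** sc (pr M)) ** cor M) ** sc V"
   unfolding D(6)[OF x] spread_pr(2)[OF D(1)] ..
  also have "... = spread ?N (\<alpha> x) ** cor ?N" unfolding sp Vs(1)[symmetric] by (simp add: mm_assoc)
  finally show "cor ?N ** sc (opr ?N x) = spread ?N (\<alpha> x) ** cor ?N" .
  qed
qed

text \<open>\<open>C\<close> sits inside \<open>B \<otimes> a\<close>, where \<open>x\<close> acts
  on the factor \<open>B\<close> and so by 0; the embedding \<open>T\<close> is injective on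
  \<open>C\<close> because \<open>ad T ** T\<close> is a nonzero multiple of its identity.\<close>

lemma linked_annihilates:
  assumes B: "equivariant_rep B" and C: "equivariant_rep C" "qirr VA C" and l: "linked VA C B"
  and x: "x \<in> VA" "opr B x = 0"
  shows "opr C x = 0"
proof -
  note uB = equivariant_repD(1)[OF B] and uC = equivariant_repD(1)[OF C(1)]
  obtain a where a: "a \<in> irrs" "qdim VA C (qtens B (rep a)) ~= 0" using l by (auto simp: linked_def)
  obtain T where T: "T \<in> QHom VA C (qtens B (rep a))" "T ~= 0" by (rule qdim_nonzeroE[OF a(2)])
  have "ad T ** T \<in> QHom VA C C"
  by (rule Hom_comp[OF T(1) Hom_ad[OF star_family_fam[OF uC]
   star_family_fam[OF uobj_qtens[OF uB rep_D(1)[OF a(1), of id]]] T(1)]])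
  then obtain c where c: "ad T ** T = c *\<^sub>C pr C" using C(2) by (auto simp: irr_def)
  have c0: "c ~= 0" using c T(2) ad_mm_self_zero[of T] by auto
  have "T ** opr C x = 0" using T(1) x by (simp add: QHom_iff)
  then have "(ad T ** T) ** opr C x = 0" by (simp add: mm_assoc)
  then have "c *\<^sub>C opr C x = 0" using uobjD(6)[OF uC] by (simp add: c mm_scale_left)
  then show ?thesis using c0 by simp
qed

text \<open>Each summand of the regular representation is replaced by a linked object that is
  irreducible for the algebra alone, and one object per equivalence class is kept. Schur's lemma
  then makes the commutant of their sum the span of the block projections, and the bicommutant
  theorem shows that the algebra acts by all block diagonal matrices.\<close>

lemma morita_trivial:
  assumes stf: "strongly_torsion_free G"
  shows "\<exists>k. equivariantly_Morita_equivalent G A \<alpha> (C_sum k) (snd (trivial_corep k))"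
proof -
  obtain M0 :: "(nat, 'a, cvec) qobj" where M0: "equivariant_rep M0" "!!x. x \<in> VA ==> opr M0 x = 0 ==> x = 0"
  using regular_object by blast
  note D0 = equivariant_repD[OF M0(1)]
  obtain F where F: "qsplits VA M0 F (%p. p)" "!!p. p \<in> F ==> irr (ix VA) (sub p (fam M0))"
  using complete_reducibility[OF star_family_fam[OF D0(1)]] by blast
  note F' = splitsD[OF F(1)]
  let ?op = "%E :: (nat \<times> nat, 'a, cvec) qobj. (pr E, opr E)"
  have sfE: "star_family VA (astar A) (?op E)" if "equivariant_rep E" for E
  using equivariant_repD(1)[OF that] by (simp add: uobj_def)
  have "\<forall>p\<in>F. \<exists>E. equivariant_rep E \<and> irr VA (?op E) \<and> linked VA (qsub p M0) E"
  proof
  fix p assume p: "p \<in> F"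
  let ?b = "qsub p M0"
  have b: "equivariant_rep ?b" "qirr VA ?b"
   using equivariant_rep_qsub[OF M0(1) F'(2,3)[OF p]] F(2)[OF p] by (simp_all add: fam_qsub)
  obtain E :: "(nat \<times> nat, 'a, cvec) qobj" and q a where E: "uobj VA (astar A) E" "qirr VA E" "a \<in> irrs"
   "proj q" "q \<in> QHom VA (qtens ?b (rep a)) (qtens ?b (rep a))" "E = qsub q (qtens ?b (rep a))"
   "linked VA ?b E" "!!c. c \<in> irrs ==> qdim VA E (qtens E (rep c)) = (if c = unit_class then 1 else 0)"
   by (rule trivial_multiplicity_object[OF stf equivariant_repD(1)[OF b(1)] b(2)]) (rule that, assumption+)
  have eE: "equivariant_rep E"
   unfolding E(6) by (rule equivariant_rep_qsub[OF equivariant_rep_qtens[OF b(1) rep_D(1)[OF E(3), of id]] E(4,5)])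
  \<comment> \<open>\<Lambda> is the image of \<alpha>(x): elements of the commutant commute with
    every coefficient of it.\<close>
  have "irr VA (?op E)"
  proof (rule commutant_scalar[OF E(1,2,8)])
   fix x assume x: "x \<in> VA"
   have "sc T ** spread E (\<alpha> x) = spread E (\<alpha> x) ** sc T" if "T \<in> Hom VA (?op E) (?op E)" for T
    by (rule spread_commutes) (use HomD(3)[OF that] ebasis_Cpow in auto)
   then show "\<exists>\<Lambda>. cor E ** sc (opr E x) = \<Lambda> ** cor E \<and> \<Lambda> ** sc (pr E) = \<Lambda>
    \<and> (\<forall>T\<in>Hom VA (?op E) (?op E). sc T ** \<Lambda> = \<Lambda> ** sc T)"
    using equivariant_repD(6)[OF eE x] spread_pr(2)[OF E(1)] by (intro exI[of _ "spread E (\<alpha> x)"]) blast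
  qed
  then show "\<exists>E. equivariant_rep E \<and> irr VA (?op E) \<and> linked VA ?b E" using eE E(7) by blast
  qed
  from bchoice[OF this] obtain Ef where Ef: "!!p. p \<in> F ==> equivariant_rep (Ef p)"
  "!!p. p \<in> F ==> irr VA (?op (Ef p))" "!!p. p \<in> F ==> linked VA (qsub p M0) (Ef p)" by blast
  \<comment> \<open>Representatives up to equivalence of representations of the algebra; this
    equivalence ignores the corepresentations.\<close>
  define r where "r p = (SOME q. q \<in> F \<and> equivf VA (?op (Ef q)) (?op (Ef p)))" for p
  have r: "r p \<in> F" "equivf VA (?op (Ef (r p))) (?op (Ef p))" if p: "p \<in> F" for p
  proof -
  have "\<exists>q. q \<in> F \<and> equivf VA (?op (Ef q)) (?op (Ef p))" using p equivf_refl[OF sfE[OF Ef(1)[OF p]]] by blast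
  from someI_ex[OF this] show "r p \<in> F" "equivf VA (?op (Ef (r p))) (?op (Ef p))" unfolding r_def by blast+
  qed
  have r_eq: "r p = r q" if "equivf VA (?op (Ef p)) (?op (Ef q))" for p q
  proof -
  have "(s \<in> F \<and> equivf VA (?op (Ef s)) (?op (Ef p))) = (s \<in> F \<and> equivf VA (?op (Ef s)) (?op (Ef q)))" for s
   using that equivf_trans equivf_sym by blast
  then show ?thesis unfolding r_def by presburger
  qed
  define k where "k = card (r ` F)"
  obtain g where g: "bij_betw g {0..<k} (r ` F)"
  using ex_bij_betw_nat_finite[of "r ` F"] F'(1) by (auto simp: k_def)
  define E where "E b = Ef (g b)" for b
  have gF: "\<exists>p\<in>F. g b = r p" if "b < k" for b using bij_betwE[OF g] that by auto
  have E: "equivariant_rep (E b)" "irr VA (?op (E b))" if "b < k" for b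
  using gF[OF that] r(1) Ef by (auto simp: E_def)
  have E_ineq: "b = c" if bc: "b < k" "c < k" and e: "equivf VA (?op (E b)) (?op (E c))" for b c
  proof -
  obtain p q where pq: "p \<in> F" "g b = r p" "q \<in> F" "g c = r q" using gF bc by metis
  have "equivf VA (?op (Ef p)) (?op (Ef q))"
  proof -
   have "equivf VA (?op (Ef (r p))) (?op (Ef (r q)))" using e pq by (simp add: E_def)
   from equivf_trans[OF equivf_trans[OF equivf_sym[OF r(2)[OF pq(1)]] this] r(2)[OF pq(3)]] show ?thesis .
  qed
  then have "g b = g c" using r_eq pq by simp
  then show ?thesis using g bc by (auto simp: bij_betw_def inj_on_def)
  qed
  \<comment> \<open>An element killed by all kept objects is killed by every \<open>Ef p\<close>
    through equivalence, by every summand through \<open>linked_annihilates\<close>, and so by the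
    faithful regular representation.\<close>
  have faithful: "x = 0" if x: "x \<in> VA" and z: "!!b. b < k ==> opr (E b) x = 0" for x
  proof -
  have "p ** opr M0 x = 0" if p: "p \<in> F" for p
  proof -
   have "r p \<in> g ` {0..<k}" using g p by (simp add: bij_betw_def)
   then obtain b where b: "b < k" "r p = g b" by auto
   obtain U U' where U: "U \<in> Hom VA (?op (Ef p)) (?op (E b))" "U' ** U = pr (Ef p)"
    using equivf_sym[OF r(2)[OF p]] b(2) by (auto simp: equivf_def E_def)
   have "U ** opr (Ef p) x = 0" using HomD(3)[OF U(1) x] z[OF b(1)] by simp
   then have "pr (Ef p) ** opr (Ef p) x = 0" by (simp add: mm_assoc flip: U(2))
   then have "opr (Ef p) x = 0" using uobjD(6)[OF equivariant_repD(1)[OF Ef(1)[OF p]]] by simp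
   then have "opr (qsub p M0) x = 0"
    using linked_annihilates[OF Ef(1)[OF p] equivariant_rep_qsub[OF M0(1) F'(2,3)[OF p]] _ Ef(3)[OF p] x]
     F(2)[OF p] by (simp add: fam_qsub)
   then show ?thesis by simp
  qed
  then have "opr M0 x = 0" using splits_expand[OF F(1), of "opr M0 x"] uobjD(6)[OF D0(1)] by simp
  then show ?thesis by (rule M0(2)[OF x])
  qed
  define D :: "(nat \<times> nat \<times> nat, 'a, cvec) qobj" where
  "D = (dsum k (%b. pr (E b)), dsum k (%b. cor (E b)), %x. dsum k (%b. opr (E b) x))"
  have D: "equivariant_rep D" unfolding D_def by (rule equivariant_rep_dsum) (rule E(1))
  note DD = equivariant_repD[OF D] and UD = uobjD[OF equivariant_repD(1)[OF D]]
  note UE = uobjD[OF equivariant_repD(1)[OF E(1)]]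
  define Q where "Q b = dsum k (%c. if c = b then pr (E c) else 0)" for b
  have Q: "proj (Q b)" "pr D ** Q b = Q b" "Q b ** pr D = Q b" "sc (Q b) ** cor D = cor D ** sc (Q b)"
  "x \<in> VA ==> Q b ** opr D x = opr D x ** Q b" for b x
  unfolding proj_def Q_def D_def fst_conv snd_conv ad_dsum sc_dsum dsum_mm
  by (auto intro!: dsum_cong simp: UE(2,3,6,7) projD[OF UE(1)])
  have QQ: "Q b ** Q c = (if b = c then Q b else 0)" for b c
  proof -
  have "Q b ** Q c = dsum k (%a. if b = c \<and> a = b then pr (E a) else 0)"
   unfolding Q_def dsum_mm by (rule dsum_cong) (auto simp: projD[OF UE(1)])
  then show ?thesis by (auto simp: Q_def dsum_def)
  qed
  have Qsum: "(\<Sum>b<k. Q b) = pr D"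
  unfolding D_def fst_conv
  proof (rule dsum_eqI)
  fix b i c j
  have "ent (\<Sum>a<k. Q a) (b, i) (c, j) = (\<Sum>a<k. if a = b then (if b = c then ent (pr (E b)) i j else 0) else 0)"
   unfolding ent_sum by (rule sum.cong) (auto simp: Q_def ent_dsum)
  then show "ent (\<Sum>a<k. Q a) (b, i) (c, j) = (if b = c \<and> b < k then ent (pr (E b)) i j else 0)" by simp
  qed
  have Q0: "Q b ~= 0" if b: "b < k" for b
  proof
  assume z: "Q b = 0"
  have "pr (E b) = 0"
   by (rule fmat_eqI) (use b arg_cong[OF z, of "%T. ent T (b, _) (b, _)"] in \<open>simp add: Q_def ent_dsum\<close>)
  then show False using E(2)[OF b] by (simp add: irr_def)
  qed
  \<comment> \<open>Blocks of \<open>T\<close> are intertwiners between irreducibles: scalar on the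
    diagonal, and zero off it because the objects are pairwise inequivalent.\<close>
  have commutant: "\<exists>a. T = (\<Sum>b<k. a b *\<^sub>C Q b)" if T: "T \<in> Hom VA (pr D, opr D) (pr D, opr D)" for T
  proof -
  have TD: "pr D ** T = T" "T ** pr D = T" "x \<in> VA ==> T ** opr D x = opr D x ** T" for x
   using HomD[OF T] by simp_all
  have Tb: "block b c T \<in> Hom VA (?op (E c)) (?op (E b))" if bc: "b < k" "c < k" for b c
  proof -
   have "pr (E b) ** block b c T = block b c T" "block b c T ** pr (E c) = block b c T"
    "x \<in> VA ==> block b c T ** opr (E c) x = opr (E b) x ** block b c T" for x
    using TD block_dsum_mm[OF bc(1), of c "%b. pr (E b)" T] block_mm_dsum[OF bc(2), of b T "%b. pr (E b)"]
     block_dsum_mm[OF bc(1), of c "%b. opr (E b) x" T] block_mm_dsum[OF bc(2), of b T "%b. opr (E b) x"]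
    by (simp_all add: D_def)
   then show ?thesis by (simp add: Hom_def)
  qed
  have "\<exists>a. block b b T = a *\<^sub>C pr (E b)" if b: "b < k" for b using E(2)[OF b] Tb[OF b b] by (auto simp: irr_def)
  then obtain a where a: "!!b. b < k ==> block b b T = a b *\<^sub>C pr (E b)" by metis
  have off: "block b c T = 0" if bc: "b < k" "c < k" "b ~= c" for b c
   using irr_equivf_iff[OF sfE[OF E(1)[OF bc(2)]] E(2)[OF bc(2)] sfE[OF E(1)[OF bc(1)]] E(2)[OF bc(1)]]
    Tb[OF bc(1,2)] E_ineq[OF bc(2,1)] bc(3) by blast
  have "T = (\<Sum>b<k. a b *\<^sub>C Q b)"
  proof (rule kr_eqI)
   fix b i c j
   have "ent (\<Sum>e<k. a e *\<^sub>C Q e) (b, i) (c, j) = (\<Sum>e<k. if e = b then (if b = c then a b * ent (pr (E b)) i j else 0) else 0)"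
    unfolding ent_sum by (rule sum.cong) (auto simp: Q_def ent_dsum ent_scaleC scaleC_complex_def)
   moreover have "ent T (b, i) (c, j) = 0" if "\<not> (b < k \<and> c < k)"
    using that TD(1,2) ent_dsum_mm[of k "%b. pr (E b)" T b i "(c, j)"] ent_mm_dsum[of T k "%b. pr (E b)" "(b, i)" c j]
    by (auto simp: D_def)
   moreover have "ent T (b, i) (c, j) = ent (block b c T) i j" by (simp add: ent_block)
   ultimately show "ent T (b, i) (c, j) = ent (\<Sum>e<k. a e *\<^sub>C Q e) (b, i) (c, j)"
    using a[of b] off[of b c] by (cases "b < k \<and> c < k"; cases "b = c") (auto simp: ent_scaleC scaleC_complex_def)
  qed
  then show ?thesis by blast
  qed
  \<comment> \<open>From here everything is transported along \<open>V\<close> from the index type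
    of the direct sum to \<open>{..<n}\<close>.\<close>
  obtain n and V :: "(nat \<times> nat \<times> nat, nat) cmat" where V: "ad V ** V = idm {..<n}" "V ** idm {..<n} = V"
  "V ** ad V = pr D" "pr D ** V = V"
  by (rule proj_isometry[OF UD(1)])
  have Vad: "idm {..<n} ** ad V = ad V" using ad_mm[of V "idm {..<n}"] V(2) by simp
  have VP: "ad V ** pr D = ad V" using ad_mm[of "pr D" V] V(4) projD(1)[OF UD(1)] by simp
  define M :: "(nat, 'a, cvec) qobj" where "M = (idm {..<n}, sc (ad V) ** cor D ** sc V, %x. ad V ** opr D x ** V)"
  have M: "equivariant_rep M" unfolding M_def by (rule equivariant_rep_compress[OF D V])
  define P where "P b = ad V ** Q b ** V" for b
  have conj_mm: "(ad V ** B ** V) ** (ad V ** C ** V) = ad V ** (B ** C) ** V" if "pr D ** C = C" for B C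
  using that by (simp add: mm_assoc mm_eq_assoc[OF V(3)] mm_eq_assoc[OF that])
  have conj_back: "V ** (ad V ** B ** V) ** ad V = B" if "pr D ** B = B" "B ** pr D = B" for B
  using that by (simp add: mm_assoc mm_eq_assoc[OF V(3)] V(3) mm_eq_assoc[OF that(1)])
  have zero_back: "B = 0" if "ad V ** B ** V = 0" "pr D ** B = B" "B ** pr D = B" for B
  using conj_back[OF that(2,3)] that(1) by simp
  have "equivariantly_Morita_equivalent G A \<alpha> (C_sum k) (snd (trivial_corep k))"
  proof (rule bimodule_of_blocks[OF M])
  show "pr M = idm {..<n}" by (simp add: M_def)
  show "x = 0" if x: "x \<in> VA" and z: "opr M x = 0" for x
  proof (rule faithful[OF x])
   fix b assume b: "b < k"
   have "opr D x = 0" by (rule zero_back) (use z UD(6,7) x in \<open>simp_all add: M_def\<close>)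
   then show "opr (E b) x = 0"
    by (intro fmat_eqI) (use b ent_dsum[of k "%b. opr (E b) x" b _ b] in \<open>simp add: D_def\<close>)
  qed
  show "proj (P b)" for b
   using projD(1,2)[OF Q(1)[of b]] conj_mm[OF Q(2)[of b], of "Q b"]
   by (simp add: proj_def P_def ad_mm) (simp add: mm_assoc)
  show "P b ~= 0" if "b < k" for b using zero_back[OF _ Q(2,3), of b] Q0[OF that] by (auto simp: P_def)
  show "P b \<in> QHom VA M M" for b
   unfolding QHom_iff
  proof (intro conjI ballI)
   show "pr M ** P b = P b" "P b ** pr M = P b"
    by (simp_all add: M_def P_def mm_assoc V(2) mm_eq_assoc[OF Vad])
   show "P b ** opr M x = opr M x ** P b" if x: "x \<in> VA" for x
    using conj_mm[OF UD(6)[of x], of "Q b"] conj_mm[OF Q(2)[of b], of "opr D x"] Q(5)[OF x, of b]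
    by (simp add: M_def P_def)
   have VsD: "sc V ** sc (ad V) = (sc (pr D) :: (_, _, 'a) fmat)" by (simp only: sc_mm[symmetric] V)
   have "sc (P b) ** cor M = sc (ad V) ** sc (Q b) ** ((sc V ** sc (ad V)) ** cor D) ** sc V"
    by (simp add: P_def M_def sc_mm mm_assoc)
   also have "... = sc (ad V) ** (sc (Q b) ** cor D) ** sc V" unfolding VsD UD(2) by (simp add: mm_assoc)
   also have "... = sc (ad V) ** (cor D ** (sc V ** sc (ad V))) ** sc (Q b) ** sc V"
    unfolding VsD UD(3) Q(4) by (simp add: mm_assoc)
   also have "... = cor M ** sc (P b)" by (simp add: P_def M_def sc_mm mm_assoc)
   finally show "sc (P b) ** cor M = cor M ** sc (P b)" .
  qed
  show "P b ** P c = 0" if "b ~= c" for b c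
   using conj_mm[OF Q(2)[of c], of "Q b"] QQ[of b c] that by (simp add: P_def)
  show "(\<Sum>b<k. P b) = idm {..<n}"
  proof -
   have "(\<Sum>b<k. P b) = ad V ** (\<Sum>b<k. Q b) ** V" by (simp add: P_def mm_sum_left mm_sum_right)
   then show ?thesis using V by (simp add: Qsum mm_assoc)
  qed
  fix K :: "(nat, nat) cmat"
  assume K: "idm {..<n} ** K = K" "K ** idm {..<n} = K" "!!b. b < k ==> P b ** K = K ** P b"
  let ?K = "V ** K ** ad V"
  have VPb: "V ** P b = Q b ** V" "P b ** ad V = ad V ** Q b" for b
   using Q(2,3)[of b] by (simp_all add: P_def mm_assoc mm_eq_assoc[OF V(3)] V(3) mm_eq_assoc[OF Q(2)])
  have QK: "Q b ** ?K = ?K ** Q b" if b: "b < k" for b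
  proof -
   have "Q b ** ?K = V ** (P b ** K) ** ad V" by (simp add: mm_assoc mm_eq_assoc[OF VPb(1)])
   also have "... = ?K ** Q b" unfolding K(3)[OF b] by (simp add: mm_assoc VPb(2))
   finally show ?thesis .
  qed
  \<comment> \<open>Moved back to the direct sum, \<open>K\<close> commutes with the block
    projections and hence with the whole commutant.\<close>
  have "?K \<in> snd (pr D, opr D) ` VA"
  proof (rule bicommutant)
   show sf: "star_family VA (astar A) (pr D, opr D)" using DD(1) by (simp add: uobj_def)
   show "csubspace (snd (pr D, opr D) ` VA)"
   proof (rule complex_vector.subspaceI; clarsimp?)
    have "opr D 0 = 0" using DD(4)[of 0 0] in_VA(7) by (metis complex_vector.scale_zero_left)
    then show "0 \<in> opr D ` VA" using in_VA(7) by (metis imageI)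
    show "opr D x + opr D y \<in> opr D ` VA" if "x \<in> VA" "y \<in> VA" for x y
     using DD(3)[OF that] in_VA(4)[OF that] by (metis imageI)
    show "c *\<^sub>C opr D x \<in> opr D ` VA" if "x \<in> VA" for c x
     using DD(4)[OF that] in_VA(6)[OF that] by (metis imageI)
   qed
   show "fst (pr D, opr D) \<in> snd (pr D, opr D) ` VA" using DD(5) in_VA(3) by (metis fst_conv imageI snd_conv)
   show "snd (pr D, opr D) x ** snd (pr D, opr D) y \<in> snd (pr D, opr D) ` VA" if "x \<in> VA" "y \<in> VA" for x y
    using DD(2)[OF that] in_VA(1)[OF that] by (metis imageI snd_conv)
   show "fst (pr D, opr D) ** ?K = ?K" "?K ** fst (pr D, opr D) = ?K"
    by (simp_all add: mm_assoc VP mm_eq_assoc[OF V(4)])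
   fix T assume "T \<in> Hom VA (pr D, opr D) (pr D, opr D)"
   then obtain a where a: "T = (\<Sum>b<k. a b *\<^sub>C Q b)" using commutant by blast
   show "T ** ?K = ?K ** T"
    unfolding a mm_sum_left mm_sum_right by (rule sum.cong) (simp_all add: mm_scale_left mm_scale_right QK)
  qed
  then obtain x where x: "x \<in> VA" "?K = opr D x" by auto
  have "ad V ** ?K ** V = K" using V(1) K(1,2) by (simp add: mm_assoc mm_eq_assoc[OF V(1)])
  then show "\<exists>x\<in>VA. opr M x = K" using x by (intro bexI[of _ x]) (simp_all add: M_def)
  qed
  then show ?thesis by blast
qed

end

theorem theorem2p8:
  fixes \<Gamma> :: "'a::complex_star_algebra quantum_group"
  assumes "discrete_quantum_group \<Gamma>"
  and "strongly_torsion_free \<Gamma>"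
  shows "torsion_free \<Gamma>"
  unfolding torsion_free_def
proof (intro allI impI)
  fix A \<alpha> assume "fd_cstar_algebra A \<and> coaction \<Gamma> A \<alpha>"
  then interpret quantum_group_coaction \<Gamma> A \<alpha>
  using assms(1) by (simp add: quantum_group_coaction_def quantum_group_coaction_axioms_def)
  show "\<exists>k. equivariantly_Morita_equivalent \<Gamma> A \<alpha> (C_sum k) (snd (trivial_corep k))"
  by (rule morita_trivial[OF assms(2)])
qed

end
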